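(* Let $R$ be an almost local-global semihereditary ring and $M$ a finitely presented $R$-module. Then $M$ decomposes as \[M\cong \Bigl(\bigoplus_{1\leq j\leq m}R/I_j\Bigr)\oplus\Bigl(\bigoplus_{1\leq i\leq p}\bigl(\bigoplus_{1\leq k\leq n_i}J_{i,k}e_i\bigr)\Bigr)\] where $I_1\supseteq\dots\supseteq I_m$ are proper invertible ideals of $R$, $\{e_1,\dots,e_p\}$ is a family of nonzero orthogonal idempotents of $R$, $n_1<\dots<n_p$ is a strictly increasing sequence of integers $>0$, and for each $i$, $1\leq i\leq p$, $J_{i,1},\dots,J_{i,n_i}$ are invertible ideals of the ring $Re_i$. Moreover the following are invariants of $M$ (i.e. they depend only on the isomorphism class of $M$ and not on the chosen decomposition of this form): (a) the ideals $I_1,\dots,I_m$ (including their number $m$); (b) the idempotents $e_1,\dots,e_p$ (including their number $p$); (c) the integers $n_1,\dots,n_p$; (d) the isomorphism class of the $R$-module $\bigoplus_{1\leq i\leq p}\bigl(\prod_{1\leq k\leq n_i}J_{i,k}\bigr)$, where $\prod_{k}J_{i,k}$ is the product of ideals in $Re_i$.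
   Context: All rings are commutative with identity. A ring is semihereditary if every finitely generated ideal is projective. An ideal is faithful if its annihilator is $0$; an ideal is invertible if it is invertible as a fractional ideal in the total ring of fractions. For an idempotent $e$, $Re$ is regarded as a ring with identity $e$. Empty direct sums ($m=0$ or $p=0$) are allowed. A ring $R$ is local-global if each polynomial $f$ over $R$ in finitely many indeterminates which admits unit values locally (i.e. for every maximal ideal $P$, $f$ takes a unit value over $R_P$) admits unit values over $R$. A ring $R$ is almost local-global if for every faithful principal ideal $I$ of $R$, the ring $R/I$ is local-global. *)

theory Defs
  imports "HOL-Algebra.Algebra"
begin

section \<open>Modules over a commutative ring\<close>

definition mod_hom ::
  "('a, 'r) ring_scheme \<Rightarrow> ('a, 'b, 'm) module_scheme \<Rightarrow> ('a, 'c, 'n) module_scheme \<Rightarrow> ('b \<Rightarrow> 'c) set"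
where
  "mod_hom R M N = {h \<in> carrier M \<rightarrow> carrier N.
     (\<forall>x\<in>carrier M. \<forall>y\<in>carrier M. h (x \<oplus>\<^bsub>M\<^esub> y) = h x \<oplus>\<^bsub>N\<^esub> h y) \<and>
     (\<forall>r\<in>carrier R. \<forall>x\<in>carrier M. h (r \<odot>\<^bsub>M\<^esub> x) = r \<odot>\<^bsub>N\<^esub> h x)}"

definition mod_isomorphic ::
  "('a, 'r) ring_scheme \<Rightarrow> ('a, 'b, 'm) module_scheme \<Rightarrow> ('a, 'c, 'n) module_scheme \<Rightarrow> bool"
where
  "mod_isomorphic R M N \<longleftrightarrow> (\<exists>h\<in>mod_hom R M N. bij_betw h (carrier M) (carrier N))"

text \<open>The module record of HOL-Algebra extends the ring record; its fields \<open>mult\<close> and \<open>one\<close> play no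
  role for modules and are filled in arbitrarily below.\<close>

definition self_module :: "('a, 'r) ring_scheme \<Rightarrow> ('a, 'a) module" where
  "self_module R = \<lparr>carrier = carrier R, monoid.mult = monoid.mult R, one = one R,
     ring.zero = ring.zero R, add = add R, smult = monoid.mult R\<rparr>"

definition ideal_module :: "('a, 'r) ring_scheme \<Rightarrow> 'a set \<Rightarrow> ('a, 'a) module" where
  "ideal_module R I = (self_module R)\<lparr>carrier := I\<rparr>"

definition quotient_module :: "('a, 'r) ring_scheme \<Rightarrow> 'a set \<Rightarrow> ('a, 'a set) module" where
  "quotient_module R I = \<lparr>carrier = carrier (R Quot I), monoid.mult = monoid.mult (R Quot I),
     one = one (R Quot I),
     ring.zero = ring.zero (R Quot I), add = add (R Quot I),
     smult = (\<lambda>r C. (I +>\<^bsub>R\<^esub> r) \<otimes>\<^bsub>R Quot I\<^esub> C)\<rparr>"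

definition direct_sum :: "'i set \<Rightarrow> ('i \<Rightarrow> ('a, 'b, 'm) module_scheme) \<Rightarrow> ('a, 'i \<Rightarrow> 'b) module" where
  "direct_sum A M = \<lparr>
     carrier = {x \<in> (\<Pi>\<^sub>E i\<in>A. carrier (M i)). finite {i \<in> A. x i \<noteq> \<zero>\<^bsub>M i\<^esub>}},
     monoid.mult = undefined, one = undefined,
     ring.zero = (\<lambda>i\<in>A. \<zero>\<^bsub>M i\<^esub>),
     add = (\<lambda>x y. \<lambda>i\<in>A. x i \<oplus>\<^bsub>M i\<^esub> y i),
     smult = (\<lambda>r x. \<lambda>i\<in>A. r \<odot>\<^bsub>M i\<^esub> x i)\<rparr>"

definition direct_sum2 ::
  "('a, 'b, 'm) module_scheme \<Rightarrow> ('a, 'c, 'n) module_scheme \<Rightarrow> ('a, 'b \<times> 'c) module"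
where
  "direct_sum2 M N = \<lparr>
     carrier = carrier M \<times> carrier N,
     monoid.mult = undefined, one = undefined,
     ring.zero = (\<zero>\<^bsub>M\<^esub>, \<zero>\<^bsub>N\<^esub>),
     add = (\<lambda>x y. (fst x \<oplus>\<^bsub>M\<^esub> fst y, snd x \<oplus>\<^bsub>N\<^esub> snd y)),
     smult = (\<lambda>r x. (r \<odot>\<^bsub>M\<^esub> fst x, r \<odot>\<^bsub>N\<^esub> snd x))\<rparr>"

text \<open>There is an exact sequence \<open>R\<^sup>s \<rightarrow> R\<^sup>t \<rightarrow> M \<rightarrow> 0\<close>.\<close>

definition finitely_presented ::
  "('a, 'r) ring_scheme \<Rightarrow> ('a, 'b, 'm) module_scheme \<Rightarrow> bool"
where
  "finitely_presented R M \<longleftrightarrow> (\<exists>(s::nat) (t::nat).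
     let Rs = direct_sum {..<s} (\<lambda>_. self_module R);
         Rt = direct_sum {..<t} (\<lambda>_. self_module R)
     in \<exists>g\<in>mod_hom R Rs Rt. \<exists>f\<in>mod_hom R Rt M.
          f ` carrier Rt = carrier M \<and>
          g ` carrier Rs = {x \<in> carrier Rt. f x = \<zero>\<^bsub>M\<^esub>})"

text \<open>The lifting property. HOL cannot quantify over all types inside a definition, so the test
  modules live in fixed types. These are large enough: the canonical surjection onto \<open>P\<close> from the
  free module on the set \<open>carrier P\<close> (finitely supported functions, of type \<open>'b \<Rightarrow> 'a\<close>) is among
  the test cases, and a splitting of it gives the lifting property for test modules of any type.\<close>

definition projective :: "('a, 'r) ring_scheme \<Rightarrow> ('a, 'b) module \<Rightarrow> bool" where
  "projective R P \<longleftrightarrow> module R P \<and>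
     (\<forall>(N :: ('a, 'b \<Rightarrow> 'a) module) (N' :: ('a, 'b) module) g f.
        module R N \<longrightarrow> module R N' \<longrightarrow>
        g \<in> mod_hom R N N' \<longrightarrow> g ` carrier N = carrier N' \<longrightarrow> f \<in> mod_hom R P N' \<longrightarrow>
        (\<exists>h\<in>mod_hom R P N. \<forall>x\<in>carrier P. g (h x) = f x))"

definition semihereditary :: "('a, 'r) ring_scheme \<Rightarrow> bool" where
  "semihereditary R \<longleftrightarrow>
     (\<forall>A. finite A \<longrightarrow> A \<subseteq> carrier R \<longrightarrow> projective R (ideal_module R (Idl\<^bsub>R\<^esub> A)))"

section \<open>Localization and invertible ideals\<close>

definition fraction_rel ::
  "('a, 'r) ring_scheme \<Rightarrow> 'a set \<Rightarrow> (('a \<times> 'a) \<times> ('a \<times> 'a)) set"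
where
  "fraction_rel R S = {((a, s), (b, t)).
     a \<in> carrier R \<and> s \<in> S \<and> b \<in> carrier R \<and> t \<in> S \<and>
     (\<exists>u\<in>S. u \<otimes>\<^bsub>R\<^esub> (a \<otimes>\<^bsub>R\<^esub> t \<ominus>\<^bsub>R\<^esub> b \<otimes>\<^bsub>R\<^esub> s) = \<zero>\<^bsub>R\<^esub>)}"

definition fraction :: "('a, 'r) ring_scheme \<Rightarrow> 'a set \<Rightarrow> 'a \<Rightarrow> 'a \<Rightarrow> ('a \<times> 'a) set" where
  "fraction R S a s = fraction_rel R S `` {(a, s)}"

text \<open>The ring \<open>S\<^sup>-\<^sup>1 R\<close>, for a multiplicatively closed set \<open>S\<close> containing \<open>1\<close>. The unions merely
  choose representatives: all sets united are equal.\<close>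

definition localization :: "('a, 'r) ring_scheme \<Rightarrow> 'a set \<Rightarrow> ('a \<times> 'a) set ring" where
  "localization R S = \<lparr>
     carrier = (carrier R \<times> S) // fraction_rel R S,
     monoid.mult = (\<lambda>C D. \<Union>(a, s)\<in>C. \<Union>(b, t)\<in>D. fraction R S (a \<otimes>\<^bsub>R\<^esub> b) (s \<otimes>\<^bsub>R\<^esub> t)),
     one = fraction R S \<one>\<^bsub>R\<^esub> \<one>\<^bsub>R\<^esub>,
     ring.zero = fraction R S \<zero>\<^bsub>R\<^esub> \<one>\<^bsub>R\<^esub>,
     add = (\<lambda>C D. \<Union>(a, s)\<in>C. \<Union>(b, t)\<in>D.
              fraction R S (a \<otimes>\<^bsub>R\<^esub> t \<oplus>\<^bsub>R\<^esub> b \<otimes>\<^bsub>R\<^esub> s) (s \<otimes>\<^bsub>R\<^esub> t))\<rparr>"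

definition to_localization :: "('a, 'r) ring_scheme \<Rightarrow> 'a set \<Rightarrow> 'a \<Rightarrow> ('a \<times> 'a) set" where
  "to_localization R S a = fraction R S a \<one>\<^bsub>R\<^esub>"

definition regular_elements :: "('a, 'r) ring_scheme \<Rightarrow> 'a set" where
  "regular_elements R = {a \<in> carrier R. \<forall>b\<in>carrier R. a \<otimes>\<^bsub>R\<^esub> b = \<zero>\<^bsub>R\<^esub> \<longrightarrow> b = \<zero>\<^bsub>R\<^esub>}"

abbreviation total_fraction_ring :: "('a, 'r) ring_scheme \<Rightarrow> ('a \<times> 'a) set ring" where
  "total_fraction_ring R \<equiv> localization R (regular_elements R)"

abbreviation to_total_fractions :: "('a, 'r) ring_scheme \<Rightarrow> 'a \<Rightarrow> ('a \<times> 'a) set" where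
  "to_total_fractions R \<equiv> to_localization R (regular_elements R)"

definition fractional_ideal :: "('a, 'r) ring_scheme \<Rightarrow> ('a \<times> 'a) set set \<Rightarrow> bool" where
  "fractional_ideal R K \<longleftrightarrow>
     additive_subgroup K (total_fraction_ring R) \<and>
     (\<forall>r\<in>carrier R. \<forall>x\<in>K. to_total_fractions R r \<otimes>\<^bsub>total_fraction_ring R\<^esub> x \<in> K) \<and>
     (\<exists>d\<in>regular_elements R. \<forall>x\<in>K.
        to_total_fractions R d \<otimes>\<^bsub>total_fraction_ring R\<^esub> x \<in> to_total_fractions R ` carrier R)"

definition invertible_ideal :: "'a set \<Rightarrow> ('a, 'r) ring_scheme \<Rightarrow> bool" where
  "invertible_ideal I R \<longleftrightarrow> ideal I R \<and>
     (\<exists>K. fractional_ideal R K \<and>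
        ideal_prod (total_fraction_ring R) (to_total_fractions R ` I) K
          = to_total_fractions R ` carrier R)"

section \<open>Almost local-global rings\<close>

text \<open>The value at the point \<open>a\<close> of \<open>S\<^sup>n\<close> of a polynomial over \<open>R\<close>, with coefficients mapped to \<open>S\<close>
  by \<open>\<phi>\<close>. Polynomials are those of \<open>Indexed_Polynomials\<close>: functions from monomials (multisets of
  indeterminates) to coefficients.\<close>

definition poly_value ::
  "('a, 'r) ring_scheme \<Rightarrow> ('b, 's) ring_scheme \<Rightarrow> ('a \<Rightarrow> 'b) \<Rightarrow> (nat multiset \<Rightarrow> 'a) \<Rightarrow> (nat \<Rightarrow> 'b) \<Rightarrow> 'b"
where
  "poly_value R S \<phi> f a =
     (\<Oplus>\<^bsub>S\<^esub>w\<in>{w. f w \<noteq> \<zero>\<^bsub>R\<^esub>}. \<phi> (f w) \<otimes>\<^bsub>S\<^esub> (\<Otimes>\<^bsub>S\<^esub>i\<in>set_mset w. a i [^]\<^bsub>S\<^esub> count w i))"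

definition unit_value_over ::
  "('a, 'r) ring_scheme \<Rightarrow> ('b, 's) ring_scheme \<Rightarrow> ('a \<Rightarrow> 'b) \<Rightarrow> nat \<Rightarrow> (nat multiset \<Rightarrow> 'a) \<Rightarrow> bool"
where
  "unit_value_over R S \<phi> n f \<longleftrightarrow> (\<exists>a\<in>{..<n} \<rightarrow> carrier S. poly_value R S \<phi> f a \<in> Units S)"

definition local_global :: "('a, 'r) ring_scheme \<Rightarrow> bool" where
  "local_global R \<longleftrightarrow>
     (\<forall>n. \<forall>f\<in>ring.indexed_pset R {..<n} (carrier R).
        (\<forall>P. maximalideal P R \<longrightarrow>
           unit_value_over R (localization R (carrier R - P)) (to_localization R (carrier R - P)) n f)
        \<longrightarrow> unit_value_over R R id n f)"

definition annihilator :: "('a, 'r) ring_scheme \<Rightarrow> 'a set \<Rightarrow> 'a set" where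
  "annihilator R I = {r \<in> carrier R. \<forall>x\<in>I. r \<otimes>\<^bsub>R\<^esub> x = \<zero>\<^bsub>R\<^esub>}"

definition almost_local_global :: "('a, 'r) ring_scheme \<Rightarrow> bool" where
  "almost_local_global R \<longleftrightarrow>
     (\<forall>a\<in>carrier R. annihilator R (PIdl\<^bsub>R\<^esub> a) = {\<zero>\<^bsub>R\<^esub>} \<longrightarrow> local_global (R Quot (PIdl\<^bsub>R\<^esub> a)))"

section \<open>Decompositions\<close>

definition corner_ring :: "('a, 'r) ring_scheme \<Rightarrow> 'a \<Rightarrow> ('a, 'r) ring_scheme" where
  "corner_ring R e = R\<lparr>carrier := carrier R #>\<^bsub>R\<^esub> e, one := e\<rparr>"

text \<open>Families are functions on \<open>nat\<close>, of which only the values at the indices \<open>1 \<le> j \<le> m\<close>,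
  \<open>1 \<le> i \<le> p\<close> and \<open>1 \<le> k \<le> n i\<close> matter.\<close>

definition decomposition_sum ::
  "('a, 'r) ring_scheme \<Rightarrow> nat \<Rightarrow> (nat \<Rightarrow> 'a set) \<Rightarrow> nat \<Rightarrow> (nat \<Rightarrow> 'a) \<Rightarrow> (nat \<Rightarrow> nat) \<Rightarrow>
   (nat \<Rightarrow> nat \<Rightarrow> 'a set) \<Rightarrow> ('a, (nat \<Rightarrow> 'a set) \<times> (nat \<Rightarrow> nat \<Rightarrow> 'a)) module"
where
  "decomposition_sum R m I p e n J =
     direct_sum2
       (direct_sum {1..m} (\<lambda>j. quotient_module R (I j)))
       (direct_sum {1..p} (\<lambda>i. direct_sum {1..n i} (\<lambda>k. ideal_module R (J i k #>\<^bsub>R\<^esub> e i))))"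

definition is_decomposition ::
  "('a, 'r) ring_scheme \<Rightarrow> ('a, 'b, 'm) module_scheme \<Rightarrow> nat \<Rightarrow> (nat \<Rightarrow> 'a set) \<Rightarrow> nat \<Rightarrow>
   (nat \<Rightarrow> 'a) \<Rightarrow> (nat \<Rightarrow> nat) \<Rightarrow> (nat \<Rightarrow> nat \<Rightarrow> 'a set) \<Rightarrow> bool"
where
  "is_decomposition R M m I p e n J \<longleftrightarrow>
     (\<forall>j\<in>{1..m}. invertible_ideal (I j) R \<and> I j \<noteq> carrier R) \<and>
     (\<forall>j\<in>{1..<m}. I (Suc j) \<subseteq> I j) \<and>
     (\<forall>i\<in>{1..p}. e i \<in> carrier R \<and> e i \<otimes>\<^bsub>R\<^esub> e i = e i \<and> e i \<noteq> \<zero>\<^bsub>R\<^esub>) \<and>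
     (\<forall>i\<in>{1..p}. \<forall>i'\<in>{1..p}. i \<noteq> i' \<longrightarrow> e i \<otimes>\<^bsub>R\<^esub> e i' = \<zero>\<^bsub>R\<^esub>) \<and>
     (\<forall>i\<in>{1..p}. 0 < n i) \<and> strict_mono_on {1..p} n \<and>
     (\<forall>i\<in>{1..p}. \<forall>k\<in>{1..n i}. invertible_ideal (J i k) (corner_ring R (e i))) \<and>
     mod_isomorphic R M (decomposition_sum R m I p e n J)"

definition product_module ::
  "('a, 'r) ring_scheme \<Rightarrow> nat \<Rightarrow> (nat \<Rightarrow> 'a) \<Rightarrow> (nat \<Rightarrow> nat) \<Rightarrow> (nat \<Rightarrow> nat \<Rightarrow> 'a set) \<Rightarrow>
   ('a, nat \<Rightarrow> 'a) module"
where
  "product_module R p e n J =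
     direct_sum {1..p} (\<lambda>i.
       ideal_module R (finprod (ideals_set (corner_ring R (e i))) (J i) {1..n i}))"

end

theory Submission
  imports Defs "HOL-Combinatorics.Permutations"
begin

text \<open>A semihereditary ring is reduced, the support of a finitely generated ideal is an idempotent, and
  functionals on a finitely generated module whose common kernel is the torsion can be found by
  saturating the relations. Splitting off the images of functionals, which are projective ideals, leaves a
  decreasing chain of idempotents that vanishes after as many steps as there are generators, and a module
  killed by a regular element \<open>s\<close>. For the latter, the ring \<open>R / (s)\<close> is local-global: a polynomial
  with unit values at all primes containing \<open>s\<close> yields a generator with an invertible annihilator \<open>I\<close>
  that spans a direct summand, and one generator less is needed for the complement, whose relations all
  lie in \<open>I\<close>; iterating gives the chain of ideals.

  For uniqueness, \<open>r\<close> lies in \<open>I (m - k)\<close> iff \<open>r\<close> times the torsion submodule is generated by \<open>r\<close> times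
  \<open>k\<close> elements, and \<open>s\<close> is fixed by the sum of the \<open>e i\<close> with \<open>N \<le> n i\<close> iff there are \<open>N\<close> elements whose
  linear relations are killed by \<open>s\<close>. Both rest on linear dependence modulo a radical ideal. The products
  of the ideals are matched by the determinant of the matrix comparing two coordinate systems.\<close>

section \<open>Finite sums\<close>

text \<open>The rank of a projective module may vary over the spectrum, so no basis can be chosen
  once and for all. Functionals can however be combined into one that vanishes only where all of
  them do. Splitting off its image lowers the rank by one wherever it is positive, and the support
  \<open>f k\<close> marks the place where the rank exceeds \<open>k\<close>. Hence
  \<open>e i\<close> is the difference of two neighbours in the chain, taken where it drops, and
  \<open>n i\<close> is the position of the drop.

  A principal ideal is faithful iff its generator is regular, so the local-global property is
  available only modulo a regular element \<open>s\<close>. On a module killed by \<open>s\<close>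
  this costs nothing, since every factor 1 + s q acts as the identity.

  Direct sums are handled through coordinate functions with values in \<open>R\<close>: linear ones
  for the ideals, and ones that are linear modulo \<open>I j\<close> for R / I j. All summands thus
  remain submodules of \<open>M\<close> in the same type, inductions can pass to a summand, and two
  decompositions become two coordinate systems on one module.\<close>

lemma (in abelian_monoid) finsum_lessThan_Suc:
 assumes "!!i. f i : carrier G"
 shows "(\<Oplus>i\<in>{..<Suc n}. f i) = (\<Oplus>i\<in>{..<n}. f i) \<oplus> f n"
 using assms by (simp add: lessThan_Suc Pi_def a_comm)

lemma (in abelian_monoid) finsum_lessThan_shift:
 assumes "!!i. f i : carrier G"
 shows "(\<Oplus>i\<in>{..<Suc n}. f i) = f 0 \<oplus> (\<Oplus>i\<in>{..<n}. f (Suc i))"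
proof (induction n)
 case 0 then show ?case using assms by (simp add: finsum_lessThan_Suc)
next
 case (Suc n)
 have "(\<Oplus>i\<in>{..<Suc (Suc n)}. f i) = (\<Oplus>i\<in>{..<Suc n}. f i) \<oplus> f (Suc n)"
  using assms by (rule finsum_lessThan_Suc)
 then show ?case using Suc assms by (simp add: finsum_lessThan_Suc[of "%i. f (Suc i)"] a_assoc)
qed

text \<open>Source and target are independent structures because the map may be a functional, a
  projection, an inclusion of carriers, or r |-> r x for a fixed element x.\<close>

lemma finsum_hom:
 assumes "abelian_monoid G" "abelian_monoid H"
  and h: "!!x. x : carrier G ==> h x : carrier H" "h \<zero>\<^bsub>G\<^esub> = \<zero>\<^bsub>H\<^esub>"
  "!!x y. x : carrier G ==> y : carrier G ==> h (x \<oplus>\<^bsub>G\<^esub> y) = h x \<oplus>\<^bsub>H\<^esub> h y"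
  and f: "!!i. i : A ==> f i : carrier G"
 shows "h (\<Oplus>\<^bsub>G\<^esub>i\<in>A. f i) = (\<Oplus>\<^bsub>H\<^esub>i\<in>A. h (f i))"
proof -
 interpret G: abelian_monoid G by fact
 interpret H: abelian_monoid H by fact
 show ?thesis using f
 proof (induction A rule: infinite_finite_induct)
  case (insert x F)
  then show ?case by (simp add: Pi_def h)
 qed (simp_all add: h)
qed

lemma (in abelian_monoid) finsum_swap:
 assumes "finite A" "finite B" "!!i j. i : A ==> j : B ==> f i j : carrier G"
 shows "(\<Oplus>i\<in>A. \<Oplus>j\<in>B. f i j) = (\<Oplus>j\<in>B. \<Oplus>i\<in>A. f i j)"
 using assms(1,3)
proof (induction A)
 case (insert x F)
 have "(\<Oplus>i\<in>insert x F. \<Oplus>j\<in>B. f i j) = (\<Oplus>j\<in>B. f x j) \<oplus> (\<Oplus>j\<in>B. \<Oplus>i\<in>F. f i j)"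
  using insert by (simp add: Pi_def)
 also have "... = (\<Oplus>j\<in>B. f x j \<oplus> (\<Oplus>i\<in>F. f i j))"
  using insert by (subst finsum_addf) (auto intro!: finsum_closed)
 also have "... = (\<Oplus>j\<in>B. \<Oplus>i\<in>insert x F. f i j)"
  using insert by (intro finsum_cong') (auto simp: Pi_def)
 finally show ?case .
qed simp

lemma (in abelian_monoid) finsum_delta:
 assumes "finite A" "i : A" "f i : carrier G"
 shows "(\<Oplus>j\<in>A. if j = i then f j else \<zero>) = f i"
proof -
 have "(\<Oplus>j\<in>A. if j = i then f j else \<zero>) = (\<Oplus>j\<in>insert i (A - {i}). if j = i then f j else \<zero>)"
  using assms by (simp add: insert_absorb)
 also have "... = f i \<oplus> (\<Oplus>j\<in>A - {i}. if j = i then f j else \<zero>)"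
  using assms by (subst finsum_insert) auto
 also have "(\<Oplus>j\<in>A - {i}. if j = i then f j else \<zero>) = (\<Oplus>j\<in>A - {i}. \<zero>)"
  by (rule finsum_cong') auto
 finally show ?thesis using assms by simp
qed

text \<open>The increasing enumeration of the indices other than \<open>k0\<close>; it removes the
  pivot row in an elimination.\<close>

definition skip :: "nat => nat => nat" where
 "skip k0 k = (if k < k0 then k else Suc k)"

lemma (in abelian_monoid) finsum_skip:
 assumes "k0 <= n" "!!i. f i : carrier G"
 shows "(\<Oplus>i\<in>{..<Suc n}. f i) = f k0 \<oplus> (\<Oplus>i\<in>{..<n}. f (skip k0 i))"
proof -
 have "k : insert k0 (skip k0 ` {..<n})" if "k < Suc n" for k
 proof (cases k k0 rule: linorder_cases)
  case greater
  then have "skip k0 (k - 1) = k" "k - 1 < n" using that by (auto simp: skip_def)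
  then show ?thesis by (metis image_eqI insertI2 lessThan_iff)
 next
  case less
  then have "skip k0 k = k" "k < n" using assms by (auto simp: skip_def)
  then show ?thesis by (metis image_eqI insertI2 lessThan_iff)
 qed auto
 moreover have "insert k0 (skip k0 ` {..<n}) <= {..<Suc n}" using assms by (auto simp: skip_def)
 ultimately have eq: "{..<Suc n} = insert k0 (skip k0 ` {..<n})" by blast
 have inj: "inj_on (skip k0) {..<n}" by (auto simp: inj_on_def skip_def split: if_splits)
 have "k0 ~: skip k0 ` {..<n}" by (auto simp: skip_def split: if_splits)
 then show ?thesis unfolding eq using assms inj by (subst finsum_insert) (auto simp: finsum_reindex)
qed

lemma (in ideal) finsum_in_ideal:
 "(!!i. i : A ==> f i : I) ==> (\<Oplus>i\<in>A. f i) : I"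
proof (induction A rule: infinite_finite_induct)
 case (insert x F)
 then show ?case using Icarr by (subst finsum_insert) (auto intro!: a_closed)
qed (auto simp: zero_closed)

lemma (in cring) ideal_lin:
 assumes "ideal I R" "a : I" "r : carrier R"
 shows "r \<otimes> a : I" "a \<otimes> r : I"
 using assms ideal.I_l_closed ideal.I_r_closed by metis+

lemma (in cring) ideal_add:
 assumes "ideal I R" "a : I" "b : I"
 shows "a \<oplus> b : I" "\<ominus> a : I" "a \<ominus> b : I"
proof -
 interpret I: ideal I R by fact
 show "a \<oplus> b : I" "\<ominus> a : I" "a \<ominus> b : I"
  using assms(2,3) by (simp_all add: a_minus_def)
qed

section \<open>Linear dependence\<close>

text \<open>Division-free elimination on m + 1 vectors with m entries, modulo a radical ideal. If
  \<open>s\<close> carries the last column into \<open>I\<close>, the relation for the other columns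
  is multiplied by \<open>s\<close>. Otherwise some entry c with s c outside \<open>I\<close> is the
  pivot, and the induction goes on with s c in place of \<open>s\<close>; this is why the
  nontriviality of the relation is stated relative to an \<open>s\<close>.\<close>

lemma (in cring) ex_dependence:
 assumes I: "ideal I R" and rad: "!!x. x : carrier R ==> x \<otimes> x : I ==> x : I"
 shows "s : carrier R ==> s ~: I ==> (!!k i. v k i : carrier R) ==>
  EX x. (ALL k::nat. x k : carrier R) & (ALL i<m. (\<Oplus>k\<in>{..<Suc m}. x k \<otimes> v k i) : I) &
   (EX j<Suc m. s \<otimes> x j ~: I)"
proof (induction m arbitrary: s v)
 case 0
 then show ?case by (intro exI[of _ "%_. \<one>"]) auto
next
 case (Suc m)
 note [simp] = Suc.prems(1) Suc.prems(3)
 interpret I: ideal I R by fact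
 show ?case
 proof (cases "ALL k<Suc (Suc m). s \<otimes> v k m : I")
  case True
  from Suc.IH[of s v] Suc.prems obtain x where x [simp]: "!!k. x k : carrier R"
   and x1: "!!i. i < m ==> (\<Oplus>k\<in>{..<Suc m}. x k \<otimes> v k i) : I"
   and x2: "EX j<Suc m. s \<otimes> x j ~: I" by blast
  define x' where "x' k = (if k < Suc m then s \<otimes> x k else \<zero>)" for k
  have [simp]: "x' k : carrier R" for k by (simp add: x'_def)
  have sum: "(\<Oplus>k\<in>{..<Suc (Suc m)}. x' k \<otimes> v k i) = s \<otimes> (\<Oplus>k\<in>{..<Suc m}. x k \<otimes> v k i)" for i
  proof -
   have "(\<Oplus>k\<in>{..<Suc (Suc m)}. x' k \<otimes> v k i) = (\<Oplus>k\<in>{..<Suc m}. x' k \<otimes> v k i)"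
    by (subst finsum_lessThan_Suc) (auto simp: x'_def)
   also have "... = (\<Oplus>k\<in>{..<Suc m}. s \<otimes> (x k \<otimes> v k i))"
    by (intro finsum_cong') (auto simp: x'_def m_assoc)
   finally show ?thesis by (simp add: finsum_rdistr Pi_def)
  qed
  have "(\<Oplus>k\<in>{..<Suc (Suc m)}. x' k \<otimes> v k i) : I" if "i < Suc m" for i
  proof (cases "i = m")
   case True
   have "(\<Oplus>k\<in>{..<Suc (Suc m)}. x' k \<otimes> v k i) = (\<Oplus>k\<in>{..<Suc m}. s \<otimes> (x k \<otimes> v k i))"
    unfolding sum by (simp add: finsum_rdistr Pi_def)
   also have "... = (\<Oplus>k\<in>{..<Suc m}. x k \<otimes> (s \<otimes> v k i))"
    by (intro finsum_cong') (auto simp: m_lcomm)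
   also have "... : I" using \<open>ALL k<_. _\<close> True by (intro I.finsum_in_ideal) (auto simp: I.I_l_closed)
   finally show ?thesis .
  next
   case False
   then show ?thesis unfolding sum using x1[of i] that by (intro I.I_l_closed) auto
  qed
  moreover obtain j where j: "j < Suc m" "s \<otimes> x j ~: I" using x2 by blast
  \<comment> \<open>A second factor x j turns s (s x j) into the square of s x j, and
    \<open>I\<close> is radical.\<close>
  have "s \<otimes> x' j ~: I"
  proof
   assume "s \<otimes> x' j : I"
   then have "x j \<otimes> (s \<otimes> x' j) : I" by (simp add: I.I_l_closed)
   moreover have "x j \<otimes> (s \<otimes> x' j) = (s \<otimes> x j) \<otimes> (s \<otimes> x j)"
    using j by (simp add: x'_def m_ac)
   ultimately show False using rad[of "s \<otimes> x j"] j by simp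
  qed
  then have "EX j<Suc (Suc m). s \<otimes> x' j ~: I" using j less_Suc_eq by blast
  ultimately show ?thesis by (intro exI[of _ x']) auto
 next
  case False
  then obtain k0 where k0: "k0 < Suc (Suc m)" "s \<otimes> v k0 m ~: I" by blast
  define c where "c = v k0 m"
  \<comment> \<open>Cross-multiplication with the pivot row makes column \<open>m\<close> zero; the
    remaining rows are renumbered by \<open>skip k0\<close>.\<close>
  define w where "w k i = c \<otimes> v (skip k0 k) i \<ominus> v (skip k0 k) m \<otimes> v k0 i" for k i
  have [simp]: "c : carrier R" "w k i : carrier R" for k i by (auto simp: c_def w_def)
  from Suc.IH[of "s \<otimes> c" w] k0 obtain x where x [simp]: "!!k. x k : carrier R"
   and x1: "!!i. i < m ==> (\<Oplus>k\<in>{..<Suc m}. x k \<otimes> w k i) : I"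
   and x2: "EX j<Suc m. (s \<otimes> c) \<otimes> x j ~: I" by (auto simp: c_def)
  define a where "a = (\<Oplus>k\<in>{..<Suc m}. x k \<otimes> v (skip k0 k) m)"
  have [simp]: "a : carrier R" by (simp add: a_def Pi_def)
  \<comment> \<open>Substituting the definition of \<open>w\<close> into the relation for
    \<open>w\<close> leaves this coefficient for the pivot row.\<close>
  define y where "y k = (if k = k0 then \<ominus> a else c \<otimes> x (if k < k0 then k else k - 1))" for k
  have [simp]: "y k : carrier R" for k by (simp add: y_def)
  have yskip [simp]: "y (skip k0 k) = c \<otimes> x k" for k by (auto simp: y_def skip_def)
  have yk0: "y k0 = \<ominus> a" by (simp add: y_def)
  have sum: "(\<Oplus>k\<in>{..<Suc (Suc m)}. y k \<otimes> v k i) = (\<Oplus>k\<in>{..<Suc m}. x k \<otimes> w k i)" for i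
  proof -
   have e: "x k \<otimes> w k i = c \<otimes> x k \<otimes> v (skip k0 k) i \<oplus> (\<ominus> v k0 i) \<otimes> (x k \<otimes> v (skip k0 k) m)" for k
   proof -
    have *: "xk \<otimes> (c \<otimes> p \<ominus> q \<otimes> r) = c \<otimes> xk \<otimes> p \<oplus> (\<ominus> r) \<otimes> (xk \<otimes> q)"
     if "xk : carrier R" "c : carrier R" "p : carrier R" "q : carrier R" "r : carrier R" for xk c p q r
     using that by algebra
    show ?thesis unfolding w_def by (rule *) auto
   qed
   have "(\<Oplus>k\<in>{..<Suc m}. x k \<otimes> w k i) = (\<Oplus>k\<in>{..<Suc m}. c \<otimes> x k \<otimes> v (skip k0 k) i \<oplus> (\<ominus> v k0 i) \<otimes> (x k \<otimes> v (skip k0 k) m))"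
    by (intro finsum_cong') (auto simp: e)
   also have "... = (\<Oplus>k\<in>{..<Suc m}. c \<otimes> x k \<otimes> v (skip k0 k) i) \<oplus> (\<Oplus>k\<in>{..<Suc m}. (\<ominus> v k0 i) \<otimes> (x k \<otimes> v (skip k0 k) m))"
    by (rule finsum_addf) auto
   also have "(\<Oplus>k\<in>{..<Suc m}. (\<ominus> v k0 i) \<otimes> (x k \<otimes> v (skip k0 k) m)) = (\<ominus> v k0 i) \<otimes> a"
    unfolding a_def by (rule finsum_rdistr[symmetric]) auto
   finally have "(\<Oplus>k\<in>{..<Suc m}. x k \<otimes> w k i) = (\<Oplus>k\<in>{..<Suc m}. c \<otimes> x k \<otimes> v (skip k0 k) i) \<oplus> (\<ominus> v k0 i) \<otimes> a" .
   moreover have "(\<Oplus>k\<in>{..<Suc (Suc m)}. y k \<otimes> v k i) = \<ominus> a \<otimes> v k0 i \<oplus> (\<Oplus>k\<in>{..<Suc m}. c \<otimes> x k \<otimes> v (skip k0 k) i)"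
    using k0 by (subst finsum_skip[of k0]) (auto simp: yk0)
   moreover have "\<ominus> a \<otimes> v k0 i = (\<ominus> v k0 i) \<otimes> a" by (simp add: l_minus r_minus m_comm)
   moreover have "(\<Oplus>k\<in>{..<Suc m}. c \<otimes> x k \<otimes> v (skip k0 k) i) : carrier R" by (rule finsum_closed) auto
   ultimately show ?thesis using a_comm[of "(\<ominus> v k0 i) \<otimes> a"] by (simp del: finsum_insert)
  qed
  have wm: "w k m = \<zero>" for k
   unfolding w_def c_def by (subst m_comm) (auto simp: r_neg minus_eq)
  have "(\<Oplus>k\<in>{..<Suc (Suc m)}. y k \<otimes> v k i) : I" if "i < Suc m" for i
   using that x1[of i] by (cases "i = m") (auto simp: sum wm less_Suc_eq)
  moreover obtain j where j: "j < Suc m" "s \<otimes> c \<otimes> x j ~: I" using x2 by blast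
  have "s \<otimes> y (skip k0 j) ~: I" using j by (simp add: m_assoc)
  moreover have "skip k0 j < Suc (Suc m)" using j by (simp add: skip_def)
  ultimately show ?thesis by (intro exI[of _ y]) auto
 qed
qed

section \<open>Localization\<close>

lemma UN_const:
 assumes "x : A" "!!y. y : A ==> f y = c"
 shows "(\<Union>y\<in>A. f y) = c"
 using assms by blast

locale localizing = cring R for R (structure) +
 fixes S
 assumes S_carrier: "S <= carrier R" and one_S [simp, intro]: "\<one> : S"
  and mult_S [simp, intro]: "s : S ==> t : S ==> s \<otimes> t : S"
begin

abbreviation "L \<equiv> localization R S"
abbreviation "frc \<equiv> fraction R S"

lemma S_closed [simp, intro]: "s : S ==> s : carrier R" using S_carrier by blast

text \<open>With an equation instead of a vanishing difference, the later computations with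
  fractions need only commutativity and associativity.\<close>

lemma in_fraction_rel_iff:
 "((a, s), (b, t)) : fraction_rel R S \<longleftrightarrow>
  a : carrier R & s : S & b : carrier R & t : S &
  (EX u:S. u \<otimes> (a \<otimes> t) = u \<otimes> (b \<otimes> s))"
proof -
 have "u \<otimes> (a \<otimes> t \<ominus> b \<otimes> s) = \<zero> \<longleftrightarrow> u \<otimes> (a \<otimes> t) = u \<otimes> (b \<otimes> s)"
  if "a : carrier R" "s : S" "b : carrier R" "t : S" "u : S" for u
  using that by (simp add: minus_eq r_distr r_minus)
   (metis S_closed m_closed minus_eq r_right_minus_eq)
 then show ?thesis unfolding fraction_rel_def by auto
qed

lemma equiv_fraction_rel: "equiv (carrier R \<times> S) (fraction_rel R S)"
proof (rule equivI)
 show "refl_on (carrier R \<times> S) (fraction_rel R S)"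
  by (auto simp: refl_on_def in_fraction_rel_iff)
 show "sym (fraction_rel R S)" by (force simp: sym_def in_fraction_rel_iff)
 show "trans (fraction_rel R S)"
 proof (rule transI, clarify)
  fix a s b t c r
  assume "((a, s), (b, t)) : fraction_rel R S" "((b, t), (c, r)) : fraction_rel R S"
  then obtain u v where [simp, intro]: "u : S" "v : S" "a : carrier R" "b : carrier R" "c : carrier R"
   "s : S" "t : S" "r : S" and uv: "u \<otimes> (a \<otimes> t) = u \<otimes> (b \<otimes> s)" "v \<otimes> (b \<otimes> r) = v \<otimes> (c \<otimes> t)"
   by (auto simp: in_fraction_rel_iff)
  \<comment> \<open>The middle denominator \<open>t\<close> joins the multiplier because it cannot
    be cancelled.\<close>
  have "(u \<otimes> v \<otimes> t) \<otimes> (a \<otimes> r) = v \<otimes> r \<otimes> (u \<otimes> (a \<otimes> t))" by (simp add: m_ac)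
  also have "... = u \<otimes> s \<otimes> (v \<otimes> (b \<otimes> r))" unfolding uv(1) by (simp add: m_ac)
  also have "... = (u \<otimes> v \<otimes> t) \<otimes> (c \<otimes> s)" unfolding uv(2) by (simp add: m_ac)
  finally show "((a, s), (c, r)) : fraction_rel R S"
   unfolding in_fraction_rel_iff by (intro conjI bexI[of _ "u \<otimes> v \<otimes> t"]) auto
 qed
qed (auto simp: fraction_rel_def)

lemma frac_eq_iff:
 assumes "a : carrier R" "s : S" "b : carrier R" "t : S"
 shows "frc a s = frc b t \<longleftrightarrow> (EX u:S. u \<otimes> (a \<otimes> t) = u \<otimes> (b \<otimes> s))"
 unfolding fraction_def using eq_equiv_class_iff[OF equiv_fraction_rel, of "(a, s)" "(b, t)"] assms
 by (simp add: in_fraction_rel_iff)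

lemma frac_eqI:
 assumes "a : carrier R" "s : S" "b : carrier R" "t : S" "a \<otimes> t = b \<otimes> s"
 shows "frc a s = frc b t"
 using assms by (subst frac_eq_iff) auto

lemma mem_frac:
 "(a', s') : frc a s \<longleftrightarrow> ((a, s), (a', s')) : fraction_rel R S"
 by (simp add: fraction_def)

lemma frac_memD:
 assumes "(a', s') : frc a s"
 shows "a' : carrier R" "s' : S" "EX u:S. u \<otimes> (a \<otimes> s') = u \<otimes> (a' \<otimes> s)"
 using assms by (auto simp: mem_frac in_fraction_rel_iff)

lemma frac_self: "a : carrier R ==> s : S ==> (a, s) : frc a s"
 by (auto simp: mem_frac in_fraction_rel_iff)

lemma frac_closed [simp, intro]: "a : carrier R ==> s : S ==> frc a s : carrier L"
 unfolding localization_def fraction_def by (auto intro: quotientI)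

lemma fracE:
 assumes "x : carrier L"
 obtains a s where "a : carrier R" "s : S" "x = frc a s"
 using assms unfolding localization_def fraction_def by (auto elim!: quotientE)

lemma frac_mult:
 assumes [simp]: "a : carrier R" "s : S" "b : carrier R" "t : S"
 shows "frc a s \<otimes>\<^bsub>L\<^esub> frc b t = frc (a \<otimes> b) (s \<otimes> t)"
proof -
 have *: "frc (a' \<otimes> b') (s' \<otimes> t') = frc (a \<otimes> b) (s \<otimes> t)"
  if m: "(a', s') : frc a s" "(b', t') : frc b t" for a' s' b' t'
 proof -
  note [simp] = frac_memD(1,2)[OF m(1)] frac_memD(1,2)[OF m(2)]
  obtain u v where [simp]: "u : S" "v : S"
   and u: "u \<otimes> (a \<otimes> s') = u \<otimes> (a' \<otimes> s)" and v: "v \<otimes> (b \<otimes> t') = v \<otimes> (b' \<otimes> t)"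
   using frac_memD(3)[OF m(1)] frac_memD(3)[OF m(2)] by auto
  have "(u \<otimes> v) \<otimes> ((a' \<otimes> b') \<otimes> (s \<otimes> t)) = (u \<otimes> (a' \<otimes> s)) \<otimes> (v \<otimes> (b' \<otimes> t))" by (simp add: m_ac)
  also have "... = (u \<otimes> v) \<otimes> ((a \<otimes> b) \<otimes> (s' \<otimes> t'))" unfolding u[symmetric] v[symmetric] by (simp add: m_ac)
  finally show ?thesis by (subst frac_eq_iff) (auto intro!: bexI[of _ "u \<otimes> v"])
 qed
 have "frc a s \<otimes>\<^bsub>L\<^esub> frc b t =
   (\<Union>(a', s')\<in>frc a s. \<Union>(b', t')\<in>frc b t. frc (a' \<otimes> b') (s' \<otimes> t'))"
  by (simp add: localization_def)
 also have "... = frc (a \<otimes> b) (s \<otimes> t)"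
 proof (rule UN_const[of "(a, s)"])
  show "(a, s) : frc a s" by (simp add: frac_self)
  fix y assume y: "y : frc a s"
  show "(case y of (a', s') => \<Union>(b', t')\<in>frc b t. frc (a' \<otimes> b') (s' \<otimes> t')) = frc (a \<otimes> b) (s \<otimes> t)"
   unfolding case_prod_beta[of _ y]
  proof (rule UN_const[of "(b, t)"])
   show "(b, t) : frc b t" by (simp add: frac_self)
   fix z assume "z : frc b t"
   with y show "(case z of (b', t') => frc (fst y \<otimes> b') (snd y \<otimes> t')) = frc (a \<otimes> b) (s \<otimes> t)"
    using *[of "fst y" "snd y" "fst z" "snd z"] by (simp add: case_prod_beta)
  qed
 qed
 finally show ?thesis .
qed

lemma frac_add:
 assumes [simp]: "a : carrier R" "s : S" "b : carrier R" "t : S"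
 shows "frc a s \<oplus>\<^bsub>L\<^esub> frc b t = frc (a \<otimes> t \<oplus> b \<otimes> s) (s \<otimes> t)"
proof -
 have *: "frc (a' \<otimes> t' \<oplus> b' \<otimes> s') (s' \<otimes> t') = frc (a \<otimes> t \<oplus> b \<otimes> s) (s \<otimes> t)"
  if m: "(a', s') : frc a s" "(b', t') : frc b t" for a' s' b' t'
 proof -
  note [simp] = frac_memD(1,2)[OF m(1)] frac_memD(1,2)[OF m(2)]
  obtain u v where [simp]: "u : S" "v : S"
   and u: "u \<otimes> (a \<otimes> s') = u \<otimes> (a' \<otimes> s)" and v: "v \<otimes> (b \<otimes> t') = v \<otimes> (b' \<otimes> t)"
   using frac_memD(3)[OF m(1)] frac_memD(3)[OF m(2)] by auto
  have "(u \<otimes> v) \<otimes> ((a' \<otimes> t' \<oplus> b' \<otimes> s') \<otimes> (s \<otimes> t)) =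
    (u \<otimes> (a' \<otimes> s)) \<otimes> (v \<otimes> t \<otimes> t') \<oplus> (v \<otimes> (b' \<otimes> t)) \<otimes> (u \<otimes> s \<otimes> s')"
   by (simp add: m_ac l_distr r_distr)
  also have "... = (u \<otimes> v) \<otimes> ((a \<otimes> t \<oplus> b \<otimes> s) \<otimes> (s' \<otimes> t'))"
   unfolding u[symmetric] v[symmetric] by (simp add: m_ac l_distr r_distr)
  finally show ?thesis by (subst frac_eq_iff) (auto intro!: bexI[of _ "u \<otimes> v"])
 qed
 have "frc a s \<oplus>\<^bsub>L\<^esub> frc b t =
   (\<Union>(a', s')\<in>frc a s. \<Union>(b', t')\<in>frc b t. frc (a' \<otimes> t' \<oplus> b' \<otimes> s') (s' \<otimes> t'))"
  by (simp add: localization_def)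
 also have "... = frc (a \<otimes> t \<oplus> b \<otimes> s) (s \<otimes> t)"
 proof (rule UN_const[of "(a, s)"])
  show "(a, s) : frc a s" by (simp add: frac_self)
  fix y assume y: "y : frc a s"
  show "(case y of (a', s') => \<Union>(b', t')\<in>frc b t. frc (a' \<otimes> t' \<oplus> b' \<otimes> s') (s' \<otimes> t')) = frc (a \<otimes> t \<oplus> b \<otimes> s) (s \<otimes> t)"
   unfolding case_prod_beta[of _ y]
  proof (rule UN_const[of "(b, t)"])
   show "(b, t) : frc b t" by (simp add: frac_self)
   fix z assume "z : frc b t"
   with y show "(case z of (b', t') => frc (fst y \<otimes> t' \<oplus> b' \<otimes> snd y) (snd y \<otimes> t')) = frc (a \<otimes> t \<oplus> b \<otimes> s) (s \<otimes> t)"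
    using *[of "fst y" "snd y" "fst z" "snd z"] by (simp add: case_prod_beta)
  qed
 qed
 finally show ?thesis .
qed

lemma frac_zero: "\<zero>\<^bsub>L\<^esub> = frc \<zero> \<one>" and frac_one: "\<one>\<^bsub>L\<^esub> = frc \<one> \<one>"
 by (simp_all add: localization_def)

lemma localization_cring: "cring L"
proof (intro cringI abelian_groupI comm_monoidI)
 fix x y z assume "x : carrier L" "y : carrier L" "z : carrier L"
 then obtain a s b t c r where xyz: "x = frc a s" "y = frc b t" "z = frc c r"
  and [simp]: "a : carrier R" "b : carrier R" "c : carrier R" "s : S" "t : S" "r : S"
  by (metis fracE)
 have m: "a : carrier R" "b : carrier R" "c : carrier R" "s : carrier R" "t : carrier R" "r : carrier R"
  by auto
 show "x \<oplus>\<^bsub>L\<^esub> y \<oplus>\<^bsub>L\<^esub> z = x \<oplus>\<^bsub>L\<^esub> (y \<oplus>\<^bsub>L\<^esub> z)"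
  unfolding xyz by (simp add: frac_add) (rule frac_eqI; simp add: m_ac l_distr r_distr a_ac)
 show "x \<otimes>\<^bsub>L\<^esub> y \<otimes>\<^bsub>L\<^esub> z = x \<otimes>\<^bsub>L\<^esub> (y \<otimes>\<^bsub>L\<^esub> z)"
  unfolding xyz by (simp add: frac_mult m_assoc)
 show "(x \<oplus>\<^bsub>L\<^esub> y) \<otimes>\<^bsub>L\<^esub> z = x \<otimes>\<^bsub>L\<^esub> z \<oplus>\<^bsub>L\<^esub> y \<otimes>\<^bsub>L\<^esub> z"
  unfolding xyz by (simp add: frac_add frac_mult) (rule frac_eqI; simp add: m_ac l_distr r_distr a_ac)
next
 fix x y assume "x : carrier L" "y : carrier L"
 then obtain a s b t where xyz: "x = frc a s" "y = frc b t"
  and [simp]: "a : carrier R" "b : carrier R" "s : S" "t : S"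
  by (metis fracE)
 show "x \<oplus>\<^bsub>L\<^esub> y = y \<oplus>\<^bsub>L\<^esub> x"
  unfolding xyz by (simp add: frac_add m_comm a_comm)
 show "x \<otimes>\<^bsub>L\<^esub> y = y \<otimes>\<^bsub>L\<^esub> x"
  unfolding xyz by (simp add: frac_mult m_comm)
 show "x \<oplus>\<^bsub>L\<^esub> y : carrier L" "x \<otimes>\<^bsub>L\<^esub> y : carrier L"
  unfolding xyz by (simp_all add: frac_add frac_mult)
next
 fix x assume "x : carrier L"
 then obtain a s where xyz: "x = frc a s" and [simp]: "a : carrier R" "s : S" by (metis fracE)
 show "\<zero>\<^bsub>L\<^esub> \<oplus>\<^bsub>L\<^esub> x = x" "\<one>\<^bsub>L\<^esub> \<otimes>\<^bsub>L\<^esub> x = x"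
  unfolding xyz by (simp_all add: frac_add frac_mult frac_zero frac_one)
 have "frc (\<ominus> a) s \<oplus>\<^bsub>L\<^esub> x = \<zero>\<^bsub>L\<^esub>"
  unfolding xyz by (simp add: frac_add frac_zero) (rule frac_eqI; simp add: l_minus l_neg)
 then show "EX y:carrier L. y \<oplus>\<^bsub>L\<^esub> x = \<zero>\<^bsub>L\<^esub>" by (intro bexI[of _ "frc (\<ominus> a) s"]) auto
qed (auto simp: frac_zero frac_one)

sublocale L: cring L by (rule localization_cring)

lemma frac_minus:
 assumes [simp]: "a : carrier R" "s : S"
 shows "\<ominus>\<^bsub>L\<^esub> frc a s = frc (\<ominus> a) s"
proof (rule L.minus_equality)
 show "frc (\<ominus> a) s \<oplus>\<^bsub>L\<^esub> frc a s = \<zero>\<^bsub>L\<^esub>"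
  by (simp add: frac_add frac_zero) (rule frac_eqI; simp add: l_minus l_neg)
qed auto

lemma to_localization_hom: "to_localization R S : ring_hom R L"
 by (rule ring_hom_memI) (auto simp: to_localization_def frac_add frac_mult frac_one)


lemma to_localization_unit:
 assumes [simp]: "s : S"
 shows "to_localization R S s : Units L"
proof -
 have "frc s \<one> \<otimes>\<^bsub>L\<^esub> frc \<one> s = \<one>\<^bsub>L\<^esub>" "frc \<one> s \<otimes>\<^bsub>L\<^esub> frc s \<one> = \<one>\<^bsub>L\<^esub>"
  by (simp_all add: frac_mult frac_one) (rule frac_eqI; simp)+
 then show ?thesis unfolding Units_def to_localization_def by (auto intro!: bexI[of _ "frc \<one> s"])
qed

end

section \<open>Invertible ideals\<close>

lemma (in cring) regularD:
 assumes "d : regular_elements R"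
 shows "d : carrier R" "b : carrier R ==> d \<otimes> b = \<zero> ==> b = \<zero>"
 using assms by (auto simp: regular_elements_def)

lemma (in cring) regularI:
 assumes "d : carrier R" "!!b. b : carrier R ==> d \<otimes> b = \<zero> ==> b = \<zero>"
 shows "d : regular_elements R"
 unfolding regular_elements_def using assms by blast

lemma (in cring) regular_mult:
 assumes "s : regular_elements R" "t : regular_elements R"
 shows "s \<otimes> t : regular_elements R"
proof (rule regularI)
 note [simp] = regularD(1)[OF assms(1)] regularD(1)[OF assms(2)]
 show "s \<otimes> t : carrier R" by simp
 fix b assume b: "b : carrier R" "s \<otimes> t \<otimes> b = \<zero>"
 then have "s \<otimes> (t \<otimes> b) = \<zero>" by (simp add: m_assoc)
 then show "b = \<zero>" using regularD(2)[OF assms(1), of "t \<otimes> b"] regularD(2)[OF assms(2), of b] b by simp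
qed

lemma (in cring) regular_localizing: "localizing R (regular_elements R)"
proof
 show "regular_elements R <= carrier R" unfolding regular_elements_def by blast
 show "\<one> : regular_elements R" by (rule regularI) auto
qed (rule regular_mult)

lemma (in cring) regular_cancel:
 assumes d: "d : regular_elements R" and [simp]: "a : carrier R" "b : carrier R"
  and e: "d \<otimes> a = d \<otimes> b"
 shows "a = b"
proof -
 note [simp] = regularD(1)[OF d]
 have "d \<otimes> (a \<ominus> b) = \<zero>" using e by (simp add: minus_eq r_distr r_minus r_neg)
 then show ?thesis using regularD(2)[OF d, of "a \<ominus> b"] by simp
qed

text \<open>A common denominator d of the inverse K will do: d K lies in R, so d I K lies in I, and
  1 lies in I K.\<close>

lemma (in cring) invertible_ideal_regular:
 assumes "invertible_ideal I R"
 shows "EX d:I. d : regular_elements R"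
proof -
 interpret Q: localizing R "regular_elements R" by (rule regular_localizing)
 note to_def = to_localization_def
 obtain K where I: "ideal I R" and K: "fractional_ideal R K"
  and IK: "ideal_prod Q.L (to_total_fractions R ` I) K = to_total_fractions R ` carrier R"
  using assms unfolding invertible_ideal_def by blast
 interpret I: ideal I R by fact
 obtain d where d: "d : regular_elements R"
  and dK: "!!x. x : K ==> to_total_fractions R d \<otimes>\<^bsub>Q.L\<^esub> x : to_total_fractions R ` carrier R"
  and sub: "additive_subgroup K Q.L"
  using K unfolding fractional_ideal_def by blast
 have KL: "K <= carrier Q.L" using sub by (rule additive_subgroup.a_subset)
 note [simp] = regularD(1)[OF d]
 have dI: "to_total_fractions R d \<otimes>\<^bsub>Q.L\<^esub> q : to_total_fractions R ` I & q : carrier Q.L"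
  if "q : ideal_prod Q.L (to_total_fractions R ` I) K" for q
  using that
 proof induction
  case (prod i j)
  then obtain a where a: "i = to_total_fractions R a" "a : I" by blast
  obtain r where r: "to_total_fractions R d \<otimes>\<^bsub>Q.L\<^esub> j = to_total_fractions R r" "r : carrier R"
   using dK[OF prod(2)] by blast
  have [simp]: "a : carrier R" using a I.Icarr by blast
  have jc: "j : carrier Q.L" using prod KL by blast
  have ic: "i : carrier Q.L" unfolding a to_def by simp
  have "to_total_fractions R d \<otimes>\<^bsub>Q.L\<^esub> (i \<otimes>\<^bsub>Q.L\<^esub> j) = i \<otimes>\<^bsub>Q.L\<^esub> (to_total_fractions R d \<otimes>\<^bsub>Q.L\<^esub> j)"
   using ic jc by (intro Q.L.m_lcomm) (auto simp: to_def)
  also have "... = to_total_fractions R (a \<otimes> r)"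
   unfolding r unfolding a using r by (simp add: to_def Q.frac_mult)
  finally show ?case using a r ic jc by (auto intro!: imageI I.I_r_closed)
 next
  case (sum p q)
  then obtain a b where ab: "to_total_fractions R d \<otimes>\<^bsub>Q.L\<^esub> p = to_total_fractions R a"
   "to_total_fractions R d \<otimes>\<^bsub>Q.L\<^esub> q = to_total_fractions R b" "a : I" "b : I" by blast
  then have [simp]: "a : carrier R" "b : carrier R" using I.Icarr by blast+
  have "to_total_fractions R d \<otimes>\<^bsub>Q.L\<^esub> (p \<oplus>\<^bsub>Q.L\<^esub> q) = to_total_fractions R (a \<oplus> b)"
   using sum ab by (subst Q.L.r_distr) (auto simp: to_def Q.frac_add)
  then show ?case using ab sum by (auto intro!: imageI)
 qed
 have "\<one>\<^bsub>Q.L\<^esub> : ideal_prod Q.L (to_total_fractions R ` I) K"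
  unfolding IK Q.frac_one to_def by blast
 from dI[OF this] obtain a where a: "a : I" "to_total_fractions R d = to_total_fractions R a"
  by (auto simp: to_def)
 then have [simp]: "a : carrier R" using I.Icarr by blast
 obtain u where u: "u : regular_elements R" "u \<otimes> d = u \<otimes> a"
  using a(2) by (auto simp: to_def Q.frac_eq_iff)
 then have "d = a" using regular_cancel[OF u(1), of d a] u(2) by simp
 then show ?thesis using a d by blast
qed

text \<open>The inverse consists of the fractions y / d with y I contained in d R. By
  \<open>dvd\<close> it contains every b i / d, and \<open>sum\<close> says that the products of the
  g i with these fractions add up to one.\<close>

lemma (in cring) invertible_idealI:
 assumes I: "ideal I R" and dI: "d : I" and d: "d : regular_elements R"
  and A: "finite A" "!!i. i : A ==> g i : I" "!!i. i : A ==> b i : carrier R"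
  and sum: "d = (\<Oplus>i\<in>A. g i \<otimes> b i)"
  and dvd: "!!i x. i : A ==> x : I ==> EX y:carrier R. x \<otimes> b i = d \<otimes> y"
 shows "invertible_ideal I R"
proof -
 interpret Q: localizing R "regular_elements R" by (rule regular_localizing)
 interpret I: ideal I R by fact
 note to_def = to_localization_def
 note [simp] = regularD(1)[OF d] d
 define B where "B = {y : carrier R. ALL x:I. EX z:carrier R. x \<otimes> y = d \<otimes> z}"
 define K where "K = (%y. Q.frc y d) ` B"
 have BR [simp]: "y : B ==> y : carrier R" for y by (simp add: B_def)
 have B0: "\<zero> : B" unfolding B_def using I.Icarr by (auto intro!: bexI[of _ \<zero>])
 have Badd: "y \<oplus> y' : B" if y: "y : B" "y' : B" for y y'
 proof -
  have "EX z:carrier R. x \<otimes> (y \<oplus> y') = d \<otimes> z" if x: "x : I" for x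
  proof -
   obtain z z' where "z : carrier R" "z' : carrier R" "x \<otimes> y = d \<otimes> z" "x \<otimes> y' = d \<otimes> z'"
    using y x unfolding B_def by blast
   then show ?thesis
    using x I.Icarr y by (intro bexI[of _ "z \<oplus> z'"]) (auto simp: r_distr)
  qed
  then show ?thesis unfolding B_def using y by simp
 qed
 have Bmul: "r \<otimes> y : B" if r: "r : carrier R" and y: "y : B" for r y
 proof -
  have "EX z:carrier R. x \<otimes> (r \<otimes> y) = d \<otimes> z" if x: "x : I" for x
  proof -
   obtain z where "z : carrier R" "x \<otimes> y = d \<otimes> z" using y x unfolding B_def by blast
   then show ?thesis
    using x I.Icarr r y by (intro bexI[of _ "r \<otimes> z"]) (auto simp: m_lcomm)
  qed
  then show ?thesis unfolding B_def using y r by simp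
 qed
 have frc_add: "Q.frc y d \<oplus>\<^bsub>Q.L\<^esub> Q.frc y' d = Q.frc (y \<oplus> y') d" if [simp]: "y : carrier R" "y' : carrier R" for y y'
  by (simp add: Q.frac_add) (rule Q.frac_eqI; simp add: m_ac l_distr r_distr)
 have KL: "K <= carrier Q.L" by (auto simp: K_def)
 have "additive_subgroup K Q.L"
 proof (intro additive_subgroup.intro Q.L.add.subgroupI)
  show "K ~= {}" using B0 by (auto simp: K_def)
  show "a : K ==> \<ominus>\<^bsub>Q.L\<^esub> a : K" for a
  proof -
   assume "a : K"
   then obtain y where y: "a = Q.frc y d" "y : B" by (auto simp: K_def)
   then have "\<ominus>\<^bsub>Q.L\<^esub> a = Q.frc (\<ominus> y) d"
    using Q.frac_minus[of y d] by simp
   moreover have "\<ominus> y = (\<ominus> \<one>) \<otimes> y" using y by (simp add: l_minus)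
   ultimately show ?thesis using Bmul[of "\<ominus> \<one>" y] y by (auto simp: K_def)
  qed
  show "a : K ==> b : K ==> a \<oplus>\<^bsub>Q.L\<^esub> b : K" for a b
   by (auto simp: K_def frc_add intro!: imageI Badd)
 qed (use KL in auto)
 moreover have "to_total_fractions R r \<otimes>\<^bsub>Q.L\<^esub> x : K" if "r : carrier R" "x : K" for r x
  using that by (auto simp: K_def to_def Q.frac_mult intro!: imageI Bmul)
 moreover have "to_total_fractions R d \<otimes>\<^bsub>Q.L\<^esub> x : to_total_fractions R ` carrier R" if x: "x : K" for x
 proof -
  obtain y where y: "x = Q.frc y d" "y : B" using x by (auto simp: K_def)
  then have "to_total_fractions R d \<otimes>\<^bsub>Q.L\<^esub> x = to_total_fractions R y"
   by (simp add: to_def Q.frac_mult) (rule Q.frac_eqI; simp add: m_comm)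
  then show ?thesis using y by auto
 qed
 ultimately have "fractional_ideal R K" unfolding fractional_ideal_def using d by blast
 moreover have "ideal_prod Q.L (to_total_fractions R ` I) K = to_total_fractions R ` carrier R"
 proof (intro equalityI subsetI)
  fix q assume "q : ideal_prod Q.L (to_total_fractions R ` I) K"
  then show "q : to_total_fractions R ` carrier R"
  proof induction
   case (prod i j)
   then obtain x y where xy: "i = to_total_fractions R x" "x : I" "j = Q.frc y d" "y : B"
    by (auto simp: K_def)
   then have [simp]: "x : carrier R" "y : carrier R" using I.Icarr by auto
   obtain z where z: "z : carrier R" "x \<otimes> y = d \<otimes> z" using xy unfolding B_def by blast
   have "i \<otimes>\<^bsub>Q.L\<^esub> j = to_total_fractions R z"
    unfolding xy to_def using z by (simp add: Q.frac_mult) (rule Q.frac_eqI; simp add: m_comm)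
   then show ?case using z by auto
  next
   case (sum p q)
   then show ?case by (auto simp: to_def Q.frac_add intro!: imageI)
  qed
 next
  fix q assume "q : to_total_fractions R ` carrier R"
  then obtain r where r [simp]: "r : carrier R" and q: "q = to_total_fractions R r" by blast
  let ?T = "ideal_prod Q.L (to_total_fractions R ` I) K"
  have gc [simp]: "i : A ==> g i : carrier R" for i using A I.Icarr by blast
  have F: "F <= A ==> Q.frc (\<Oplus>i\<in>F. g i \<otimes> (r \<otimes> b i)) d : ?T" if "finite F" for F
   using that
  proof (induction F)
   case empty
   have "to_total_fractions R \<zero> \<otimes>\<^bsub>Q.L\<^esub> Q.frc \<zero> d : ?T"
    by (rule ideal_prod.prod) (auto simp: K_def B0)
   moreover have "to_total_fractions R \<zero> \<otimes>\<^bsub>Q.L\<^esub> Q.frc \<zero> d = Q.frc \<zero> d"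
    by (simp add: to_def Q.frac_mult)
   ultimately show ?case by simp
  next
   case (insert i F)
   then have i: "i : A" by simp
   have "to_total_fractions R (g i) \<otimes>\<^bsub>Q.L\<^esub> Q.frc (r \<otimes> b i) d : ?T"
   proof (intro ideal_prod.prod imageI)
    have "b i : B" using dvd[OF i] A(3)[OF i] unfolding B_def by blast
    then show "Q.frc (r \<otimes> b i) d : K" unfolding K_def using Bmul r by blast
   qed (use A i in blast)
   moreover have "to_total_fractions R (g i) \<otimes>\<^bsub>Q.L\<^esub> Q.frc (r \<otimes> b i) d = Q.frc (g i \<otimes> (r \<otimes> b i)) d"
    using i A by (simp add: to_def Q.frac_mult)
   ultimately have 1: "Q.frc (g i \<otimes> (r \<otimes> b i)) d : ?T" by simp
   have fc: "(\<Oplus>i\<in>F. g i \<otimes> (r \<otimes> b i)) : carrier R" using insert A by (intro finsum_closed) auto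
   have "(\<Oplus>i\<in>insert i F. g i \<otimes> (r \<otimes> b i)) = g i \<otimes> (r \<otimes> b i) \<oplus> (\<Oplus>i\<in>F. g i \<otimes> (r \<otimes> b i))"
    using insert A by (intro finsum_insert) auto
   then have "Q.frc (\<Oplus>i\<in>insert i F. g i \<otimes> (r \<otimes> b i)) d =
     Q.frc (g i \<otimes> (r \<otimes> b i)) d \<oplus>\<^bsub>Q.L\<^esub> Q.frc (\<Oplus>i\<in>F. g i \<otimes> (r \<otimes> b i)) d"
    using fc i A by (simp add: frc_add)
   then show ?case using 1 insert by (auto intro: ideal_prod.sum)
  qed
  have "(\<Oplus>i\<in>A. g i \<otimes> (r \<otimes> b i)) = (\<Oplus>i\<in>A. r \<otimes> (g i \<otimes> b i))"
   using A by (intro finsum_cong') (auto simp: m_lcomm)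
  also have "... = r \<otimes> d" unfolding sum using A by (intro finsum_rdistr[symmetric]) auto
  finally have "Q.frc (r \<otimes> d) d : ?T" using F[OF A(1)] by simp
  moreover have "Q.frc (r \<otimes> d) d = q" unfolding q to_def by (rule Q.frac_eqI) auto
  ultimately show "q : ?T" by simp
 qed
 ultimately show ?thesis unfolding invertible_ideal_def using I by blast
qed

section \<open>Polynomial functions over almost local-global rings\<close>

text \<open>The rules mirror the generation of \<open>indexed_pset\<close>, but for functions and
  with variables of any type, so that a polynomial can be given by its values. The rule
  \<open>cong\<close> admits expressions that agree with a polynomial only at points of the
  carrier.\<close>

inductive polyfun :: "('a, 'r) ring_scheme => 'v set => (('v => 'a) => 'a) => bool" for R V where
 const: "k : carrier R ==> polyfun R V (%_. k)"
| add: "polyfun R V F ==> polyfun R V G ==> polyfun R V (%a. F a \<oplus>\<^bsub>R\<^esub> G a)"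
| mult_var: "polyfun R V F ==> v : V ==> polyfun R V (%a. F a \<otimes>\<^bsub>R\<^esub> a v)"
| cong: "polyfun R V F ==> (!!a. a : V \<rightarrow> carrier R ==> G a = F a) ==> polyfun R V G"

lemma (in cring) polyfun_closed:
 "polyfun R V F ==> a : V \<rightarrow> carrier R ==> F a : carrier R"
 by (induction rule: polyfun.induct) auto

lemma (in cring) polyfun_sum:
 assumes "finite A" "!!i. i : A ==> polyfun R V (F i)"
 shows "polyfun R V (%a. \<Oplus>i\<in>A. F i a)"
 using assms
proof (induction A)
 case empty
 then show ?case by (simp add: polyfun.const)
next
 case (insert x B)
 have "polyfun R V (%a. F x a \<oplus> (\<Oplus>i\<in>B. F i a))"
  using insert by (intro polyfun.add) auto
 then show ?case
 proof (rule polyfun.cong)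
  fix a assume a: "a : V \<rightarrow> carrier R"
  have "F i a : carrier R" if "i : insert x B" for i
   using polyfun_closed[OF insert.prems[OF that] a] .
  then show "(\<Oplus>i\<in>insert x B. F i a) = F x a \<oplus> (\<Oplus>i\<in>B. F i a)"
   using insert by (intro finsum_insert) auto
 qed
qed

section \<open>Values of formal polynomials\<close>

definition mono_value :: "('b, 's) ring_scheme => (nat => 'b) => nat multiset => 'b" where
 "mono_value S a w = (\<Otimes>\<^bsub>S\<^esub>i\<in>set_mset w. a i [^]\<^bsub>S\<^esub> count w i)"

lemma (in cring) mono_value_superset:
 assumes "finite A" "set_mset w <= A" "a : A \<rightarrow> carrier R"
 shows "mono_value R a w = (\<Otimes>i\<in>A. a i [^] count w i)"
 unfolding mono_value_def
 by (rule finprod_mono_neutral_cong_left) (use assms in \<open>auto simp: not_in_iff\<close>)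

lemma (in cring) mono_value_closed:
 "a : set_mset w \<rightarrow> carrier R ==> mono_value R a w : carrier R"
 unfolding mono_value_def by (intro finprod_closed) auto

lemma (in cring) mono_value_add_mset:
 assumes a: "a : insert i (set_mset w) \<rightarrow> carrier R"
 shows "mono_value R a (add_mset i w) = mono_value R a w \<otimes> a i"
proof -
 define A where "A = set_mset w - {i}"
 have A: "finite A" "i ~: A" "insert i (set_mset w) = insert i A" by (auto simp: A_def)
 have a': "a i : carrier R" "a : A \<rightarrow> carrier R" using a A by auto
 define P where "P = (\<Otimes>j\<in>A. a j [^] count w j)"
 have P [simp]: "P : carrier R" unfolding P_def using a' by (intro finprod_closed) auto
 have "mono_value R a (add_mset i w) = (\<Otimes>j\<in>insert i A. a j [^] count (add_mset i w) j)"
  using A a by (intro mono_value_superset) auto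
 also have "... = a i [^] Suc (count w i) \<otimes> (\<Otimes>j\<in>A. a j [^] count (add_mset i w) j)"
  using A a' by (subst finprod_insert) auto
 also have "(\<Otimes>j\<in>A. a j [^] count (add_mset i w) j) = P"
  unfolding P_def using A a' by (intro finprod_cong') auto
 finally have 1: "mono_value R a (add_mset i w) = a i [^] Suc (count w i) \<otimes> P" .
 have "mono_value R a w = (\<Otimes>j\<in>insert i A. a j [^] count w j)"
  using A a by (intro mono_value_superset) auto
 also have "... = a i [^] count w i \<otimes> P"
  unfolding P_def using A a' by (subst finprod_insert) auto
 finally show ?thesis using 1 a' by (simp add: m_ac)
qed

lemma (in cring) indexed_pset_support:
 assumes "f : indexed_pset V (carrier R)"
 shows "finite {w. f w ~= \<zero>} & (ALL w. f w : carrier R) & (ALL w. f w ~= \<zero> --> set_mset w <= V)"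
 using assms
proof induction
 case (indexed_const k)
 have "{w. indexed_const k w ~= \<zero>} <= {{#}}" by (auto simp: indexed_const_def)
 then show ?case using indexed_const finite_subset by (fastforce simp: indexed_const_def)
next
 case (indexed_padd P Q)
 have "{w. indexed_padd P Q w ~= \<zero>} <= {w. P w ~= \<zero>} \<union> {w. Q w ~= \<zero>}"
  using indexed_padd by (auto simp: indexed_padd_def)
 then have "finite {w. indexed_padd P Q w ~= \<zero>}" using indexed_padd by (meson finite_Un finite_subset)
 moreover have "set_mset w <= V" if "indexed_padd P Q w ~= \<zero>" for w
 proof -
  have "P w ~= \<zero> | Q w ~= \<zero>" using that by (auto simp: indexed_padd_def)
  then show ?thesis using indexed_padd by blast
 qed
 ultimately show ?case using indexed_padd by (auto simp: indexed_padd_def)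
next
 case (indexed_pmult P i)
 have "{w. indexed_pmult P i w ~= \<zero>} <= add_mset i ` {w. P w ~= \<zero>}"
 proof
  fix w assume "w : {w. indexed_pmult P i w ~= \<zero>}"
  then have "i :# w" "P (w - {#i#}) ~= \<zero>" by (auto simp: indexed_pmult_def split: if_splits)
  then show "w : add_mset i ` {w. P w ~= \<zero>}" by (auto intro!: image_eqI[of _ _ "w - {#i#}"])
 qed
 then have "finite {w. indexed_pmult P i w ~= \<zero>}" using indexed_pmult by (meson finite_imageI finite_subset)
 moreover have "set_mset w <= V" if "indexed_pmult P i w ~= \<zero>" for w
 proof -
  have "i :# w" "P (w - {#i#}) ~= \<zero>" using that by (auto simp: indexed_pmult_def split: if_splits)
  then have "set_mset (w - {#i#}) <= V" using indexed_pmult by blast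
  then show ?thesis using indexed_pmult(2) by (metis \<open>i :# w\<close> insert_DiffM insert_subset set_mset_add_mset_insert)
 qed
 ultimately show ?case using indexed_pmult by (auto simp: indexed_pmult_def)
qed

lemma (in cring) poly_value_superset:
 assumes f: "f : indexed_pset V (carrier R)" and a: "a : V \<rightarrow> carrier R"
  and B: "finite B" "{w. f w ~= \<zero>} <= B" "!!w. w : B ==> set_mset w <= V"
 shows "poly_value R R id f a = (\<Oplus>w\<in>B. f w \<otimes> mono_value R a w)"
 unfolding poly_value_def mono_value_def[symmetric]
proof (rule add.finprod_mono_neutral_cong_left)
 have mc: "mono_value R a w : carrier R" if "w : B" for w
  using that a B(3)[of w] by (intro mono_value_closed) auto
 show "(%w. f w \<otimes> mono_value R a w) : B \<rightarrow> carrier R"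
  using mc indexed_pset_support[OF f] by auto
 show "f i \<otimes> mono_value R a i = \<zero>" if "i : B - {w. f w ~= \<zero>}" for i
  using that mc by auto
qed (use B in auto)

lemma (in cring) poly_value_ops:
 assumes a: "a : V \<rightarrow> carrier R"
 shows "k : carrier R ==> poly_value R R id (indexed_const k) a = k"
  and "P : indexed_pset V (carrier R) ==> Q : indexed_pset V (carrier R) ==>
   poly_value R R id (indexed_padd P Q) a = poly_value R R id P a \<oplus> poly_value R R id Q a"
  and "P : indexed_pset V (carrier R) ==> i : V ==>
   poly_value R R id (indexed_pmult P i) a = poly_value R R id P a \<otimes> a i"
proof -
 assume k: "k : carrier R"
 have "poly_value R R id (indexed_const k) a = (\<Oplus>w\<in>{{#}}. indexed_const k w \<otimes> mono_value R a w)"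
  using k a by (intro poly_value_superset[of _ V]) (auto intro: indexed_pset.indexed_const, auto simp: indexed_const_def split: if_splits)
 also have "... = k" using k by (simp add: indexed_const_def mono_value_def)
 finally show "poly_value R R id (indexed_const k) a = k" .
next
 assume P: "P : indexed_pset V (carrier R)" and Q: "Q : indexed_pset V (carrier R)"
 note sP = indexed_pset_support[OF P] and sQ = indexed_pset_support[OF Q]
 define B where "B = {w. P w ~= \<zero>} \<union> {w. Q w ~= \<zero>}"
 have B: "finite B" "!!w. w : B ==> set_mset w <= V" using sP sQ by (auto simp: B_def)
 have PQ: "indexed_padd P Q : indexed_pset V (carrier R)" using P Q by (rule indexed_pset.indexed_padd)
 have sub: "{w. indexed_padd P Q w ~= \<zero>} <= B" unfolding B_def indexed_padd_def by auto
 have mc: "mono_value R a w : carrier R" if "w : B" for w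
  using that a B(2)[of w] by (intro mono_value_closed) auto
 have "poly_value R R id (indexed_padd P Q) a = (\<Oplus>w\<in>B. indexed_padd P Q w \<otimes> mono_value R a w)"
  by (rule poly_value_superset[OF PQ a B(1) sub B(2)])
 also have "... = (\<Oplus>w\<in>B. P w \<otimes> mono_value R a w \<oplus> Q w \<otimes> mono_value R a w)"
  using mc sP sQ by (intro finsum_cong') (auto simp: l_distr indexed_padd_def)
 also have "... = (\<Oplus>w\<in>B. P w \<otimes> mono_value R a w) \<oplus> (\<Oplus>w\<in>B. Q w \<otimes> mono_value R a w)"
  using mc sP sQ by (intro finsum_addf) auto
 also have "(\<Oplus>w\<in>B. P w \<otimes> mono_value R a w) = poly_value R R id P a"
  by (rule poly_value_superset[OF P a B(1) _ B(2), symmetric]) (auto simp: B_def)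
 also have "(\<Oplus>w\<in>B. Q w \<otimes> mono_value R a w) = poly_value R R id Q a"
  by (rule poly_value_superset[OF Q a B(1) _ B(2), symmetric]) (auto simp: B_def)
 finally show "poly_value R R id (indexed_padd P Q) a = poly_value R R id P a \<oplus> poly_value R R id Q a" .
next
 assume P: "P : indexed_pset V (carrier R)" and i: "i : V"
 note sP = indexed_pset_support[OF P]
 define A where "A = {w. P w ~= \<zero>}"
 have A: "finite A" "!!w. w : A ==> set_mset w <= V" using sP by (auto simp: A_def)
 have Pi: "indexed_pmult P i : indexed_pset V (carrier R)" using P i by (rule indexed_pset.indexed_pmult)
 have sub: "{w. indexed_pmult P i w ~= \<zero>} <= add_mset i ` A"
 proof
  fix w assume "w : {w. indexed_pmult P i w ~= \<zero>}"
  then have "i :# w" "P (w - {#i#}) ~= \<zero>" by (auto simp: indexed_pmult_def split: if_splits)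
  then show "w : add_mset i ` A" by (auto simp: A_def intro!: image_eqI[of _ _ "w - {#i#}"])
 qed
 have mc: "mono_value R a w : carrier R" if "set_mset w <= V" for w
  using that a by (intro mono_value_closed) auto
 have ai: "a i : carrier R" using a i by auto
 have "poly_value R R id (indexed_pmult P i) a =
   (\<Oplus>w\<in>add_mset i ` A. indexed_pmult P i w \<otimes> mono_value R a w)"
 proof (rule poly_value_superset[OF Pi a _ sub])
  show "set_mset w <= V" if "w : add_mset i ` A" for w
   using that i by (auto dest: subsetD[OF A(2)])
 qed (use A in simp)
 also have "... = (\<Oplus>w\<in>A. indexed_pmult P i (add_mset i w) \<otimes> mono_value R a (add_mset i w))"
 proof (rule finsum_reindex)
  have "mono_value R a (add_mset i w) : carrier R" if "w : A" for w
   using i A(2)[OF that] by (intro mc) auto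
  then show "(%w. indexed_pmult P i w \<otimes> mono_value R a w) : add_mset i ` A \<rightarrow> carrier R"
   using sP by (auto simp: indexed_pmult_def)
 qed (simp add: inj_on_def)
 also have "... = (\<Oplus>w\<in>A. P w \<otimes> mono_value R a w \<otimes> a i)"
 proof (intro finsum_cong')
  fix w assume w: "w : A"
  have "mono_value R a (add_mset i w) = mono_value R a w \<otimes> a i"
   using a i A(2)[OF w] by (intro mono_value_add_mset) auto
  then show "indexed_pmult P i (add_mset i w) \<otimes> mono_value R a (add_mset i w) = P w \<otimes> mono_value R a w \<otimes> a i"
   using w mc[OF A(2)[OF w]] sP ai by (simp add: indexed_pmult_def m_assoc)
 next
  show "(%w. P w \<otimes> mono_value R a w \<otimes> a i) : A \<rightarrow> carrier R"
   using sP mc[OF A(2)] ai by auto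
 qed simp
 also have "... = (\<Oplus>w\<in>A. P w \<otimes> mono_value R a w) \<otimes> a i"
  using sP mc[OF A(2)] A(1) ai by (intro finsum_ldistr[symmetric]) auto
 also have "(\<Oplus>w\<in>A. P w \<otimes> mono_value R a w) = poly_value R R id P a"
  by (rule poly_value_superset[OF P a A(1) _ A(2), symmetric]) (auto simp: A_def)
 finally show "poly_value R R id (indexed_pmult P i) a = poly_value R R id P a \<otimes> a i" .
qed

lemma poly_value_hom:
 assumes "cring R" "cring S" "\<phi> : ring_hom R S"
  and f: "f : ring.indexed_pset R V (carrier R)" and a: "a : V \<rightarrow> carrier R"
 shows "poly_value R S \<phi> f (%i. \<phi> (a i)) = \<phi> (poly_value R R id f a)"
proof -
 interpret R: cring R by fact
 interpret S: cring S by fact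
 interpret h: ring_hom_cring R S \<phi> using assms(3) by unfold_locales
 note s = R.indexed_pset_support[OF f]
 have m: "(\<Otimes>\<^bsub>R\<^esub>i\<in>set_mset w. a i [^]\<^bsub>R\<^esub> count w i) : carrier R" if "f w ~= \<zero>\<^bsub>R\<^esub>" for w
  using s that a by (intro R.finprod_closed) blast
 have "\<phi> (poly_value R R id f a) = (\<Oplus>\<^bsub>S\<^esub>w\<in>{w. f w ~= \<zero>\<^bsub>R\<^esub>}. \<phi> (f w \<otimes>\<^bsub>R\<^esub> (\<Otimes>\<^bsub>R\<^esub>i\<in>set_mset w. a i [^]\<^bsub>R\<^esub> count w i)))"
  unfolding poly_value_def using s m by (subst h.hom_finsum) (auto simp: o_def)
 also have "... = poly_value R S \<phi> f (%i. \<phi> (a i))"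
  unfolding poly_value_def
 proof (intro S.finsum_cong')
  fix w assume w: "w : {w. f w ~= \<zero>\<^bsub>R\<^esub>}"
  then have aw: "i :# w ==> a i : carrier R" for i using s a by blast
  have "\<phi> (f w \<otimes>\<^bsub>R\<^esub> (\<Otimes>\<^bsub>R\<^esub>i\<in>set_mset w. a i [^]\<^bsub>R\<^esub> count w i)) =
    \<phi> (f w) \<otimes>\<^bsub>S\<^esub> (\<Otimes>\<^bsub>S\<^esub>i\<in>set_mset w. \<phi> (a i [^]\<^bsub>R\<^esub> count w i))"
   using s m[of w] w aw by (subst h.hom_mult) (auto simp: h.hom_finprod o_def Pi_def)
  also have "(\<Otimes>\<^bsub>S\<^esub>i\<in>set_mset w. \<phi> (a i [^]\<^bsub>R\<^esub> count w i)) = (\<Otimes>\<^bsub>S\<^esub>i\<in>set_mset w. \<phi> (a i) [^]\<^bsub>S\<^esub> count w i)"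
   using aw by (intro S.finprod_cong') auto
  finally show "\<phi> (f w \<otimes>\<^bsub>R\<^esub> (\<Otimes>\<^bsub>R\<^esub>i\<in>set_mset w. a i [^]\<^bsub>R\<^esub> count w i)) =
    \<phi> (f w) \<otimes>\<^bsub>S\<^esub> (\<Otimes>\<^bsub>S\<^esub>i\<in>set_mset w. \<phi> (a i) [^]\<^bsub>S\<^esub> count w i)" .
 next
  show "(%w. \<phi> (f w) \<otimes>\<^bsub>S\<^esub> (\<Otimes>\<^bsub>S\<^esub>i\<in>set_mset w. \<phi> (a i) [^]\<^bsub>S\<^esub> count w i)) : {w. f w ~= \<zero>\<^bsub>R\<^esub>} \<rightarrow> carrier S"
  proof (intro funcsetI S.m_closed S.finprod_closed S.nat_pow_closed)
   fix w i assume "w : {w. f w ~= \<zero>\<^bsub>R\<^esub>}" "i :# w"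
   then have "a i : carrier R" using s a by blast
   then show "\<phi> (a i) : carrier S" by simp
  qed (use s in simp)
 qed simp
 finally show ?thesis by simp
qed


lemma (in cring) FactRing_carrierE:
 assumes "x : carrier (R Quot I)"
 obtains r where "r : carrier R" "x = I +> r"
 using assms by (auto simp: FactRing_def A_RCOSETS_def')

text \<open>Indeterminates in \<open>local_global\<close> are natural numbers, so the variables in
  \<open>V\<close> are numbered by \<open>e\<close>. The point \<open>b\<close> is tied to
  \<open>a\<close> only at these numbers, which lets one formal polynomial serve every choice of
  representatives.\<close>

lemma (in cring) polyfun_quot:
 assumes I: "ideal I R" and F: "polyfun R V F" and e: "e ` V <= {..<n}" "inj_on e V"
 shows "EX f:ring.indexed_pset (R Quot I) {..<n} (carrier (R Quot I)).
  ALL a b. a : V \<rightarrow> carrier R --> b : {..<n} \<rightarrow> carrier (R Quot I) --> (ALL v:V. b (e v) = I +> a v) -->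
   poly_value (R Quot I) (R Quot I) id f b = I +> F a"
proof -
 interpret I: ideal I R by fact
 interpret Q: cring "R Quot I" using I.quotient_is_cring[OF cring_axioms] .
 have hom: "(+>) I : ring_hom R (R Quot I)" by (rule I.rcos_ring_hom)
 note h = ring_hom_memE[OF hom]
 show ?thesis using F
 proof induction
  case (const k)
  then have k: "I +> k : carrier (R Quot I)" by (rule h(1))
  then show ?case
   by (intro bexI[OF _ Q.indexed_pset.indexed_const[OF k]] allI impI) (rule Q.poly_value_ops(1), assumption+)
 next
  case (add F G)
  then obtain f g where f: "f : Q.indexed_pset {..<n} (carrier (R Quot I))" and
   fv: "!!a b. a : V \<rightarrow> carrier R ==> b : {..<n} \<rightarrow> carrier (R Quot I) ==> ALL v:V. b (e v) = I +> a v ==>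
   poly_value (R Quot I) (R Quot I) id f b = I +> F a" and g: "g : Q.indexed_pset {..<n} (carrier (R Quot I))" and
   gv: "!!a b. a : V \<rightarrow> carrier R ==> b : {..<n} \<rightarrow> carrier (R Quot I) ==> ALL v:V. b (e v) = I +> a v ==>
   poly_value (R Quot I) (R Quot I) id g b = I +> G a" by blast
  show ?case
  proof (intro bexI[OF _ Q.indexed_pset.indexed_padd[OF f g]] allI impI)
   fix a b assume ab: "a : V \<rightarrow> carrier R" "b : {..<n} \<rightarrow> carrier (R Quot I)" "ALL v:V. b (e v) = I +> a v"
   show "poly_value (R Quot I) (R Quot I) id (Q.indexed_padd f g) b = I +> (F a \<oplus> G a)"
    unfolding Q.poly_value_ops(2)[OF ab(2) f g] fv[OF ab] gv[OF ab]
    using polyfun_closed[OF add(1) ab(1)] polyfun_closed[OF add(2) ab(1)] h(3) by simp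
  qed
 next
  case (mult_var F v)
  then obtain f where f: "f : Q.indexed_pset {..<n} (carrier (R Quot I))" and
   fv: "!!a b. a : V \<rightarrow> carrier R ==> b : {..<n} \<rightarrow> carrier (R Quot I) ==> ALL v:V. b (e v) = I +> a v ==>
   poly_value (R Quot I) (R Quot I) id f b = I +> F a" by blast
  have ev: "e v : {..<n}" using mult_var e by blast
  show ?case
  proof (intro bexI[OF _ Q.indexed_pset.indexed_pmult[OF f ev]] allI impI)
   fix a b assume ab: "a : V \<rightarrow> carrier R" "b : {..<n} \<rightarrow> carrier (R Quot I)" "ALL v:V. b (e v) = I +> a v"
   have "b (e v) = I +> a v" "a v : carrier R" using ab mult_var by auto
   then show "poly_value (R Quot I) (R Quot I) id (Q.indexed_pmult f (e v)) b = I +> (F a \<otimes> a v)"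
    unfolding Q.poly_value_ops(3)[OF ab(2) f ev] fv[OF ab]
    using polyfun_closed[OF mult_var(1) ab(1)] h(2) by simp
  qed
 next
  case (cong F G)
  then show ?case by metis
 qed
qed

text \<open>A maximal ideal of R / (s) pulls back to a prime that contains \<open>s\<close>. A point
  at which \<open>F\<close> avoids this prime is a point with a unit value in the localization, so
  \<open>F\<close> has a unit value over R / (s); lifting an inverse gives r F a = 1 + s q.\<close>

lemma (in cring) almost_local_global_polyfun:
 assumes alg: "almost_local_global R" and s: "s : regular_elements R"
  and V: "finite V" and F: "polyfun R V F"
  and loc: "!!P. primeideal P R ==> s : P ==> EX a:V \<rightarrow> carrier R. F a ~: P"
 shows "EX a:V \<rightarrow> carrier R. EX r:carrier R. EX q:carrier R. r \<otimes> F a = \<one> \<oplus> s \<otimes> q"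
proof -
 note [simp] = regularD(1)[OF s]
 define I where "I = PIdl s"
 have I: "ideal I R" unfolding I_def by (rule cgenideal_ideal) simp
 interpret I: ideal I R by fact
 have sI: "s : I" unfolding I_def by (rule cgenideal_self) simp
 define Q where "Q = R Quot I"
 interpret Q: cring Q unfolding Q_def using I.quotient_is_cring[OF cring_axioms] .
 have hom: "(+>) I : ring_hom R Q" unfolding Q_def by (rule I.rcos_ring_hom)
 note h = ring_hom_memE[OF hom]
 interpret pi: ring_hom_cring R Q "(+>) I" using hom by unfold_locales
 have pir: "ring_hom_ring R Q ((+>) I)" unfolding Q_def by (rule I.rcos_ring_hom_ring)
 \<comment> \<open>Regularity of \<open>s\<close> is faithfulness of the principal ideal
   (s).\<close>
 have "annihilator R I = {\<zero>}"
  using regularD(2)[OF s] sI I.Icarr by (auto simp: annihilator_def m_comm)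
 then have lg: "local_global Q"
  using alg unfolding almost_local_global_def Q_def I_def by simp
 obtain e and n :: nat where e: "e ` V <= {..<n}" "inj_on e V"
  using finite_imp_inj_to_nat_seg[OF V] by (metis Collect_mono_iff lessThan_def order_refl)
 define dec where "dec = inv_into V e"
 have dec: "v : V ==> dec (e v) = v" for v unfolding dec_def using e by simp
 obtain f where f: "f : ring.indexed_pset Q {..<n} (carrier Q)" and
  fv: "!!a b. a : V \<rightarrow> carrier R ==> b : {..<n} \<rightarrow> carrier Q ==> ALL v:V. b (e v) = I +> a v ==>
   poly_value Q Q id f b = I +> F a"
  using polyfun_quot[OF I F e] unfolding Q_def by blast
 have "unit_value_over Q (localization Q (carrier Q - P)) (to_localization Q (carrier Q - P)) n f"
  if P: "maximalideal P Q" for P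
 proof -
  interpret P: primeideal P Q by (rule Q.maximalideal_prime[OF P])
  interpret L: localizing Q "carrier Q - P"
  proof
   show "\<one>\<^bsub>Q\<^esub> : carrier Q - P" using P.one_imp_carrier P.I_notcarr by blast
   show "x \<otimes>\<^bsub>Q\<^esub> y : carrier Q - P" if "x : carrier Q - P" "y : carrier Q - P" for x y
    using that P.I_prime[of x y] by blast
  qed blast
  define P' where "P' = {r : carrier R. I +> r : P}"
  have "primeideal P' R"
   unfolding P'_def using P.primeideal_axioms by (rule ring_hom_ring.primeideal_vimage[OF pir is_cring])
  moreover have "s : P'"
  proof -
   have "I +> s = \<zero>\<^bsub>Q\<^esub>" unfolding I.a_rcos_const[OF sI] Q_def FactRing_def by simp
   then have "I +> s : P" using P.zero_closed by (rule ssubst)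
   then show ?thesis unfolding P'_def by simp
  qed
  ultimately obtain a where a: "a : V \<rightarrow> carrier R" "F a ~: P'" using loc by blast
  define b where "b i = (if i : e ` V then I +> a (dec i) else \<zero>\<^bsub>Q\<^esub>)" for i
  have b: "b : {..<n} \<rightarrow> carrier Q" using a dec h(1) by (auto simp: b_def Pi_def)
  have v: "poly_value Q Q id f b = I +> F a" using a(1) b by (rule fv) (auto simp: b_def dec)
  have "I +> F a : carrier Q - P" using a polyfun_closed[OF F a(1)] by (auto simp: P'_def)
  then have "to_localization Q (carrier Q - P) (I +> F a) : Units L.L"
   by (rule L.to_localization_unit)
  moreover have "poly_value Q L.L (to_localization Q (carrier Q - P)) f (%i. to_localization Q (carrier Q - P) (b i))
    = to_localization Q (carrier Q - P) (I +> F a)"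
   unfolding v[symmetric] using f b
   by (intro poly_value_hom Q.is_cring L.localization_cring L.to_localization_hom)
  moreover have "(%i. to_localization Q (carrier Q - P) (b i)) : {..<n} \<rightarrow> carrier L.L"
   using b ring_hom_memE(1)[OF L.to_localization_hom] by auto
  ultimately show ?thesis unfolding unit_value_over_def by metis
 qed
 then have "unit_value_over Q Q id n f" using lg f unfolding local_global_def by blast
 then obtain b where b: "b : {..<n} \<rightarrow> carrier Q" "poly_value Q Q id f b : Units Q"
  unfolding unit_value_over_def by blast
 have "EX x:carrier R. b (e v) = I +> x" if "v : V" for v
 proof -
  have "b (e v) : carrier Q" using b e that by blast
  then show ?thesis unfolding Q_def by (meson FactRing_carrierE)
 qed
 then obtain a where a: "!!v. v : V ==> a v : carrier R & b (e v) = I +> a v" by metis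
 then have aV: "a : V \<rightarrow> carrier R" by blast
 have [simp]: "F a : carrier R" using polyfun_closed[OF F aV] .
 have "I +> F a : Units Q" using fv[OF aV b(1)] a b(2) by simp
 then obtain y where "y : carrier Q" "y \<otimes>\<^bsub>Q\<^esub> (I +> F a) = \<one>\<^bsub>Q\<^esub>" unfolding Units_def by blast
 moreover from this obtain r where r [simp]: "r : carrier R" and yr: "y = I +> r"
  unfolding Q_def by (meson FactRing_carrierE)
 ultimately have "I +> (r \<otimes> F a) = I +> \<one>" using h(2)[of r "F a"] h(4) by simp
 then have "r \<otimes> F a : I +> \<one>" using I.a_rcos_self[of "r \<otimes> F a"] by simp
 then obtain i where i: "i : I" "r \<otimes> F a = i \<oplus> \<one>" by (auto simp: a_r_coset_def')
 obtain q where "q : carrier R" "i = q \<otimes> s" using i unfolding I_def cgenideal_def by blast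
 then have "r \<otimes> F a = \<one> \<oplus> s \<otimes> q" using i by (simp add: m_comm a_comm)
 then show ?thesis using aV r \<open>q : carrier R\<close> by blast
qed

section \<open>Determinants\<close>

lemma (in abelian_monoid) finsum_Times:
 assumes "finite A" "finite B" "!!x. x : A \<times> B ==> f x : carrier G"
 shows "(\<Oplus>x\<in>A \<times> B. f x) = (\<Oplus>a\<in>A. \<Oplus>b\<in>B. f (a, b))"
 using assms(1,3)
proof (induction A)
 case (insert a A)
 have "insert a A \<times> B = Pair a ` B \<union> A \<times> B" by auto
 then have "(\<Oplus>x\<in>insert a A \<times> B. f x) = (\<Oplus>x\<in>Pair a ` B \<union> A \<times> B. f x)" by simp
 also have "... = (\<Oplus>x\<in>Pair a ` B. f x) \<oplus> (\<Oplus>x\<in>A \<times> B. f x)"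
  using insert assms(2) by (intro finsum_Un_disjoint) auto
 also have "(\<Oplus>x\<in>Pair a ` B. f x) = (\<Oplus>b\<in>B. f (a, b))"
  using insert by (intro finsum_reindex) (auto simp: inj_on_def)
 also have "(\<Oplus>x\<in>A \<times> B. f x) = (\<Oplus>a\<in>A. \<Oplus>b\<in>B. f (a, b))" by (rule insert.IH) (use insert.prems in auto)
 also have "(\<Oplus>b\<in>B. f (a, b)) \<oplus> ... = (\<Oplus>a\<in>insert a A. \<Oplus>b\<in>B. f (a, b))"
  using insert by (subst finsum_insert) (auto intro!: finsum_closed)
 finally show ?case .
qed simp

text \<open>The functions from {..<m} to {..<n}, extended by the identity rather than by
  \<open>undefined\<close>: for m = n the permutations in the sense of \<open>permutes\<close> are
  then among them.\<close>

definition bounded_funs :: "nat => nat => (nat => nat) set" where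
 "bounded_funs m n = {f. (ALL i<m. f i < n) & (ALL i>=m. f i = i)}"

lemma bounded_funs_0: "bounded_funs 0 n = {id}"
 by (auto simp: bounded_funs_def)

lemma bounded_funs_Suc:
 "bounded_funs (Suc m) n = (%(y, f). f(m := y)) ` ({..<n} \<times> bounded_funs m n)"
proof (intro equalityI subsetI)
 fix f assume f: "f : bounded_funs (Suc m) n"
 then have "(f m, f(m := m)) : {..<n} \<times> bounded_funs m n" by (auto simp: bounded_funs_def)
 moreover have "f = (%(y, f). f(m := y)) (f m, f(m := m))" by simp
 ultimately show "f : (%(y, f). f(m := y)) ` ({..<n} \<times> bounded_funs m n)" by (rule rev_image_eqI)
qed (auto simp: bounded_funs_def less_Suc_eq)

lemma bounded_funs_inj: "inj_on (%(y, f). f(m := y)) ({..<n} \<times> bounded_funs m n)"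
proof (rule inj_onI, clarify)
 fix y f y' f' assume f: "f : bounded_funs m n" "f' : bounded_funs m n" and e: "f(m := y) = f'(m := y')"
 have "y = y'" using fun_cong[OF e, of m] by simp
 moreover have "f i = f' i" for i
 proof (cases "i = m")
  case True then show ?thesis using f by (simp add: bounded_funs_def)
 next
  case False then show ?thesis using fun_cong[OF e, of i] by simp
 qed
 ultimately show "y = y' & f = f'" by blast
qed

lemma finite_bounded_funs: "finite (bounded_funs m n)"
 by (induction m) (simp_all add: bounded_funs_0 bounded_funs_Suc)

lemma (in cring) finprod_lessThan_Suc:
 assumes "!!i. f i : carrier R"
 shows "(\<Otimes>i\<in>{..<Suc n}. f i) = (\<Otimes>i\<in>{..<n}. f i) \<otimes> f n"
 using assms by (simp add: lessThan_Suc Pi_def m_comm)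

lemma (in cring) finprod_closed':
 assumes "!!i. i : A ==> f i : carrier R"
 shows "finprod R f A : carrier R"
 using assms by (intro finprod_closed) auto

lemma (in cring) finsum_closed':
 assumes "!!i. i : A ==> f i : carrier R"
 shows "finsum R f A : carrier R"
 using assms by (intro finsum_closed) auto

lemma (in cring) finprod_finsum:
 assumes F [simp]: "!!i k. F i k : carrier R"
 shows "(\<Otimes>i\<in>{..<m}. \<Oplus>k\<in>{..<n::nat}. F i k) = (\<Oplus>f\<in>bounded_funs m n. \<Otimes>i\<in>{..<m}. F i (f i))"
proof (induction m)
 case 0
 then show ?case by (simp add: bounded_funs_0)
next
 case (Suc m)
 have c [simp]: "(\<Otimes>i\<in>{..<m}. F i (f i)) : carrier R" for f by (intro finprod_closed') simp
 have s [simp]: "(\<Oplus>f\<in>bounded_funs m n. \<Otimes>i\<in>{..<m}. F i (f i)) : carrier R" by (intro finsum_closed') simp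
 have "(\<Otimes>i\<in>{..<Suc m}. \<Oplus>k\<in>{..<n}. F i k) =
   (\<Oplus>f\<in>bounded_funs m n. \<Otimes>i\<in>{..<m}. F i (f i)) \<otimes> (\<Oplus>k\<in>{..<n}. F m k)"
  by (subst finprod_lessThan_Suc) (auto simp: Suc intro!: finsum_closed')
 also have "... = (\<Oplus>k\<in>{..<n}. (\<Oplus>f\<in>bounded_funs m n. \<Otimes>i\<in>{..<m}. F i (f i)) \<otimes> F m k)"
  by (rule finsum_rdistr) auto
 also have "... = (\<Oplus>k\<in>{..<n}. \<Oplus>f\<in>bounded_funs m n. (\<Otimes>i\<in>{..<m}. F i (f i)) \<otimes> F m k)"
  by (intro finsum_cong' refl finsum_ldistr) (auto simp: finite_bounded_funs intro!: finsum_closed')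
 also have "... = (\<Oplus>x\<in>{..<n} \<times> bounded_funs m n. (\<Otimes>i\<in>{..<m}. F i (snd x i)) \<otimes> F m (fst x))"
  by (subst finsum_Times) (auto simp: finite_bounded_funs)
 also have "... = (\<Oplus>x\<in>{..<n} \<times> bounded_funs m n. \<Otimes>i\<in>{..<Suc m}. F i ((case x of (y, f) => f(m := y)) i))"
 proof (intro finsum_cong' refl)
  fix x assume "x : {..<n} \<times> bounded_funs m n"
  obtain y f where x: "x = (y, f)" by force
  have "(\<Otimes>i\<in>{..<Suc m}. F i ((f(m := y)) i)) = (\<Otimes>i\<in>{..<m}. F i ((f(m := y)) i)) \<otimes> F m y"
   by (subst finprod_lessThan_Suc) auto
  also have "(\<Otimes>i\<in>{..<m}. F i ((f(m := y)) i)) = (\<Otimes>i\<in>{..<m}. F i (f i))"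
   by (intro finprod_cong') auto
  finally show "(\<Otimes>i\<in>{..<m}. F i (snd x i)) \<otimes> F m (fst x) = (\<Otimes>i\<in>{..<Suc m}. F i ((case x of (y, f) => f(m := y)) i))"
   by (simp add: x)
 qed (auto intro!: finprod_closed')
 also have "... = (\<Oplus>f\<in>bounded_funs (Suc m) n. \<Otimes>i\<in>{..<Suc m}. F i (f i))"
  unfolding bounded_funs_Suc
  by (rule finsum_reindex[symmetric]) (auto intro!: finprod_closed' bounded_funs_inj)
 finally show ?case .
qed

section \<open>Determinants by the Leibniz formula\<close>

definition rsign :: "('a, 'r) ring_scheme => (nat => nat) => 'a" where
 "rsign R p = (if evenperm p then \<one>\<^bsub>R\<^esub> else \<ominus>\<^bsub>R\<^esub> \<one>\<^bsub>R\<^esub>)"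

definition rdet :: "('a, 'r) ring_scheme => nat => (nat => nat => 'a) => 'a" where
 "rdet R n A = (\<Oplus>\<^bsub>R\<^esub>p\<in>{p. p permutes {..<n}}. rsign R p \<otimes>\<^bsub>R\<^esub> (\<Otimes>\<^bsub>R\<^esub>i\<in>{..<n}. A i (p i)))"

lemma finite_perms: "finite {p. p permutes {..<n::nat}}"
 by (simp add: finite_permutations)

context cring
begin

lemma rsign_closed [simp]: "rsign R p : carrier R"
 by (simp add: rsign_def)

lemma rsign_comp:
 assumes "p permutes {..<n}" "q permutes {..<n}"
 shows "rsign R (p \<circ> q) = rsign R p \<otimes> rsign R q"
proof -
 have "permutation p" "permutation q" using assms by (auto simp: permutation_permutes)
 then show ?thesis by (simp add: rsign_def evenperm_comp l_minus)
qed

lemma rdet_closed: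
 assumes "!!i j. A i j : carrier R"
 shows "rdet R n A : carrier R"
 unfolding rdet_def using assms by (intro finsum_closed' m_closed finprod_closed') auto

lemma rdet_cong:
 assumes "!!i j. i < n ==> j < n ==> A i j = B i j" "!!i j. B i j : carrier R"
 shows "rdet R n A = rdet R n B"
 unfolding rdet_def
proof (intro finsum_cong' refl)
 fix p assume p: "p : {p. p permutes {..<n}}"
 have "(\<Otimes>i\<in>{..<n}. A i (p i)) = (\<Otimes>i\<in>{..<n}. B i (p i))"
  using p assms permutes_in_image[of p "{..<n}"] by (intro finprod_cong') auto
 then show "rsign R p \<otimes> (\<Otimes>i\<in>{..<n}. A i (p i)) = rsign R p \<otimes> (\<Otimes>i\<in>{..<n}. B i (p i))" by simp
qed (use assms in \<open>auto intro!: finprod_closed'\<close>)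

lemma finprod_permute:
 assumes p: "p permutes {..<n::nat}" and "!!i. f i : carrier R"
 shows "(\<Otimes>i\<in>{..<n}. f (p i)) = (\<Otimes>i\<in>{..<n}. f i)"
proof -
 have "(\<Otimes>i\<in>{..<n}. f i) = (\<Otimes>i\<in>p ` {..<n}. f i)" using permutes_image[OF p] by simp
 also have "... = (\<Otimes>i\<in>{..<n}. f (p i))"
  using assms permutes_inj_on[OF p] by (intro finprod_reindex) auto
 finally show ?thesis by simp
qed

lemma rdet_scale_columns:
 assumes [simp]: "!!i j. A i j : carrier R" "!!j. c j : carrier R"
 shows "rdet R n (%i j. c j \<otimes> A i j) = (\<Otimes>j\<in>{..<n}. c j) \<otimes> rdet R n A"
proof -
 let ?P = "{p. p permutes {..<n}}"
 have pc [simp]: "(\<Otimes>i\<in>{..<n}. A i (p i)) : carrier R" "(\<Otimes>j\<in>{..<n}. c j) : carrier R" for p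
  by (auto intro!: finprod_closed')
 have "rdet R n (%i j. c j \<otimes> A i j) = (\<Oplus>p\<in>?P. (\<Otimes>j\<in>{..<n}. c j) \<otimes> (rsign R p \<otimes> (\<Otimes>i\<in>{..<n}. A i (p i))))"
  unfolding rdet_def
 proof (intro finsum_cong' refl)
  fix p assume p: "p : ?P"
  have "(\<Otimes>i\<in>{..<n}. c (p i) \<otimes> A i (p i)) = (\<Otimes>i\<in>{..<n}. c (p i)) \<otimes> (\<Otimes>i\<in>{..<n}. A i (p i))"
   by (rule finprod_multf) auto
  also have "(\<Otimes>i\<in>{..<n}. c (p i)) = (\<Otimes>i\<in>{..<n}. c i)" using p by (intro finprod_permute) auto
  finally show "rsign R p \<otimes> (\<Otimes>i\<in>{..<n}. c (p i) \<otimes> A i (p i)) = (\<Otimes>j\<in>{..<n}. c j) \<otimes> (rsign R p \<otimes> (\<Otimes>i\<in>{..<n}. A i (p i)))"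
   by (simp add: m_lcomm)
 qed auto
 also have "... = (\<Otimes>j\<in>{..<n}. c j) \<otimes> rdet R n A"
  unfolding rdet_def by (rule finsum_rdistr[symmetric]) (auto simp: finite_perms)
 finally show ?thesis .
qed

lemma finprod_zero:
 assumes "finite A" "i : A" "f i = \<zero>" "!!i. i : A ==> f i : carrier R"
 shows "(\<Otimes>i\<in>A. f i) = \<zero>"
proof -
 have "(\<Otimes>i\<in>insert i (A - {i}). f i) = f i \<otimes> (\<Otimes>i\<in>A - {i}. f i)"
  using assms by (intro finprod_insert) auto
 then show ?thesis using assms by (simp add: insert_absorb finprod_closed')
qed

lemma rdet_diagonal:
 assumes [simp]: "!!i j. A i j : carrier R" and z: "!!i j. i < n ==> j < n ==> i ~= j ==> A i j = \<zero>"
 shows "rdet R n A = (\<Otimes>i\<in>{..<n}. A i i)"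
proof -
 have "rdet R n A = (\<Oplus>p\<in>{id}. rsign R p \<otimes> (\<Otimes>i\<in>{..<n}. A i (p i)))"
  unfolding rdet_def
 proof (rule add.finprod_mono_neutral_cong_right)
  show "rsign R p \<otimes> (\<Otimes>i\<in>{..<n}. A i (p i)) = \<zero>" if p: "p : {p. p permutes {..<n}} - {id}" for p
  proof -
   have pp: "p permutes {..<n}" "p ~= id" using p by auto
   then obtain i where i: "p i ~= i" by (metis eq_id_iff)
   then have "i < n" using pp by (metis lessThan_iff permutes_def)
   moreover have "p i < n" using \<open>i < n\<close> pp permutes_in_image[of p "{..<n}" i] by simp
   ultimately have "(\<Otimes>i\<in>{..<n}. A i (p i)) = \<zero>" using i z by (intro finprod_zero[of _ i]) auto
   then show ?thesis by simp
  qed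
  show "(%p. rsign R p \<otimes> (\<Otimes>i\<in>{..<n}. A i (p i))) : {p. p permutes {..<n}} \<rightarrow> carrier R"
   by (auto intro!: finprod_closed')
 qed (auto simp: finite_perms permutes_id)
 also have "... = (\<Otimes>i\<in>{..<n}. A i i)"
  by (simp add: rsign_def finprod_closed')
 finally show ?thesis .
qed

lemma finsum_perms_compose:
 assumes q: "q permutes {..<n}" and f: "!!p. p permutes {..<n} ==> f p : carrier R"
 shows "(\<Oplus>p\<in>{p. p permutes {..<n}}. f p) = (\<Oplus>p\<in>{p. p permutes {..<n}}. f (p \<circ> q))"
proof -
 let ?P = "{p. p permutes {..<n}}"
 have "?P = (%p. p \<circ> q) ` ?P"
 proof (intro equalityI subsetI)
  fix p assume "p : ?P"
  then have "p \<circ> inv_into UNIV q : ?P" using permutes_compose[OF permutes_inv[OF q]] by auto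
  moreover have "p = (p \<circ> inv_into UNIV q) \<circ> q" using permutes_inv_o(2)[OF q] by (simp add: comp_assoc)
  ultimately show "p : (%p. p \<circ> q) ` ?P" by blast
 qed (use permutes_compose[OF q] in auto)
 moreover have "inj_on (%p. p \<circ> q) ?P"
  by (intro inj_onI) (metis comp_assoc comp_id permutes_inv_o(1)[OF q])
 ultimately show ?thesis
  using f permutes_compose[OF q] finsum_reindex[of f "%p. p \<circ> q" ?P] by auto
qed

lemma rdet_permute_rows:
 assumes q: "q permutes {..<n}" and [simp]: "!!i j. A i j : carrier R"
 shows "rdet R n (%i. A (q i)) = rsign R q \<otimes> rdet R n A"
proof -
 let ?P = "{p. p permutes {..<n}}"
 have pc [simp]: "(\<Otimes>i\<in>{..<n}. A i (p i)) : carrier R" "(\<Otimes>i\<in>{..<n}. A (q i) (p i)) : carrier R" for p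
  by (auto intro!: finprod_closed')
 have "rdet R n (%i. A (q i)) = (\<Oplus>p\<in>?P. rsign R (p \<circ> q) \<otimes> (\<Otimes>i\<in>{..<n}. A (q i) ((p \<circ> q) i)))"
  unfolding rdet_def by (rule finsum_perms_compose[OF q]) simp
 also have "... = (\<Oplus>p\<in>?P. rsign R q \<otimes> (rsign R p \<otimes> (\<Otimes>i\<in>{..<n}. A i (p i))))"
 proof (intro finsum_cong' refl)
  fix p assume p: "p : ?P"
  have "(\<Otimes>i\<in>{..<n}. A (q i) ((p \<circ> q) i)) = (\<Otimes>i\<in>{..<n}. A i (p i))"
   using finprod_permute[OF q, of "%i. A i (p i)"] by simp
  then show "rsign R (p \<circ> q) \<otimes> (\<Otimes>i\<in>{..<n}. A (q i) ((p \<circ> q) i)) = rsign R q \<otimes> (rsign R p \<otimes> (\<Otimes>i\<in>{..<n}. A i (p i)))"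
   using p q by (simp add: rsign_comp m_ac)
 qed auto
 also have "... = rsign R q \<otimes> rdet R n A"
  unfolding rdet_def by (rule finsum_rdistr[symmetric]) (auto simp: finite_perms)
 finally show ?thesis .
qed

text \<open>In characteristic two this does not follow from antisymmetry: even and odd permutations are
  paired off by composition with the transposition of the equal rows.\<close>

lemma rdet_equal_rows:
 assumes ab: "a < n" "b < n" "a ~= b" and e: "!!j. A a j = A b j" and [simp]: "!!i j. A i j : carrier R"
 shows "rdet R n A = \<zero>"
proof -
 define t where "t = transpose a b"
 have t: "t permutes {..<n}" unfolding t_def using ab by (intro permutes_swap_id) auto
 have tt: "t \<circ> t = id" by (simp add: t_def)
 let ?P = "{p. p permutes {..<n}}"
 define E where "E = {p : ?P. evenperm p}"
 define D where "D = {p : ?P. ~evenperm p}"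
 have fin: "finite E" "finite D" by (auto simp: E_def D_def finite_perms)
 define g where "g p = (\<Otimes>i\<in>{..<n}. A i (p i))" for p
 have g [simp]: "g p : carrier R" for p unfolding g_def by (auto intro!: finprod_closed')
 have gt: "g (p \<circ> t) = g p" for p
 proof -
  have "A (t i) j = A i j" for i j using e by (auto simp: t_def transpose_def)
  then have "g (p \<circ> t) = (\<Otimes>i\<in>{..<n}. A (t i) (p (t i)))" unfolding g_def by simp
  also have "... = g p" unfolding g_def using finprod_permute[OF t, of "%i. A i (p i)"] by simp
  finally show ?thesis .
 qed
 have perm: "permutation p" if "p : ?P" for p using that by (auto simp: permutation_permutes)
 have ev: "evenperm (p \<circ> t) \<longleftrightarrow> ~evenperm p" if "p : ?P" for p
  using evenperm_comp[OF perm[OF that], of t] perm[of t] t ab by (simp add: t_def evenperm_swap)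
 have ct: "p \<circ> t : ?P" if "p : ?P" for p using permutes_compose[OF t] that by auto
 have DE: "D = (%p. p \<circ> t) ` E"
 proof (intro equalityI subsetI)
  fix p assume p: "p : D"
  then have "p \<circ> t : E" using ev ct by (auto simp: D_def E_def)
  moreover have "p = (p \<circ> t) \<circ> t" using tt by (simp add: comp_assoc)
  ultimately show "p : (%p. p \<circ> t) ` E" by blast
 qed (use ev ct in \<open>auto simp: D_def E_def\<close>)
 have inj: "inj_on (%p. p \<circ> t) E" by (intro inj_onI) (metis comp_assoc comp_id tt)
 have "?P = E \<union> D" "E \<inter> D = {}" by (auto simp: E_def D_def)
 then have "rdet R n A = (\<Oplus>p\<in>E. rsign R p \<otimes> g p) \<oplus> (\<Oplus>p\<in>D. rsign R p \<otimes> g p)"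
  unfolding rdet_def g_def[symmetric] using fin by (simp add: finsum_Un_disjoint Pi_def)
 also have "(\<Oplus>p\<in>E. rsign R p \<otimes> g p) = (\<Oplus>p\<in>E. g p)"
  by (intro finsum_cong') (auto simp: E_def rsign_def)
 also have "(\<Oplus>p\<in>D. rsign R p \<otimes> g p) = (\<Oplus>p\<in>D. \<ominus> \<one> \<otimes> g p)"
  by (intro finsum_cong') (auto simp: D_def rsign_def)
 also have "... = \<ominus> \<one> \<otimes> (\<Oplus>p\<in>D. g p)" using fin by (intro finsum_rdistr[symmetric]) auto
 also have "(\<Oplus>p\<in>D. g p) = (\<Oplus>p\<in>E. g (p \<circ> t))"
  unfolding DE using inj by (intro finsum_reindex) auto
 also have "... = (\<Oplus>p\<in>E. g p)" by (simp add: gt)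
 finally show ?thesis by (simp add: l_minus r_neg finsum_closed')
qed

text \<open>Expanding the products of row sums yields a sum over all functions f, in which the
  product of the A i (f i) is multiplied by the determinant of the rows f i of \<open>B\<close>. If
  f is not injective, two of these rows agree and the term vanishes; a permutation contributes its
  sign.\<close>

lemma rdet_mult:
 assumes [simp]: "!!i j. A i j : carrier R" "!!i j. B i j : carrier R"
 shows "rdet R n (%i j. \<Oplus>k\<in>{..<n}. A i k \<otimes> B k j) = rdet R n A \<otimes> rdet R n B"
proof -
 let ?P = "{p. p permutes {..<n}}" and ?F = "bounded_funs n n"
 have pA [simp]: "(\<Otimes>i\<in>{..<n}. A i (f i)) : carrier R" for f by (auto intro!: finprod_closed')
 have pB [simp]: "(\<Otimes>i\<in>{..<n}. B (f i) (p i)) : carrier R" for f p by (auto intro!: finprod_closed')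
 have dB [simp]: "rdet R n (%i. B (f i)) : carrier R" for f by (intro rdet_closed) simp
 have PF: "?P <= ?F"
 proof
  fix p assume "p : ?P"
  then show "p : ?F" using permutes_in_image[of p "{..<n}"] by (auto simp: bounded_funs_def permutes_def)
 qed
 have "rdet R n (%i j. \<Oplus>k\<in>{..<n}. A i k \<otimes> B k j) =
   (\<Oplus>p\<in>?P. \<Oplus>f\<in>?F. rsign R p \<otimes> ((\<Otimes>i\<in>{..<n}. A i (f i)) \<otimes> (\<Otimes>i\<in>{..<n}. B (f i) (p i))))"
  unfolding rdet_def
 proof (intro finsum_cong' refl)
  fix p
  have "(\<Otimes>i\<in>{..<n}. \<Oplus>k\<in>{..<n}. A i k \<otimes> B k (p i)) = (\<Oplus>f\<in>?F. \<Otimes>i\<in>{..<n}. A i (f i) \<otimes> B (f i) (p i))"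
   by (rule finprod_finsum) simp
  also have "... = (\<Oplus>f\<in>?F. (\<Otimes>i\<in>{..<n}. A i (f i)) \<otimes> (\<Otimes>i\<in>{..<n}. B (f i) (p i)))"
   by (intro finsum_cong' refl finprod_multf) auto
  finally show "rsign R p \<otimes> (\<Otimes>i\<in>{..<n}. \<Oplus>k\<in>{..<n}. A i k \<otimes> B k (p i)) =
    (\<Oplus>f\<in>?F. rsign R p \<otimes> ((\<Otimes>i\<in>{..<n}. A i (f i)) \<otimes> (\<Otimes>i\<in>{..<n}. B (f i) (p i))))"
   by (simp add: finsum_rdistr finite_bounded_funs)
 qed (auto intro!: finsum_closed')
 also have "... = (\<Oplus>f\<in>?F. \<Oplus>p\<in>?P. rsign R p \<otimes> ((\<Otimes>i\<in>{..<n}. A i (f i)) \<otimes> (\<Otimes>i\<in>{..<n}. B (f i) (p i))))"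
  by (rule finsum_swap) (auto simp: finite_perms finite_bounded_funs)
 also have "... = (\<Oplus>f\<in>?F. (\<Otimes>i\<in>{..<n}. A i (f i)) \<otimes> rdet R n (%i. B (f i)))"
 proof (intro finsum_cong' refl)
  fix f
  have "(\<Oplus>p\<in>?P. rsign R p \<otimes> ((\<Otimes>i\<in>{..<n}. A i (f i)) \<otimes> (\<Otimes>i\<in>{..<n}. B (f i) (p i)))) =
    (\<Oplus>p\<in>?P. (\<Otimes>i\<in>{..<n}. A i (f i)) \<otimes> (rsign R p \<otimes> (\<Otimes>i\<in>{..<n}. B (f i) (p i))))"
   by (intro finsum_cong' refl m_lcomm) auto
  also have "... = (\<Otimes>i\<in>{..<n}. A i (f i)) \<otimes> rdet R n (%i. B (f i))"
   unfolding rdet_def by (rule finsum_rdistr[symmetric]) (auto simp: finite_perms)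
  finally show "(\<Oplus>p\<in>?P. rsign R p \<otimes> ((\<Otimes>i\<in>{..<n}. A i (f i)) \<otimes> (\<Otimes>i\<in>{..<n}. B (f i) (p i)))) =
    (\<Otimes>i\<in>{..<n}. A i (f i)) \<otimes> rdet R n (%i. B (f i))" .
 qed auto
 also have "... = (\<Oplus>f\<in>?P. (\<Otimes>i\<in>{..<n}. A i (f i)) \<otimes> rdet R n (%i. B (f i)))"
 proof (rule add.finprod_mono_neutral_cong_right)
  fix f assume f: "f : ?F - ?P"
  then have im: "f ` {..<n} <= {..<n}" by (auto simp: bounded_funs_def)
  have "~inj_on f {..<n}"
  proof
   assume inj: "inj_on f {..<n}"
   have "f ` {..<n} = {..<n}" using endo_inj_surj[OF finite_lessThan im inj] .
   then have "f permutes {..<n}"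
    using f inj by (intro bij_imp_permutes) (auto simp: bij_betw_def bounded_funs_def)
   then show False using f by simp
  qed
  then obtain a b where "a < n" "b < n" "a ~= b" "f a = f b" unfolding inj_on_def by auto
  then have "rdet R n (%i. B (f i)) = \<zero>" by (intro rdet_equal_rows[of a n b]) auto
  then show "(\<Otimes>i\<in>{..<n}. A i (f i)) \<otimes> rdet R n (%i. B (f i)) = \<zero>" by simp
 qed (use PF in \<open>auto simp: finite_bounded_funs\<close>)
 also have "... = (\<Oplus>f\<in>?P. (rsign R f \<otimes> (\<Otimes>i\<in>{..<n}. A i (f i))) \<otimes> rdet R n B)"
 proof (intro finsum_cong' refl)
  fix f assume "f : ?P"
  then have "rdet R n (%i. B (f i)) = rsign R f \<otimes> rdet R n B" by (intro rdet_permute_rows) auto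
  then show "(\<Otimes>i\<in>{..<n}. A i (f i)) \<otimes> rdet R n (%i. B (f i)) = (rsign R f \<otimes> (\<Otimes>i\<in>{..<n}. A i (f i))) \<otimes> rdet R n B"
   using dB[of id] by (simp add: m_ac)
 qed (use dB[of id] in auto)
 also have "... = rdet R n A \<otimes> rdet R n B"
  unfolding rdet_def[of R n A] using dB[of id] by (intro finsum_ldistr[symmetric]) (auto simp: finite_perms)
 finally show ?thesis .
qed

end

section \<open>Semihereditary rings\<close>

lemma (in cring) finsum_minus:
 assumes "!!i. i : A ==> f i : carrier R" "!!i. i : A ==> g i : carrier R"
 shows "(\<Oplus>i\<in>A. f i \<ominus> g i) = (\<Oplus>i\<in>A. f i) \<ominus> (\<Oplus>i\<in>A. g i)"
proof -
 have neg: "(\<Oplus>i\<in>A. \<ominus> g i) = \<ominus> (\<Oplus>i\<in>A. g i)"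
  by (rule finsum_hom[symmetric, OF abelian_monoid_axioms abelian_monoid_axioms])
   (use assms in \<open>auto simp: minus_add\<close>)
 have "(\<Oplus>i\<in>A. f i \<ominus> g i) = (\<Oplus>i\<in>A. f i) \<oplus> (\<Oplus>i\<in>A. \<ominus> g i)"
  unfolding a_minus_def using assms by (intro finsum_addf) auto
 then show ?thesis unfolding neg by (simp add: a_minus_def)
qed

lemma (in cring) sum_delta_left:
 assumes "finite A" "i : A" "!!j. x j : carrier R"
 shows "(\<Oplus>j\<in>A. (if j = i then \<one> else \<zero>) \<otimes> x j) = x i" "(\<Oplus>j\<in>A. x j \<otimes> (if j = i then \<one> else \<zero>)) = x i"
proof -
 have "(\<Oplus>j\<in>A. (if j = i then \<one> else \<zero>) \<otimes> x j) = (\<Oplus>j\<in>A. if j = i then x j else \<zero>)"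
  using assms by (intro finsum_cong') auto
 then show "(\<Oplus>j\<in>A. (if j = i then \<one> else \<zero>) \<otimes> x j) = x i" using finsum_delta[of A i x] assms by simp
 have "(\<Oplus>j\<in>A. x j \<otimes> (if j = i then \<one> else \<zero>)) = (\<Oplus>j\<in>A. if j = i then x j else \<zero>)"
  using assms by (intro finsum_cong') auto
 then show "(\<Oplus>j\<in>A. x j \<otimes> (if j = i then \<one> else \<zero>)) = x i" using finsum_delta[of A i x] assms by simp
qed

lemma (in cring) genideal_family:
 assumes A: "finite A" and g: "!!i. i : A ==> g i : carrier R"
 shows "Idl (g ` A) = {\<Oplus>i\<in>A. w i \<otimes> g i | w. ALL i. w i : carrier R}" (is "_ = ?S")
proof
 have gs: "g ` A <= carrier R" using g by blast
 have c: "(\<Oplus>i\<in>A. w i \<otimes> g i) : carrier R" if "ALL i. w i : carrier R" for w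
  using that g by (intro finsum_closed') auto
 have SI: "ideal ?S R"
 proof (rule idealI[OF ring_axioms])
  show "subgroup ?S (add_monoid R)"
  proof (rule add.subgroupI)
   show "?S <= carrier R" using c by auto
   show "?S ~= {}" by (auto intro!: exI[of _ "%_. \<zero>"])
   show "\<ominus> a : ?S" if aS: "a : ?S" for a
   proof -
    obtain w where w: "ALL i. w i : carrier R" "a = (\<Oplus>i\<in>A. w i \<otimes> g i)" using aS by auto
    have "a : carrier R" unfolding w(2) using w(1) by (rule c)
    then have "\<ominus> a = (\<ominus> \<one>) \<otimes> a" by (simp add: l_minus)
    also have "... = (\<Oplus>i\<in>A. (\<ominus> \<one>) \<otimes> (w i \<otimes> g i))"
     unfolding w(2) using w(1) g A by (intro finsum_rdistr) auto
    also have "... = (\<Oplus>i\<in>A. (\<ominus> w i) \<otimes> g i)"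
     using w(1) g by (intro finsum_cong') (auto simp: l_minus)
    finally show ?thesis using w(1) unfolding mem_Collect_eq by (intro exI[of _ "%i. \<ominus> w i"] conjI) auto
   qed
   show "a \<oplus> b : ?S" if aS: "a : ?S" "b : ?S" for a b
   proof -
    obtain w v where w: "ALL i. w i : carrier R" "a = (\<Oplus>i\<in>A. w i \<otimes> g i)" "ALL i. v i : carrier R" "b = (\<Oplus>i\<in>A. v i \<otimes> g i)" using aS by auto
    have "(\<Oplus>i\<in>A. (w i \<oplus> v i) \<otimes> g i) = (\<Oplus>i\<in>A. w i \<otimes> g i \<oplus> v i \<otimes> g i)"
     using w(1,3) g by (intro finsum_cong') (auto simp: l_distr)
    also have "... = a \<oplus> b" unfolding w(2,4) using w(1,3) g by (intro finsum_addf) auto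
    finally have "a \<oplus> b = (\<Oplus>i\<in>A. (w i \<oplus> v i) \<otimes> g i)" ..
    then show ?thesis using w(1,3) unfolding mem_Collect_eq by (intro exI[of _ "%i. w i \<oplus> v i"] conjI) auto
   qed
  qed
  have "x \<otimes> a : ?S" if aS: "a : ?S" "x : carrier R" for a x
  proof -
   obtain w where w: "ALL i. w i : carrier R" "a = (\<Oplus>i\<in>A. w i \<otimes> g i)" using aS by auto
   have "x \<otimes> a = (\<Oplus>i\<in>A. x \<otimes> (w i \<otimes> g i))"
    unfolding w(2) using w(1) g A that by (intro finsum_rdistr) auto
   also have "... = (\<Oplus>i\<in>A. (x \<otimes> w i) \<otimes> g i)"
    using w(1) g that by (intro finsum_cong') (auto simp: m_assoc)
   finally show ?thesis using w(1) that unfolding mem_Collect_eq by (intro exI[of _ "%i. x \<otimes> w i"] conjI) auto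
  qed
  then show "x \<otimes> a : ?S" "a \<otimes> x : ?S" if aS: "a : ?S" "x : carrier R" for a x
  proof -
   show "x \<otimes> a : ?S" using that \<open>!!x a. a : ?S ==> x : carrier R ==> x \<otimes> a : ?S\<close> by blast
   moreover have "a : carrier R" using that(1) c by auto
   ultimately show "a \<otimes> x : ?S" using m_comm[of a x] that(2) by simp
  qed
 qed
 have "g ` A <= ?S"
 proof clarify
  fix i assume i: "i : A"
  have "(\<Oplus>j\<in>A. (if j = i then \<one> else \<zero>) \<otimes> g j) = (\<Oplus>j\<in>A. if j = i then g j else \<zero>)"
   using g by (intro finsum_cong') auto
  also have "... = g i" using A i g by (intro finsum_delta) auto
  finally show "EX w. g i = (\<Oplus>i\<in>A. w i \<otimes> g i) & (ALL i. w i : carrier R)"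
   by (intro exI[of _ "%j. if j = i then \<one> else \<zero>"]) auto
 qed
 then show "Idl (g ` A) <= ?S" by (rule genideal_minimal[OF SI])
 have I: "ideal (Idl (g ` A)) R" by (rule genideal_ideal[OF gs])
 interpret I: ideal "Idl (g ` A)" R by fact
 show "?S <= Idl (g ` A)"
 proof
  fix x assume x: "x : ?S"
  obtain w where w: "ALL i. w i : carrier R" "x = (\<Oplus>i\<in>A. w i \<otimes> g i)" using x by auto
  show "x : Idl (g ` A)" unfolding w(2)
   using w(1) genideal_self[OF gs] by (intro I.finsum_in_ideal I.I_l_closed) auto
 qed
qed

lemma (in cring) free_module:
 assumes "finite A"
 shows "module R (direct_sum A (%_. self_module R))"
proof -
 let ?N = "direct_sum A (%_. self_module R)"
 have carr: "carrier ?N = (A \<rightarrow>\<^sub>E carrier R)"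
  using assms by (auto simp: direct_sum_def self_module_def)
 have add: "x \<oplus>\<^bsub>?N\<^esub> y = (\<lambda>i\<in>A. x i \<oplus> y i)" for x y
  by (simp add: direct_sum_def self_module_def)
 have smult: "r \<odot>\<^bsub>?N\<^esub> y = (\<lambda>i\<in>A. r \<otimes> y i)" for r y
  by (simp add: direct_sum_def self_module_def)
 have zero: "\<zero>\<^bsub>?N\<^esub> = (\<lambda>i\<in>A. \<zero>)"
  by (simp add: direct_sum_def self_module_def)
 have ext: "x = y" if "x : A \<rightarrow>\<^sub>E carrier R" "y : A \<rightarrow>\<^sub>E carrier R" "!!i. i : A ==> x i = y i" for x y
  using that by (rule PiE_ext)
 have val: "x i : carrier R" if "x : A \<rightarrow>\<^sub>E carrier R" "i : A" for x i using that by auto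
 show ?thesis
 proof (intro moduleI abelian_groupI is_cring, unfold carr add smult zero)
  fix x y z assume x: "x : A \<rightarrow>\<^sub>E carrier R" and y: "y : A \<rightarrow>\<^sub>E carrier R" 
  show "(\<lambda>i\<in>A. x i \<oplus> y i) = (\<lambda>i\<in>A. y i \<oplus> x i)"
   using val[OF x] val[OF y] by (intro restrict_ext) (simp add: a_comm)
  show "(\<lambda>i\<in>A. x i \<oplus> y i) : A \<rightarrow>\<^sub>E carrier R" using val[OF x] val[OF y] by auto
  assume z: "z : A \<rightarrow>\<^sub>E carrier R"
  show "(\<lambda>i\<in>A. (\<lambda>i\<in>A. x i \<oplus> y i) i \<oplus> z i) = (\<lambda>i\<in>A. x i \<oplus> (\<lambda>i\<in>A. y i \<oplus> z i) i)"
   using val[OF x] val[OF y] val[OF z] by (intro restrict_ext) (simp add: a_assoc)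
 next
  fix x assume x: "x : A \<rightarrow>\<^sub>E carrier R"
  show "(\<lambda>i\<in>A. (\<lambda>i\<in>A. \<zero>) i \<oplus> x i) = x" using val[OF x] x by (intro ext) auto
  show "EX y:A \<rightarrow>\<^sub>E carrier R. (\<lambda>i\<in>A. y i \<oplus> x i) = (\<lambda>i\<in>A. \<zero>)"
   using val[OF x] by (intro bexI[of _ "\<lambda>i\<in>A. \<ominus> x i"] restrict_ext) (auto simp: l_neg)
  show "(\<lambda>i\<in>A. \<one> \<otimes> x i) = x" using val[OF x] x by (intro ext) auto
  fix a assume a: "a : carrier R"
  show "(\<lambda>i\<in>A. a \<otimes> x i) : A \<rightarrow>\<^sub>E carrier R" using a val[OF x] by auto
  fix b assume b: "b : carrier R"
  show "(\<lambda>i\<in>A. (a \<oplus> b) \<otimes> x i) = (\<lambda>i\<in>A. (\<lambda>i\<in>A. a \<otimes> x i) i \<oplus> (\<lambda>i\<in>A. b \<otimes> x i) i)"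
   using a b val[OF x] by (intro restrict_ext) (simp add: l_distr)
  show "(\<lambda>i\<in>A. (a \<otimes> b) \<otimes> x i) = (\<lambda>i\<in>A. a \<otimes> (\<lambda>i\<in>A. b \<otimes> x i) i)"
   using a b val[OF x] by (intro restrict_ext) (simp add: m_assoc)
 next
  fix a x y assume a: "a : carrier R" and x: "x : A \<rightarrow>\<^sub>E carrier R" and y: "y : A \<rightarrow>\<^sub>E carrier R" 
  show "(\<lambda>i\<in>A. a \<otimes> (\<lambda>i\<in>A. x i \<oplus> y i) i) = (\<lambda>i\<in>A. (\<lambda>i\<in>A. a \<otimes> x i) i \<oplus> (\<lambda>i\<in>A. a \<otimes> y i) i)"
   using a val[OF x] val[OF y] by (intro restrict_ext) (simp add: r_distr)
 qed auto
qed

section \<open>Dual bases and supports of finitely generated ideals\<close>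

locale semihereditary_ring = cring +
 assumes semihereditary: "semihereditary R"
begin

text \<open>The identity of the projective ideal is lifted through the surjection from the free
  module on \<open>A\<close>. That module is indexed by the elements of \<open>A\<close> themselves
  because the test modules of \<open>projective\<close> consist here of functions from
  \<open>'a\<close> to \<open>'a\<close>.\<close>

lemma dual_basis_set:
 assumes A: "finite A" "A <= carrier R"
 shows "EX h. (ALL a:A. (ALL x:Idl A. h a x : carrier R) &
   (ALL x:Idl A. ALL y:Idl A. h a (x \<oplus> y) = h a x \<oplus> h a y) &
   (ALL r:carrier R. ALL x:Idl A. h a (r \<otimes> x) = r \<otimes> h a x)) &
  (ALL x:Idl A. x = (\<Oplus>a\<in>A. h a x \<otimes> a))"
proof -
 let ?I = "Idl A" let ?P = "ideal_module R ?I" let ?N = "direct_sum A (%_. self_module R)"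
 have P: "projective R ?P" using semihereditary A unfolding semihereditary_def by blast
 have I: "ideal ?I R" by (rule genideal_ideal) fact
 have fam: "?I = {\<Oplus>i\<in>A. w i \<otimes> i | w. ALL i. w i : carrier R}"
  using genideal_family[of A "%x. x"] A by auto
 define G where "G w = (\<Oplus>a\<in>A. w a \<otimes> a)" for w
 have carr: "carrier ?N = (A \<rightarrow>\<^sub>E carrier R)"
  using A by (auto simp: direct_sum_def self_module_def)
 have cl: "G w : ?I" if "w : A \<rightarrow> carrier R" for w
 proof -
  have "G w = (\<Oplus>a\<in>A. (if a : A then w a else \<zero>) \<otimes> a)"
   unfolding G_def using that A by (intro finsum_cong') (auto simp: subset_iff Pi_iff)
  then show ?thesis unfolding fam mem_Collect_eq using that
   by (intro exI[of _ "%a. if a : A then w a else \<zero>"] conjI) auto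
 qed
 have Ghom: "G : mod_hom R ?N ?P"
  unfolding mod_hom_def
 proof (intro CollectI conjI ballI funcsetI)
  show "G w : carrier ?P" if "w : carrier ?N" for w
   using that cl[of w] unfolding carr by (auto simp: ideal_module_def)
  show "G (x \<oplus>\<^bsub>?N\<^esub> y) = G x \<oplus>\<^bsub>?P\<^esub> G y" if "x : carrier ?N" "y : carrier ?N" for x y
  proof -
   have xy: "x a : carrier R" "y a : carrier R" "a : carrier R" if "a : A" for a
    using \<open>x : _\<close> \<open>y : _\<close> that A unfolding carr by auto
   have "G (x \<oplus>\<^bsub>?N\<^esub> y) = (\<Oplus>a\<in>A. x a \<otimes> a \<oplus> y a \<otimes> a)"
    unfolding G_def using xy by (intro finsum_cong') (auto simp: direct_sum_def self_module_def l_distr)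
   also have "... = G x \<oplus> G y" unfolding G_def using xy by (intro finsum_addf) auto
   finally show ?thesis by (simp add: ideal_module_def self_module_def)
  qed
  show "G (r \<odot>\<^bsub>?N\<^esub> x) = r \<odot>\<^bsub>?P\<^esub> G x" if r: "r : carrier R" and "x : carrier ?N" for r x
  proof -
   have xy: "x a : carrier R" "a : carrier R" if "a : A" for a
    using \<open>x : _\<close> that A unfolding carr by auto
   have "G (r \<odot>\<^bsub>?N\<^esub> x) = (\<Oplus>a\<in>A. r \<otimes> (x a \<otimes> a))"
    unfolding G_def using xy r by (intro finsum_cong') (auto simp: direct_sum_def self_module_def m_assoc)
   also have "... = r \<otimes> G x" unfolding G_def using xy r A by (intro finsum_rdistr[symmetric]) auto
   finally show ?thesis by (simp add: ideal_module_def self_module_def)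
  qed
 qed
 have Gsurj: "G ` carrier ?N = carrier ?P"
 proof
  show "G ` carrier ?N <= carrier ?P" using Ghom by (auto simp: mod_hom_def)
  show "carrier ?P <= G ` carrier ?N"
  proof
   fix x assume "x : carrier ?P"
   then obtain w where w: "ALL i. w i : carrier R" "x = G w"
    unfolding G_def by (auto simp: ideal_module_def fam)
   have "x = G (restrict w A)"
    unfolding w G_def using w A by (intro finsum_cong') auto
   moreover have "restrict w A : carrier ?N" unfolding carr using w by auto
   ultimately show "x : G ` carrier ?N" by blast
  qed
 qed
 have id: "id : mod_hom R ?P ?P" by (auto simp: mod_hom_def)
 have N: "module R ?N" by (rule free_module) fact
 have MP: "module R ?P" using P unfolding projective_def by blast
 have "EX h:mod_hom R ?P ?N. ALL x:carrier ?P. G (h x) = id x"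
  using P N MP Ghom Gsurj id unfolding projective_def by blast
 then obtain h where h: "h : mod_hom R ?P ?N" and hG: "!!x. x : ?I ==> G (h x) = x"
  by (auto simp: ideal_module_def)
 have hc: "h x a : carrier R" if "x : ?I" "a : A" for x a
  using h that unfolding mod_hom_def carr by (auto simp: ideal_module_def)
 have ha: "h (x \<oplus> y) a = h x a \<oplus> h y a" if "x : ?I" "y : ?I" "a : A" for x y a
  using h that unfolding mod_hom_def by (auto simp: ideal_module_def direct_sum_def self_module_def)
 have hm: "h (r \<otimes> x) a = r \<otimes> h x a" if "x : ?I" "r : carrier R" "a : A" for x r a
  using h that unfolding mod_hom_def by (auto simp: ideal_module_def direct_sum_def self_module_def)
 show ?thesis
  using hc ha hm hG by (intro exI[of _ "%a x. h x a"]) (simp add: G_def)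
qed

text \<open>For a family, several indices may give the same generator. One index is kept for each
  generator, and the coordinates at all others are zero.\<close>

lemma dual_basis:
 assumes A: "finite A" and g: "!!i. i : A ==> g i : carrier R"
 obtains h where "!!i x. x : Idl (g ` A) ==> h i x : carrier R"
  "!!i x y. x : Idl (g ` A) ==> y : Idl (g ` A) ==> h i (x \<oplus> y) = h i x \<oplus> h i y"
  "!!i r x. r : carrier R ==> x : Idl (g ` A) ==> h i (r \<otimes> x) = r \<otimes> h i x"
  "!!x. x : Idl (g ` A) ==> x = (\<Oplus>i\<in>A. h i x \<otimes> g i)"
proof -
 let ?I = "Idl (g ` A)"
 have gA: "finite (g ` A)" "g ` A <= carrier R" using A g by auto
 obtain h where hc: "!!a x. a : g ` A ==> x : ?I ==> h a x : carrier R"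
  and ha: "!!a x y. a : g ` A ==> x : ?I ==> y : ?I ==> h a (x \<oplus> y) = h a x \<oplus> h a y"
  and hm: "!!a r x. a : g ` A ==> r : carrier R ==> x : ?I ==> h a (r \<otimes> x) = r \<otimes> h a x"
  and hs: "!!x. x : ?I ==> x = (\<Oplus>a\<in>g ` A. h a x \<otimes> a)"
  using dual_basis_set[OF gA] by blast
 interpret I: ideal ?I R by (rule genideal_ideal) fact
 define B where "B = inv_into A g ` g ` A"
 have BA: "B <= A" unfolding B_def by (auto intro: inv_into_into)
 have Bg: "i : B ==> g i : g ` A" for i using BA by blast
 define h' where "h' i x = (if i : B then h (g i) x else \<zero>)" for i x
 show ?thesis
 proof (rule that[of h'])
  fix x assume x: "x : ?I"
  have "(\<Oplus>i\<in>A. h' i x \<otimes> g i) = (\<Oplus>i\<in>B. h (g i) x \<otimes> g i)"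
   by (rule add.finprod_mono_neutral_cong_right)
    (use A BA Bg x g hc in \<open>auto simp: h'_def subsetD[OF BA]\<close>)
  also have "... = (\<Oplus>a\<in>g ` A. h (g (inv_into A g a)) x \<otimes> g (inv_into A g a))"
   unfolding B_def by (rule finsum_reindex) (use x g hc in \<open>auto simp: f_inv_into_f inv_into_into intro!: inj_on_inv_into\<close>)
  also have "... = (\<Oplus>a\<in>g ` A. h a x \<otimes> a)"
   using hc x g by (intro finsum_cong') (auto simp: f_inv_into_f)
  finally show "x = (\<Oplus>i\<in>A. h' i x \<otimes> g i)" using hs[OF x] by simp
 qed (use hc ha hm Bg in \<open>auto simp: h'_def\<close>)
qed

text \<open>For a single generator the dual basis is one linear map h with x = h(x) g, and e = h(g)
  works: e e = h(e g) = h(g), and r g = 0 implies r e = h(r g) = 0.\<close>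

lemma principal_support:
 assumes [simp]: "g : carrier R"
 shows "EX e:carrier R. e \<otimes> e = e & e \<otimes> g = g & (ALL r:carrier R. r \<otimes> g = \<zero> --> r \<otimes> e = \<zero>)"
proof -
 let ?I = "Idl ((%_. g) ` {()})"
 obtain h :: "unit => 'a => 'a" where hc: "!!i x. x : ?I ==> h i x : carrier R"
  and ha: "!!i x y. x : ?I ==> y : ?I ==> h i (x \<oplus> y) = h i x \<oplus> h i y"
  and hm: "!!i r x. r : carrier R ==> x : ?I ==> h i (r \<otimes> x) = r \<otimes> h i x"
  and hs: "!!x. x : ?I ==> x = (\<Oplus>i\<in>{()}. h i x \<otimes> g)"
  by (rule dual_basis[of "{()}" "%_. g"]) auto
 have gI: "g : ?I" using genideal_self[of "{g}"] by auto
 interpret I: ideal ?I R by (rule genideal_ideal) auto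
 define e where "e = h () g"
 have [simp]: "e : carrier R" unfolding e_def using gI hc by blast
 have eg: "e \<otimes> g = g" using hs[OF gI] by (simp add: e_def[symmetric])
 have ee: "e \<otimes> e = e" using hm[of e g "()"] gI by (simp add: eg e_def[symmetric])
 have "r \<otimes> e = \<zero>" if "r : carrier R" "r \<otimes> g = \<zero>" for r
 proof -
  have "h () \<zero> = \<zero>" using hm[of \<zero> g "()"] gI hc[OF gI] by simp
  then show ?thesis using hm[of r g "()"] gI that by (simp add: e_def)
 qed
 then show ?thesis using eg ee by (intro bexI[of _ e]) auto
qed

lemma support:
 assumes "finite A" "!!i. i : A ==> g i : carrier R"
 shows "EX e:carrier R. e \<otimes> e = e & (ALL i:A. e \<otimes> g i = g i) &
  (ALL r:carrier R. (ALL i:A. r \<otimes> g i = \<zero>) --> r \<otimes> e = \<zero>)"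
 using assms
proof (induction A)
 case empty
 then show ?case by (intro bexI[of _ \<zero>]) auto
next
 case (insert j A)
 then obtain f where f: "f : carrier R" "f \<otimes> f = f" "!!i. i : A ==> f \<otimes> g i = g i"
  "!!r. r : carrier R ==> (!!i. i : A ==> r \<otimes> g i = \<zero>) ==> r \<otimes> f = \<zero>" by auto
 obtain e where e: "e : carrier R" "e \<otimes> e = e" "e \<otimes> g j = g j"
  "!!r. r : carrier R ==> r \<otimes> g j = \<zero> ==> r \<otimes> e = \<zero>"
  using principal_support[of "g j"] insert by auto
 \<comment> \<open>The join of the two idempotents; its annihilator is the intersection of
   theirs.\<close>
 define k where "k = f \<oplus> e \<ominus> f \<otimes> e"
 have [simp]: "k : carrier R" "f : carrier R" "e : carrier R" using e f by (auto simp: k_def)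
 have kx: "k \<otimes> x = f \<otimes> x \<oplus> e \<otimes> x \<ominus> e \<otimes> (f \<otimes> x)" "k \<otimes> x = f \<otimes> x \<oplus> e \<otimes> x \<ominus> f \<otimes> (e \<otimes> x)"
  if "x : carrier R" for x
  using that f(1) e(1) unfolding k_def by algebra+
 have cancel: "a \<oplus> b \<ominus> b = a" "b \<oplus> a \<ominus> b = a" if "a : carrier R" "b : carrier R" for a b
  using that by algebra+
 have kf: "k \<otimes> f = f" using kx(1)[of f] cancel[of f "e \<otimes> f"] f(2) by simp
 have ke: "k \<otimes> e = e" using kx(2)[of e] cancel[of e "f \<otimes> e"] e(2) by simp
 have "k \<otimes> k = k \<otimes> f \<oplus> k \<otimes> e \<ominus> k \<otimes> f \<otimes> e"
  using \<open>k : carrier R\<close> f(1) e(1) unfolding k_def[of] by algebra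
 then have "k \<otimes> k = k" by (simp add: kf ke) (simp add: k_def)
 moreover have "k \<otimes> g i = g i" if "i : A" for i
  using kx(1)[of "g i"] cancel[of "g i" "e \<otimes> g i"] f(3)[OF that] insert.prems[of i] that by simp
 moreover have "k \<otimes> g j = g j"
  using kx(2)[of "g j"] cancel[of "g j" "f \<otimes> g j"] e(3) insert.prems[of j] by simp
 moreover have "r \<otimes> k = \<zero>" if "r : carrier R" "ALL i:insert j A. r \<otimes> g i = \<zero>" for r
 proof -
  have "r \<otimes> f = \<zero>" "r \<otimes> e = \<zero>" using that f(4) e(4) by auto
  moreover have "r \<otimes> k = r \<otimes> f \<oplus> r \<otimes> e \<ominus> (r \<otimes> f) \<otimes> e"
   using that(1) f(1) e(1) unfolding k_def by algebra
  ultimately show ?thesis by (simp add: minus_eq)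
 qed
 ultimately show ?case by (intro bexI[of _ k]) auto
qed

text \<open>The support e of x satisfies e x = x, and x x = 0 gives x e = 0.\<close>

lemma reduced:
 assumes "x : carrier R" "x \<otimes> x = \<zero>"
 shows "x = \<zero>"
 using principal_support[OF assms(1)] assms by (metis m_comm)

text \<open>Each further column is added only where the combination so far vanishes, that is, with
  the factor 1 - f, where f is the common support of the present combinations over all rows
  \<open>b\<close>. Multiplication by f then separates the old part from the new one. The same
  coefficients serve all rows.\<close>

lemma ex_combination:
 assumes B: "finite B" and w: "!!b i. w b i : carrier R"
 shows "EX c. (ALL i. c i : carrier R) &
  (ALL r:carrier R. (ALL b:B. r \<otimes> (\<Oplus>i\<in>{..<q::nat}. c i \<otimes> w b i) = \<zero>) --> (ALL b:B. ALL i<q. r \<otimes> w b i = \<zero>))"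
proof (induction q)
 case 0
 then show ?case by (intro exI[of _ "%_. \<zero>"]) simp
next
 case (Suc q)
 then obtain c where c: "!!i. c i : carrier R" and ih: "!!r b i. r : carrier R ==>
  (!!b. b : B ==> r \<otimes> (\<Oplus>i\<in>{..<q}. c i \<otimes> w b i) = \<zero>) ==> b : B ==> i < q ==> r \<otimes> w b i = \<zero>" by metis
 define l where "l b = (\<Oplus>i\<in>{..<q}. c i \<otimes> w b i)" for b
 have l: "l b : carrier R" for b unfolding l_def using c w by (intro finsum_closed') auto
 obtain f where f: "f : carrier R" "f \<otimes> f = f" "!!b. b : B ==> f \<otimes> l b = l b"
  "!!r. r : carrier R ==> (!!b. b : B ==> r \<otimes> l b = \<zero>) ==> r \<otimes> f = \<zero>"
  using support[OF B, of l] l by auto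
 define c' where "c' i = (if i < q then c i else \<one> \<ominus> f)" for i
 have c': "c' i : carrier R" for i using c f by (auto simp: c'_def)
 have l': "(\<Oplus>i\<in>{..<Suc q}. c' i \<otimes> w b i) = l b \<oplus> (\<one> \<ominus> f) \<otimes> w b q" for b
 proof -
  have "(\<Oplus>i\<in>{..<Suc q}. c' i \<otimes> w b i) = (\<Oplus>i\<in>{..<q}. c' i \<otimes> w b i) \<oplus> c' q \<otimes> w b q"
   using c' w by (intro finsum_lessThan_Suc) auto
  also have "(\<Oplus>i\<in>{..<q}. c' i \<otimes> w b i) = l b"
   unfolding l_def using c w by (intro finsum_cong') (auto simp: c'_def)
  finally show ?thesis by (simp add: c'_def)
 qed
 have "r \<otimes> w b i = \<zero>"
  if r: "r : carrier R" and h: "ALL b:B. r \<otimes> (\<Oplus>i\<in>{..<Suc q}. c' i \<otimes> w b i) = \<zero>" and b: "b : B" and i: "i < Suc q" for r b i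
 proof -
  have rl: "r \<otimes> l b = \<zero>" if b: "b : B" for b
  proof -
   have e: "f \<otimes> (r \<otimes> (x \<oplus> (\<one> \<ominus> f) \<otimes> y)) = r \<otimes> (f \<otimes> x) \<oplus> r \<otimes> ((f \<ominus> f \<otimes> f) \<otimes> y)" if "x : carrier R" "y : carrier R" for x y
    using that f(1) r by algebra
   have "f \<otimes> (r \<otimes> (l b \<oplus> (\<one> \<ominus> f) \<otimes> w b q)) = \<zero>" using h b f(1) by (simp add: l')
   then show ?thesis using e[OF l w] f(1-3) l r w b by (simp add: r_neg minus_eq)
  qed
  then have rf: "r \<otimes> f = \<zero>" using f(4) r by blast
  show ?thesis
  proof (cases "i < q")
   case True
   then show ?thesis using ih[OF r _ b] rl unfolding l_def by blast
  next
   case False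
   then have iq: "i = q" using i by simp
   have "r \<otimes> (l b \<oplus> (\<one> \<ominus> f) \<otimes> w b q) = \<zero>" using h b by (simp add: l')
   moreover have "r \<otimes> (x \<oplus> (\<one> \<ominus> f) \<otimes> y) = r \<otimes> x \<oplus> r \<otimes> y \<ominus> (r \<otimes> f) \<otimes> y" if "x : carrier R" "y : carrier R" for x y
    using that f(1) r by algebra
   ultimately show ?thesis using l w r rl[OF b] by (simp add: rf iq minus_eq)
  qed
 qed
 then show ?case using c' by (intro exI[of _ c']) blast
qed

end

section \<open>Linear combinations\<close>

text \<open>Only the entries below \<open>t\<close> count, but the lemmas ask for all entries to lie
  in the carrier, so that closure conditions carry no index bounds.\<close>

definition dot :: "('a, 'r) ring_scheme => nat => (nat => 'a) => (nat => 'a) => 'a" where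
 "dot R t x w = (\<Oplus>\<^bsub>R\<^esub>a\<in>{..<t}. x a \<otimes>\<^bsub>R\<^esub> w a)"

context cring
begin

lemma dot_closed [simp]: "[|!!a. x a : carrier R; !!a. w a : carrier R|] ==> dot R t x w : carrier R"
 unfolding dot_def by (intro finsum_closed') simp

lemma dot_comm: "[|!!a. x a : carrier R; !!a. w a : carrier R|] ==> dot R t x w = dot R t w x"
 unfolding dot_def by (intro finsum_cong') (auto simp: m_comm)

lemma dot_cong: "[|!!a. a < t ==> x a = y a; !!a. y a : carrier R; !!a. w a : carrier R|] ==> dot R t x w = dot R t y w"
 unfolding dot_def by (intro finsum_cong') auto

lemma dot_lin:
 assumes [simp]: "r : carrier R" "s : carrier R" "!!a. x a : carrier R" "!!a. y a : carrier R" "!!a. w a : carrier R"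
 shows "dot R t (%a. r \<otimes> x a \<ominus> s \<otimes> y a) w = r \<otimes> dot R t x w \<ominus> s \<otimes> dot R t y w"
proof -
 have "dot R t (%a. r \<otimes> x a \<ominus> s \<otimes> y a) w = (\<Oplus>a\<in>{..<t}. r \<otimes> (x a \<otimes> w a) \<ominus> s \<otimes> (y a \<otimes> w a))"
  unfolding dot_def
 proof (intro finsum_cong' refl)
  fix a
  have *: "(r \<otimes> p \<ominus> s \<otimes> q) \<otimes> v = r \<otimes> (p \<otimes> v) \<ominus> s \<otimes> (q \<otimes> v)" if "p : carrier R" "q : carrier R" "v : carrier R" for p q v
   using that assms(1,2) by algebra
  show "(r \<otimes> x a \<ominus> s \<otimes> y a) \<otimes> w a = r \<otimes> (x a \<otimes> w a) \<ominus> s \<otimes> (y a \<otimes> w a)" by (rule *) auto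
 qed auto
 also have "... = (\<Oplus>a\<in>{..<t}. r \<otimes> (x a \<otimes> w a)) \<ominus> (\<Oplus>a\<in>{..<t}. s \<otimes> (y a \<otimes> w a))"
  by (rule finsum_minus) auto
 also have "(\<Oplus>a\<in>{..<t}. r \<otimes> (x a \<otimes> w a)) = r \<otimes> dot R t x w"
  unfolding dot_def by (rule finsum_rdistr[symmetric]) auto
 also have "(\<Oplus>a\<in>{..<t}. s \<otimes> (y a \<otimes> w a)) = s \<otimes> dot R t y w"
  unfolding dot_def by (rule finsum_rdistr[symmetric]) auto
 finally show ?thesis .
qed

lemma dot_lin_right:
 assumes [simp]: "r : carrier R" "s : carrier R" "!!a. x a : carrier R" "!!a. y a : carrier R" "!!a. w a : carrier R"
 shows "dot R t w (%a. r \<otimes> x a \<ominus> s \<otimes> y a) = r \<otimes> dot R t w x \<ominus> s \<otimes> dot R t w y"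
 using dot_lin[of r s x y w t] by (simp add: dot_comm[of w])

lemma dot_add:
 assumes [simp]: "!!a. x a : carrier R" "!!a. y a : carrier R" "!!a. w a : carrier R"
 shows "dot R t (%a. x a \<oplus> y a) w = dot R t x w \<oplus> dot R t y w"
proof -
 have "dot R t (%a. x a \<oplus> y a) w = (\<Oplus>a\<in>{..<t}. x a \<otimes> w a \<oplus> y a \<otimes> w a)"
  unfolding dot_def by (intro finsum_cong') (auto simp: l_distr)
 also have "... = dot R t x w \<oplus> dot R t y w"
  unfolding dot_def by (rule finsum_addf) auto
 finally show ?thesis .
qed

lemma dot_smult:
 assumes [simp]: "r : carrier R" "!!a. x a : carrier R" "!!a. w a : carrier R"
 shows "dot R t (%a. r \<otimes> x a) w = r \<otimes> dot R t x w"
proof -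
 have "dot R t (%a. r \<otimes> x a) w = (\<Oplus>a\<in>{..<t}. r \<otimes> (x a \<otimes> w a))"
  unfolding dot_def by (intro finsum_cong') (auto simp: m_assoc)
 also have "... = r \<otimes> dot R t x w"
  unfolding dot_def by (rule finsum_rdistr[symmetric]) auto
 finally show ?thesis .
qed

lemma dot_sum:
 assumes [simp]: "!!j. c j : carrier R" "!!j a. x j a : carrier R" "!!a. w a : carrier R"
 shows "dot R t (%a. dot R q c (%j. x j a)) w = dot R q c (%j. dot R t (x j) w)"
proof -
 have "dot R t (%a. dot R q c (%j. x j a)) w = (\<Oplus>a\<in>{..<t}. \<Oplus>j\<in>{..<q}. c j \<otimes> (x j a \<otimes> w a))"
  unfolding dot_def
 proof (intro finsum_cong' refl)
  fix a
  have "(\<Oplus>j\<in>{..<q}. c j \<otimes> x j a) \<otimes> w a = (\<Oplus>j\<in>{..<q}. c j \<otimes> x j a \<otimes> w a)"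
   by (rule finsum_ldistr) auto
  also have "... = (\<Oplus>j\<in>{..<q}. c j \<otimes> (x j a \<otimes> w a))"
   by (intro finsum_cong') (auto simp: m_assoc)
  finally show "(\<Oplus>j\<in>{..<q}. c j \<otimes> x j a) \<otimes> w a = (\<Oplus>j\<in>{..<q}. c j \<otimes> (x j a \<otimes> w a))" .
 qed (auto intro!: finsum_closed')
 also have "... = (\<Oplus>j\<in>{..<q}. \<Oplus>a\<in>{..<t}. c j \<otimes> (x j a \<otimes> w a))"
  by (rule finsum_swap) auto
 also have "... = dot R q c (%j. dot R t (x j) w)"
  unfolding dot_def by (intro finsum_cong' refl finsum_rdistr[symmetric]) (auto intro!: finsum_closed')
 finally show ?thesis .
qed

lemma dot_delta:
 assumes "i < t" "!!a. w a : carrier R"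
 shows "dot R t (%a. if a = i then \<one> else \<zero>) w = w i"
 unfolding dot_def using assms by (intro sum_delta_left(1)) auto

end

text \<open>The forms \<theta> i cut out the saturation of the span of the relations: what they kill
  lies in the span after multiplication by one regular \<open>D\<close>. The induction starts with
  the coordinate forms and D = 1. For a new relation, the forms are corrected by a combination of
  themselves so that they vanish on it as well, and \<open>D\<close> acquires a regular
  factor.\<close>

lemma (in semihereditary_ring) ex_saturation:
 assumes g: "!!b a. g b a : carrier R"
 shows "EX \<theta> D. (ALL i a. \<theta> i a : carrier R) & D : regular_elements R &
  (ALL b<N. ALL i<t. dot R t (\<theta> i) (g b) = \<zero>) &
  (ALL w. (ALL a. w a : carrier R) --> (ALL i<t. dot R t (\<theta> i) w = \<zero>) -->
   (EX c. (ALL b. c b : carrier R) & (ALL a<t. D \<otimes> w a = dot R N c (%b. g b a))))"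
proof (induction N)
 case 0
 define \<theta> where "\<theta> i a = (if a = i then \<one> else \<zero>)" for i a :: nat
 have "\<one> : regular_elements R" by (rule regularI) auto
 moreover have "dot R t (\<theta> i) w = w i" if "i < t" "ALL a. w a : carrier R" for i w
  unfolding \<theta>_def using that by (intro dot_delta) auto
 ultimately show ?case
  by (intro exI[of _ \<theta>] exI[of _ \<one>]) (auto simp: \<theta>_def dot_def intro!: exI[of _ "%_. \<zero>"])
next
 case (Suc N)
 then obtain \<theta>0 D0 where th0 [simp]: "!!i a. \<theta>0 i a : carrier R" and D0: "D0 : regular_elements R"
  and z0: "!!b i. b < N ==> i < t ==> dot R t (\<theta>0 i) (g b) = \<zero>"
  and k0: "!!w. (!!a. w a : carrier R) ==> (!!i. i < t ==> dot R t (\<theta>0 i) w = \<zero>) ==>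
   EX c. (ALL b. c b : carrier R) & (ALL a<t. D0 \<otimes> w a = dot R N c (%b. g b a))" by blast
 note [simp] = g regularD(1)[OF D0]
 define h where "h i = dot R t (\<theta>0 i) (g N)" for i
 have h [simp]: "h i : carrier R" for i by (simp add: h_def)
 obtain c where c [simp]: "!!i. c i : carrier R"
  and cann: "!!r i. r : carrier R ==> r \<otimes> (\<Oplus>i\<in>{..<t}. c i \<otimes> h i) = \<zero> ==> i < t ==> r \<otimes> h i = \<zero>"
  using ex_combination[of "{()}" "%_. h" t] by auto
 define \<delta> where "\<delta> = dot R t c h"
 have [simp]: "\<delta> : carrier R" by (simp add: \<delta>_def)
 obtain f where f [simp]: "f : carrier R" "f \<otimes> f = f" "f \<otimes> \<delta> = \<delta>"
  and fann: "!!r. r : carrier R ==> r \<otimes> \<delta> = \<zero> ==> r \<otimes> f = \<zero>"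
  using principal_support[of \<delta>] by auto
 have df: "\<delta> \<otimes> f = \<delta>" using f(3) m_comm[of \<delta> f] by simp
 \<comment> \<open>\<delta> shares its annihilator with all the values h i. Filling in 1 - f outside
   its support makes it regular.\<close>
 define \<delta>' where "\<delta>' = \<delta> \<oplus> (\<one> \<ominus> f)"
 have [simp]: "\<delta>' : carrier R" by (simp add: \<delta>'_def)
 have reg: "\<delta>' : regular_elements R"
 proof (rule regularI)
  fix r assume r: "r : carrier R" "\<delta>' \<otimes> r = \<zero>"
  have *: "f \<otimes> ((d \<oplus> (\<one> \<ominus> f)) \<otimes> r) = r \<otimes> (f \<otimes> d) \<oplus> (f \<ominus> f \<otimes> f) \<otimes> r"
   "(d \<oplus> (\<one> \<ominus> f)) \<otimes> r = r \<otimes> d \<oplus> (r \<ominus> r \<otimes> f)" if "d : carrier R" for d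
   using that f(1) r(1) by algebra+
  have rd: "r \<otimes> \<delta> = \<zero>" using *(1)[of \<delta>] r by (simp add: \<delta>'_def r_neg minus_eq)
  then have "r \<otimes> f = \<zero>" using fann r by blast
  then show "r = \<zero>" using *(2)[of \<delta>] r rd by (simp add: \<delta>'_def minus_eq)
 qed simp
 have hf: "(\<one> \<ominus> f) \<otimes> h i = \<zero>" if "i < t" for i
 proof (rule cann[OF _ _ that])
  have "(\<one> \<ominus> f) \<otimes> d = d \<ominus> f \<otimes> d" if "d : carrier R" for d using that f(1) by algebra
  then show "(\<one> \<ominus> f) \<otimes> (\<Oplus>i\<in>{..<t}. c i \<otimes> h i) = \<zero>"
   using \<open>\<delta> : carrier R\<close> f(3) unfolding \<delta>_def dot_def by (simp add: r_neg minus_eq)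
 qed simp
 \<comment> \<open>At the new relation the value is \<delta>' h i - h i \<delta> = (1 - f) h i, and
   this is zero because 1 - f kills \<delta> and hence every h i.\<close>
 define \<theta> where "\<theta> i a = \<delta>' \<otimes> \<theta>0 i a \<ominus> h i \<otimes> dot R t c (%j. \<theta>0 j a)" for i a
 have th [simp]: "\<theta> i a : carrier R" for i a by (simp add: \<theta>_def)
 have app: "dot R t (\<theta> i) w = \<delta>' \<otimes> dot R t (\<theta>0 i) w \<ominus> h i \<otimes> dot R t c (%j. dot R t (\<theta>0 j) w)"
  if [simp]: "!!a. w a : carrier R" for i w
  unfolding \<theta>_def by (subst dot_lin) (auto simp: dot_sum)
 have "dot R t (\<theta> i) (g b) = \<zero>" if b: "b < Suc N" and i: "i < t" for b i
 proof (cases "b = N")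
  case True
  have "\<delta>' \<otimes> h i \<ominus> h i \<otimes> \<delta> = (\<one> \<ominus> f) \<otimes> h i"
  proof -
   have "(d \<oplus> (\<one> \<ominus> f)) \<otimes> x \<ominus> x \<otimes> d = (\<one> \<ominus> f) \<otimes> x" if "x : carrier R" "d : carrier R" for x d
    using that f(1) by algebra
   then show ?thesis by (simp add: \<delta>'_def)
  qed
  then show ?thesis unfolding True app[of "g N", OF g] h_def[symmetric] \<delta>_def[symmetric] using hf[OF i] by simp
 next
  case False
  have "dot R t c (%j. dot R t (\<theta>0 j) (g b)) = dot R t (%j. dot R t (\<theta>0 j) (g b)) c"
   by (rule dot_comm) auto
  also have "... = dot R t (%_. \<zero>) c"
   using z0[of b] b False by (intro dot_cong) auto
  also have "... = \<zero>" by (simp add: dot_def)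
  finally show ?thesis using z0[of b i] b i False by (simp add: app minus_eq)
 qed
 moreover have "EX c. (ALL b. c b : carrier R) & (ALL a<t. (D0 \<otimes> \<delta>') \<otimes> w a = dot R (Suc N) c (%b. g b a))"
  if w [simp]: "!!a. w a : carrier R" and z: "!!i. i < t ==> dot R t (\<theta> i) w = \<zero>" for w
 proof -
  define l where "l = dot R t c (%j. dot R t (\<theta>0 j) w)"
  have [simp]: "l : carrier R" by (simp add: l_def)
  \<comment> \<open>Subtracting l times the new relation from \<delta>' w gives a vector killed by
    the old forms, to which the induction hypothesis applies.\<close>
  have "dot R t (\<theta>0 i) (%a. \<delta>' \<otimes> w a \<ominus> l \<otimes> g N a) = \<zero>" if "i < t" for i
  proof -
   have "dot R t (\<theta>0 i) (%a. \<delta>' \<otimes> w a \<ominus> l \<otimes> g N a) = \<delta>' \<otimes> dot R t (\<theta>0 i) w \<ominus> l \<otimes> h i"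
    unfolding h_def by (rule dot_lin_right) auto
   also have "... = dot R t (\<theta> i) w" unfolding app[OF w] l_def[symmetric] using m_comm[of l "h i"] by simp
   finally show ?thesis using z[OF that] by simp
  qed
  then obtain c' where c' [simp]: "!!b. c' b : carrier R"
   and e: "!!a. a < t ==> D0 \<otimes> (\<delta>' \<otimes> w a \<ominus> l \<otimes> g N a) = dot R N c' (%b. g b a)"
   using k0[of "%a. \<delta>' \<otimes> w a \<ominus> l \<otimes> g N a"] by auto
  define c'' where "c'' b = (if b = N then D0 \<otimes> l else c' b)" for b
  have [simp]: "c'' b : carrier R" for b by (simp add: c''_def)
  have "D0 \<otimes> \<delta>' \<otimes> w a = dot R (Suc N) c'' (%b. g b a)" if "a < t" for a
  proof -
   have "dot R (Suc N) c'' (%b. g b a) = dot R N c'' (%b. g b a) \<oplus> c'' N \<otimes> g N a"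
    unfolding dot_def by (rule finsum_lessThan_Suc) simp
   also have "dot R N c'' (%b. g b a) = dot R N c' (%b. g b a)"
    by (rule dot_cong) (auto simp: c''_def)
   also have "... \<oplus> c'' N \<otimes> g N a = D0 \<otimes> (\<delta>' \<otimes> w a \<ominus> l \<otimes> g N a) \<oplus> D0 \<otimes> l \<otimes> g N a"
    by (simp add: e[OF that, symmetric] c''_def)
   also have "... = D0 \<otimes> \<delta>' \<otimes> w a"
   proof -
    have "x \<otimes> (y \<otimes> z \<ominus> u \<otimes> v) \<oplus> x \<otimes> u \<otimes> v = x \<otimes> y \<otimes> z"
     if "x : carrier R" "y : carrier R" "z : carrier R" "u : carrier R" "v : carrier R" for x y z u v
     using that by algebra
    then show ?thesis by simp
   qed
   finally show ?thesis ..
  qed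
  then show ?thesis by (intro exI[of _ c'']) auto
 qed
 ultimately show ?case
  using regular_mult[OF D0 reg] by (intro exI[of _ \<theta>] exI[of _ "D0 \<otimes> \<delta>'"]) auto
qed

section \<open>Linear combinations and functionals in a module\<close>

definition lc :: "('a, 'b, 'm) module_scheme => nat => (nat => 'a) => (nat => 'b) => 'b" where
 "lc M t w y = (\<Oplus>\<^bsub>M\<^esub>i\<in>{..<t}. w i \<odot>\<^bsub>M\<^esub> y i)"

definition spans :: "('a, 'r) ring_scheme => ('a, 'b, 'm) module_scheme => nat => (nat => 'b) => bool" where
 "spans R M t y \<longleftrightarrow> (ALL i. y i : carrier M) &
  (ALL x:carrier M. EX w. (ALL i. w i : carrier R) & x = lc M t w y)"

definition functional :: "('a, 'r) ring_scheme => ('a, 'b, 'm) module_scheme => ('b => 'a) => bool" where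
 "functional R M \<phi> \<longleftrightarrow> (ALL x:carrier M. \<phi> x : carrier R) &
  (ALL x:carrier M. ALL y:carrier M. \<phi> (x \<oplus>\<^bsub>M\<^esub> y) = \<phi> x \<oplus>\<^bsub>R\<^esub> \<phi> y) &
  (ALL r:carrier R. ALL x:carrier M. \<phi> (r \<odot>\<^bsub>M\<^esub> x) = r \<otimes>\<^bsub>R\<^esub> \<phi> x)"

context module
begin

lemma lc_closed [simp]:
 "[|!!i. w i : carrier R; !!i. y i : carrier M|] ==> lc M t w y : carrier M"
 unfolding lc_def by (intro M.finsum_closed) auto

lemma lc_cong:
 "[|!!i. i < t ==> w i = v i; !!i. v i : carrier R; !!i. y i : carrier M|] ==> lc M t w y = lc M t v y"
 unfolding lc_def by (intro M.finsum_cong') auto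

lemma lc_cong2:
 "[|!!i. i < t ==> y i = z i; !!i. w i : carrier R; !!i. z i : carrier M|] ==> lc M t w y = lc M t w z"
 unfolding lc_def by (intro M.finsum_cong') auto

lemma lc_add:
 assumes [simp]: "!!i. w i : carrier R" "!!i. v i : carrier R" "!!i. y i : carrier M"
 shows "lc M t (%i. w i \<oplus> v i) y = lc M t w y \<oplus>\<^bsub>M\<^esub> lc M t v y"
 unfolding lc_def
 by (subst M.finsum_addf[symmetric]) (auto simp: smult_l_distr intro!: M.finsum_cong')

lemma lc_smult:
 assumes [simp]: "r : carrier R" "!!i. w i : carrier R" "!!i. y i : carrier M"
 shows "lc M t (%i. r \<otimes> w i) y = r \<odot>\<^bsub>M\<^esub> lc M t w y"
 unfolding lc_def
 by (subst finsum_smult_ldistr) (auto simp: smult_assoc1 intro!: M.finsum_cong')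

lemma lc_neg:
 assumes [simp]: "!!i. w i : carrier R" "!!i. y i : carrier M"
 shows "lc M t (%i. \<ominus> w i) y = \<ominus>\<^bsub>M\<^esub> lc M t w y"
proof -
 have "lc M t (%i. \<ominus> w i) y = lc M t (%i. (\<ominus> \<one>) \<otimes> w i) y" by (rule lc_cong) (auto simp: l_minus)
 then show ?thesis using lc_smult[of "\<ominus> \<one>" w y t] by (simp add: smult_l_minus)
qed

lemma lc_minus:
 assumes [simp]: "!!i. w i : carrier R" "!!i. v i : carrier R" "!!i. y i : carrier M"
 shows "lc M t (%i. w i \<ominus> v i) y = lc M t w y \<ominus>\<^bsub>M\<^esub> lc M t v y"
 using lc_add[of w "%i. \<ominus> v i" y t] by (simp add: lc_neg R.minus_eq M.minus_eq)

lemma lc_delta: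
 assumes "i < t" and y [simp]: "!!i. y i : carrier M"
 shows "lc M t (%j. if j = i then \<one> else \<zero>) y = y i"
proof -
 have "lc M t (%j. if j = i then \<one> else \<zero>) y = (\<Oplus>\<^bsub>M\<^esub>j\<in>{..<t}. if j = i then y j else \<zero>\<^bsub>M\<^esub>)"
  unfolding lc_def by (intro M.finsum_cong') auto
 then show ?thesis using assms by (simp add: M.finsum_delta)
qed

lemma lc_lc:
 assumes [simp]: "!!b. c b : carrier R" "!!b a. g b a : carrier R" "!!i. y i : carrier M"
 shows "lc M N c (%b. lc M t (g b) y) = lc M t (%a. dot R N c (%b. g b a)) y"
proof -
 have "lc M N c (%b. lc M t (g b) y) = (\<Oplus>\<^bsub>M\<^esub>b\<in>{..<N}. \<Oplus>\<^bsub>M\<^esub>a\<in>{..<t}. (c b \<otimes> g b a) \<odot>\<^bsub>M\<^esub> y a)"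
  unfolding lc_def
 proof (intro M.finsum_cong' refl)
  fix b
  have "c b \<odot>\<^bsub>M\<^esub> (\<Oplus>\<^bsub>M\<^esub>a\<in>{..<t}. g b a \<odot>\<^bsub>M\<^esub> y a) = (\<Oplus>\<^bsub>M\<^esub>a\<in>{..<t}. c b \<odot>\<^bsub>M\<^esub> (g b a \<odot>\<^bsub>M\<^esub> y a))"
   by (rule finsum_smult_ldistr) auto
  also have "... = (\<Oplus>\<^bsub>M\<^esub>a\<in>{..<t}. (c b \<otimes> g b a) \<odot>\<^bsub>M\<^esub> y a)"
   by (intro M.finsum_cong') (auto simp: smult_assoc1)
  finally show "c b \<odot>\<^bsub>M\<^esub> (\<Oplus>\<^bsub>M\<^esub>a\<in>{..<t}. g b a \<odot>\<^bsub>M\<^esub> y a) = (\<Oplus>\<^bsub>M\<^esub>a\<in>{..<t}. (c b \<otimes> g b a) \<odot>\<^bsub>M\<^esub> y a)" .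
 qed (auto intro!: M.finsum_closed)
 also have "... = (\<Oplus>\<^bsub>M\<^esub>a\<in>{..<t}. \<Oplus>\<^bsub>M\<^esub>b\<in>{..<N}. (c b \<otimes> g b a) \<odot>\<^bsub>M\<^esub> y a)"
  by (rule M.finsum_swap) auto
 also have "... = lc M t (%a. dot R N c (%b. g b a)) y"
  unfolding lc_def dot_def
 proof (intro M.finsum_cong' refl)
  fix a
  show "(\<Oplus>\<^bsub>M\<^esub>b\<in>{..<N}. (c b \<otimes> g b a) \<odot>\<^bsub>M\<^esub> y a) = (\<Oplus>b\<in>{..<N}. c b \<otimes> g b a) \<odot>\<^bsub>M\<^esub> y a"
   by (rule finsum_hom[symmetric, OF R.abelian_monoid_axioms M.abelian_monoid_axioms])
    (auto simp: smult_l_distr)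
 qed (auto intro!: M.finsum_closed R.finsum_closed')
 finally show ?thesis .
qed

lemma functional_closed: "functional R M \<phi> ==> x : carrier M ==> \<phi> x : carrier R"
 and functional_add: "functional R M \<phi> ==> x : carrier M ==> y : carrier M ==> \<phi> (x \<oplus>\<^bsub>M\<^esub> y) = \<phi> x \<oplus> \<phi> y"
 and functional_smult: "functional R M \<phi> ==> r : carrier R ==> x : carrier M ==> \<phi> (r \<odot>\<^bsub>M\<^esub> x) = r \<otimes> \<phi> x"
 by (simp_all add: functional_def)

lemma functional_zero: "functional R M \<phi> ==> \<phi> \<zero>\<^bsub>M\<^esub> = \<zero>"
 using functional_smult[of \<phi> \<zero> "\<zero>\<^bsub>M\<^esub>"] functional_closed[of \<phi> "\<zero>\<^bsub>M\<^esub>"] by simp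

lemma functional_minus:
 assumes "functional R M \<phi>" "x : carrier M" "y : carrier M"
 shows "\<phi> (\<ominus>\<^bsub>M\<^esub> x) = \<ominus> \<phi> x" "\<phi> (x \<ominus>\<^bsub>M\<^esub> y) = \<phi> x \<ominus> \<phi> y"
proof -
 have neg: "\<phi> (\<ominus>\<^bsub>M\<^esub> z) = \<ominus> \<phi> z" if "z : carrier M" for z
  using functional_smult[OF assms(1), of "\<ominus> \<one>" z] that functional_closed[OF assms(1) that]
  by (simp add: smult_l_minus l_minus)
 then show "\<phi> (\<ominus>\<^bsub>M\<^esub> x) = \<ominus> \<phi> x" using assms by blast
 show "\<phi> (x \<ominus>\<^bsub>M\<^esub> y) = \<phi> x \<ominus> \<phi> y"
  unfolding M.minus_eq R.minus_eq using assms by (simp add: functional_add neg)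
qed

lemma functional_lc:
 assumes "functional R M \<phi>" and [simp]: "!!i. w i : carrier R" "!!i. y i : carrier M"
 shows "\<phi> (lc M t w y) = dot R t w (%i. \<phi> (y i))"
proof -
 have "\<phi> (lc M t w y) = (\<Oplus>i\<in>{..<t}. \<phi> (w i \<odot>\<^bsub>M\<^esub> y i))"
  unfolding lc_def
  by (rule finsum_hom[OF M.abelian_monoid_axioms R.abelian_monoid_axioms])
   (use assms functional_closed functional_zero functional_add in auto)
 then show ?thesis unfolding dot_def
  using assms functional_closed by (auto intro!: R.finsum_cong' simp: functional_smult)
qed

lemma functional_dot:
 assumes "!!i. functional R M (\<theta> i)" and [simp]: "!!i. c i : carrier R"
 shows "functional R M (%x. dot R q c (%i. \<theta> i x))"
proof -
 note [simp] = functional_closed[OF assms(1)] functional_add[OF assms(1)] functional_smult[OF assms(1)]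
 have "dot R q c (%i. \<theta> i x \<oplus> \<theta> i y) = dot R q c (%i. \<theta> i x) \<oplus> dot R q c (%i. \<theta> i y)"
  if "x : carrier M" "y : carrier M" for x y
  using that R.dot_add[of "%i. \<theta> i x" "%i. \<theta> i y" c q] by (simp add: R.dot_comm[of c])
 moreover have "dot R q c (%i. r \<otimes> \<theta> i x) = r \<otimes> dot R q c (%i. \<theta> i x)"
  if "x : carrier M" "r : carrier R" for x r
  using that R.dot_smult[of r "%i. \<theta> i x" c q] by (simp add: R.dot_comm[of c])
 ultimately show ?thesis unfolding functional_def by simp
qed

lemma spans_closed: "spans R M t y ==> y i : carrier M"
 by (simp add: spans_def)

lemma submodule_closed: "submodule H R M ==> x : H ==> x : carrier M"
 using submoduleE(1) by blast

text \<open>A finite sum depends on the carrier of its structure, so sums in \<open>H\<close> and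
  sums in \<open>M\<close> have to be compared through the inclusion, which is a
  homomorphism.\<close>

lemma submodule_lc:
 assumes H: "submodule H R M" and [simp]: "!!i. w i : carrier R" and y: "!!i. y i : H"
 shows "lc (M\<lparr>carrier := H\<rparr>) t w y = lc M t w y"
proof -
 interpret N: module R "M\<lparr>carrier := H\<rparr>"
  by (rule submodule.submodule_is_module[OF H module_axioms])
 have "(%x. x) (lc (M\<lparr>carrier := H\<rparr>) t w y) = (\<Oplus>\<^bsub>M\<^esub>i\<in>{..<t}. w i \<odot>\<^bsub>M\<lparr>carrier := H\<rparr>\<^esub> y i)"
  unfolding lc_def
 proof (rule finsum_hom[OF N.abelian_monoid_axioms M.abelian_monoid_axioms])
  show "w i \<odot>\<^bsub>M\<lparr>carrier := H\<rparr>\<^esub> y i : carrier (M\<lparr>carrier := H\<rparr>)" for i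
   using N.smult_closed[of "w i" "y i"] y by simp
 qed (use submodule_closed[OF H] in auto)
 then show ?thesis by (simp add: lc_def)
qed

lemma functional_submodule:
 assumes "submodule H R M" "functional R M \<phi>"
 shows "functional R (M\<lparr>carrier := H\<rparr>) \<phi>"
 using assms submodule_closed[OF assms(1)] by (auto simp: functional_def)

end

section \<open>Splitting off ideals\<close>

definition fg_ideal :: "('a, 'r) ring_scheme => 'a set => bool" where
 "fg_ideal R I \<longleftrightarrow> (EX N g. (ALL i::nat. g i : carrier R) & I = Idl\<^bsub>R\<^esub> (g ` {..<N}))"

definition linear_proj :: "('a, 'r) ring_scheme => ('a, 'b, 'm) module_scheme => 'b set => ('b => 'b) => bool" where
 "linear_proj R M H \<pi> \<longleftrightarrow> submodule H R M & (ALL x:carrier M. \<pi> x : H) & (ALL x:H. \<pi> x = x) &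
  (ALL x:carrier M. ALL y:carrier M. \<pi> (x \<oplus>\<^bsub>M\<^esub> y) = \<pi> x \<oplus>\<^bsub>M\<^esub> \<pi> y) &
  (ALL r:carrier R. ALL x:carrier M. \<pi> (r \<odot>\<^bsub>M\<^esub> x) = r \<odot>\<^bsub>M\<^esub> \<pi> x)"

lemma (in cring) complement_mult:
 assumes "e : carrier R" "x : carrier R"
 shows "(\<one> \<ominus> e) \<otimes> x = x \<ominus> e \<otimes> x"
 using assms by algebra

lemma (in cring) complement_mult_eq_zero_iff:
 assumes "e : carrier R" "x : carrier R"
 shows "(\<one> \<ominus> e) \<otimes> x = \<zero> \<longleftrightarrow> e \<otimes> x = x"
 using assms complement_mult[OF assms] by (metis m_closed r_right_minus_eq)

text \<open>\<open>x \<mapsto> (\<beta> 0 x, \<dots>, \<beta> (n - 1) x, \<pi> x)\<close> is an isomorphism onto \<open>B 0 \<oplus> \<dots> \<oplus> B (n - 1) \<oplus> H\<close>; the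
  idempotents \<open>f k\<close> are the supports of the ideals \<open>B k\<close>.\<close>

definition splitting ::
 "('a, 'r) ring_scheme => ('a, 'b, 'm) module_scheme => nat => (nat => 'a) => (nat => 'a set) =>
  (nat => 'b => 'a) => 'b set => ('b => 'b) => bool"
where
 "splitting R M n f B \<beta> H \<pi> \<longleftrightarrow>
  (ALL k. f k : carrier R & f k \<otimes>\<^bsub>R\<^esub> f k = f k) & (ALL k<n. f (Suc k) \<otimes>\<^bsub>R\<^esub> f k = f (Suc k)) &
  (ALL k<n. fg_ideal R (B k) & (ALL b:B k. f k \<otimes>\<^bsub>R\<^esub> b = b) &
   (EX d:B k. ALL r:carrier R. r \<otimes>\<^bsub>R\<^esub> d = \<zero>\<^bsub>R\<^esub> --> r \<otimes>\<^bsub>R\<^esub> f k = \<zero>\<^bsub>R\<^esub>)) &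
  linear_proj R M H \<pi> & (ALL k<n. functional R M (\<beta> k)) &
  (ALL k<n. ALL x:carrier M. \<beta> k x : B k) & (ALL k<n. ALL x:H. \<beta> k x = \<zero>\<^bsub>R\<^esub>) &
  (ALL x:carrier M. \<pi> x = \<zero>\<^bsub>M\<^esub> --> (ALL k<n. \<beta> k x = \<zero>\<^bsub>R\<^esub>) --> x = \<zero>\<^bsub>M\<^esub>) &
  (ALL b. (ALL k<n. b k : B k) --> (EX x:carrier M. \<pi> x = \<zero>\<^bsub>M\<^esub> & (ALL k<n. \<beta> k x = b k)))"

lemma (in module) linear_proj_comp:
 assumes 1: "linear_proj R M K \<tau>" and 2: "linear_proj R (M\<lparr>carrier := K\<rparr>) H \<pi>"
 shows "linear_proj R M H (%x. \<pi> (\<tau> x))"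
proof -
 have K: "submodule K R M" using 1 by (simp add: linear_proj_def)
 note Kc = submodule_closed[OF K]
 interpret N: module R "M\<lparr>carrier := K\<rparr>"
  by (rule submodule.submodule_is_module[OF K module_axioms])
 have H: "submodule H R (M\<lparr>carrier := K\<rparr>)" using 2 by (simp add: linear_proj_def)
 have HK: "H <= K" using N.submoduleE(1)[OF H] by simp
 have "submodule H R M"
 proof (rule submoduleI)
  show "H <= carrier M" using HK submoduleE(1)[OF K] by blast
  show "a \<oplus>\<^bsub>M\<^esub> b : H" if "a : H" "b : H" for a b using N.submoduleE(5)[OF H that] by simp
  show sm: "a \<odot>\<^bsub>M\<^esub> b : H" if "a : carrier R" "b : H" for a b using N.submoduleE(4)[OF H that] by simp
  obtain h where h: "h : H" using N.submoduleE(2)[OF H] by blast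
  then have hc: "h : carrier M" using HK Kc by blast
  show "\<zero>\<^bsub>M\<^esub> : H" using sm[of \<zero> h] h hc by simp
  show "\<ominus>\<^bsub>M\<^esub> a : H" if "a : H" for a
  proof -
   have "a : carrier M" using that HK Kc by blast
   then show ?thesis using sm[of "\<ominus> \<one>" a] that smult_l_minus[of \<one> a] by simp
  qed
 qed
 then show ?thesis using 1 2 Kc HK unfolding linear_proj_def by auto
qed

text \<open>The summand split off is the kernel of \<pi>, on which \<open>l\<close> is an
  isomorphism onto \<open>A\<close>. The idempotent \<open>e\<close> is at the same time the support
  of \<open>A\<close> and the common support of the functionals \<theta> i with i < q.\<close>

definition splitting_step ::
 "('a, 'r) ring_scheme => ('a, 'b, 'm) module_scheme => (nat => 'b => 'a) => nat => 'a => 'a set =>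
  ('b => 'a) => ('b => 'b) => 'b set => bool"
where
 "splitting_step R M \<theta> q e A l \<pi> H \<longleftrightarrow> e : carrier R & e \<otimes>\<^bsub>R\<^esub> e = e &
  (ALL r:carrier R. r \<otimes>\<^bsub>R\<^esub> e = \<zero>\<^bsub>R\<^esub> \<longleftrightarrow> (ALL x:carrier M. ALL i<q. r \<otimes>\<^bsub>R\<^esub> \<theta> i x = \<zero>\<^bsub>R\<^esub>)) &
  fg_ideal R A & (ALL b:A. e \<otimes>\<^bsub>R\<^esub> b = b) &
  (EX d:A. ALL r:carrier R. r \<otimes>\<^bsub>R\<^esub> d = \<zero>\<^bsub>R\<^esub> --> r \<otimes>\<^bsub>R\<^esub> e = \<zero>\<^bsub>R\<^esub>) &
  functional R M l & (ALL x:carrier M. l x : A) & (ALL b:A. EX x:carrier M. l x = b & \<pi> x = \<zero>\<^bsub>M\<^esub>) &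
  (ALL x:carrier M. (ALL i<q. \<theta> i x = \<zero>\<^bsub>R\<^esub>) --> l x = \<zero>\<^bsub>R\<^esub>) &
  linear_proj R M H \<pi> & H = {x : carrier M. l x = \<zero>\<^bsub>R\<^esub>}"

text \<open>By \<open>ex_combination\<close> there is a combination l of the \<theta> i whose values
  on the generators have the same annihilator as the values of all \<theta> i. Its image is a
  finitely generated ideal, hence projective, so l splits.\<close>

lemma (in module) ex_splitting_step:
 assumes sh: "semihereditary_ring R" and y: "spans R M t y" and \<theta>: "!!i. functional R M (\<theta> i)"
 shows "EX e A l \<pi> H. splitting_step R M \<theta> q e A l \<pi> H"
proof -
 interpret sh: semihereditary_ring R by fact
 note yc [simp] = spans_closed[OF y]
 note th [simp] = functional_closed[OF \<theta>]
 have gen: "EX w. (ALL i. w i : carrier R) & x = lc M t w y" if "x : carrier M" for x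
  using y that unfolding spans_def by blast
 obtain c where c' : "ALL i. c i : carrier R" and cann': "ALL r:carrier R.
  (ALL b:{..<t}. r \<otimes> (\<Oplus>i\<in>{..<q}. c i \<otimes> \<theta> i (y b)) = \<zero>) --> (ALL b:{..<t}. ALL i<q. r \<otimes> \<theta> i (y b) = \<zero>)"
  using sh.ex_combination[of "{..<t}" "%b i. \<theta> i (y b)" q, OF finite_lessThan th[OF yc]] by (elim exE conjE) 
 have c [simp]: "c i : carrier R" for i using c' by blast
 have cann: "r \<otimes> \<theta> i (y b) = \<zero>" if "r : carrier R"
  "!!b. b < t ==> r \<otimes> (\<Oplus>i\<in>{..<q}. c i \<otimes> \<theta> i (y b)) = \<zero>" "b < t" "i < q" for r b i
  using cann' that by (meson lessThan_iff)
 define l where "l x = dot R q c (%i. \<theta> i x)" for x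
 have l: "functional R M l" unfolding l_def by (rule functional_dot[OF \<theta> c])
 note lc [simp] = functional_closed[OF l]
 obtain e where e [simp]: "e : carrier R" and ee: "e \<otimes> e = e" and el': "ALL b:{..<t}. e \<otimes> l (y b) = l (y b)"
  and eann': "ALL r:carrier R. (ALL b:{..<t}. r \<otimes> l (y b) = \<zero>) --> r \<otimes> e = \<zero>"
  using sh.support[of "{..<t}" "%b. l (y b)", OF finite_lessThan lc[OF yc]] by (elim bexE conjE)
 have el: "e \<otimes> l (y b) = l (y b)" if "b < t" for b using el' that by blast
 have eann: "r \<otimes> e = \<zero>" if "r : carrier R" "!!b. b < t ==> r \<otimes> l (y b) = \<zero>" for r
  using eann' that by (meson lessThan_iff)
 have dot0: "r \<otimes> dot R t w v = \<zero>" if "r : carrier R" "!!i. w i : carrier R" "!!i. v i : carrier R" "!!i. i < t ==> r \<otimes> v i = \<zero>" for r w v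
 proof -
  have "r \<otimes> dot R t w v = dot R t (%i. r \<otimes> v i) w"
   using that R.dot_smult[of r v w t] R.dot_comm[of v w t] by simp
  also have "... = dot R t (%_. \<zero>) w" using that by (intro R.dot_cong) auto
  finally show ?thesis using that by (simp add: dot_def)
 qed
 have esupp: "r \<otimes> e = \<zero> \<longleftrightarrow> (ALL x:carrier M. ALL i<q. r \<otimes> \<theta> i x = \<zero>)" if r [simp]: "r : carrier R" for r
 proof
  assume re: "r \<otimes> e = \<zero>"
  have rl: "r \<otimes> l (y b) = \<zero>" if "b < t" for b
  proof -
   have "r \<otimes> l (y b) = (r \<otimes> e) \<otimes> l (y b)" using el[OF that] by (simp add: R.m_assoc)
   then show ?thesis by (simp add: re)
  qed
  show "ALL x:carrier M. ALL i<q. r \<otimes> \<theta> i x = \<zero>"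
  proof (intro ballI allI impI)
   fix x i assume x: "x : carrier M" and i: "i < q"
   obtain w where w: "!!i. w i : carrier R" "x = lc M t w y" using gen[OF x] by blast
   have "r \<otimes> \<theta> i (y b) = \<zero>" if "b < t" for b
    using cann[OF r _ that i] rl unfolding l_def dot_def by blast
   then show "r \<otimes> \<theta> i x = \<zero>" unfolding w(2) using w(1) by (subst functional_lc[OF \<theta>]) (auto intro!: dot0)
  qed
 next
  assume h: "ALL x:carrier M. ALL i<q. r \<otimes> \<theta> i x = \<zero>"
  show "r \<otimes> e = \<zero>"
  proof (rule eann[OF r])
   fix b
   have "r \<otimes> l (y b) = r \<otimes> dot R q (%i. \<theta> i (y b)) c" unfolding l_def by (subst R.dot_comm) auto
   also have "... = dot R q (%i. r \<otimes> \<theta> i (y b)) c" by (subst R.dot_smult) auto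
   also have "... = dot R q (%_. \<zero>) c" using h by (intro R.dot_cong) auto
   finally show "r \<otimes> l (y b) = \<zero>" by (simp add: dot_def)
  qed
 qed
 define A where "A = Idl ((%b. l (y b)) ` {..<t})"
 have AR: "(%b. l (y b)) ` {..<t} <= carrier R" by auto
 interpret A: ideal A R unfolding A_def by (rule R.genideal_ideal[OF AR])
 have Afam: "A = {dot R t w (%b. l (y b)) | w. ALL i. w i : carrier R}"
  unfolding A_def dot_def by (rule R.genideal_family) auto
 have fg: "fg_ideal R A" unfolding fg_ideal_def A_def by (intro exI[of _ t] exI[of _ "%b. l (y b)"]) simp
 have lA: "l x : A" if x: "x : carrier M" for x
 proof -
  obtain w where w: "!!i. w i : carrier R" "x = lc M t w y" using gen[OF x] by blast
  have "l x = dot R t w (%b. l (y b))" unfolding w(2) using w(1) by (intro functional_lc[OF l]) auto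
  then show ?thesis unfolding Afam using w(1) by blast
 qed
 have eA: "e \<otimes> a = a" if a: "a : A" for a
 proof -
  obtain w where w: "!!i. w i : carrier R" "a = dot R t w (%b. l (y b))" using a unfolding Afam by auto
  have "(\<one> \<ominus> e) \<otimes> a = \<zero>"
  proof (unfold w(2), rule dot0)
   fix i assume "i < t"
   have "(\<one> \<ominus> e) \<otimes> x = x \<ominus> e \<otimes> x" if "x : carrier R" for x using that e by algebra
   then show "(\<one> \<ominus> e) \<otimes> l (y i) = \<zero>" using el[OF \<open>i < t\<close>] by (simp add: R.minus_eq R.r_neg)
  qed (use w in auto)
  moreover have "(\<one> \<ominus> e) \<otimes> a = a \<ominus> e \<otimes> a" using A.Icarr[OF a] e by algebra
  ultimately show ?thesis using A.Icarr[OF a] by simp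
 qed
 \<comment> \<open>A second combination, now of the generators of \<open>A\<close>, gives a single
   element of \<open>A\<close> with the annihilator of \<open>e\<close>.\<close>
 obtain v where v': "ALL i. v i : carrier R"
  and vann': "ALL r:carrier R. (ALL b:{()}. r \<otimes> (\<Oplus>i\<in>{..<t}. v i \<otimes> l (y i)) = \<zero>) --> (ALL b:{()}. ALL i<t. r \<otimes> l (y i) = \<zero>)"
  using sh.ex_combination[of "{()}" "%_ i. l (y i)" t, OF finite lc[OF yc]] by (elim exE conjE)
 have v [simp]: "v i : carrier R" for i using v' by blast
 have vann: "r \<otimes> l (y i) = \<zero>" if "r : carrier R" "r \<otimes> (\<Oplus>i\<in>{..<t}. v i \<otimes> l (y i)) = \<zero>" "i < t" for r i
  using bspec[OF vann' that(1)] that by simp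
 have dA: "EX d:A. ALL r:carrier R. r \<otimes> d = \<zero> --> r \<otimes> e = \<zero>"
 proof (intro bexI[of _ "dot R t v (%b. l (y b))"] ballI impI)
  show "dot R t v (%b. l (y b)) : A" unfolding Afam using v by blast
  fix r assume "r : carrier R" "r \<otimes> dot R t v (%b. l (y b)) = \<zero>"
  then show "r \<otimes> e = \<zero>" by (intro eann vann) (auto simp: dot_def)
 qed
 obtain h where hc: "!!i x. x : A ==> h i x : carrier R"
  and ha: "!!i x z. x : A ==> z : A ==> h i (x \<oplus> z) = h i x \<oplus> h i z"
  and hm: "!!i r x. r : carrier R ==> x : A ==> h i (r \<otimes> x) = r \<otimes> h i x"
  and hs: "!!x. x : A ==> x = (\<Oplus>i\<in>{..<t}. h i x \<otimes> l (y i))"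
  by (rule sh.dual_basis[of "{..<t}" "%b. l (y b)"]) (auto simp: A_def)
 \<comment> \<open>A section of \<open>l\<close>: the generators l (y i) in the dual basis expansion
   are replaced by their preimages y i.\<close>
 define \<tau> where "\<tau> a = lc M t (%i. h i a) y" for a
 have sc [simp]: "\<tau> a : carrier M" if "a : A" for a unfolding \<tau>_def using hc[OF that] by (intro lc_closed) auto
 have ls: "l (\<tau> a) = a" if "a : A" for a
  unfolding \<tau>_def using hc[OF that] hs[OF that] by (subst functional_lc[OF l]) (auto simp: dot_def)
 have sa: "\<tau> (a \<oplus> b) = \<tau> a \<oplus>\<^bsub>M\<^esub> \<tau> b" if "a : A" "b : A" for a b
  unfolding \<tau>_def using hc[OF that(1)] hc[OF that(2)] ha[OF that]
  by (simp add: lc_add)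
 have sm: "\<tau> (r \<otimes> a) = r \<odot>\<^bsub>M\<^esub> \<tau> a" if "r : carrier R" "a : A" for r a
  unfolding \<tau>_def using hc[OF that(2)] hm[OF that] that by (simp add: lc_smult)
 have s0: "\<tau> \<zero> = \<zero>\<^bsub>M\<^esub>" using sm[of \<zero> \<zero>] A.zero_closed by simp
 define \<pi> where "\<pi> x = x \<ominus>\<^bsub>M\<^esub> \<tau> (l x)" for x
 define H where "H = {x : carrier M. l x = \<zero>}"
 have HM: "submodule H R M"
  by (rule submoduleI)
   (auto simp: H_def functional_zero[OF l] functional_add[OF l] functional_smult[OF l] functional_minus[OF l])
 have "linear_proj R M H \<pi>"
  unfolding linear_proj_def
 proof (intro conjI HM ballI)
  show "\<pi> x : H" if "x : carrier M" for x
   using that lA[OF that] ls by (simp add: H_def \<pi>_def functional_minus[OF l] R.minus_eq R.r_neg)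
  show "\<pi> x = x" if "x : H" for x
   using that by (simp add: \<pi>_def H_def s0 M.minus_eq)
  show "\<pi> (x \<oplus>\<^bsub>M\<^esub> z) = \<pi> x \<oplus>\<^bsub>M\<^esub> \<pi> z" if x: "x : carrier M" "z : carrier M" for x z
  proof -
   have "(x \<oplus>\<^bsub>M\<^esub> z) \<ominus>\<^bsub>M\<^esub> (a \<oplus>\<^bsub>M\<^esub> b) = (x \<ominus>\<^bsub>M\<^esub> a) \<oplus>\<^bsub>M\<^esub> (z \<ominus>\<^bsub>M\<^esub> b)" if "a : carrier M" "b : carrier M" for a b
    using x that by (simp add: M.minus_eq M.minus_add M.a_ac)
   then show ?thesis using x lA by (simp add: \<pi>_def functional_add[OF l] sa)
  qed
  show "\<pi> (r \<odot>\<^bsub>M\<^esub> x) = r \<odot>\<^bsub>M\<^esub> \<pi> x" if "r : carrier R" "x : carrier M" for r x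
   using that lA by (simp add: \<pi>_def functional_smult[OF l] sm M.minus_eq smult_r_distr smult_r_minus)
 qed
 moreover have "EX x:carrier M. l x = b & \<pi> x = \<zero>\<^bsub>M\<^esub>" if "b : A" for b
  using that ls[OF that] by (intro bexI[of _ "\<tau> b"]) (auto simp: \<pi>_def M.minus_eq M.r_neg)
 moreover have "l x = \<zero>" if "x : carrier M" "ALL i<q. \<theta> i x = \<zero>" for x
 proof -
  have "l x = dot R q (%i. \<theta> i x) c" unfolding l_def using that by (intro R.dot_comm) auto
  also have "... = dot R q (%_. \<zero>) c" using that by (intro R.dot_cong) auto
  finally show ?thesis by (simp add: dot_def)
 qed
 ultimately show ?thesis
  using ee esupp fg eA dA l lA
  by (intro exI[of _ e] exI[of _ A] exI[of _ l] exI[of _ \<pi>] exI[of _ H]) (auto simp: H_def splitting_step_def)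
qed

lemma (in module) linear_proj_lc:
 assumes p: "linear_proj R M H \<pi>" and [simp]: "!!i. w i : carrier R" "!!i. y i : carrier M"
 shows "\<pi> (lc M t w y) = lc M t w (%i. \<pi> (y i))"
proof -
 have H: "submodule H R M" using p by (simp add: linear_proj_def)
 have pc: "\<pi> x : carrier M" if "x : carrier M" for x
  using p that submodule_closed[OF H] unfolding linear_proj_def by blast
 have pm: "\<pi> (r \<odot>\<^bsub>M\<^esub> x) = r \<odot>\<^bsub>M\<^esub> \<pi> x" if "r : carrier R" "x : carrier M" for r x
  using p that unfolding linear_proj_def by blast
 have p0: "\<pi> \<zero>\<^bsub>M\<^esub> = \<zero>\<^bsub>M\<^esub>" using pm[of \<zero> "\<zero>\<^bsub>M\<^esub>"] pc[of "\<zero>\<^bsub>M\<^esub>"] by simp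
 have "\<pi> (lc M t w y) = (\<Oplus>\<^bsub>M\<^esub>i\<in>{..<t}. \<pi> (w i \<odot>\<^bsub>M\<^esub> y i))"
  unfolding lc_def
  by (rule finsum_hom[OF M.abelian_monoid_axioms M.abelian_monoid_axioms])
   (use p pc p0 in \<open>auto simp: linear_proj_def\<close>)
 then show ?thesis unfolding lc_def using pc by (simp add: pm)
qed

lemma (in module) spans_proj:
 assumes p: "linear_proj R M H \<pi>" and y: "spans R M t y"
 shows "spans R (M\<lparr>carrier := H\<rparr>) t (%i. \<pi> (y i))"
proof -
 have H: "submodule H R M" using p by (simp add: linear_proj_def)
 have pH: "\<pi> (y i) : H" for i using p spans_closed[OF y] unfolding linear_proj_def by blast
 show ?thesis
  unfolding spans_def
 proof (intro conjI allI ballI)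
  fix x assume "x : carrier (M\<lparr>carrier := H\<rparr>)"
  then have x: "x : H" "x : carrier M" using submodule_closed[OF H] by auto
  then obtain w where w: "!!i. w i : carrier R" "x = lc M t w y" using y unfolding spans_def by blast
  have "x = \<pi> x" using p x unfolding linear_proj_def by simp
  also have "... = lc M t w (%i. \<pi> (y i))"
   unfolding w(2) using w(1) spans_closed[OF y] by (intro linear_proj_lc[OF p]) auto
  also have "... = lc (M\<lparr>carrier := H\<rparr>) t w (%i. \<pi> (y i))"
   using w(1) pH by (intro submodule_lc[OF H, symmetric]) auto
  finally show "EX w. (ALL i. w i : carrier R) & x = lc (M\<lparr>carrier := H\<rparr>) t w (%i. \<pi> (y i))" using w(1) by blast
 qed (use pH in simp)
qed

text \<open>The \<theta> i stay fixed while the module shrinks. The claim on f 0 makes the chain of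
  idempotents decrease when another step is put in front; the claim on f n says that f n still
  supports the \<theta> i on the remainder \<open>H\<close>; the last claim says that the \<theta> i
  separate the elements of the part split off.\<close>

lemma ex_splitting:
 fixes M :: "('a, 'b, 'm) module_scheme" and q :: nat
 assumes sh: "semihereditary_ring R"
 shows "module R M ==> spans R M t y ==> (!!i. functional R M (\<theta> i)) ==>
  EX f B \<beta> H \<pi>. splitting R M n f B \<beta> H \<pi> &
   (ALL r:carrier R. r \<otimes>\<^bsub>R\<^esub> f 0 = \<zero>\<^bsub>R\<^esub> \<longleftrightarrow> (ALL x:carrier M. ALL i<q. r \<otimes>\<^bsub>R\<^esub> \<theta> i x = \<zero>\<^bsub>R\<^esub>)) &
   (ALL x:H. ALL i<q. f n \<otimes>\<^bsub>R\<^esub> \<theta> i x = \<theta> i x) &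
   (ALL x:carrier M. \<pi> x = \<zero>\<^bsub>M\<^esub> --> (ALL i<q. \<theta> i x = \<zero>\<^bsub>R\<^esub>) --> x = \<zero>\<^bsub>M\<^esub>)"
proof (induction n arbitrary: M y)
 case 0
 interpret module R M by fact
 obtain e A l \<pi> H where step: "splitting_step R M \<theta> q e A l \<pi> H"
  using ex_splitting_step[where \<theta> = \<theta>, OF sh 0(2,3)] by blast
 then have e12: "e : carrier R" "e \<otimes>\<^bsub>R\<^esub> e = e"
  and e3: "ALL r:carrier R. (r \<otimes>\<^bsub>R\<^esub> e = \<zero>\<^bsub>R\<^esub>) = (ALL x:carrier M. ALL i<q. r \<otimes>\<^bsub>R\<^esub> \<theta> i x = \<zero>\<^bsub>R\<^esub>)"
  unfolding splitting_step_def by blast+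
 note e = e12 bspec[OF e3]
 have "e \<otimes>\<^bsub>R\<^esub> \<theta> i x = \<theta> i x" if x: "x : carrier M" and i: "i < q" for x i
 proof -
  have t: "\<theta> i x : carrier R" using functional_closed[OF 0(3) x] .
  have "(\<one>\<^bsub>R\<^esub> \<ominus>\<^bsub>R\<^esub> e) \<otimes>\<^bsub>R\<^esub> e = \<zero>\<^bsub>R\<^esub>"
   using e R.complement_mult_eq_zero_iff[of e e] by simp
  then have "(\<one>\<^bsub>R\<^esub> \<ominus>\<^bsub>R\<^esub> e) \<otimes>\<^bsub>R\<^esub> \<theta> i x = \<zero>\<^bsub>R\<^esub>"
   using e(3)[OF R.minus_closed[OF R.one_closed e(1)]] x i by blast
  then show ?thesis using R.complement_mult_eq_zero_iff[OF e(1) t] by simp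
 qed
 then show ?case
  using e carrier_is_submodule
  by (intro exI[of _ "%_. e"] exI[of _ "%_. {}"] exI[of _ "%_ _. \<zero>\<^bsub>R\<^esub>"] exI[of _ "carrier M"] exI[of _ "%x. x"])
   (auto simp: splitting_def linear_proj_def)
next
 case (Suc n)
 interpret module R M by fact
 obtain e A l \<tau> K where step: "splitting_step R M \<theta> q e A l \<tau> K"
  using ex_splitting_step[where \<theta> = \<theta>, OF sh Suc.prems(2,3)] by blast
 then have e: "e : carrier R" "e \<otimes>\<^bsub>R\<^esub> e = e"
  and eann': "ALL r:carrier R. (r \<otimes>\<^bsub>R\<^esub> e = \<zero>\<^bsub>R\<^esub>) = (ALL x:carrier M. ALL i<q. r \<otimes>\<^bsub>R\<^esub> \<theta> i x = \<zero>\<^bsub>R\<^esub>)"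
  and A: "fg_ideal R A" "ALL b:A. e \<otimes>\<^bsub>R\<^esub> b = b" "EX d:A. ALL r:carrier R. r \<otimes>\<^bsub>R\<^esub> d = \<zero>\<^bsub>R\<^esub> --> r \<otimes>\<^bsub>R\<^esub> e = \<zero>\<^bsub>R\<^esub>"
  and l: "functional R M l" and lA': "ALL x:carrier M. l x : A"
  and lsurj': "ALL b:A. EX x:carrier M. l x = b & \<tau> x = \<zero>\<^bsub>M\<^esub>"
  and lker': "ALL x:carrier M. (ALL i<q. \<theta> i x = \<zero>\<^bsub>R\<^esub>) --> l x = \<zero>\<^bsub>R\<^esub>"
  and \<tau>: "linear_proj R M K \<tau>" and K: "K = {x : carrier M. l x = \<zero>\<^bsub>R\<^esub>}"
  unfolding splitting_step_def by blast+
 note eann = bspec[OF eann'] and lA = bspec[OF lA'] and lsurj = bspec[OF lsurj'] and lker = bspec[OF lker', rule_format]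
 have KM: "submodule K R M" using \<tau> by (simp add: linear_proj_def)
 note Kc = submodule_closed[OF KM]
 have \<tau>K: "\<tau> x : K" if "x : carrier M" for x using \<tau> that by (simp add: linear_proj_def)
 have \<tau>id: "\<tau> x = x" if "x : K" for x using \<tau> that by (simp add: linear_proj_def)
 let ?N = "M\<lparr>carrier := K\<rparr>"
 interpret N: module R ?N by (rule submodule.submodule_is_module[OF KM module_axioms])
 obtain f B \<beta> H \<pi> where IH: "splitting R ?N n f B \<beta> H \<pi> &
   (ALL r:carrier R. r \<otimes>\<^bsub>R\<^esub> f 0 = \<zero>\<^bsub>R\<^esub> \<longleftrightarrow> (ALL x:carrier ?N. ALL i<q. r \<otimes>\<^bsub>R\<^esub> \<theta> i x = \<zero>\<^bsub>R\<^esub>)) &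
   (ALL x:H. ALL i<q. f n \<otimes>\<^bsub>R\<^esub> \<theta> i x = \<theta> i x) &
   (ALL x:carrier ?N. \<pi> x = \<zero>\<^bsub>?N\<^esub> --> (ALL i<q. \<theta> i x = \<zero>\<^bsub>R\<^esub>) --> x = \<zero>\<^bsub>?N\<^esub>)"
  using Suc.IH[OF N.module_axioms spans_proj[OF \<tau> Suc.prems(2)] functional_submodule[OF KM Suc.prems(3)]]
  by blast
 note sp = conjunct1[OF IH] and f0' = conjunct1[OF conjunct2[OF IH]]
  and fn' = conjunct1[OF conjunct2[OF conjunct2[OF IH]]] and ker' = conjunct2[OF conjunct2[OF conjunct2[OF IH]]]
 have f0: "(r \<otimes>\<^bsub>R\<^esub> f 0 = \<zero>\<^bsub>R\<^esub>) = (ALL x:K. ALL i<q. r \<otimes>\<^bsub>R\<^esub> \<theta> i x = \<zero>\<^bsub>R\<^esub>)" if "r : carrier R" for r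
  using f0' that by simp
 have fn: "f n \<otimes>\<^bsub>R\<^esub> \<theta> i x = \<theta> i x" if "x : H" "i < q" for x i using fn' that by simp
 have ker: "x = \<zero>\<^bsub>M\<^esub>" if "x : K" "\<pi> x = \<zero>\<^bsub>M\<^esub>" "ALL i<q. \<theta> i x = \<zero>\<^bsub>R\<^esub>" for x
  using ker' that by simp
 have fc: "f k : carrier R" "f k \<otimes>\<^bsub>R\<^esub> f k = f k" for k using sp by (simp_all add: splitting_def)
 have \<pi>: "linear_proj R ?N H \<pi>" using sp by (simp add: splitting_def)
 have HK: "H <= K" using \<pi> N.submoduleE(1) unfolding linear_proj_def by fastforce
 have "f 0 \<otimes>\<^bsub>R\<^esub> e = f 0"
 proof -
  have c: "\<one>\<^bsub>R\<^esub> \<ominus>\<^bsub>R\<^esub> e : carrier R" using e(1) by simp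
  \<comment> \<open>On \<open>M\<close>, 1 - e kills all the \<theta> i; it does so on the submodule
    \<open>K\<close> too, where f 0 is their support.\<close>
  have "(\<one>\<^bsub>R\<^esub> \<ominus>\<^bsub>R\<^esub> e) \<otimes>\<^bsub>R\<^esub> e = \<zero>\<^bsub>R\<^esub>"
   using e R.complement_mult_eq_zero_iff[of e e] by simp
  then have "(\<one>\<^bsub>R\<^esub> \<ominus>\<^bsub>R\<^esub> e) \<otimes>\<^bsub>R\<^esub> f 0 = \<zero>\<^bsub>R\<^esub>"
   using eann[OF c] f0[OF c] Kc by blast
  then have "e \<otimes>\<^bsub>R\<^esub> f 0 = f 0" using R.complement_mult_eq_zero_iff[OF e(1) fc(1)[of 0]] by simp
  then show ?thesis using R.m_comm[OF e(1) fc(1)[of 0]] by simp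
 qed
 let ?f = "case_nat e f" and ?B = "case_nat A B" and ?\<beta> = "case_nat l (%k x. \<beta> k (\<tau> x))" and ?\<pi> = "%x. \<pi> (\<tau> x)"
 have lp: "linear_proj R M H ?\<pi>" by (rule linear_proj_comp[OF \<tau> \<pi>])
 have \<pi>c: "\<pi> x : H" "\<pi> (\<tau> x') : H" if "x : K" "x' : carrier M" for x x'
  using \<pi> that \<tau>K unfolding linear_proj_def by simp_all
 have zK: "\<zero>\<^bsub>M\<^esub> : K" using N.M.zero_closed by simp
 have p0: "\<pi> \<zero>\<^bsub>M\<^esub> = \<zero>\<^bsub>M\<^esub>"
 proof -
  have "ALL r:carrier R. ALL x:K. \<pi> (r \<odot>\<^bsub>M\<^esub> x) = r \<odot>\<^bsub>M\<^esub> \<pi> x" using \<pi> unfolding linear_proj_def by simp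
  then have "\<pi> (\<zero>\<^bsub>R\<^esub> \<odot>\<^bsub>M\<^esub> \<zero>\<^bsub>M\<^esub>) = \<zero>\<^bsub>R\<^esub> \<odot>\<^bsub>M\<^esub> \<pi> \<zero>\<^bsub>M\<^esub>" using zK R.zero_closed by blast
  moreover have "\<pi> \<zero>\<^bsub>M\<^esub> : carrier M" using \<pi>c(1)[OF zK M.zero_closed] HK Kc by blast
  ultimately show ?thesis by simp
 qed
 have \<beta>: "functional R ?N (\<beta> k)" "x : K ==> \<beta> k x : B k" "x : H ==> \<beta> k x = \<zero>\<^bsub>R\<^esub>" if "k < n" for k x
  using sp that unfolding splitting_def by simp_all
 have \<beta>0: "\<beta> k \<zero>\<^bsub>M\<^esub> = \<zero>\<^bsub>R\<^esub>" if "k < n" for k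
  using N.functional_zero[OF \<beta>(1)[OF that]] by simp
 have inj: "x = \<zero>\<^bsub>M\<^esub>" if "x : K" "\<pi> x = \<zero>\<^bsub>M\<^esub>" "ALL k<n. \<beta> k x = \<zero>\<^bsub>R\<^esub>" for x
  using sp that unfolding splitting_def by simp
 have surj: "EX x:K. \<pi> x = \<zero>\<^bsub>M\<^esub> & (ALL k<n. \<beta> k x = b k)" if "ALL k<n. b k : B k" for b
  using sp that unfolding splitting_def by simp
 have split_lt: "(ALL k<Suc n. P k) \<longleftrightarrow> P 0 & (ALL k<n. P (Suc k))" for P
  by (auto simp: less_Suc_eq_0_disj)
 have "splitting R M (Suc n) ?f ?B ?\<beta> H ?\<pi>"
  unfolding splitting_def split_lt nat.case
 proof (intro conjI allI ballI impI)
  show "?f k : carrier R" "?f k \<otimes>\<^bsub>R\<^esub> ?f k = ?f k" for k using e fc by (auto split: nat.split)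
  show "f 0 \<otimes>\<^bsub>R\<^esub> e = f 0" by fact
  show "f (Suc k) \<otimes>\<^bsub>R\<^esub> f k = f (Suc k)" if "k < n" for k using sp that by (simp add: splitting_def)
  show "e \<otimes>\<^bsub>R\<^esub> b = b" if "b : A" for b using A that by blast
  show "fg_ideal R A" by (rule A)
  show "EX d:A. ALL r:carrier R. r \<otimes>\<^bsub>R\<^esub> d = \<zero>\<^bsub>R\<^esub> --> r \<otimes>\<^bsub>R\<^esub> e = \<zero>\<^bsub>R\<^esub>" by (rule A)
  show "fg_ideal R (B k)" "EX d:B k. ALL r:carrier R. r \<otimes>\<^bsub>R\<^esub> d = \<zero>\<^bsub>R\<^esub> --> r \<otimes>\<^bsub>R\<^esub> f k = \<zero>\<^bsub>R\<^esub>" if "k < n" for k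
   using sp that unfolding splitting_def by simp_all
  show "f k \<otimes>\<^bsub>R\<^esub> b = b" if "k < n" "b : B k" for k b
   using sp that unfolding splitting_def by simp
  show "linear_proj R M H ?\<pi>" by (rule lp)
  show "functional R M l" by (rule l)
  show "functional R M (%x. \<beta> k (\<tau> x))" if "k < n" for k
   using \<beta>(1)[OF that] \<tau> \<tau>K unfolding functional_def linear_proj_def by simp
  show "l x : A" if "x : carrier M" for x by (rule lA[OF that])
  show "\<beta> k (\<tau> x) : B k" if "k < n" "x : carrier M" for k x using \<beta>(2)[OF that(1)] \<tau>K[OF that(2)] by blast
  show "l x = \<zero>\<^bsub>R\<^esub>" if "x : H" for x using that HK K by blast
  show "\<beta> k (\<tau> x) = \<zero>\<^bsub>R\<^esub>" if "k < n" "x : H" for k x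
  proof -
   have "\<tau> x = x" using that HK \<tau>id by blast
   then show ?thesis using \<beta>(3)[OF that] by simp
  qed
  show "x = \<zero>\<^bsub>M\<^esub>" if x: "x : carrier M" "\<pi> (\<tau> x) = \<zero>\<^bsub>M\<^esub>" "l x = \<zero>\<^bsub>R\<^esub> & (ALL k<n. \<beta> k (\<tau> x) = \<zero>\<^bsub>R\<^esub>)" for x
  proof -
   have "x : K" using x K by blast
   then show ?thesis using inj[of x] \<tau>id[of x] x by simp
  qed
  show "EX x:carrier M. \<pi> (\<tau> x) = \<zero>\<^bsub>M\<^esub> & l x = b 0 & (ALL k<n. \<beta> k (\<tau> x) = b (Suc k))"
   if b: "b 0 : A & (ALL k<n. b (Suc k) : B k)" for b
  proof -
   obtain x0 where x0: "x0 : carrier M" "l x0 = b 0" "\<tau> x0 = \<zero>\<^bsub>M\<^esub>" using lsurj b by blast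
   obtain x1 where x1: "x1 : K" "\<pi> x1 = \<zero>\<^bsub>M\<^esub>" "ALL k<n. \<beta> k x1 = b (Suc k)" using surj[of "%k. b (Suc k)"] b by blast
   have c: "x1 : carrier M" "l x1 = \<zero>\<^bsub>R\<^esub>" using x1 K by auto
   have lc0: "b 0 : carrier R" using functional_closed[OF l x0(1)] x0(2) by simp
   have "\<tau> (x0 \<oplus>\<^bsub>M\<^esub> x1) = \<tau> x0 \<oplus>\<^bsub>M\<^esub> \<tau> x1" using \<tau> x0 c unfolding linear_proj_def by blast
   then have "\<tau> (x0 \<oplus>\<^bsub>M\<^esub> x1) = x1" using x0 \<tau>id[OF x1(1)] c by simp
   moreover have "l (x0 \<oplus>\<^bsub>M\<^esub> x1) = b 0" using functional_add[OF l x0(1) c(1)] x0 c lc0 by simp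
   ultimately show ?thesis using x0 x1 c by (intro bexI[of _ "x0 \<oplus>\<^bsub>M\<^esub> x1"]) auto
  qed
 qed
 moreover have "x = \<zero>\<^bsub>M\<^esub>" if x: "x : carrier M" "\<pi> (\<tau> x) = \<zero>\<^bsub>M\<^esub>" "ALL i<q. \<theta> i x = \<zero>\<^bsub>R\<^esub>" for x
 proof -
  have "x : K" using x lker K by blast
  then show ?thesis using ker[of x] \<tau>id[of x] x by simp
 qed
 ultimately show ?case
  using eann' fn' by (intro exI[of _ ?f] exI[of _ ?B] exI[of _ ?\<beta>] exI[of _ H] exI[of _ ?\<pi>]) simp
qed

section \<open>Finitely generated relations\<close>

definition fg_relations :: "('a, 'r) ring_scheme => ('a, 'b, 'm) module_scheme => nat => (nat => 'b) => bool" where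
 "fg_relations R M t y \<longleftrightarrow> (EX N g. (ALL b a. g b a : carrier R) & (ALL b<N. lc M t (g b) y = \<zero>\<^bsub>M\<^esub>) &
  (ALL w. (ALL a. w a : carrier R) --> lc M t w y = \<zero>\<^bsub>M\<^esub> -->
   (EX c. (ALL b. c b : carrier R) & (ALL a<t. w a = dot R N c (%b. g b a)))))"

lemma (in cring) dot_append:
 assumes [simp]: "!!i. c i : carrier R" "!!i. g i : carrier R"
 shows "dot R (N + K) c g = dot R N c g \<oplus> dot R K (%i. c (N + i)) (%i. g (N + i))"
proof (induction K)
 case 0
 then show ?case by (simp add: dot_def)
next
 case (Suc K)
 have "dot R (N + Suc K) c g = dot R (N + K) c g \<oplus> c (N + K) \<otimes> g (N + K)"
  unfolding dot_def add_Suc_right by (rule finsum_lessThan_Suc) simp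
 moreover have "dot R (Suc K) (%i. c (N + i)) (%i. g (N + i)) =
   dot R K (%i. c (N + i)) (%i. g (N + i)) \<oplus> c (N + K) \<otimes> g (N + K)"
  unfolding dot_def by (rule finsum_lessThan_Suc) simp
 ultimately show ?case using Suc by (simp add: a_assoc)
qed

text \<open>Write y' = P y and y = Q y'. The relations of y' are generated by the rows g b Q
  together with the rows of 1 - P Q: a relation w of y' equals (w P) Q + w (1 - P Q), and w P is a
  relation of y.\<close>

lemma (in module) fg_relations_change:
 assumes y: "spans R M t y" and y': "spans R M t' y'" and rel: "fg_relations R M t y"
 shows "fg_relations R M t' y'"
proof -
 note [simp] = spans_closed[OF y] spans_closed[OF y']
 obtain N g where g [simp]: "!!b a. g b a : carrier R" and g0: "!!b. b < N ==> lc M t (g b) y = \<zero>\<^bsub>M\<^esub>"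
  and gr: "!!w. (!!a. w a : carrier R) ==> lc M t w y = \<zero>\<^bsub>M\<^esub> ==>
   EX c. (ALL b. c b : carrier R) & (ALL a<t. w a = dot R N c (%b. g b a))"
  using rel unfolding fg_relations_def by blast
 have "ALL j. EX w. (ALL i. w i : carrier R) & y' j = lc M t w y" using y unfolding spans_def by simp
 then obtain P where P': "ALL j. (ALL i. P j i : carrier R) & y' j = lc M t (P j) y" by metis
 then have P [simp]: "P j i : carrier R" and yP: "y' j = lc M t (P j) y" for j i by blast+
 have "ALL j. EX w. (ALL i. w i : carrier R) & y j = lc M t' w y'" using y' unfolding spans_def by simp
 then obtain Q where Q': "ALL j. (ALL i. Q j i : carrier R) & y j = lc M t' (Q j) y'" by metis
 then have Q [simp]: "Q j i : carrier R" and yQ: "y j = lc M t' (Q j) y'" for j i by blast+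
 define g' where "g' b j = (if b < N then dot R t (g b) (%a. Q a j)
   else (if j = b - N then \<one> else \<zero>) \<ominus> dot R t (P (b - N)) (%a. Q a j))" for b j
 have g' [simp]: "g' b j : carrier R" for b j by (simp add: g'_def)
 have lcQ: "lc M t' (%j. dot R t x (%a. Q a j)) y' = lc M t x y" if "!!a. x a : carrier R" for x
 proof -
  have "lc M t x y = lc M t x (%a. lc M t' (Q a) y')" using that by (intro lc_cong2) (auto simp: yQ[symmetric])
  then show ?thesis using that by (simp add: lc_lc)
 qed
 have "lc M t' (g' b) y' = \<zero>\<^bsub>M\<^esub>" if b: "b < N + t'" for b
 proof (cases "b < N")
  case True
  then have "g' b = (%j. dot R t (g b) (%a. Q a j))" by (auto simp: g'_def)
  then show ?thesis using lcQ[of "g b"] g0[OF True] by simp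
 next
  case False
  let ?k = "b - N"
  have "g' b = (%j. (if j = ?k then \<one> else \<zero>) \<ominus> dot R t (P ?k) (%a. Q a j))" using False by (auto simp: g'_def)
  then have "lc M t' (g' b) y' = lc M t' (%j. if j = ?k then \<one> else \<zero>) y' \<ominus>\<^bsub>M\<^esub> lc M t' (%j. dot R t (P ?k) (%a. Q a j)) y'"
   by (simp only:) (rule lc_minus, auto)
  also have "... = y' ?k \<ominus>\<^bsub>M\<^esub> y' ?k"
   using b False by (subst lc_delta) (auto simp: lcQ yP[symmetric])
  finally show ?thesis by (simp add: M.minus_eq M.r_neg)
 qed
 moreover have "EX c. (ALL b. c b : carrier R) & (ALL j<t'. w j = dot R (N + t') c (%b. g' b j))"
  if w [simp]: "!!a. w a : carrier R" and z: "lc M t' w y' = \<zero>\<^bsub>M\<^esub>" for w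
 proof -
  define wP where "wP a = dot R t' w (%j. P j a)" for a
  have [simp]: "wP a : carrier R" for a by (simp add: wP_def)
  have "lc M t' w y' = lc M t' w (%j. lc M t (P j) y)" by (intro lc_cong2) (auto simp: yP[symmetric])
  also have "... = lc M t wP y" unfolding wP_def by (rule lc_lc) auto
  finally have "lc M t wP y = \<zero>\<^bsub>M\<^esub>" using z by simp
  then obtain c where c [simp]: "!!b. c b : carrier R" and e: "!!a. a < t ==> wP a = dot R N c (%b. g b a)"
   using gr[of wP] by auto
  define c' where "c' b = (if b < N then c b else w (b - N))" for b
  have [simp]: "c' b : carrier R" for b by (simp add: c'_def)
  have "w j = dot R (N + t') c' (%b. g' b j)" if j: "j < t'" for j
  proof -
   have "dot R (N + t') c' (%b. g' b j) =
     dot R N c' (%b. g' b j) \<oplus> dot R t' (%i. c' (N + i)) (%i. g' (N + i) j)"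
    by (rule R.dot_append) auto
   also have "dot R N c' (%b. g' b j) = dot R N c (%b. dot R t (g b) (%a. Q a j))"
    unfolding dot_def[of R N] by (intro R.finsum_cong') (auto simp: c'_def g'_def)
   also have "... = dot R t (%a. dot R N c (%b. g b a)) (%a. Q a j)" by (rule R.dot_sum[symmetric]) auto
   also have "... = dot R t wP (%a. Q a j)" by (intro R.dot_cong) (auto simp: e)
   also have "dot R t' (%i. c' (N + i)) (%i. g' (N + i) j) =
     dot R t' w (%k. \<one> \<otimes> (if k = j then \<one> else \<zero>) \<ominus> \<one> \<otimes> dot R t (P k) (%a. Q a j))"
    unfolding dot_def[of R t'] by (intro R.finsum_cong') (auto simp: c'_def g'_def)
   also have "... = \<one> \<otimes> dot R t' w (%k. if k = j then \<one> else \<zero>) \<ominus> \<one> \<otimes> dot R t' w (%k. dot R t (P k) (%a. Q a j))"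
    by (rule R.dot_lin_right) auto
   also have "dot R t' w (%k. if k = j then \<one> else \<zero>) = w j"
    unfolding dot_def using j by (intro R.sum_delta_left(2)) auto
   also have "dot R t' w (%k. dot R t (P k) (%a. Q a j)) = dot R t wP (%a. Q a j)"
    unfolding wP_def by (rule R.dot_sum[symmetric]) auto
   also have "dot R t wP (%a. Q a j) \<oplus> (\<one> \<otimes> w j \<ominus> \<one> \<otimes> dot R t wP (%a. Q a j)) = w j"
   proof -
    have "x \<oplus> (\<one> \<otimes> z \<ominus> \<one> \<otimes> x) = z" if "x : carrier R" "z : carrier R" for x z
     using that by algebra
    then show ?thesis by simp
   qed
   finally show ?thesis ..
  qed
  then show ?thesis by (intro exI[of _ c']) auto
 qed
 ultimately show ?thesis
  unfolding fg_relations_def by (intro exI[of _ "N + t'"] exI[of _ g']) auto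
qed

lemma (in module) linear_projD:
 assumes "linear_proj R M H \<pi>"
 shows "submodule H R M" "x : carrier M ==> \<pi> x : H" "x : carrier M ==> \<pi> x : carrier M" "x : H ==> \<pi> x = x"
  "x : carrier M ==> z : carrier M ==> \<pi> (x \<oplus>\<^bsub>M\<^esub> z) = \<pi> x \<oplus>\<^bsub>M\<^esub> \<pi> z"
  "r : carrier R ==> x : carrier M ==> \<pi> (r \<odot>\<^bsub>M\<^esub> x) = r \<odot>\<^bsub>M\<^esub> \<pi> x"
  "\<pi> \<zero>\<^bsub>M\<^esub> = \<zero>\<^bsub>M\<^esub>"
  "x : carrier M ==> z : carrier M ==> \<pi> (x \<ominus>\<^bsub>M\<^esub> z) = \<pi> x \<ominus>\<^bsub>M\<^esub> \<pi> z"
proof -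
 show H: "submodule H R M" using assms unfolding linear_proj_def by blast
 show pH: "\<pi> x : H" if "x : carrier M" for x using assms that unfolding linear_proj_def by blast
 show pc: "\<pi> x : carrier M" if "x : carrier M" for x using pH[OF that] submodule_closed[OF H] by blast
 show "x : H ==> \<pi> x = x" using assms unfolding linear_proj_def by blast
 show pa: "x : carrier M ==> z : carrier M ==> \<pi> (x \<oplus>\<^bsub>M\<^esub> z) = \<pi> x \<oplus>\<^bsub>M\<^esub> \<pi> z" for x z
  using assms unfolding linear_proj_def by blast
 show pm: "r : carrier R ==> x : carrier M ==> \<pi> (r \<odot>\<^bsub>M\<^esub> x) = r \<odot>\<^bsub>M\<^esub> \<pi> x" for r x
  using assms unfolding linear_proj_def by blast
 show "\<pi> \<zero>\<^bsub>M\<^esub> = \<zero>\<^bsub>M\<^esub>" using pm[of \<zero> "\<zero>\<^bsub>M\<^esub>"] pc[of "\<zero>\<^bsub>M\<^esub>"] by simp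
 have neg: "\<pi> (\<ominus>\<^bsub>M\<^esub> z) = \<ominus>\<^bsub>M\<^esub> \<pi> z" if "z : carrier M" for z
  using pm[of "\<ominus> \<one>" z] that pc[OF that] by (simp add: smult_l_minus)
 show "x : carrier M ==> z : carrier M ==> \<pi> (x \<ominus>\<^bsub>M\<^esub> z) = \<pi> x \<ominus>\<^bsub>M\<^esub> \<pi> z"
  unfolding M.minus_eq by (simp add: pa neg)
qed

text \<open>The kernel of \<pi> is generated by the elements y j - \<pi> (y j). Expressing them in
  the generators as E j y and adding the rows E j suffices: if w is a relation of the images, then w
  and w E give the same element of \<open>M\<close>, so w - w E is a relation of y.\<close>

lemma (in module) fg_relations_proj:
 assumes p: "linear_proj R M H \<pi>" and y: "spans R M t y" and rel: "fg_relations R M t y"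
 shows "fg_relations R (M\<lparr>carrier := H\<rparr>) t (%i. \<pi> (y i))"
proof -
 note [simp] = spans_closed[OF y] linear_projD(3)[OF p]
 note H = linear_projD(1)[OF p]
 obtain N g where g [simp]: "!!b a. g b a : carrier R" and g0: "!!b. b < N ==> lc M t (g b) y = \<zero>\<^bsub>M\<^esub>"
  and gr: "!!w. (!!a. w a : carrier R) ==> lc M t w y = \<zero>\<^bsub>M\<^esub> ==>
   EX c. (ALL b. c b : carrier R) & (ALL a<t. w a = dot R N c (%b. g b a))"
  using rel unfolding fg_relations_def by blast
 have "ALL j. EX w. (ALL i. w i : carrier R) & y j \<ominus>\<^bsub>M\<^esub> \<pi> (y j) = lc M t w y" using y unfolding spans_def by simp
 then obtain E where E': "ALL j. (ALL i. E j i : carrier R) & y j \<ominus>\<^bsub>M\<^esub> \<pi> (y j) = lc M t (E j) y" by metis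
 then have E [simp]: "E j i : carrier R" and yE: "y j \<ominus>\<^bsub>M\<^esub> \<pi> (y j) = lc M t (E j) y" for j i by blast+
 have lp: "lc (M\<lparr>carrier := H\<rparr>) t w (%i. \<pi> (y i)) = \<pi> (lc M t w y)" if "!!a. w a : carrier R" for w
  using that by (subst linear_proj_lc[OF p]) (auto intro!: submodule_lc[OF H] linear_projD(2)[OF p])
 define g' where "g' b = (if b < N then g b else E (b - N))" for b
 have g' [simp]: "g' b a : carrier R" for b a by (simp add: g'_def)
 have "lc (M\<lparr>carrier := H\<rparr>) t (g' b) (%i. \<pi> (y i)) = \<zero>\<^bsub>M\<^esub>" for b
 proof (cases "b < N")
  case True
  then show ?thesis using g0[OF True] linear_projD(7)[OF p] by (simp add: lp g'_def)
 next
  case False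
  let ?k = "b - N"
  have "\<pi> (\<pi> (y ?k)) = \<pi> (y ?k)" by (rule linear_projD(4)[OF p linear_projD(2)[OF p]]) simp
  moreover have "\<pi> (y ?k \<ominus>\<^bsub>M\<^esub> \<pi> (y ?k)) = \<pi> (y ?k) \<ominus>\<^bsub>M\<^esub> \<pi> (\<pi> (y ?k))" by (rule linear_projD(8)[OF p]) auto
  ultimately have "\<pi> (y ?k \<ominus>\<^bsub>M\<^esub> \<pi> (y ?k)) = \<zero>\<^bsub>M\<^esub>" by (simp add: M.minus_eq M.r_neg)
  then show ?thesis using False by (simp add: lp g'_def yE)
 qed
 moreover have "EX c. (ALL b. c b : carrier R) & (ALL a<t. w a = dot R (N + t) c (%b. g' b a))"
  if w [simp]: "!!a. w a : carrier R" and z: "lc (M\<lparr>carrier := H\<rparr>) t w (%i. \<pi> (y i)) = \<zero>\<^bsub>M\<^esub>" for w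
 proof -
  define wE where "wE a = dot R t w (%j. E j a)" for a
  have [simp]: "wE a : carrier R" for a by (simp add: wE_def)
  have "lc M t wE y = lc M t w (%j. lc M t (E j) y)" unfolding wE_def by (rule lc_lc[symmetric]) auto
  also have "... = lc M t w (%j. y j \<ominus>\<^bsub>M\<^esub> \<pi> (y j))" by (simp add: yE)
  also have "... = lc M t w y"
  proof -
   have "lc M t w y = lc M t w (%j. (y j \<ominus>\<^bsub>M\<^esub> \<pi> (y j)) \<oplus>\<^bsub>M\<^esub> \<pi> (y j))"
    by (intro lc_cong2) (auto simp: M.minus_eq M.a_assoc M.l_neg)
   also have "... = lc M t w (%j. y j \<ominus>\<^bsub>M\<^esub> \<pi> (y j)) \<oplus>\<^bsub>M\<^esub> lc M t w (%j. \<pi> (y j))"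
    unfolding lc_def by (subst M.finsum_addf[symmetric]) (auto simp: smult_r_distr intro!: M.finsum_cong')
   also have "lc M t w (%j. \<pi> (y j)) = \<zero>\<^bsub>M\<^esub>"
    using z linear_projD(2)[OF p] by (subst submodule_lc[OF H, symmetric]) auto
   finally show ?thesis by simp
  qed
  finally have e: "lc M t wE y = lc M t w y" .
  have "lc M t (%a. w a \<ominus> wE a) y = \<zero>\<^bsub>M\<^esub>"
   by (subst lc_minus) (auto simp: e M.minus_eq M.r_neg)
  then obtain c where c [simp]: "!!b. c b : carrier R" and ce: "!!a. a < t ==> w a \<ominus> wE a = dot R N c (%b. g b a)"
   using gr[of "%a. w a \<ominus> wE a"] by auto
  define c' where "c' b = (if b < N then c b else w (b - N))" for b
  have [simp]: "c' b : carrier R" for b by (simp add: c'_def)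
  have "w a = dot R (N + t) c' (%b. g' b a)" if a: "a < t" for a
  proof -
   have "dot R (N + t) c' (%b. g' b a) =
     dot R N c' (%b. g' b a) \<oplus> dot R t (%i. c' (N + i)) (%i. g' (N + i) a)"
    by (rule R.dot_append) auto
   also have "dot R N c' (%b. g' b a) = dot R N c (%b. g b a)"
    unfolding dot_def[of R N] by (intro R.finsum_cong') (auto simp: c'_def g'_def)
   also have "dot R t (%i. c' (N + i)) (%i. g' (N + i) a) = wE a"
    unfolding wE_def by (simp add: c'_def g'_def)
   also have "dot R N c (%b. g b a) \<oplus> wE a = w a"
   proof -
    have "(x \<ominus> z) \<oplus> z = x" if "x : carrier R" "z : carrier R" for x z
     using that by algebra
    then show ?thesis unfolding ce[OF a, symmetric] by simp
   qed
   finally show ?thesis ..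
  qed
  then show ?thesis by (intro exI[of _ c']) auto
 qed
 ultimately show ?thesis
  unfolding fg_relations_def by (intro exI[of _ "N + t"] exI[of _ g']) auto
qed

section \<open>Torsion modules\<close>

text \<open>\<open>C\<close> is generated by the entries of all relations, which makes it a Fitting
  ideal of \<open>M\<close>. If an element c = u z, with z a combination of relations, generated
  \<open>C\<close>, then z divided by c would be a vector on which u takes the value one, and
  \<open>C\<close> would annihilate the element with these coefficients, because c does. Locally a
  single entry of a relation generates \<open>C\<close>; the local-global property provides u and z
  for which all this holds up to a unit modulo \<open>s\<close>.\<close>

lemma (in module) ex_cyclic_summand:
 assumes sh: "semihereditary_ring R" and alg: "almost_local_global R" and s: "s : regular_elements R"
  and y: "spans R M (Suc t) y" and rel: "fg_relations R M (Suc t) y"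
  and sM': "ALL z:carrier M. s \<odot>\<^bsub>M\<^esub> z = \<zero>\<^bsub>M\<^esub>"
  and I: "ideal I R" and relI: "ALL w. (ALL a. w a : carrier R) --> lc M (Suc t) w y = \<zero>\<^bsub>M\<^esub> --> (ALL a<Suc t. w a : I)"
 shows "EX C u z q. ideal C R & fg_ideal R C & s : C & C <= I & (ALL a. u a : carrier R) & (ALL a. z a : carrier R) &
  q : carrier R & dot R (Suc t) u z = \<one> \<oplus> s \<otimes> q &
  (ALL w. (ALL a. w a : carrier R) --> lc M (Suc t) w y = \<zero>\<^bsub>M\<^esub> --> (ALL a<Suc t. w a : C)) &
  (ALL r:C. r \<odot>\<^bsub>M\<^esub> lc M (Suc t) z y = \<zero>\<^bsub>M\<^esub>)"
proof -
 interpret sh: semihereditary_ring R by fact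
 let ?t = "Suc t"
 note yc [simp] = spans_closed[OF y] and sM = bspec[OF sM']
 note sR [simp] = R.regularD(1)[OF s]
 obtain N g where g [simp]: "!!b a. g b a : carrier R" and g0: "!!b. b < N ==> lc M ?t (g b) y = \<zero>\<^bsub>M\<^esub>"
  and gr: "!!w. (!!a. w a : carrier R) ==> lc M ?t w y = \<zero>\<^bsub>M\<^esub> ==>
   EX c. (ALL b. c b : carrier R) & (ALL a<?t. w a = dot R N c (%b. g b a))"
  using rel unfolding fg_relations_def by blast
 define A where "A = {..<?t} \<times> {..<N}"
 define G where "G k = g (snd k) (fst k)" for k :: "nat \<times> nat"
 have A: "finite A" by (simp add: A_def)
 have G [simp]: "G k : carrier R" for k by (simp add: G_def)
 define C where "C = Idl (G ` A)"
 have GA: "G ` A <= carrier R" by auto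
 have GC: "k : A ==> G k : C" for k unfolding C_def using R.genideal_self[OF GA] by blast
 have idC: "ideal C R" unfolding C_def by (rule R.genideal_ideal[OF GA])
 interpret C: ideal C R by (rule idC)
 have CI: "C <= I"
  unfolding C_def
 proof (rule R.genideal_minimal[OF I], clarify)
  fix a b assume "(a, b) : A"
  then show "G (a, b) : I" using relI[rule_format, of "g b" a] g0[of b] by (simp add: A_def G_def)
 qed
 have relC: "w a : C" if w: "!!a. w a : carrier R" "lc M ?t w y = \<zero>\<^bsub>M\<^esub>" and a: "a < ?t" for w a
 proof -
  obtain c where c: "!!b. c b : carrier R" and e: "w a = dot R N c (%b. g b a)" using gr[OF w] a by blast
  show ?thesis unfolding e dot_def
   using c GC[of "(a, _)"] a by (intro C.finsum_in_ideal C.I_l_closed) (auto simp: A_def G_def)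
 qed
 \<comment> \<open>Since s y 0 = 0, the element \<open>s\<close> is itself an entry of a
   relation.\<close>
 have sC: "s : C"
 proof -
  have "lc M ?t (%j. s \<otimes> (if j = 0 then \<one> else \<zero>)) y = s \<odot>\<^bsub>M\<^esub> y 0"
   using lc_smult[of s "%j. if j = 0 then \<one> else \<zero>" y ?t] lc_delta[of 0 ?t y] by simp
  then have "s \<otimes> (if 0 = (0::nat) then \<one> else \<zero>) : C"
   by (intro relC[of "%j. s \<otimes> (if j = 0 then \<one> else \<zero>)" 0]) (auto simp: sM)
  then show ?thesis by simp
 qed
 \<comment> \<open>Units modulo \<open>s\<close> therefore act invertibly on
   \<open>M\<close>.\<close>
 have sker: "(\<one> \<oplus> s \<otimes> q) \<odot>\<^bsub>M\<^esub> z = z" if "q : carrier R" "z : carrier M" for q z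
 proof -
  have "(s \<otimes> q) \<odot>\<^bsub>M\<^esub> z = s \<odot>\<^bsub>M\<^esub> (q \<odot>\<^bsub>M\<^esub> z)" using that by (simp add: smult_assoc1)
  then show ?thesis using that by (simp add: smult_l_distr sM)
 qed
 obtain h :: "nat \<times> nat => 'a => 'a" where hc: "!!i x. x : C ==> h i x : carrier R"
  and ha: "!!i x z. x : C ==> z : C ==> h i (x \<oplus> z) = h i x \<oplus> h i z"
  and hm: "!!i r x. r : carrier R ==> x : C ==> h i (r \<otimes> x) = r \<otimes> h i x"
  and hs: "!!x. x : C ==> x = (\<Oplus>i\<in>A. h i x \<otimes> G i)"
  by (rule sh.dual_basis[of A G]) (auto simp: C_def A)
 \<comment> \<open>Each \<open>h i\<close> is multiplication by an element of the inverse of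
   \<open>C\<close>, and \<mu> i k is its product with G k. The dual basis property, with
   \<open>s\<close> cancelled, says that the diagonal sums to one.\<close>
 define \<mu> where "\<mu> i k = (if k : A then h i (G k) else \<zero>)" for i k
 have mu [simp]: "\<mu> i k : carrier R" for i k using hc[OF GC] by (simp add: \<mu>_def)
 have mswap: "G k \<otimes> \<mu> i l = G l \<otimes> \<mu> i k" if "k : A" "l : A" for i k l
  using hm[of "G k" "G l" i] hm[of "G l" "G k" i] that GC R.m_comm[of "G k" "G l"] by (simp add: \<mu>_def)
 have lam: "(\<Oplus>i\<in>A. \<mu> i i) = \<one>"
 proof (rule R.regular_cancel[OF s])
  have "s \<otimes> (\<Oplus>i\<in>A. \<mu> i i) = (\<Oplus>i\<in>A. s \<otimes> \<mu> i i)" using A by (intro R.finsum_rdistr) auto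
  also have "... = (\<Oplus>i\<in>A. h i s \<otimes> G i)"
  proof (intro R.finsum_cong' refl)
   fix i assume i: "i : A"
   have "s \<otimes> \<mu> i i = h i (s \<otimes> G i)" using hm[OF sR GC[OF i]] i by (simp add: \<mu>_def)
   also have "... = h i (G i \<otimes> s)" by (simp add: R.m_comm)
   also have "... = h i s \<otimes> G i" using hm[OF G sC] hc[OF sC] by (simp add: R.m_comm)
   finally show "s \<otimes> \<mu> i i = h i s \<otimes> G i" .
  qed (use hc[OF sC] in auto)
  also have "... = s \<otimes> \<one>" using hs[OF sC] by simp
  finally show "s \<otimes> (\<Oplus>i\<in>A. \<mu> i i) = s \<otimes> \<one>" .
 qed (auto intro!: R.finsum_closed')
 text \<open>The variables of the polynomial: \<open>(0, a, 0)\<close>, \<open>(1, b, 0)\<close> and \<open>(2, i)\<close> stand for \<open>u a\<close>, \<open>v b\<close> and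
    \<open>\<eta> i\<close>. At a prime \<open>P\<close>, some diagonal entry \<open>\<mu> i i\<close> is not in \<open>P\<close>, and then \<open>G i\<close> generates \<open>C\<close> locally.\<close>
 define V where "V = {0, 1, 2 :: nat} \<times> {..<?t + N} \<times> {..<?t + N}"
 define F where "F \<alpha> = (\<Oplus>i\<in>A. \<Oplus>k\<in>A. \<mu> i i \<otimes> \<mu> i k \<otimes> \<alpha> (2, i) \<otimes> \<alpha> (0, fst k, 0) \<otimes> \<alpha> (1, snd k, 0))"
  for \<alpha> :: "nat \<times> nat \<times> nat => 'a"
 have V: "(2, i) : V" "(0, fst i, 0) : V" "(1, snd i, 0) : V" if "i : A" for i
  using that by (auto simp: A_def V_def)
 have polyF: "polyfun R V F"
  unfolding F_def using A V by (intro R.polyfun_sum polyfun.mult_var polyfun.const) auto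
 have "EX \<alpha>:V \<rightarrow> carrier R. F \<alpha> ~: P" if P: "primeideal P R" "s : P" for P
 proof -
  interpret P: primeideal P R by fact
  have "EX i:A. \<mu> i i ~: P"
  proof (rule ccontr)
   assume "~(EX i:A. \<mu> i i ~: P)"
   then have "(\<Oplus>i\<in>A. \<mu> i i) : P" by (intro P.finsum_in_ideal) auto
   then show False using lam P.one_imp_carrier P.I_notcarr by simp
  qed
  then obtain i where i: "i : A" "\<mu> i i ~: P" by blast
  \<comment> \<open>Only the variables that belong to \<open>i\<close> are one, and the double sum
    collapses to the square of \<mu> i i.\<close>
  define \<alpha> where "\<alpha> v = (if v : {(2, i), (0, fst i, 0), (1, snd i, 0)} then \<one> else \<zero>)" for v :: "nat \<times> nat \<times> nat"
  have \<alpha> [simp]: "\<alpha> v : carrier R" for v by (simp add: \<alpha>_def)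
  have \<alpha>2: "\<alpha> (2, j) = (if j = i then \<one> else \<zero>)" for j by (auto simp: \<alpha>_def)
  have \<alpha>01: "\<alpha> (0, fst k, 0) \<otimes> \<alpha> (1, snd k, 0) = (if k = i then \<one> else \<zero>)" for k
   by (cases k; cases i) (auto simp: \<alpha>_def)
  have "F \<alpha> = (\<Oplus>j\<in>A. if j = i then \<mu> j j \<otimes> \<mu> j i else \<zero>)"
   unfolding F_def
  proof (intro R.finsum_cong' refl)
   fix j
   have "(\<Oplus>k\<in>A. \<mu> j j \<otimes> \<mu> j k \<otimes> \<alpha> (2, j) \<otimes> \<alpha> (0, fst k, 0) \<otimes> \<alpha> (1, snd k, 0)) =
     (\<Oplus>k\<in>A. if k = i then \<mu> j j \<otimes> \<mu> j k \<otimes> \<alpha> (2, j) else \<zero>)"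
   proof (intro R.finsum_cong' refl)
    fix k
    have "\<mu> j j \<otimes> \<mu> j k \<otimes> \<alpha> (2, j) \<otimes> \<alpha> (0, fst k, 0) \<otimes> \<alpha> (1, snd k, 0) =
      \<mu> j j \<otimes> \<mu> j k \<otimes> \<alpha> (2, j) \<otimes> (\<alpha> (0, fst k, 0) \<otimes> \<alpha> (1, snd k, 0))"
     by (rule R.m_assoc) auto
    then show "\<mu> j j \<otimes> \<mu> j k \<otimes> \<alpha> (2, j) \<otimes> \<alpha> (0, fst k, 0) \<otimes> \<alpha> (1, snd k, 0) =
      (if k = i then \<mu> j j \<otimes> \<mu> j k \<otimes> \<alpha> (2, j) else \<zero>)"
     unfolding \<alpha>01 by simp
   qed auto
   also have "... = \<mu> j j \<otimes> \<mu> j i \<otimes> \<alpha> (2, j)" using A i by (intro R.finsum_delta) auto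
   finally show "(\<Oplus>k\<in>A. \<mu> j j \<otimes> \<mu> j k \<otimes> \<alpha> (2, j) \<otimes> \<alpha> (0, fst k, 0) \<otimes> \<alpha> (1, snd k, 0)) =
     (if j = i then \<mu> j j \<otimes> \<mu> j i else \<zero>)" by (simp add: \<alpha>2)
  qed auto
  also have "... = \<mu> i i \<otimes> \<mu> i i" using A i by (intro R.finsum_delta) auto
  finally have "F \<alpha> = \<mu> i i \<otimes> \<mu> i i" .
  moreover have "\<mu> i i \<otimes> \<mu> i i ~: P" using P.I_prime[of "\<mu> i i" "\<mu> i i"] i by auto
  ultimately show ?thesis by (intro bexI[of _ \<alpha>]) auto
 qed
 then obtain \<alpha> r q where \<alpha>: "\<alpha> : V \<rightarrow> carrier R" and r [simp]: "r : carrier R" and q [simp]: "q : carrier R"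
  and rF: "r \<otimes> F \<alpha> = \<one> \<oplus> s \<otimes> q"
  using R.almost_local_global_polyfun[OF alg s _ polyF] by (auto simp: V_def)
 define u where "u a = (if a < ?t then \<alpha> (0, a, 0) else \<zero>)" for a
 define v where "v b = (if b < N then \<alpha> (1, b, 0) else \<zero>)" for b
 define \<eta> where "\<eta> i = (if i : A then \<alpha> (2, i) else \<zero>)" for i
 have uvn [simp]: "u a : carrier R" "v b : carrier R" "\<eta> i : carrier R" for a b i
  using \<alpha> V(1)[of i] by (auto simp: u_def v_def \<eta>_def V_def A_def)
 \<comment> \<open>\<kappa> k is the value at G k of the linear map K on \<open>C\<close> that sums
   the h i with weights \<mu> i i \<eta> i. Accordingly F \<alpha> is the value of K at the element
   c below.\<close>
 define \<kappa> where "\<kappa> k = (\<Oplus>i\<in>A. \<mu> i i \<otimes> \<mu> i k \<otimes> \<eta> i)" for k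
 have kc [simp]: "\<kappa> k : carrier R" for k unfolding \<kappa>_def by (intro R.finsum_closed') auto
 define \<kappa>' where "\<kappa>' a = dot R N v (%b. \<kappa> (a, b))" for a
 have kc' [simp]: "\<kappa>' a : carrier R" for a by (simp add: \<kappa>'_def)
 have Fk: "F \<alpha> = (\<Oplus>k\<in>A. u (fst k) \<otimes> (v (snd k) \<otimes> \<kappa> k))"
 proof -
  have "F \<alpha> = (\<Oplus>i\<in>A. \<Oplus>k\<in>A. (u (fst k) \<otimes> v (snd k)) \<otimes> (\<mu> i i \<otimes> \<mu> i k \<otimes> \<eta> i))"
   unfolding F_def
  proof (intro R.finsum_cong' refl)
   fix i k assume "i : A" "k : A"
   then have "\<alpha> (2, i) = \<eta> i" "\<alpha> (0, fst k, 0) = u (fst k)" "\<alpha> (1, snd k, 0) = v (snd k)"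
    by (auto simp: \<eta>_def u_def v_def A_def)
   then show "\<mu> i i \<otimes> \<mu> i k \<otimes> \<alpha> (2, i) \<otimes> \<alpha> (0, fst k, 0) \<otimes> \<alpha> (1, snd k, 0) = (u (fst k) \<otimes> v (snd k)) \<otimes> (\<mu> i i \<otimes> \<mu> i k \<otimes> \<eta> i)"
    by (simp add: R.m_ac)
  qed (auto intro!: R.finsum_closed')
  also have "... = (\<Oplus>k\<in>A. \<Oplus>i\<in>A. (u (fst k) \<otimes> v (snd k)) \<otimes> (\<mu> i i \<otimes> \<mu> i k \<otimes> \<eta> i))"
   using A by (intro R.finsum_swap) auto
  also have "... = (\<Oplus>k\<in>A. u (fst k) \<otimes> (v (snd k) \<otimes> \<kappa> k))"
   unfolding \<kappa>_def
  proof (intro R.finsum_cong' refl)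
   fix k
   have "(\<Oplus>i\<in>A. (u (fst k) \<otimes> v (snd k)) \<otimes> (\<mu> i i \<otimes> \<mu> i k \<otimes> \<eta> i)) = (u (fst k) \<otimes> v (snd k)) \<otimes> \<kappa> k"
    unfolding \<kappa>_def using A by (intro R.finsum_rdistr[symmetric]) auto
   then show "(\<Oplus>i\<in>A. (u (fst k) \<otimes> v (snd k)) \<otimes> (\<mu> i i \<otimes> \<mu> i k \<otimes> \<eta> i)) = u (fst k) \<otimes> (v (snd k) \<otimes> (\<Oplus>i\<in>A. \<mu> i i \<otimes> \<mu> i k \<otimes> \<eta> i))"
    unfolding \<kappa>_def[symmetric] by (simp add: R.m_assoc)
  qed (auto intro!: R.finsum_closed')
  finally show ?thesis .
 qed
 have sumA: "(\<Oplus>k\<in>A. u (fst k) \<otimes> (v (snd k) \<otimes> f k)) = dot R ?t u (%a. dot R N v (%b. f (a, b)))"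
  if [simp]: "!!k. f k : carrier R" for f
 proof -
  have "(\<Oplus>k\<in>A. u (fst k) \<otimes> (v (snd k) \<otimes> f k)) = (\<Oplus>a\<in>{..<?t}. \<Oplus>b\<in>{..<N}. u a \<otimes> (v b \<otimes> f (a, b)))"
   unfolding A_def by (subst R.finsum_Times) auto
  also have "... = dot R ?t u (%a. dot R N v (%b. f (a, b)))"
   unfolding dot_def by (intro R.finsum_cong' refl R.finsum_rdistr[symmetric]) (auto intro!: R.finsum_closed')
  finally show ?thesis .
 qed
 have Fu: "F \<alpha> = dot R ?t u \<kappa>'" unfolding Fk \<kappa>'_def by (rule sumA) simp
 define z where "z a = dot R N v (%b. g b a)" for a
 have zc [simp]: "z a : carrier R" for a by (simp add: z_def)
 have z0: "lc M ?t z y = \<zero>\<^bsub>M\<^esub>"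
 proof -
  have "lc M ?t z y = lc M N v (%b. lc M ?t (g b) y)" unfolding z_def by (rule lc_lc[symmetric]) auto
  also have "... = lc M N v (%b. \<zero>\<^bsub>M\<^esub>)" using g0 by (intro lc_cong2) auto
  also have "... = \<zero>\<^bsub>M\<^esub>" unfolding lc_def by simp
  finally show ?thesis .
 qed
 define c where "c = dot R ?t u z"
 have cc [simp]: "c : carrier R" by (simp add: c_def)
 have cG: "c = (\<Oplus>k\<in>A. u (fst k) \<otimes> (v (snd k) \<otimes> G k))"
  unfolding c_def z_def by (subst sumA) (auto simp: G_def)
 have Fc [simp]: "F \<alpha> : carrier R" by (simp add: Fu)
 \<comment> \<open>For a linear map K on the ideal \<open>C\<close>, K(c) G l = K(c G l) = K(G l)
   c.\<close>
 have FG: "F \<alpha> \<otimes> G l = \<kappa> l \<otimes> c" if l: "l : A" for l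
 proof -
  have kG: "\<kappa> k \<otimes> G l = \<kappa> l \<otimes> G k" if k: "k : A" for k
  proof -
   have "\<kappa> k \<otimes> G l = (\<Oplus>i\<in>A. \<mu> i i \<otimes> \<mu> i k \<otimes> \<eta> i \<otimes> G l)" unfolding \<kappa>_def using A by (intro R.finsum_ldistr) auto
   also have "... = (\<Oplus>i\<in>A. \<mu> i i \<otimes> \<mu> i l \<otimes> \<eta> i \<otimes> G k)"
   proof (intro R.finsum_cong' refl)
    fix i
    have "\<mu> i i \<otimes> \<mu> i k \<otimes> \<eta> i \<otimes> G l = \<mu> i i \<otimes> \<eta> i \<otimes> (G l \<otimes> \<mu> i k)" by (simp add: R.m_ac)
    also have "... = \<mu> i i \<otimes> \<mu> i l \<otimes> \<eta> i \<otimes> G k" unfolding mswap[OF l k] by (simp add: R.m_ac)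
    finally show "\<mu> i i \<otimes> \<mu> i k \<otimes> \<eta> i \<otimes> G l = \<mu> i i \<otimes> \<mu> i l \<otimes> \<eta> i \<otimes> G k" .
   qed auto
   also have "... = \<kappa> l \<otimes> G k" unfolding \<kappa>_def using A by (intro R.finsum_ldistr[symmetric]) auto
   finally show ?thesis .
  qed
  have "F \<alpha> \<otimes> G l = (\<Oplus>k\<in>A. u (fst k) \<otimes> (v (snd k) \<otimes> \<kappa> k) \<otimes> G l)"
   unfolding Fk using A by (intro R.finsum_ldistr) auto
  also have "... = (\<Oplus>k\<in>A. \<kappa> l \<otimes> (u (fst k) \<otimes> (v (snd k) \<otimes> G k)))"
  proof (intro R.finsum_cong' refl)
   fix k assume k: "k : A"
   have "u (fst k) \<otimes> (v (snd k) \<otimes> \<kappa> k) \<otimes> G l = u (fst k) \<otimes> v (snd k) \<otimes> (\<kappa> k \<otimes> G l)" by (simp add: R.m_ac)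
   also have "... = \<kappa> l \<otimes> (u (fst k) \<otimes> (v (snd k) \<otimes> G k))" unfolding kG[OF k] by (simp add: R.m_ac)
   finally show "u (fst k) \<otimes> (v (snd k) \<otimes> \<kappa> k) \<otimes> G l = \<kappa> l \<otimes> (u (fst k) \<otimes> (v (snd k) \<otimes> G k))" .
  qed auto
  also have "... = \<kappa> l \<otimes> c" unfolding cG using A by (intro R.finsum_rdistr[symmetric]) auto
  finally show ?thesis .
 qed
 have Fz: "F \<alpha> \<otimes> z a = \<kappa>' a \<otimes> c" if a: "a < ?t" for a
 proof -
  have "F \<alpha> \<otimes> z a = (\<Oplus>b\<in>{..<N}. F \<alpha> \<otimes> (v b \<otimes> g b a))"
   unfolding z_def dot_def by (intro R.finsum_rdistr) auto
  also have "... = (\<Oplus>b\<in>{..<N}. v b \<otimes> \<kappa> (a, b) \<otimes> c)"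
  proof (intro R.finsum_cong' refl)
   fix b assume b: "b : {..<N}"
   have "F \<alpha> \<otimes> (v b \<otimes> g b a) = v b \<otimes> (F \<alpha> \<otimes> G (a, b))" by (simp add: G_def R.m_ac)
   also have "... = v b \<otimes> \<kappa> (a, b) \<otimes> c" using FG[of "(a, b)"] a b by (simp add: A_def R.m_ac)
   finally show "F \<alpha> \<otimes> (v b \<otimes> g b a) = v b \<otimes> \<kappa> (a, b) \<otimes> c" .
  qed auto
  also have "... = \<kappa>' a \<otimes> c" unfolding \<kappa>'_def dot_def by (intro R.finsum_ldistr[symmetric]) auto
  finally show ?thesis .
 qed
 \<comment> \<open>By \<open>Fz\<close>, \<kappa>' a stands for F \<alpha> times z a / c; the factor
   r turns F \<alpha> into 1 + s q, so z' replaces the quotient of z by c.\<close>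
 define z' where "z' a = r \<otimes> \<kappa>' a" for a
 have z' [simp]: "z' a : carrier R" for a by (simp add: z'_def)
 have uz: "dot R ?t u z' = \<one> \<oplus> s \<otimes> q"
 proof -
  have "dot R ?t u z' = dot R ?t z' u" by (rule R.dot_comm) auto
  also have "... = r \<otimes> dot R ?t \<kappa>' u" unfolding z'_def by (rule R.dot_smult) auto
  also have "dot R ?t \<kappa>' u = F \<alpha>" unfolding Fu by (rule R.dot_comm) auto
  finally show ?thesis using rF by simp
 qed
 define x where "x = lc M ?t z' y"
 have xc [simp]: "x : carrier M" by (simp add: x_def)
 have cx: "c \<odot>\<^bsub>M\<^esub> x = \<zero>\<^bsub>M\<^esub>"
 proof -
  have "c \<odot>\<^bsub>M\<^esub> x = lc M ?t (%a. c \<otimes> z' a) y" unfolding x_def by (rule lc_smult[symmetric]) auto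
  also have "... = lc M ?t (%a. (r \<otimes> F \<alpha>) \<otimes> z a) y"
  proof (rule lc_cong)
   fix a assume "a < ?t"
   have "c \<otimes> z' a = r \<otimes> (\<kappa>' a \<otimes> c)" by (simp add: z'_def R.m_ac)
   also have "... = r \<otimes> F \<alpha> \<otimes> z a" unfolding Fz[OF \<open>a < ?t\<close>, symmetric] by (simp add: R.m_assoc)
   finally show "c \<otimes> z' a = r \<otimes> F \<alpha> \<otimes> z a" .
  qed auto
  also have "... = (r \<otimes> F \<alpha>) \<odot>\<^bsub>M\<^esub> lc M ?t z y" by (rule lc_smult) auto
  finally show ?thesis by (simp add: z0)
 qed
 have Cx: "p \<odot>\<^bsub>M\<^esub> x = \<zero>\<^bsub>M\<^esub>" if p: "p : C" for p
 proof -
  have Gx: "G l \<odot>\<^bsub>M\<^esub> x = \<zero>\<^bsub>M\<^esub>" if l: "l : A" for l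
  proof -
   have "G l \<odot>\<^bsub>M\<^esub> x = G l \<odot>\<^bsub>M\<^esub> ((r \<otimes> F \<alpha>) \<odot>\<^bsub>M\<^esub> x)" unfolding rF by (simp add: sker)
   also have "... = (r \<otimes> \<kappa> l \<otimes> c) \<odot>\<^bsub>M\<^esub> x"
   proof -
    have "G l \<otimes> (r \<otimes> F \<alpha>) = r \<otimes> (F \<alpha> \<otimes> G l)" by (simp add: R.m_ac)
    also have "... = r \<otimes> \<kappa> l \<otimes> c" unfolding FG[OF l] by (simp add: R.m_assoc)
    finally show ?thesis by (simp add: smult_assoc1[symmetric])
   qed
   also have "... = (r \<otimes> \<kappa> l) \<odot>\<^bsub>M\<^esub> (c \<odot>\<^bsub>M\<^esub> x)" by (rule smult_assoc1) auto
   finally show ?thesis by (simp add: cx)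
  qed
  obtain w where w: "!!i. w i : carrier R" "p = (\<Oplus>i\<in>A. w i \<otimes> G i)"
   using p unfolding C_def by (subst (asm) R.genideal_family[OF A]) auto
  have "p \<odot>\<^bsub>M\<^esub> x = (\<Oplus>\<^bsub>M\<^esub>i\<in>A. (w i \<otimes> G i) \<odot>\<^bsub>M\<^esub> x)"
   unfolding w(2)
   by (rule finsum_hom[OF R.abelian_monoid_axioms M.abelian_monoid_axioms])
    (use w(1) in \<open>auto simp: smult_l_distr\<close>)
  also have "... = (\<Oplus>\<^bsub>M\<^esub>i\<in>A. \<zero>\<^bsub>M\<^esub>)"
   using w(1) by (intro M.finsum_cong') (auto simp: smult_assoc1 Gx)
  finally show ?thesis by simp
 qed
 have fgC: "fg_ideal R C"
 proof -
  have "finite (G ` A)" using A by simp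
  then obtain n e where e: "G ` A = e ` {i::nat. i < n}" using finite_imp_nat_seg_image_inj_on by metis
  define e' where "e' i = (if i < n then e i else \<zero>)" for i
  have "e' i : carrier R" for i using GA unfolding e by (auto simp: e'_def)
  moreover have "e' ` {..<n} = G ` A" unfolding e by (auto simp: e'_def)
  ultimately show ?thesis unfolding fg_ideal_def C_def by metis
 qed
 show ?thesis
  using idC fgC sC CI uz relC Cx unfolding x_def
  by (intro exI[of _ C] exI[of _ u] exI[of _ z'] exI[of _ q]) auto
qed

text \<open>The cyclic summand R / C is described by \<gamma>, whose values in R represent cosets of
  \<open>C\<close>; hence the congruences modulo \<open>C\<close> in place of linearity. The summand
  is the kernel of \<pi>.\<close>

definition torsion_step ::
 "('a, 'r) ring_scheme => ('a, 'b, 'm) module_scheme => 'a set => ('b => 'a) => ('b => 'b) => 'b set => bool"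
where
 "torsion_step R M C \<gamma> \<pi> H \<longleftrightarrow> linear_proj R M H \<pi> &
  (ALL x:carrier M. \<gamma> x : carrier R) &
  (ALL x:carrier M. ALL y:carrier M. \<gamma> (x \<oplus>\<^bsub>M\<^esub> y) \<ominus>\<^bsub>R\<^esub> (\<gamma> x \<oplus>\<^bsub>R\<^esub> \<gamma> y) : C) &
  (ALL r:carrier R. ALL x:carrier M. \<gamma> (r \<odot>\<^bsub>M\<^esub> x) \<ominus>\<^bsub>R\<^esub> r \<otimes>\<^bsub>R\<^esub> \<gamma> x : C) &
  (ALL x:carrier M. \<gamma> x : C --> \<pi> x = x) &
  (ALL c:carrier R. EX x:carrier M. \<gamma> x \<ominus>\<^bsub>R\<^esub> c : C & \<pi> x = \<zero>\<^bsub>M\<^esub>) &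
  (ALL x:H. \<gamma> x : C)"

lemma (in abelian_group) minus_zeroD:
 assumes "x : carrier G" "y : carrier G" "x \<ominus> y = \<zero>"
 shows "x = y"
proof -
 have "x = (x \<ominus> y) \<oplus> y" using assms(1,2) by (simp add: minus_eq a_assoc l_neg)
 then show ?thesis using assms by simp
qed

lemma (in cring) ideal_cong:
 assumes C: "ideal C R" and [simp]: "a : carrier R" "b : carrier R" and "a \<ominus> b : C"
 shows "a : C \<longleftrightarrow> b : C"
proof -
 have "a = (a \<ominus> b) \<oplus> b" "b = a \<ominus> (a \<ominus> b)" using assms(2,3) by algebra+
 then show ?thesis using ideal_add[OF C] assms(4) by metis
qed

text \<open>Relations have entries in \<open>C\<close>, so evaluating u on the coefficients of an
  element gives a coordinate \<gamma> modulo \<open>C\<close>. The element x from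
  \<open>ex_cyclic_summand\<close> is killed by \<open>C\<close> and has coordinate one, so
  subtracting \<gamma> times x is a projection onto H. A second use of the local-global property
  exchanges one of the t + 1 generators for x, which leaves t generators for H.\<close>

lemma (in module) ex_torsion_step:
 assumes sh: "semihereditary_ring R" and alg: "almost_local_global R" and s: "s : regular_elements R"
  and y: "spans R M (Suc t) y" and rel: "fg_relations R M (Suc t) y"
  and sM': "ALL z:carrier M. s \<odot>\<^bsub>M\<^esub> z = \<zero>\<^bsub>M\<^esub>"
  and I: "ideal I R" and relI: "ALL w. (ALL a. w a : carrier R) --> lc M (Suc t) w y = \<zero>\<^bsub>M\<^esub> --> (ALL a<Suc t. w a : I)"
 shows "EX C \<gamma> \<pi> H y'. (ideal C R & fg_ideal R C & s : C & C <= I) & torsion_step R M C \<gamma> \<pi> H &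
  spans R (M\<lparr>carrier := H\<rparr>) t y' & fg_relations R (M\<lparr>carrier := H\<rparr>) t y' &
  (ALL w. (ALL a. w a : carrier R) --> lc (M\<lparr>carrier := H\<rparr>) t w y' = \<zero>\<^bsub>M\<^esub> --> (ALL a<t. w a : C))"
proof -
 let ?t = "Suc t"
 note yc [simp] = spans_closed[OF y] and sM = bspec[OF sM']
 note sR [simp] = R.regularD(1)[OF s]
 obtain C u z q where st: "ideal C R & fg_ideal R C & s : C & C <= I & (ALL a. u a : carrier R) & (ALL a. z a : carrier R) &
  q : carrier R & dot R ?t u z = \<one> \<oplus> s \<otimes> q &
  (ALL w. (ALL a. w a : carrier R) --> lc M ?t w y = \<zero>\<^bsub>M\<^esub> --> (ALL a<?t. w a : C)) &
  (ALL r:C. r \<odot>\<^bsub>M\<^esub> lc M ?t z y = \<zero>\<^bsub>M\<^esub>)"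
  using ex_cyclic_summand[OF sh alg s y rel sM' I relI] by (elim exE)
 have idC: "ideal C R" and fgC: "fg_ideal R C" and sC: "s : C" and CI: "C <= I"
  and u [simp]: "u a : carrier R" and z [simp]: "z a : carrier R" and q [simp]: "q : carrier R"
  and uz: "dot R ?t u z = \<one> \<oplus> s \<otimes> q" for a
  using st by (elim conjE, simp)+
 have relC: "w a : C" if "!!a. w a : carrier R" "lc M ?t w y = \<zero>\<^bsub>M\<^esub>" "a < ?t" for w a
  using st that by (elim conjE) simp
 have Cx: "r \<odot>\<^bsub>M\<^esub> lc M ?t z y = \<zero>\<^bsub>M\<^esub>" if "r : C" for r
  using st that by (elim conjE) simp
 interpret C: ideal C R by (rule idC)
 define x where "x = lc M ?t z y"
 have xc [simp]: "x : carrier M" by (simp add: x_def)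
 have Cx: "r \<odot>\<^bsub>M\<^esub> x = \<zero>\<^bsub>M\<^esub>" if "r : C" for r using Cx[OF that] by (simp add: x_def)
 have eqx: "a \<odot>\<^bsub>M\<^esub> x = b \<odot>\<^bsub>M\<^esub> x" if [simp]: "a : carrier R" "b : carrier R" and "a \<ominus> b : C" for a b
 proof -
  have "a = (a \<ominus> b) \<oplus> b" using that(1,2) by algebra
  then have "a \<odot>\<^bsub>M\<^esub> x = ((a \<ominus> b) \<oplus> b) \<odot>\<^bsub>M\<^esub> x" by simp
  also have "... = (a \<ominus> b) \<odot>\<^bsub>M\<^esub> x \<oplus>\<^bsub>M\<^esub> b \<odot>\<^bsub>M\<^esub> x" by (rule smult_l_distr) auto
  finally show ?thesis using Cx[OF that(3)] by simp
 qed
 have sqC: "s \<otimes> q' : C" if "q' : carrier R" for q' using C.I_r_closed[OF sC that] .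
 have unitC: "l : C" if "l \<otimes> (\<one> \<oplus> s \<otimes> q') : C" "l : carrier R" "q' : carrier R" for l q'
 proof -
  have "l = l \<otimes> (\<one> \<oplus> s \<otimes> q') \<ominus> l \<otimes> (s \<otimes> q')" using that(2,3) sR by algebra
  then show ?thesis using R.ideal_add(3)[OF idC that(1) C.I_l_closed[OF sqC[OF that(3)] that(2)]] by simp
 qed
 have sker: "(\<one> \<oplus> s \<otimes> q') \<odot>\<^bsub>M\<^esub> m = m" if "q' : carrier R" "m : carrier M" for q' m
 proof -
  have "(s \<otimes> q') \<odot>\<^bsub>M\<^esub> m = s \<odot>\<^bsub>M\<^esub> (q' \<odot>\<^bsub>M\<^esub> m)" using that by (simp add: smult_assoc1)
  then show ?thesis using that by (simp add: smult_l_distr sM)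
 qed
 have dotC: "dot R n v w : C" if "!!a. v a : carrier R" "!!a. a < n ==> w a : C" for n v w
  unfolding dot_def using that by (intro C.finsum_in_ideal C.I_l_closed) auto
 define W where "W \<zeta> = (SOME w. (ALL a. w a : carrier R) & \<zeta> = lc M ?t w y)" for \<zeta>
 have W: "W \<zeta> a : carrier R" "\<zeta> = lc M ?t (W \<zeta>) y" if "\<zeta> : carrier M" for \<zeta> a
 proof -
  have "EX w. (ALL a. w a : carrier R) & \<zeta> = lc M ?t w y" using y that unfolding spans_def by blast
  from someI_ex[OF this] show "W \<zeta> a : carrier R" "\<zeta> = lc M ?t (W \<zeta>) y" unfolding W_def by blast+
 qed
 \<comment> \<open>The chosen coefficients matter only modulo \<open>C\<close>; this is the fact
   \<open>g\<close> that follows.\<close>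
 define \<gamma> where "\<gamma> \<zeta> = dot R ?t u (W \<zeta>)" for \<zeta>
 have gc [simp]: "\<gamma> \<zeta> : carrier R" if "\<zeta> : carrier M" for \<zeta> using W(1)[OF that] by (simp add: \<gamma>_def)
 have g: "\<gamma> (lc M ?t w y) \<ominus> dot R ?t u w : C" if w [simp]: "!!a. w a : carrier R" for w
 proof -
  let ?W = "W (lc M ?t w y)"
  have W1 [simp]: "?W a : carrier R" for a by (rule W(1)) simp
  have W2: "lc M ?t ?W y = lc M ?t w y" by (rule W(2)[symmetric]) simp
  have "lc M ?t (%a. ?W a \<ominus> w a) y = \<zero>\<^bsub>M\<^esub>" using W2 by (subst lc_minus) (auto simp: M.minus_eq M.r_neg)
  then have d: "?W a \<ominus> w a : C" if "a < ?t" for a using relC[of "%a. ?W a \<ominus> w a"] that by simp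
  have "dot R ?t u (%a. \<one> \<otimes> ?W a \<ominus> \<one> \<otimes> w a) : C" by (rule dotC) (auto simp: d)
  then show ?thesis unfolding \<gamma>_def by (subst (asm) R.dot_lin_right) auto
 qed
 have gadd: "\<gamma> (a \<oplus>\<^bsub>M\<^esub> b) \<ominus> (\<gamma> a \<oplus> \<gamma> b) : C" if ab: "a : carrier M" "b : carrier M" for a b
 proof -
  note [simp] = W(1)[OF ab(1)] W(1)[OF ab(2)]
  have "a \<oplus>\<^bsub>M\<^esub> b = lc M ?t (%i. W a i \<oplus> W b i) y"
   using W(2)[OF ab(1)] W(2)[OF ab(2)] by (subst lc_add) auto
  moreover have "dot R ?t u (%i. W a i \<oplus> W b i) = \<gamma> a \<oplus> \<gamma> b"
   using R.dot_add[of "W a" "W b" u ?t] unfolding \<gamma>_def by (simp add: R.dot_comm[of u])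
  ultimately show ?thesis using g[of "%i. W a i \<oplus> W b i"] by simp
 qed
 have gsmult: "\<gamma> (r \<odot>\<^bsub>M\<^esub> a) \<ominus> r \<otimes> \<gamma> a : C" if ab: "a : carrier M" and [simp]: "r : carrier R" for a r
 proof -
  note [simp] = W(1)[OF ab(1)]
  have "r \<odot>\<^bsub>M\<^esub> a = lc M ?t (%i. r \<otimes> W a i) y"
   using W(2)[OF ab(1)] by (subst lc_smult) auto
  moreover have "dot R ?t u (%i. r \<otimes> W a i) = r \<otimes> \<gamma> a"
   using R.dot_smult[of r "W a" u ?t] unfolding \<gamma>_def by (simp add: R.dot_comm[of u])
  ultimately show ?thesis using g[of "%i. r \<otimes> W a i"] by simp
 qed
 have gxs: "\<gamma> (c \<odot>\<^bsub>M\<^esub> x) \<ominus> c : C" if [simp]: "c : carrier R" for c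
 proof -
  have "c \<odot>\<^bsub>M\<^esub> x = lc M ?t (%i. c \<otimes> z i) y" unfolding x_def by (subst lc_smult) auto
  moreover have "dot R ?t u (%i. c \<otimes> z i) = c \<otimes> (\<one> \<oplus> s \<otimes> q)"
   using R.dot_smult[of c z u ?t] uz by (simp add: R.dot_comm[of u])
  ultimately have 1: "\<gamma> (c \<odot>\<^bsub>M\<^esub> x) \<ominus> c \<otimes> (\<one> \<oplus> s \<otimes> q) : C" using g[of "%i. c \<otimes> z i"] by simp
  have *: "w \<ominus> c = (w \<ominus> c \<otimes> (\<one> \<oplus> s \<otimes> q)) \<oplus> c \<otimes> (s \<otimes> q)" if "w : carrier R" for w
   using that \<open>c : carrier R\<close> sR q by algebra
  have "\<gamma> (c \<odot>\<^bsub>M\<^esub> x) : carrier R" by simp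
  from *[OF this] show ?thesis using R.ideal_add(1)[OF idC 1 C.I_l_closed[OF sqC[OF q], of c]] by (rule ssubst) simp
 qed
 define \<pi> where "\<pi> \<zeta> = \<zeta> \<ominus>\<^bsub>M\<^esub> \<gamma> \<zeta> \<odot>\<^bsub>M\<^esub> x" for \<zeta>
 have pc [simp]: "\<pi> \<zeta> : carrier M" if "\<zeta> : carrier M" for \<zeta> using that by (simp add: \<pi>_def)
 define H where "H = {\<zeta> : carrier M. \<gamma> \<zeta> : C}"
 have "\<gamma> \<zeta> : C \<longleftrightarrow> d : C" if "\<gamma> \<zeta> \<ominus> d : C" "\<zeta> : carrier M" "d : carrier R" for \<zeta> d
  using R.ideal_cong[OF idC _ _ that(1)] that by simp
 note gcong = this
 have HM: "submodule H R M"
 proof (rule submoduleI)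
  show Hs: "r \<odot>\<^bsub>M\<^esub> a : H" if "r : carrier R" "a : H" for r a
   using that gcong[OF gsmult[of a r]] C.I_l_closed[of "\<gamma> a" r] by (auto simp: H_def)
  have "\<gamma> \<zero>\<^bsub>M\<^esub> \<ominus> \<zero> : C" using gxs[OF R.zero_closed] unfolding smult_l_null[OF xc] .
  from gcong[OF this M.zero_closed R.zero_closed] show "\<zero>\<^bsub>M\<^esub> : H"
   using C.zero_closed unfolding H_def by blast
  show "a \<oplus>\<^bsub>M\<^esub> b : H" if "a : H" "b : H" for a b
  proof -
   have ab: "a : carrier M" "b : carrier M" "\<gamma> a : C" "\<gamma> b : C" using that by (auto simp: H_def)
   have "\<gamma> (a \<oplus>\<^bsub>M\<^esub> b) : C"
    using gcong[OF gadd[OF ab(1,2)]] R.ideal_add(1)[OF idC ab(3,4)] ab(1,2) by simp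
   then show ?thesis using ab by (simp add: H_def)
  qed
  show "\<ominus>\<^bsub>M\<^esub> a : H" if "a : H" for a
  proof -
   have "a : carrier M" using that by (simp add: H_def)
   then show ?thesis using Hs[of "\<ominus> \<one>" a] that smult_l_minus[of \<one> a] by simp
  qed
 qed (auto simp: H_def)
 have g_id: "\<pi> \<zeta> = \<zeta>" if "\<zeta> : carrier M" "\<gamma> \<zeta> : C" for \<zeta>
  using that by (simp add: \<pi>_def Cx M.minus_eq)
 have px0: "\<pi> (c \<odot>\<^bsub>M\<^esub> x) = \<zero>\<^bsub>M\<^esub>" if "c : carrier R" for c
  using that eqx[OF _ that gxs[OF that]] by (simp add: \<pi>_def M.minus_eq M.r_neg)
 have lp: "linear_proj R M H \<pi>"
  unfolding linear_proj_def
 proof (intro conjI HM ballI)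
  show padd: "\<pi> (a \<oplus>\<^bsub>M\<^esub> b) = \<pi> a \<oplus>\<^bsub>M\<^esub> \<pi> b" if ab: "a : carrier M" "b : carrier M" for a b
  proof -
   have "\<gamma> (a \<oplus>\<^bsub>M\<^esub> b) \<odot>\<^bsub>M\<^esub> x = (\<gamma> a \<oplus> \<gamma> b) \<odot>\<^bsub>M\<^esub> x" using ab by (intro eqx gadd) auto
   also have "... = \<gamma> a \<odot>\<^bsub>M\<^esub> x \<oplus>\<^bsub>M\<^esub> \<gamma> b \<odot>\<^bsub>M\<^esub> x" using ab by (intro smult_l_distr) auto
   finally show ?thesis using ab by (simp add: \<pi>_def M.minus_eq M.minus_add M.a_ac)
  qed
  show "\<pi> (r \<odot>\<^bsub>M\<^esub> a) = r \<odot>\<^bsub>M\<^esub> \<pi> a" if ab: "r : carrier R" "a : carrier M" for r a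
  proof -
   have "\<gamma> (r \<odot>\<^bsub>M\<^esub> a) \<odot>\<^bsub>M\<^esub> x = (r \<otimes> \<gamma> a) \<odot>\<^bsub>M\<^esub> x" using ab by (intro eqx gsmult) auto
   then show ?thesis using ab by (simp add: \<pi>_def M.minus_eq smult_r_distr smult_r_minus smult_assoc1)
  qed
  show "\<pi> a = a" if "a : H" for a using that g_id by (simp add: H_def)
  show "\<pi> a : H" if a: "a : carrier M" for a
  proof -
   have m: "\<pi> a = a \<oplus>\<^bsub>M\<^esub> (\<ominus> \<gamma> a) \<odot>\<^bsub>M\<^esub> x" using a by (simp add: \<pi>_def M.minus_eq smult_l_minus)
   let ?v = "\<gamma> ((\<ominus> \<gamma> a) \<odot>\<^bsub>M\<^esub> x)"
   have 1: "?v \<ominus> (\<ominus> \<gamma> a) : C" using a by (intro gxs) simp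
   have *: "g \<oplus> v = v \<ominus> (\<ominus> g)" if "g : carrier R" "v : carrier R" for g v using that by algebra
   have "\<gamma> a \<oplus> ?v = ?v \<ominus> (\<ominus> \<gamma> a)" using a by (intro *) auto
   then have "\<gamma> a \<oplus> ?v : C" using 1 by metis
   then have "\<gamma> (\<pi> a) : C" unfolding m using a gadd[of a "(\<ominus> \<gamma> a) \<odot>\<^bsub>M\<^esub> x"] by (subst gcong[of _ "\<gamma> a \<oplus> ?v"]) auto
   then show ?thesis using a by (simp add: H_def)
  qed
 qed
 have step: "torsion_step R M C \<gamma> \<pi> H"
  unfolding torsion_step_def
 proof (intro conjI ballI impI)
  fix c assume "c : carrier R"
  then show "EX x:carrier M. \<gamma> x \<ominus> c : C & \<pi> x = \<zero>\<^bsub>M\<^esub>"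
   using gxs px0 by (intro bexI[of _ "c \<odot>\<^bsub>M\<^esub> x"]) auto
 qed (use lp gadd gsmult g_id in \<open>auto simp: H_def\<close>)
 \<comment> \<open>In the generators y 0 and y (Suc a) - \<beta> a y 0, the coefficient of x at y 0
   is F \<beta>. Once it is a unit modulo \<open>s\<close>, y 0 can be exchanged for x.\<close>
 define F where "F \<beta> = z 0 \<oplus> (\<Oplus>a\<in>{..<t}. z (Suc a) \<otimes> \<beta> a)" for \<beta> :: "nat => 'a"
 have polyF: "polyfun R {..<t} F"
  unfolding F_def by (intro polyfun.add polyfun.const R.polyfun_sum polyfun.mult_var) auto
 have "EX \<beta>:{..<t} \<rightarrow> carrier R. F \<beta> ~: P" if P: "primeideal P R" "s : P" for P
 proof -
  interpret P: primeideal P R by fact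
  show ?thesis
  proof (cases "z 0 : P")
   case False
   have "(\<Oplus>a\<in>{..<t}. z (Suc a) \<otimes> \<zero>) = \<zero>" by simp
   then have "F (%_. \<zero>) = z 0" unfolding F_def by simp
   then show ?thesis using False by (intro bexI[of _ "%_. \<zero>"]) auto
  next
   case True
   \<comment> \<open>Not all z a lie in P, as u z = 1 + s q and s lies in P.\<close>
   have "EX a<t. z (Suc a) ~: P"
   proof (rule ccontr)
    assume "~(EX a<t. z (Suc a) ~: P)"
    then have "z a : P" if "a < ?t" for a using True that by (cases a) auto
    then have "dot R ?t u z : P" unfolding dot_def by (intro P.finsum_in_ideal P.I_l_closed) auto
    then have "\<one> \<oplus> s \<otimes> q : P" using uz by simp
    moreover have "s \<otimes> q : P" using P by (intro P.I_r_closed) auto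
    ultimately have "\<one> \<oplus> s \<otimes> q \<ominus> s \<otimes> q : P" using R.ideal_add(3)[OF P.is_ideal] by blast
    moreover have "\<one> \<oplus> s \<otimes> q \<ominus> s \<otimes> q = \<one>" using sR q by algebra
    ultimately show False using P.one_imp_carrier P.I_notcarr by simp
   qed
   then obtain a where a: "a < t" "z (Suc a) ~: P" by blast
   have Fa: "F (%j. if j = a then \<one> else \<zero>) = z 0 \<oplus> z (Suc a)"
    unfolding F_def using a by (subst R.sum_delta_left(2)) auto
   have "F (%j. if j = a then \<one> else \<zero>) ~: P"
   proof
    assume "F (%j. if j = a then \<one> else \<zero>) : P"
    then have "(z 0 \<oplus> z (Suc a)) \<ominus> z 0 : P" unfolding Fa using R.ideal_add(3)[OF P.is_ideal] True by blast
    moreover have *: "(p \<oplus> p') \<ominus> p = p'" if "p : carrier R" "p' : carrier R" for p p' using that by algebra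
    ultimately show False using a *[OF z z, of 0 "Suc a"] by metis
   qed
   then show ?thesis by (intro bexI[of _ "%j. if j = a then \<one> else \<zero>"]) auto
  qed
 qed
 then obtain \<beta>0 \<rho> q2 where \<beta>0: "\<beta>0 : {..<t} \<rightarrow> carrier R" and \<rho> [simp]: "\<rho> : carrier R" and q2 [simp]: "q2 : carrier R"
  and rF0: "\<rho> \<otimes> F \<beta>0 = \<one> \<oplus> s \<otimes> q2"
  using R.almost_local_global_polyfun[OF alg s _ polyF] by auto
 define \<beta> where "\<beta> a = (if a < t then \<beta>0 a else \<zero>)" for a
 have \<beta> [simp]: "\<beta> a : carrier R" for a using \<beta>0 by (auto simp: \<beta>_def)
 define d where "d = z 0 \<oplus> dot R t (%a. z (Suc a)) \<beta>"
 have [simp]: "d : carrier R" by (simp add: d_def)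
 have "(\<Oplus>a\<in>{..<t}. z (Suc a) \<otimes> \<beta>0 a) = (\<Oplus>a\<in>{..<t}. z (Suc a) \<otimes> \<beta> a)"
 proof (intro R.finsum_cong' refl)
  show "z (Suc a) \<otimes> \<beta>0 a = z (Suc a) \<otimes> \<beta> a" if "a : {..<t}" for a using that by (simp add: \<beta>_def)
 qed auto
 then have "F \<beta>0 = d" unfolding F_def d_def dot_def by simp
 then have rd: "\<rho> \<otimes> d = \<one> \<oplus> s \<otimes> q2" using rF0 by simp
 define y' where "y' a = \<pi> (y (Suc a) \<ominus>\<^bsub>M\<^esub> \<beta> a \<odot>\<^bsub>M\<^esub> y 0)" for a
 have y'c [simp]: "y' a : carrier M" for a by (simp add: y'_def)
 have y'H: "y' a : H" for a unfolding y'_def by (rule linear_projD(2)[OF lp]) simp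
 \<comment> \<open>The coefficients of a combination of the y (Suc a) - \<beta> a y 0, written in
   the original generators.\<close>
 define ext where "ext w a = (case a of 0 => \<ominus> dot R t w \<beta> | Suc a => w a)" for w :: "nat => 'a" and a
 have ext_c [simp]: "ext w a : carrier R" if "!!a. w a : carrier R" for w a
  using that by (auto simp: ext_def split: nat.split)
 have lcs: "lc M ?t v m = v 0 \<odot>\<^bsub>M\<^esub> m 0 \<oplus>\<^bsub>M\<^esub> lc M t (%a. v (Suc a)) (%a. m (Suc a))"
  if "!!a. v a : carrier R" "!!a. m a : carrier M" for v m
  unfolding lc_def using that by (intro M.finsum_lessThan_shift) simp
 have lcy': "lc M t w y' = \<pi> (lc M ?t (ext w) y)" if w [simp]: "!!a. w a : carrier R" for w
 proof -
  have "lc M t w y' = \<pi> (lc M t w (%a. y (Suc a) \<ominus>\<^bsub>M\<^esub> \<beta> a \<odot>\<^bsub>M\<^esub> y 0))"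
   unfolding y'_def by (rule linear_proj_lc[OF lp, symmetric]) auto
  also have "lc M t w (%a. y (Suc a) \<ominus>\<^bsub>M\<^esub> \<beta> a \<odot>\<^bsub>M\<^esub> y 0) = lc M ?t (ext w) y"
  proof -
   have "lc M t w (%a. y (Suc a) \<ominus>\<^bsub>M\<^esub> \<beta> a \<odot>\<^bsub>M\<^esub> y 0) =
     (\<Oplus>\<^bsub>M\<^esub>a\<in>{..<t}. w a \<odot>\<^bsub>M\<^esub> y (Suc a) \<oplus>\<^bsub>M\<^esub> (\<ominus> (w a \<otimes> \<beta> a)) \<odot>\<^bsub>M\<^esub> y 0)"
    unfolding lc_def by (intro M.finsum_cong') (auto simp: M.minus_eq smult_r_distr smult_r_minus smult_l_minus smult_assoc1)
   also have "... = lc M t w (%a. y (Suc a)) \<oplus>\<^bsub>M\<^esub> (\<Oplus>\<^bsub>M\<^esub>a\<in>{..<t}. (\<ominus> (w a \<otimes> \<beta> a)) \<odot>\<^bsub>M\<^esub> y 0)"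
    unfolding lc_def by (rule M.finsum_addf) auto
   also have "(\<Oplus>\<^bsub>M\<^esub>a\<in>{..<t}. (\<ominus> (w a \<otimes> \<beta> a)) \<odot>\<^bsub>M\<^esub> y 0) = (\<ominus> dot R t w \<beta>) \<odot>\<^bsub>M\<^esub> y 0"
    unfolding dot_def
    by (rule finsum_hom[symmetric, OF R.abelian_monoid_axioms M.abelian_monoid_axioms, of "%r. (\<ominus> r) \<odot>\<^bsub>M\<^esub> y 0"])
     (auto simp: R.minus_add smult_l_distr[symmetric])
   finally have 1: "lc M t w (%a. y (Suc a) \<ominus>\<^bsub>M\<^esub> \<beta> a \<odot>\<^bsub>M\<^esub> y 0) =
     lc M t w (%a. y (Suc a)) \<oplus>\<^bsub>M\<^esub> (\<ominus> dot R t w \<beta>) \<odot>\<^bsub>M\<^esub> y 0" .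
   have "lc M ?t (ext w) y = ext w 0 \<odot>\<^bsub>M\<^esub> y 0 \<oplus>\<^bsub>M\<^esub> lc M t (%a. ext w (Suc a)) (%a. y (Suc a))"
    by (rule lcs) auto
   then show ?thesis unfolding 1 by (simp add: ext_def M.a_comm)
  qed
  finally show ?thesis .
 qed
 \<comment> \<open>A relation of y' means that the element \<zeta> with coefficients ext w is l x,
   so ext w - l z has entries in \<open>C\<close>. Pairing these entries with (1, \<beta>)
   eliminates w and leaves l d in \<open>C\<close>. As d is a unit modulo \<open>s\<close>, l lies
   in \<open>C\<close>, and then so does every entry of w.\<close>
 have relC': "w a : C" if w [simp]: "!!a. w a : carrier R" and z0: "lc M t w y' = \<zero>\<^bsub>M\<^esub>" and a: "a < t" for w a
 proof -
  define \<zeta> where "\<zeta> = lc M ?t (ext w) y"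
  have [simp]: "\<zeta> : carrier M" by (simp add: \<zeta>_def)
  define l where "l = \<gamma> \<zeta>"
  have [simp]: "l : carrier R" by (simp add: l_def)
  have "\<pi> \<zeta> = \<zero>\<^bsub>M\<^esub>" using z0 lcy'[OF w] by (simp add: \<zeta>_def)
  then have "\<zeta> = l \<odot>\<^bsub>M\<^esub> x" unfolding \<pi>_def l_def by (rule M.minus_zeroD[rotated 2]) auto
  also have "... = lc M ?t (%i. l \<otimes> z i) y" unfolding x_def by (subst lc_smult) auto
  finally have "lc M ?t (%i. ext w i \<ominus> l \<otimes> z i) y = \<zero>\<^bsub>M\<^esub>"
   unfolding \<zeta>_def by (subst lc_minus) (auto simp: M.minus_eq M.r_neg)
  then have r: "ext w i \<ominus> l \<otimes> z i : C" if "i < ?t" for i using relC[of "%i. ext w i \<ominus> l \<otimes> z i" i] that by simp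
  have r0: "\<ominus> dot R t w \<beta> \<ominus> l \<otimes> z 0 : C" using r[of 0] by (simp add: ext_def)
  have ra: "w i \<ominus> l \<otimes> z (Suc i) : C" if "i < t" for i using r[of "Suc i"] that by (simp add: ext_def)
  have "dot R t \<beta> (%i. \<one> \<otimes> w i \<ominus> l \<otimes> z (Suc i)) : C" by (rule dotC) (auto simp: ra)
  then have 1: "dot R t w \<beta> \<ominus> l \<otimes> dot R t (%i. z (Suc i)) \<beta> : C"
   by (subst (asm) R.dot_lin_right) (auto simp: R.dot_comm[of \<beta>])
  have *: "\<ominus> p \<ominus> l \<otimes> z0 \<oplus> (p \<ominus> l \<otimes> p') = \<ominus> (l \<otimes> (z0 \<oplus> p'))" if "p : carrier R" "z0 : carrier R" "p' : carrier R" for p z0 p'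
   using that \<open>l : carrier R\<close> by algebra
  have "\<ominus> dot R t w \<beta> \<ominus> l \<otimes> z 0 \<oplus> (dot R t w \<beta> \<ominus> l \<otimes> dot R t (%i. z (Suc i)) \<beta>) = \<ominus> (l \<otimes> d)"
   unfolding d_def by (rule *) auto
  then have "\<ominus> (l \<otimes> d) : C" using R.ideal_add(1)[OF idC r0 1] by metis
  then have "\<ominus> (\<ominus> (l \<otimes> d)) : C" by (rule C.a_inv_closed)
  then have "l \<otimes> d : C" by simp
  then have "\<rho> \<otimes> (l \<otimes> d) : C" by (rule C.I_l_closed) simp
  moreover have "\<rho> \<otimes> (l \<otimes> d) = l \<otimes> (\<one> \<oplus> s \<otimes> q2)" unfolding rd[symmetric] by (simp add: R.m_ac)
  ultimately have "l : C" using unitC[of l q2] by simp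
  then have "l \<otimes> z (Suc a) : C" by (intro C.I_r_closed) auto
  moreover have "w a = (w a \<ominus> l \<otimes> z (Suc a)) \<oplus> l \<otimes> z (Suc a)"
  proof -
   have *: "p = (p \<ominus> p') \<oplus> p'" if "p : carrier R" "p' : carrier R" for p p' using that by algebra
   show ?thesis by (rule *) auto
  qed
  ultimately show ?thesis using R.ideal_add(1)[OF idC ra[OF a]] by metis
 qed
 have spans': "spans R (M\<lparr>carrier := H\<rparr>) t y'"
  unfolding spans_def
 proof (intro conjI allI ballI)
  fix \<zeta> assume "\<zeta> : carrier (M\<lparr>carrier := H\<rparr>)"
  then have \<zeta>: "\<zeta> : H" "\<zeta> : carrier M" by (auto simp: H_def)
  note [simp] = W(1)[OF \<zeta>(2)]
  define y0 where "y0 = \<pi> (y 0)"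
  have y0 [simp]: "y0 : carrier M" by (simp add: y0_def)
  have expand: "\<pi> (lc M ?t w y) = (w 0 \<oplus> dot R t (%a. w (Suc a)) \<beta>) \<odot>\<^bsub>M\<^esub> y0 \<oplus>\<^bsub>M\<^esub> lc M t (%a. w (Suc a)) y'"
   if w [simp]: "!!a. w a : carrier R" for w
  proof -
   let ?D = "dot R t (%a. w (Suc a)) \<beta>"
   let ?L = "lc M t (%a. w (Suc a)) (%a. y (Suc a))"
   let ?e = "ext (%a. w (Suc a))"
   have "lc M ?t ?e y = ?e 0 \<odot>\<^bsub>M\<^esub> y 0 \<oplus>\<^bsub>M\<^esub> lc M t (%a. ?e (Suc a)) (%a. y (Suc a))"
    by (rule lcs) auto
   then have e: "lc M ?t ?e y = (\<ominus> ?D) \<odot>\<^bsub>M\<^esub> y 0 \<oplus>\<^bsub>M\<^esub> ?L" by (simp add: ext_def)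
   have "lc M t (%a. w (Suc a)) y' = \<pi> ((\<ominus> ?D) \<odot>\<^bsub>M\<^esub> y 0 \<oplus>\<^bsub>M\<^esub> ?L)"
    using lcy'[of "%a. w (Suc a)"] e by simp
   also have "... = (\<ominus> ?D) \<odot>\<^bsub>M\<^esub> y0 \<oplus>\<^bsub>M\<^esub> \<pi> ?L"
    unfolding y0_def by (subst linear_projD(5)[OF lp]) (auto simp: linear_projD(6)[OF lp])
   finally have 1: "lc M t (%a. w (Suc a)) y' = (\<ominus> ?D) \<odot>\<^bsub>M\<^esub> y0 \<oplus>\<^bsub>M\<^esub> \<pi> ?L" .
   have "\<pi> (lc M ?t w y) = w 0 \<odot>\<^bsub>M\<^esub> y0 \<oplus>\<^bsub>M\<^esub> \<pi> ?L"
    unfolding y0_def by (subst lcs) (auto simp: linear_projD(5)[OF lp] linear_projD(6)[OF lp])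
   also have "... = (w 0 \<oplus> ?D) \<odot>\<^bsub>M\<^esub> y0 \<oplus>\<^bsub>M\<^esub> ((\<ominus> ?D) \<odot>\<^bsub>M\<^esub> y0 \<oplus>\<^bsub>M\<^esub> \<pi> ?L)"
    by (subst smult_l_distr) (auto simp: smult_l_minus M.a_assoc M.r_neg2)
   finally show ?thesis unfolding 1 .
  qed
  \<comment> \<open>Expanding \<pi> x = 0 in the new generators expresses d \<pi> (y 0) by y'; since
    d acts invertibly on \<open>M\<close>, \<pi> (y 0) is a combination of y' as well.\<close>
  have "\<pi> x = \<zero>\<^bsub>M\<^esub>" using px0[of \<one>] by simp
  then have "d \<odot>\<^bsub>M\<^esub> y0 \<oplus>\<^bsub>M\<^esub> lc M t (%a. z (Suc a)) y' = \<zero>\<^bsub>M\<^esub>"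
   unfolding x_def using expand[of z] by (simp add: d_def)
  then have "d \<odot>\<^bsub>M\<^esub> y0 = \<ominus>\<^bsub>M\<^esub> lc M t (%a. z (Suc a)) y'"
   by (intro M.minus_equality[symmetric]) auto
  then have "d \<odot>\<^bsub>M\<^esub> y0 = lc M t (%a. \<ominus> z (Suc a)) y'" by (simp add: lc_neg)
  then have "(\<rho> \<otimes> d) \<odot>\<^bsub>M\<^esub> y0 = \<rho> \<odot>\<^bsub>M\<^esub> lc M t (%a. \<ominus> z (Suc a)) y'" by (simp add: smult_assoc1)
  then have y0l: "y0 = \<rho> \<odot>\<^bsub>M\<^esub> lc M t (%a. \<ominus> z (Suc a)) y'" unfolding rd by (simp add: sker)
  let ?w = "W \<zeta>" and ?l = "W \<zeta> 0 \<oplus> dot R t (%a. W \<zeta> (Suc a)) \<beta>"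
  define v where "v a = ?l \<otimes> (\<rho> \<otimes> \<ominus> z (Suc a)) \<oplus> ?w (Suc a)" for a
  have v [simp]: "v a : carrier R" for a by (simp add: v_def)
  have "\<zeta> = \<pi> (lc M ?t ?w y)" using linear_projD(4)[OF lp \<zeta>(1)] W(2)[OF \<zeta>(2)] by simp
  also have "... = ?l \<odot>\<^bsub>M\<^esub> y0 \<oplus>\<^bsub>M\<^esub> lc M t (%a. ?w (Suc a)) y'" by (rule expand) simp
  also have "?l \<odot>\<^bsub>M\<^esub> y0 = lc M t (%a. ?l \<otimes> (\<rho> \<otimes> \<ominus> z (Suc a))) y'"
   unfolding y0l by (simp add: lc_smult)
  also have "... \<oplus>\<^bsub>M\<^esub> lc M t (%a. ?w (Suc a)) y' = lc M t v y'"
   unfolding v_def by (rule lc_add[symmetric]) auto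
  also have "... = lc (M\<lparr>carrier := H\<rparr>) t v y'"
   by (rule submodule_lc[OF HM, symmetric]) (auto simp: y'H)
  finally show "EX w. (ALL i. w i : carrier R) & \<zeta> = lc (M\<lparr>carrier := H\<rparr>) t w y'" using v by blast
 qed (use y'H in simp)
 interpret N: module R "M\<lparr>carrier := H\<rparr>"
  by (rule submodule.submodule_is_module[OF HM module_axioms])
 have fgr: "fg_relations R (M\<lparr>carrier := H\<rparr>) t y'"
  by (rule N.fg_relations_change[OF spans_proj[OF lp y] spans' fg_relations_proj[OF lp y rel]])
 have "ALL w. (ALL a. w a : carrier R) --> lc (M\<lparr>carrier := H\<rparr>) t w y' = \<zero>\<^bsub>M\<^esub> --> (ALL a<t. w a : C)"
 proof (intro allI impI)
  fix w a assume w: "ALL a. w a : carrier R" and z: "lc (M\<lparr>carrier := H\<rparr>) t w y' = \<zero>\<^bsub>M\<^esub>" and a: "a < t"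
  have "lc M t w y' = \<zero>\<^bsub>M\<^esub>" using z w by (subst submodule_lc[OF HM _ y'H, symmetric]) auto
  then show "w a : C" using w a by (intro relC'[of w]) auto
 qed
 then show ?thesis
  using idC fgC sC CI step spans' fgr
  by (intro exI[of _ C] exI[of _ \<gamma>] exI[of _ \<pi>] exI[of _ H] exI[of _ y']) simp
qed

text \<open>A dual basis h of \<open>C\<close> gives the elements h i s required by
  \<open>invertible_idealI\<close>: linearity yields x (h i s) = h i (x s) = s (h i x).\<close>

lemma (in semihereditary_ring) fg_regular_invertible:
 assumes C: "fg_ideal R C" and sC: "s : C" and s: "s : regular_elements R"
 shows "invertible_ideal C R"
proof -
 note sR [simp] = regularD(1)[OF s]
 obtain N :: nat and g where g: "!!i. g i : carrier R" and Cg: "C = Idl (g ` {..<N})"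
  using C unfolding fg_ideal_def by blast
 have gR: "g ` {..<N} <= carrier R" using g by auto
 have idC: "ideal C R" unfolding Cg by (rule genideal_ideal[OF gR])
 interpret C: ideal C R by fact
 obtain h where hc: "!!i x. x : C ==> h i x : carrier R"
  and ha: "!!i x z. x : C ==> z : C ==> h i (x \<oplus> z) = h i x \<oplus> h i z"
  and hm: "!!i r x. r : carrier R ==> x : C ==> h i (r \<otimes> x) = r \<otimes> h i x"
  and hs: "!!x. x : C ==> x = (\<Oplus>i\<in>{..<N}. h i x \<otimes> g i)"
  by (rule dual_basis[of "{..<N}" g]) (auto simp: Cg g)
 show ?thesis
 proof (rule invertible_idealI[OF idC sC s finite_lessThan])
  show "g i : C" if "i : {..<N}" for i unfolding Cg using genideal_self[OF gR] that by blast
  show "h i s : carrier R" for i by (rule hc[OF sC])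
  have "(\<Oplus>i\<in>{..<N}. h i s \<otimes> g i) = (\<Oplus>i\<in>{..<N}. g i \<otimes> h i s)"
   using g hc[OF sC] by (intro finsum_cong') (auto simp: m_comm)
  then show "s = (\<Oplus>i\<in>{..<N}. g i \<otimes> h i s)" using hs[OF sC] by simp
  fix i x assume x: "x : C"
  have "x \<otimes> h i s = s \<otimes> h i x"
   using hm[OF C.Icarr[OF x] sC, of i] hm[OF sR x, of i] m_comm[of x s] C.Icarr[OF x] by simp
  then show "EX y:carrier R. x \<otimes> h i s = s \<otimes> y" using hc[OF x] by blast
 qed
qed

text \<open>A coordinate form of an isomorphism of \<open>M\<close> onto the direct sum of the R / I
  j, with indices starting at 0, whereas those of \<open>decomp_coords\<close> start at 1.\<close>

definition torsion_coords ::
 "('a, 'r) ring_scheme => ('a, 'b, 'm) module_scheme => nat => (nat => 'a set) => (nat => 'b => 'a) => bool"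
where
 "torsion_coords R M m I \<gamma> \<longleftrightarrow>
  (ALL j<m. invertible_ideal (I j) R & I j ~= carrier R) & (ALL j. Suc j < m --> I (Suc j) <= I j) &
  (ALL j<m. ALL x:carrier M. \<gamma> j x : carrier R) &
  (ALL j<m. ALL x:carrier M. ALL y:carrier M. \<gamma> j (x \<oplus>\<^bsub>M\<^esub> y) \<ominus>\<^bsub>R\<^esub> (\<gamma> j x \<oplus>\<^bsub>R\<^esub> \<gamma> j y) : I j) &
  (ALL j<m. ALL r:carrier R. ALL x:carrier M. \<gamma> j (r \<odot>\<^bsub>M\<^esub> x) \<ominus>\<^bsub>R\<^esub> r \<otimes>\<^bsub>R\<^esub> \<gamma> j x : I j) &
  (ALL x:carrier M. (ALL j<m. \<gamma> j x : I j) --> x = \<zero>\<^bsub>M\<^esub>) &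
  (ALL c. (ALL j<m. c j : carrier R) --> (EX x:carrier M. ALL j<m. \<gamma> j x \<ominus>\<^bsub>R\<^esub> c j : I j))"

text \<open>The bound \<open>I\<close> on the entries of relations is what makes the ideals
  decrease: a step yields \<open>C\<close> inside \<open>I\<close>, and the relations of the
  complement have their entries in \<open>C\<close>, which is the bound for the next step. When
  \<open>C\<close> is the whole ring, the cyclic summand is zero; nothing is recorded, and so all
  recorded ideals are proper.\<close>

lemma ex_torsion_coords:
 fixes M :: "('a, 'b, 'm) module_scheme"
 assumes sh: "semihereditary_ring R" and alg: "almost_local_global R" and s: "s : regular_elements R"
 shows "module R M ==> spans R M t y ==> fg_relations R M t y ==>
  ALL z:carrier M. s \<odot>\<^bsub>M\<^esub> z = \<zero>\<^bsub>M\<^esub> ==> ideal I R ==>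
  ALL w. (ALL a. w a : carrier R) --> lc M t w y = \<zero>\<^bsub>M\<^esub> --> (ALL a<t. w a : I) ==>
  EX m Is \<gamma>. torsion_coords R M m Is \<gamma> & (0 < m --> Is 0 <= I)"
proof (induction t arbitrary: M y I)
 case 0
 interpret module R M by fact
 have "x = \<zero>\<^bsub>M\<^esub>" if x: "x : carrier M" for x
 proof -
  obtain w where "x = lc M 0 w y" using 0(2) x unfolding spans_def by blast
  then show ?thesis by (simp add: lc_def)
 qed
 then have "torsion_coords R M 0 (%_. {}) (%_ _. \<zero>\<^bsub>R\<^esub>)"
  unfolding torsion_coords_def using M.zero_closed by auto
 then show ?case by blast
next
 case (Suc t)
 interpret module R M by fact
 interpret sh: semihereditary_ring R by fact
 obtain C \<gamma> \<pi> H y' where C: "ideal C R & fg_ideal R C & s : C & C <= I" and step: "torsion_step R M C \<gamma> \<pi> H"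
  and sp: "spans R (M\<lparr>carrier := H\<rparr>) t y'" and rel: "fg_relations R (M\<lparr>carrier := H\<rparr>) t y'"
  and relC: "ALL w. (ALL a. w a : carrier R) --> lc (M\<lparr>carrier := H\<rparr>) t w y' = \<zero>\<^bsub>M\<^esub> --> (ALL a<t. w a : C)"
  using ex_torsion_step[OF sh alg s Suc.prems(2-6)] by blast
 have lp: "linear_proj R M H \<pi>" using step unfolding torsion_step_def by blast
 have HM: "submodule H R M" by (rule linear_projD(1)[OF lp])
 have idC: "ideal C R" using C by blast
 interpret C: ideal C R by fact
 let ?N = "M\<lparr>carrier := H\<rparr>"
 interpret N: module R ?N by (rule submodule.submodule_is_module[OF HM module_axioms])
 have sN: "ALL z:carrier ?N. s \<odot>\<^bsub>?N\<^esub> z = \<zero>\<^bsub>?N\<^esub>"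
  using Suc.prems(4) submodule_closed[OF HM] by simp
 have relC': "ALL w. (ALL a. w a : carrier R) --> lc ?N t w y' = \<zero>\<^bsub>?N\<^esub> --> (ALL a<t. w a : C)" using relC by simp
 obtain m Is \<gamma>s where tc: "torsion_coords R ?N m Is \<gamma>s" and m0: "0 < m --> Is 0 <= C"
  using Suc.IH[OF N.module_axioms sp rel sN idC relC'] by blast
 have t1: "ALL j<m. invertible_ideal (Is j) R & Is j ~= carrier R"
  and t2: "ALL j. Suc j < m --> Is (Suc j) <= Is j"
  and t3: "ALL j<m. ALL x:carrier ?N. \<gamma>s j x : carrier R"
  and t4: "ALL j<m. ALL x:carrier ?N. ALL y:carrier ?N. \<gamma>s j (x \<oplus>\<^bsub>?N\<^esub> y) \<ominus>\<^bsub>R\<^esub> (\<gamma>s j x \<oplus>\<^bsub>R\<^esub> \<gamma>s j y) : Is j"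
  and t5: "ALL j<m. ALL r:carrier R. ALL x:carrier ?N. \<gamma>s j (r \<odot>\<^bsub>?N\<^esub> x) \<ominus>\<^bsub>R\<^esub> r \<otimes>\<^bsub>R\<^esub> \<gamma>s j x : Is j"
  and t6: "ALL x:carrier ?N. (ALL j<m. \<gamma>s j x : Is j) --> x = \<zero>\<^bsub>?N\<^esub>"
  and t7: "ALL c. (ALL j<m. c j : carrier R) --> (EX x:carrier ?N. ALL j<m. \<gamma>s j x \<ominus>\<^bsub>R\<^esub> c j : Is j)"
  using tc[unfolded torsion_coords_def] by - (elim conjE, assumption)+
 note [simp] = linear_projD(2)[OF lp] linear_projD(3)[OF lp]
 have g: "\<gamma> x : carrier R" if "x : carrier M" for x using step that unfolding torsion_step_def by blast
 have gid: "\<pi> x = x" if "x : carrier M" "\<gamma> x : C" for x using step that unfolding torsion_step_def by blast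
 have gH: "\<gamma> x : C" if "x : H" for x using step that unfolding torsion_step_def by blast
 have gadd: "\<gamma> (x \<oplus>\<^bsub>M\<^esub> z) \<ominus>\<^bsub>R\<^esub> (\<gamma> x \<oplus>\<^bsub>R\<^esub> \<gamma> z) : C" if "x : carrier M" "z : carrier M" for x z
  using step that unfolding torsion_step_def by blast
 have gsm: "\<gamma> (r \<odot>\<^bsub>M\<^esub> x) \<ominus>\<^bsub>R\<^esub> r \<otimes>\<^bsub>R\<^esub> \<gamma> x : C" if "x : carrier M" "r : carrier R" for x r
  using step that unfolding torsion_step_def by blast
 have gsurj: "EX x:carrier M. \<gamma> x \<ominus>\<^bsub>R\<^esub> c : C & \<pi> x = \<zero>\<^bsub>M\<^esub>" if "c : carrier R" for c
  using step that unfolding torsion_step_def by blast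
 show ?case
 proof (cases "C = carrier R")
  case True
  have "H = carrier M"
  proof
   show "H <= carrier M" using submodule_closed[OF HM] by blast
   show "carrier M <= H"
   proof
    fix x assume x: "x : carrier M"
    then have "\<pi> x = x" using gid g True by simp
    then show "x : H" using linear_projD(2)[OF lp x] by simp
   qed
  qed
  then have "?N = M" by simp
  then have "torsion_coords R M m Is \<gamma>s" using tc by simp
  moreover have "0 < m --> Is 0 <= I" using m0 C by auto
  ultimately show ?thesis by (intro exI conjI)
 next
  case False
  let ?I = "case_nat C Is" and ?\<gamma> = "case_nat \<gamma> (%j x. \<gamma>s j (\<pi> x))"
  have sl: "(ALL j<Suc m. P j) \<longleftrightarrow> P 0 & (ALL j<m. P (Suc j))" for P
   by (auto simp: less_Suc_eq_0_disj)
  have "torsion_coords R M (Suc m) ?I ?\<gamma>"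
   unfolding torsion_coords_def sl nat.case
  proof (intro conjI ballI impI)
   show "invertible_ideal C R" using sh.fg_regular_invertible[of C s] C s by blast
   show "C ~= carrier R" by fact
   show "ALL j<m. invertible_ideal (Is j) R & Is j ~= carrier R" by (rule t1)
   show "ALL j. Suc j < Suc m --> Is j <= ?I j"
   proof (intro allI impI)
    fix j assume j: "Suc j < Suc m"
    show "Is j <= ?I j"
    proof (cases j)
     case 0 then show ?thesis using m0 j by simp
    next
     case (Suc j') then show ?thesis using t2 j by simp
    qed
   qed
   show "\<gamma> x : carrier R" if "x : carrier M" for x using g that .
   show "ALL j<m. ALL x:carrier M. \<gamma>s j (\<pi> x) : carrier R" using t3 by simp
   show "\<gamma> (x \<oplus>\<^bsub>M\<^esub> z) \<ominus>\<^bsub>R\<^esub> (\<gamma> x \<oplus>\<^bsub>R\<^esub> \<gamma> z) : C" if "x : carrier M" "z : carrier M" for x z using gadd that .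
   show "ALL j<m. ALL x:carrier M. ALL z:carrier M. \<gamma>s j (\<pi> (x \<oplus>\<^bsub>M\<^esub> z)) \<ominus>\<^bsub>R\<^esub> (\<gamma>s j (\<pi> x) \<oplus>\<^bsub>R\<^esub> \<gamma>s j (\<pi> z)) : Is j"
    using t4 by (simp add: linear_projD(5)[OF lp])
   show "\<gamma> (r \<odot>\<^bsub>M\<^esub> x) \<ominus>\<^bsub>R\<^esub> r \<otimes>\<^bsub>R\<^esub> \<gamma> x : C" if "r : carrier R" "x : carrier M" for x r using gsm that by blast
   show "ALL j<m. ALL r:carrier R. ALL x:carrier M. \<gamma>s j (\<pi> (r \<odot>\<^bsub>M\<^esub> x)) \<ominus>\<^bsub>R\<^esub> r \<otimes>\<^bsub>R\<^esub> \<gamma>s j (\<pi> x) : Is j"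
    using t5 by (simp add: linear_projD(6)[OF lp])
   show "x = \<zero>\<^bsub>M\<^esub>" if x: "x : carrier M" "\<gamma> x : C & (ALL j<m. \<gamma>s j (\<pi> x) : Is j)" for x
   proof -
    have "\<pi> x = \<zero>\<^bsub>M\<^esub>" using t6 x by simp
    then show ?thesis using gid x by simp
   qed
   show "ALL c. c 0 : carrier R & (ALL j<m. c (Suc j) : carrier R) -->
    (EX x:carrier M. \<gamma> x \<ominus>\<^bsub>R\<^esub> c 0 : C & (ALL j<m. \<gamma>s j (\<pi> x) \<ominus>\<^bsub>R\<^esub> c (Suc j) : Is j))"
   proof (intro allI impI)
    fix c assume c: "c 0 : carrier R & (ALL j<m. c (Suc j) : carrier R)"
    then obtain x0 where x0: "x0 : carrier M" "\<gamma> x0 \<ominus>\<^bsub>R\<^esub> c 0 : C" "\<pi> x0 = \<zero>\<^bsub>M\<^esub>" using gsurj by blast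
    obtain x1 where x1: "x1 : carrier ?N" "ALL j<m. \<gamma>s j x1 \<ominus>\<^bsub>R\<^esub> c (Suc j) : Is j"
     using c t7[rule_format, of "%j. c (Suc j)"] by auto
    have x1H: "x1 : H" "x1 : carrier M" using x1 submodule_closed[OF HM] by auto
    have "\<pi> (x0 \<oplus>\<^bsub>M\<^esub> x1) = x1" using x0 x1H linear_projD(4)[OF lp] by (simp add: linear_projD(5)[OF lp])
    moreover have "\<gamma> (x0 \<oplus>\<^bsub>M\<^esub> x1) \<ominus>\<^bsub>R\<^esub> c 0 : C"
    proof -
     have e: "a \<ominus>\<^bsub>R\<^esub> c = (a \<ominus>\<^bsub>R\<^esub> (b \<oplus>\<^bsub>R\<^esub> b')) \<oplus>\<^bsub>R\<^esub> ((b \<ominus>\<^bsub>R\<^esub> c) \<oplus>\<^bsub>R\<^esub> b')"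
      if "a : carrier R" "b : carrier R" "b' : carrier R" "c : carrier R" for a b b' c
      using that by algebra
     have "\<gamma> (x0 \<oplus>\<^bsub>M\<^esub> x1) \<ominus>\<^bsub>R\<^esub> c 0 = (\<gamma> (x0 \<oplus>\<^bsub>M\<^esub> x1) \<ominus>\<^bsub>R\<^esub> (\<gamma> x0 \<oplus>\<^bsub>R\<^esub> \<gamma> x1)) \<oplus>\<^bsub>R\<^esub> ((\<gamma> x0 \<ominus>\<^bsub>R\<^esub> c 0) \<oplus>\<^bsub>R\<^esub> \<gamma> x1)"
      by (rule e) (use g x0 x1H c in auto)
     then show ?thesis
      using R.ideal_add(1)[OF idC gadd[OF x0(1) x1H(2)] R.ideal_add(1)[OF idC x0(2) gH[OF x1H(1)]]] by metis
    qed
    ultimately show "EX x:carrier M. \<gamma> x \<ominus>\<^bsub>R\<^esub> c 0 : C & (ALL j<m. \<gamma>s j (\<pi> x) \<ominus>\<^bsub>R\<^esub> c (Suc j) : Is j)"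
     using x0 x1 x1H by (intro bexI[of _ "x0 \<oplus>\<^bsub>M\<^esub> x1"]) auto
   qed
  qed
  then show ?thesis using C by (intro exI[of _ "Suc m"] exI[of _ ?I] exI[of _ ?\<gamma>]) auto
 qed
qed

section \<open>Coordinates of a decomposition\<close>

text \<open>A coordinate form of an isomorphism onto \<open>decomposition_sum\<close>: \<gamma> j x
  represents a coset of \<open>I j\<close>, and \<phi> i k x is an element of J i k. The last two
  clauses are injectivity and surjectivity.\<close>

definition decomp_coords ::
 "('a, 'r) ring_scheme => ('a, 'b, 'm) module_scheme => nat => (nat => 'a set) => nat =>
  (nat => nat) => (nat => nat => 'a set) => (nat => 'b => 'a) => (nat => nat => 'b => 'a) => bool"
where
 "decomp_coords R M m I p n J \<gamma> \<phi> \<longleftrightarrow>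
  (ALL j:{1..m}. ALL x:carrier M. \<gamma> j x : carrier R) &
  (ALL j:{1..m}. ALL x:carrier M. ALL y:carrier M. \<gamma> j (x \<oplus>\<^bsub>M\<^esub> y) \<ominus>\<^bsub>R\<^esub> (\<gamma> j x \<oplus>\<^bsub>R\<^esub> \<gamma> j y) : I j) &
  (ALL j:{1..m}. ALL r:carrier R. ALL x:carrier M. \<gamma> j (r \<odot>\<^bsub>M\<^esub> x) \<ominus>\<^bsub>R\<^esub> r \<otimes>\<^bsub>R\<^esub> \<gamma> j x : I j) &
  (ALL i:{1..p}. ALL k:{1..n i}. functional R M (\<phi> i k)) &
  (ALL i:{1..p}. ALL k:{1..n i}. ALL x:carrier M. \<phi> i k x : J i k) &
  (ALL x:carrier M. (ALL j:{1..m}. \<gamma> j x : I j) --> (ALL i:{1..p}. ALL k:{1..n i}. \<phi> i k x = \<zero>\<^bsub>R\<^esub>) --> x = \<zero>\<^bsub>M\<^esub>) &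
  (ALL c a. (ALL j:{1..m}. c j : carrier R) --> (ALL i:{1..p}. ALL k:{1..n i}. a i k : J i k) -->
   (EX x:carrier M. (ALL j:{1..m}. \<gamma> j x \<ominus>\<^bsub>R\<^esub> c j : I j) & (ALL i:{1..p}. ALL k:{1..n i}. \<phi> i k x = a i k)))"

text \<open>Just what is needed to read an element of \<open>decomposition_sum\<close> as a pair of
  families. The existence proof enters here before it has shown anything to be a decomposition, so
  nothing about the idempotents is assumed.\<close>

locale decomposition_shape = module R M
 for R :: "('a, 'r) ring_scheme" (structure) and M :: "('a, 'b, 'm) module_scheme" (structure) +
 fixes m p :: nat and I :: "nat => 'a set" and e :: "nat => 'a" and n :: "nat => nat"
  and J :: "nat => nat => 'a set"
 assumes ideal_I: "j : {1..m} ==> ideal (I j) R"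
  and J_coset: "i : {1..p} ==> k : {1..n i} ==> J i k #> e i = J i k"
  and J_carrier: "i : {1..p} ==> k : {1..n i} ==> J i k <= carrier R"
begin

abbreviation "D \<equiv> decomposition_sum R m I p e n J"

lemma coset_eq_iff:
 assumes "j : {1..m}" "a : carrier R" "b : carrier R"
 shows "I j +> a = I j +> b \<longleftrightarrow> a \<ominus> b : I j"
 using R.quotient_eq_iff_same_a_r_cos[OF ideal_I[OF assms(1)] assms(2,3)] by simp

lemma carrier_D:
 "x : carrier D \<longleftrightarrow>
  fst x : (\<Pi>\<^sub>E j\<in>{1..m}. carrier (R Quot (I j))) & snd x : (\<Pi>\<^sub>E i\<in>{1..p}. \<Pi>\<^sub>E k\<in>{1..n i}. J i k)"
proof -
 have "(\<Pi>\<^sub>E i\<in>{1..p}. \<Pi>\<^sub>E k\<in>{1..n i}. J i k #> e i) = (\<Pi>\<^sub>E i\<in>{1..p}. \<Pi>\<^sub>E k\<in>{1..n i}. J i k)"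
  using J_coset by (intro PiE_cong) auto
 then show ?thesis
  by (cases x) (simp add: decomposition_sum_def direct_sum2_def direct_sum_def quotient_module_def ideal_module_def self_module_def)
qed

lemma add_D:
 "x \<oplus>\<^bsub>D\<^esub> y = (\<lambda>j\<in>{1..m}. fst x j \<oplus>\<^bsub>R Quot (I j)\<^esub> fst y j, \<lambda>i\<in>{1..p}. \<lambda>k\<in>{1..n i}. snd x i k \<oplus> snd y i k)"
 by (simp add: decomposition_sum_def direct_sum2_def direct_sum_def quotient_module_def ideal_module_def self_module_def)

lemma smult_D:
 "r \<odot>\<^bsub>D\<^esub> x = (\<lambda>j\<in>{1..m}. (I j +> r) \<otimes>\<^bsub>R Quot (I j)\<^esub> fst x j, \<lambda>i\<in>{1..p}. \<lambda>k\<in>{1..n i}. r \<otimes> snd x i k)"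
 by (simp add: decomposition_sum_def direct_sum2_def direct_sum_def quotient_module_def ideal_module_def self_module_def)

lemma quot_ops:
 assumes "j : {1..m}" "a : carrier R" "b : carrier R"
 shows "(I j +> a) \<oplus>\<^bsub>R Quot (I j)\<^esub> (I j +> b) = I j +> (a \<oplus> b)"
  "(I j +> a) \<otimes>\<^bsub>R Quot (I j)\<^esub> (I j +> b) = I j +> (a \<otimes> b)"
  "I j +> a : carrier (R Quot (I j))"
 using ring_hom_memE[OF ideal.rcos_ring_hom[OF ideal_I[OF assms(1)]]] assms by metis+

lemma coords_imp_iso:
 assumes "decomp_coords R M m I p n J \<gamma> \<phi>"
 shows "mod_isomorphic R M D"
proof -
 have dc1: "ALL j:{1..m}. ALL x:carrier M. \<gamma> j x : carrier R"
  and dc2: "ALL j:{1..m}. ALL x:carrier M. ALL y:carrier M. \<gamma> j (x \<oplus>\<^bsub>M\<^esub> y) \<ominus> (\<gamma> j x \<oplus> \<gamma> j y) : I j"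
  and dc3: "ALL j:{1..m}. ALL r:carrier R. ALL x:carrier M. \<gamma> j (r \<odot>\<^bsub>M\<^esub> x) \<ominus> r \<otimes> \<gamma> j x : I j"
  and dc4: "ALL i:{1..p}. ALL k:{1..n i}. functional R M (\<phi> i k)"
  and dc5: "ALL i:{1..p}. ALL k:{1..n i}. ALL x:carrier M. \<phi> i k x : J i k"
  and dc6: "ALL x:carrier M. (ALL j:{1..m}. \<gamma> j x : I j) --> (ALL i:{1..p}. ALL k:{1..n i}. \<phi> i k x = \<zero>) --> x = \<zero>\<^bsub>M\<^esub>"
  and surj: "ALL c a. (ALL j:{1..m}. c j : carrier R) --> (ALL i:{1..p}. ALL k:{1..n i}. a i k : J i k) -->
   (EX x:carrier M. (ALL j:{1..m}. \<gamma> j x \<ominus> c j : I j) & (ALL i:{1..p}. ALL k:{1..n i}. \<phi> i k x = a i k))"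
  using assms[unfolded decomp_coords_def] by - (elim conjE, assumption)+
 have gc: "\<gamma> j x : carrier R" if "j : {1..m}" "x : carrier M" for j x using dc1 that by blast
 have gadd: "\<gamma> j (x \<oplus>\<^bsub>M\<^esub> y) \<ominus> (\<gamma> j x \<oplus> \<gamma> j y) : I j" if "j : {1..m}" "x : carrier M" "y : carrier M" for j x y using dc2 that by blast
 have gsm: "\<gamma> j (r \<odot>\<^bsub>M\<^esub> x) \<ominus> r \<otimes> \<gamma> j x : I j" if "j : {1..m}" "r : carrier R" "x : carrier M" for j x r using dc3 that by blast
 have f: "functional R M (\<phi> i k)" if "i : {1..p}" "k : {1..n i}" for i k using dc4 that by blast
 have fJ: "\<phi> i k x : J i k" if "i : {1..p}" "k : {1..n i}" "x : carrier M" for i k x using dc5 that by blast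
 have inj: "x = \<zero>\<^bsub>M\<^esub>" if "x : carrier M" "!!j. j : {1..m} ==> \<gamma> j x : I j" "!!i k. i : {1..p} ==> k : {1..n i} ==> \<phi> i k x = \<zero>" for x
  using dc6 that by blast
 define h where "h x = (\<lambda>j\<in>{1..m}. I j +> \<gamma> j x, \<lambda>i\<in>{1..p}. \<lambda>k\<in>{1..n i}. \<phi> i k x)" for x
 have hD: "h x : carrier D" if "x : carrier M" for x
  unfolding carrier_D
 proof
  show "fst (h x) : (\<Pi>\<^sub>E j\<in>{1..m}. carrier (R Quot (I j)))"
   unfolding h_def fst_conv restrict_PiE_iff by (intro ballI quot_ops(3)[OF _ _ R.zero_closed] gc that)
  show "snd (h x) : (\<Pi>\<^sub>E i\<in>{1..p}. \<Pi>\<^sub>E k\<in>{1..n i}. J i k)"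
   unfolding h_def snd_conv restrict_PiE_iff by (intro ballI fJ that)
 qed
 have hom: "h : mod_hom R M D"
  unfolding mod_hom_def
 proof (intro CollectI conjI ballI funcsetI)
  show "h x : carrier D" if "x : carrier M" for x using hD that .
  show "h (x \<oplus>\<^bsub>M\<^esub> y) = h x \<oplus>\<^bsub>D\<^esub> h y" if xy: "x : carrier M" "y : carrier M" for x y
  proof -
   have "I j +> \<gamma> j (x \<oplus>\<^bsub>M\<^esub> y) = (I j +> \<gamma> j x) \<oplus>\<^bsub>R Quot (I j)\<^esub> (I j +> \<gamma> j y)" if j: "j : {1..m}" for j
    using gadd[OF j xy] gc[OF j] xy by (simp only: quot_ops(1)[OF j] coset_eq_iff[OF j] M.add.m_closed R.add.m_closed)
   moreover have "\<phi> i k (x \<oplus>\<^bsub>M\<^esub> y) = \<phi> i k x \<oplus> \<phi> i k y" if "i : {1..p}" "k : {1..n i}" for i k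
    by (rule functional_add[OF f[OF that] xy])
   ultimately show ?thesis unfolding h_def add_D by (intro prod_eqI ext) (simp_all add: restrict_def)
  qed
  show "h (r \<odot>\<^bsub>M\<^esub> x) = r \<odot>\<^bsub>D\<^esub> h x" if r: "r : carrier R" and x: "x : carrier M" for r x
  proof -
   have "I j +> \<gamma> j (r \<odot>\<^bsub>M\<^esub> x) = (I j +> r) \<otimes>\<^bsub>R Quot (I j)\<^esub> (I j +> \<gamma> j x)" if j: "j : {1..m}" for j
    using gsm[OF j r x] gc[OF j] x r by (simp only: quot_ops(2)[OF j] coset_eq_iff[OF j] smult_closed R.m_closed)
   moreover have "\<phi> i k (r \<odot>\<^bsub>M\<^esub> x) = r \<otimes> \<phi> i k x" if "i : {1..p}" "k : {1..n i}" for i k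
    by (rule functional_smult[OF f[OF that] r x])
   ultimately show ?thesis unfolding h_def smult_D by (intro prod_eqI ext) (simp_all add: restrict_def)
  qed
 qed
 have "bij_betw h (carrier M) (carrier D)"
  unfolding bij_betw_def
 proof
  show "inj_on h (carrier M)"
  proof (rule inj_onI)
   fix x y assume x: "x : carrier M" and y: "y : carrier M" and e: "h x = h y"
   have "x \<ominus>\<^bsub>M\<^esub> y = \<zero>\<^bsub>M\<^esub>"
   proof (rule inj)
    fix j assume j: "j : {1..m}"
    note Ij = ideal_I[OF j]
    have "I j +> \<gamma> j x = I j +> \<gamma> j y" using e j unfolding h_def by (auto dest: fun_cong[of _ _ j])
    then have 1: "\<gamma> j x \<ominus> \<gamma> j y : I j" using coset_eq_iff[OF j] gc[OF j] x y by simp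
    have 2: "\<gamma> j (x \<ominus>\<^bsub>M\<^esub> y) \<ominus> (\<gamma> j x \<oplus> \<gamma> j (\<ominus>\<^bsub>M\<^esub> y)) : I j" unfolding M.minus_eq using x y by (intro gadd j) auto
    have my: "\<ominus>\<^bsub>M\<^esub> y = (\<ominus> \<one>) \<odot>\<^bsub>M\<^esub> y" using y by (simp add: smult_l_minus)
    have 3: "\<gamma> j (\<ominus>\<^bsub>M\<^esub> y) \<ominus> (\<ominus> \<one>) \<otimes> \<gamma> j y : I j" unfolding my using y by (intro gsm j) auto
    have *: "a = (a \<ominus> (b \<oplus> c)) \<oplus> ((c \<ominus> (\<ominus> \<one>) \<otimes> d) \<oplus> (b \<ominus> d))"
     if "a : carrier R" "b : carrier R" "c : carrier R" "d : carrier R" for a b c d using that by algebra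
    have "\<gamma> j (x \<ominus>\<^bsub>M\<^esub> y) = (\<gamma> j (x \<ominus>\<^bsub>M\<^esub> y) \<ominus> (\<gamma> j x \<oplus> \<gamma> j (\<ominus>\<^bsub>M\<^esub> y))) \<oplus> ((\<gamma> j (\<ominus>\<^bsub>M\<^esub> y) \<ominus> (\<ominus> \<one>) \<otimes> \<gamma> j y) \<oplus> (\<gamma> j x \<ominus> \<gamma> j y))"
     by (rule *) (use gc[OF j] x y in auto)
    then show "\<gamma> j (x \<ominus>\<^bsub>M\<^esub> y) : I j"
     using R.ideal_add(1)[OF Ij 2 R.ideal_add(1)[OF Ij 3 1]] by metis
   next
    fix i k assume ik: "i : {1..p}" "k : {1..n i}"
    have "snd (h x) i k = snd (h y) i k" using e by simp
    then have "\<phi> i k x = \<phi> i k y" using ik unfolding h_def by simp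
    then show "\<phi> i k (x \<ominus>\<^bsub>M\<^esub> y) = \<zero>"
     using x y f[OF ik] functional_closed[OF f[OF ik] y] by (simp add: functional_minus R.minus_eq R.r_neg)
   qed (use x y in simp)
   then show "x = y" by (rule M.minus_zeroD[OF x y])
  qed
  show "h ` carrier M = carrier D"
  proof (intro equalityI subsetI)
   fix d assume d: "d : carrier D"
   note d1 = conjunct1[OF d[unfolded carrier_D]] and d2 = conjunct2[OF d[unfolded carrier_D]]
   have "EX r:carrier R. fst d j = I j +> r" if j: "j : {1..m}" for j
   proof -
    have "fst d j : carrier (R Quot (I j))" using d j unfolding carrier_D by auto
    then show ?thesis by (meson R.FactRing_carrierE)
   qed
   then obtain c where c: "!!j. j : {1..m} ==> c j : carrier R & fst d j = I j +> c j" by metis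
   have a: "snd d i k : J i k" if "i : {1..p}" "k : {1..n i}" for i k 
    by (rule PiE_mem[OF PiE_mem[OF conjunct2[OF d[unfolded carrier_D]] that(1)] that(2)])
   have "EX x:carrier M. (ALL j:{1..m}. \<gamma> j x \<ominus> c j : I j) & (ALL i:{1..p}. ALL k:{1..n i}. \<phi> i k x = snd d i k)"
    by (rule surj[THEN spec, THEN spec, THEN mp, THEN mp]) (use c a in blast)+
   then obtain x where x: "x : carrier M" "!!j. j : {1..m} ==> \<gamma> j x \<ominus> c j : I j"
    "!!i k. i : {1..p} ==> k : {1..n i} ==> \<phi> i k x = snd d i k" by blast
   have "h x = d"
   proof (rule prod_eqI)
    show "fst (h x) = fst d"
    proof
     fix j
     show "fst (h x) j = fst d j"
     proof (cases "j : {1..m}")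
      case True
      then show ?thesis using x(2)[OF True] c[OF True] coset_eq_iff[OF True] gc[OF True x(1)] by (simp add: h_def)
     next
      case False
      then show ?thesis using PiE_arb[OF d1 False] False by (auto simp: h_def)
     qed
    qed
    show "snd (h x) = snd d"
    proof
     fix i
     show "snd (h x) i = snd d i"
     proof (cases "i : {1..p}")
      case True
      then have di: "snd d i : (\<Pi>\<^sub>E k\<in>{1..n i}. J i k)" by (rule PiE_mem[OF d2])
      have "(\<lambda>k\<in>{1..n i}. \<phi> i k x) = snd d i"
      proof
       fix k show "(\<lambda>k\<in>{1..n i}. \<phi> i k x) k = snd d i k"
        using x(3)[OF True, of k] PiE_arb[OF di, of k] by simp
      qed
      then show ?thesis using True by (simp add: h_def)
     next
      case False
      then show ?thesis using PiE_arb[OF d2 False] False by (auto simp: h_def)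
     qed
    qed
   qed
   then show "d : h ` carrier M" using x(1) by blast
  qed (use hD in blast)
 qed
 then show ?thesis using hom unfolding mod_isomorphic_def by blast
qed

lemma iso_imp_coords:
 assumes "mod_isomorphic R M D"
 shows "EX \<gamma> \<phi>. decomp_coords R M m I p n J \<gamma> \<phi>"
proof -
 obtain h where hom: "h : mod_hom R M D" and bij: "bij_betw h (carrier M) (carrier D)"
  using assms unfolding mod_isomorphic_def by blast
 have hD: "h x : carrier D" if "x : carrier M" for x using hom that unfolding mod_hom_def by blast
 have h1: "fst (h x) : (\<Pi>\<^sub>E j\<in>{1..m}. carrier (R Quot (I j)))" if "x : carrier M" for x
  using hD[OF that] unfolding carrier_D by (rule conjunct1)
 have h2: "snd (h x) : (\<Pi>\<^sub>E i\<in>{1..p}. \<Pi>\<^sub>E k\<in>{1..n i}. J i k)" if "x : carrier M" for x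
  using hD[OF that] unfolding carrier_D by (rule conjunct2)
 have hadd: "h (x \<oplus>\<^bsub>M\<^esub> y) = h x \<oplus>\<^bsub>D\<^esub> h y" if "x : carrier M" "y : carrier M" for x y
  using hom that unfolding mod_hom_def by blast
 have hsm: "h (r \<odot>\<^bsub>M\<^esub> x) = r \<odot>\<^bsub>D\<^esub> h x" if "r : carrier R" "x : carrier M" for r x
  using hom that unfolding mod_hom_def by blast
 define \<phi> where "\<phi> i k x = snd (h x) i k" for i k x
 define \<gamma> where "\<gamma> j x = (SOME r. r : carrier R & fst (h x) j = I j +> r)" for j x
 have g: "\<gamma> j x : carrier R" "fst (h x) j = I j +> \<gamma> j x" if "j : {1..m}" "x : carrier M" for j x
 proof -
  have "fst (h x) j : carrier (R Quot (I j))" by (rule PiE_mem[OF h1[OF that(2)] that(1)])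
  then have "EX r. r : carrier R & fst (h x) j = I j +> r" by (meson R.FactRing_carrierE)
  from someI_ex[OF this] show "\<gamma> j x : carrier R" "fst (h x) j = I j +> \<gamma> j x" unfolding \<gamma>_def by blast+
 qed
 have fJ: "\<phi> i k x : J i k" if "i : {1..p}" "k : {1..n i}" "x : carrier M" for i k x
  unfolding \<phi>_def by (rule PiE_mem[OF PiE_mem[OF conjunct2[OF hD[OF that(3), unfolded carrier_D mem_Times_iff]] that(1)] that(2)])
 have "decomp_coords R M m I p n J \<gamma> \<phi>"
  unfolding decomp_coords_def
 proof (intro conjI ballI allI impI)
  show "\<gamma> j x : carrier R" if "j : {1..m}" "x : carrier M" for j x using g that by blast
  show "\<gamma> j (x \<oplus>\<^bsub>M\<^esub> y) \<ominus> (\<gamma> j x \<oplus> \<gamma> j y) : I j" if j: "j : {1..m}" and xy: "x : carrier M" "y : carrier M" for j x y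
  proof -
   have "I j +> \<gamma> j (x \<oplus>\<^bsub>M\<^esub> y) = fst (h (x \<oplus>\<^bsub>M\<^esub> y)) j" using g(2)[OF j] xy by simp
   also have "... = fst (h x) j \<oplus>\<^bsub>R Quot (I j)\<^esub> fst (h y) j" unfolding hadd[OF xy] add_D using j by simp
   also have "... = I j +> (\<gamma> j x \<oplus> \<gamma> j y)" unfolding g(2)[OF j xy(1)] g(2)[OF j xy(2)] using g(1)[OF j] xy by (intro quot_ops(1)[OF j]) auto
   finally show ?thesis using coset_eq_iff[OF j] g(1)[OF j] xy by simp
  qed
  show "\<gamma> j (r \<odot>\<^bsub>M\<^esub> x) \<ominus> r \<otimes> \<gamma> j x : I j" if j: "j : {1..m}" and r: "r : carrier R" and x: "x : carrier M" for j x r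
  proof -
   have "I j +> \<gamma> j (r \<odot>\<^bsub>M\<^esub> x) = fst (h (r \<odot>\<^bsub>M\<^esub> x)) j" using g(2)[OF j] x r by simp
   also have "... = (I j +> r) \<otimes>\<^bsub>R Quot (I j)\<^esub> fst (h x) j" unfolding hsm[OF r x] smult_D using j by simp
   also have "... = I j +> (r \<otimes> \<gamma> j x)" unfolding g(2)[OF j x] using g(1)[OF j] x r by (intro quot_ops(2)[OF j]) auto
   finally show ?thesis using coset_eq_iff[OF j] g(1)[OF j] x r by simp
  qed
  show "functional R M (\<phi> i k)" if ik: "i : {1..p}" "k : {1..n i}" for i k
   unfolding functional_def
   using ik fJ[OF ik] J_carrier[OF ik] by (auto simp: \<phi>_def hadd hsm add_D smult_D)
  show "\<phi> i k x : J i k" if "i : {1..p}" "k : {1..n i}" "x : carrier M" for i k x using fJ that .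
  show "x = \<zero>\<^bsub>M\<^esub>" if x: "x : carrier M" and gx: "ALL j:{1..m}. \<gamma> j x : I j" and fx: "ALL i:{1..p}. ALL k:{1..n i}. \<phi> i k x = \<zero>" for x
  proof -
   have hx: "h x = (\<lambda>j\<in>{1..m}. I j +> \<zero>, \<lambda>i\<in>{1..p}. \<lambda>k\<in>{1..n i}. \<zero>)" if x: "x : carrier M" and gx: "ALL j:{1..m}. \<gamma> j x : I j" and fx: "ALL i:{1..p}. ALL k:{1..n i}. \<phi> i k x = \<zero>" for x
   proof (rule prod_eqI)
    show "fst (h x) = fst (\<lambda>j\<in>{1..m}. I j +> \<zero>, \<lambda>i\<in>{1..p}. \<lambda>k\<in>{1..n i}. \<zero>)"
    proof
     fix j
     show "fst (h x) j = fst (\<lambda>j\<in>{1..m}. I j +> \<zero>, \<lambda>i\<in>{1..p}. \<lambda>k\<in>{1..n i}. \<zero>) j"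
     proof (cases "j : {1..m}")
      case True
      have "\<gamma> j x \<ominus> \<zero> : I j" using gx True g(1)[OF True x] by (simp add: R.minus_eq)
      then show ?thesis using g[OF True x] coset_eq_iff[OF True] True by simp
     next
      case False
      then show ?thesis using PiE_arb[OF h1[OF x] False] False by auto
     qed
    qed
    show "snd (h x) = snd (\<lambda>j\<in>{1..m}. I j +> \<zero>, \<lambda>i\<in>{1..p}. \<lambda>k\<in>{1..n i}. \<zero>)"
    proof
     fix i
     show "snd (h x) i = snd (\<lambda>j\<in>{1..m}. I j +> \<zero>, \<lambda>i\<in>{1..p}. \<lambda>k\<in>{1..n i}. \<zero>) i"
     proof (cases "i : {1..p}")
      case True
      then have di: "snd (h x) i : (\<Pi>\<^sub>E k\<in>{1..n i}. J i k)" by (rule PiE_mem[OF h2[OF x]])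
      have "snd (h x) i = (\<lambda>k\<in>{1..n i}. \<zero>)"
      proof
       fix k show "snd (h x) i k = (\<lambda>k\<in>{1..n i}. \<zero>) k"
        using fx True PiE_arb[OF di, of k] by (auto simp: \<phi>_def)
      qed
      then show ?thesis using True by simp
     next
      case False
      then show ?thesis using PiE_arb[OF h2[OF x] False] False by auto
     qed
    qed
   qed
   have "h \<zero>\<^bsub>M\<^esub> = \<zero> \<odot>\<^bsub>D\<^esub> h \<zero>\<^bsub>M\<^esub>" using hsm[of \<zero> "\<zero>\<^bsub>M\<^esub>"] by simp
   then have h0: "h \<zero>\<^bsub>M\<^esub> = (\<lambda>j\<in>{1..m}. I j +> \<zero>, \<lambda>i\<in>{1..p}. \<lambda>k\<in>{1..n i}. \<zero>)"
   proof -
    have 1: "(I j +> \<zero>) \<otimes>\<^bsub>R Quot (I j)\<^esub> fst (h \<zero>\<^bsub>M\<^esub>) j = I j +> \<zero>" if j: "j : {1..m}" for j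
     using g[OF j M.zero_closed] quot_ops(2)[OF j R.zero_closed, of "\<gamma> j \<zero>\<^bsub>M\<^esub>"] by simp
    have 2: "\<zero> \<otimes> snd (h \<zero>\<^bsub>M\<^esub>) i k = \<zero>" if "i : {1..p}" "k : {1..n i}" for i k
     using fJ[OF that M.zero_closed] J_carrier[OF that] unfolding \<phi>_def by auto
    have "\<zero> \<odot>\<^bsub>D\<^esub> h \<zero>\<^bsub>M\<^esub> = (\<lambda>j\<in>{1..m}. I j +> \<zero>, \<lambda>i\<in>{1..p}. \<lambda>k\<in>{1..n i}. \<zero>)"
     unfolding smult_D using 1 2 by (auto intro!: restrict_ext)
    then show ?thesis using \<open>h \<zero>\<^bsub>M\<^esub> = \<zero> \<odot>\<^bsub>D\<^esub> h \<zero>\<^bsub>M\<^esub>\<close> by metis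
   qed
   show ?thesis
    using hx[OF x gx fx] h0 bij x M.zero_closed unfolding bij_betw_def inj_on_def by metis
  qed
  show "EX x:carrier M. (ALL j:{1..m}. \<gamma> j x \<ominus> c j : I j) & (ALL i:{1..p}. ALL k:{1..n i}. \<phi> i k x = a i k)"
   if c: "ALL j:{1..m}. c j : carrier R" and a: "ALL i:{1..p}. ALL k:{1..n i}. a i k : J i k" for c a
  proof -
   define d where "d = (\<lambda>j\<in>{1..m}. I j +> c j, \<lambda>i\<in>{1..p}. \<lambda>k\<in>{1..n i}. a i k)"
   have "d : carrier D"
    unfolding carrier_D d_def fst_conv snd_conv restrict_PiE_iff
    using quot_ops(3)[OF _ _ R.zero_closed] c a by (intro conjI ballI) auto
   then obtain x where x: "x : carrier M" "h x = d"
    unfolding bij_betw_imp_surj_on[OF bij, symmetric] by (elim imageE) simp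
   have "\<gamma> j x \<ominus> c j : I j" if j: "j : {1..m}" for j
   proof -
    have cj: "c j : carrier R" by (rule bspec[OF c j])
    have "fst (h x) j = I j +> c j" unfolding x(2) d_def using j by simp
    then have "I j +> \<gamma> j x = I j +> c j" unfolding g(2)[OF j x(1)] .
    then show ?thesis by (rule coset_eq_iff[OF j g(1)[OF j x(1)] cj, THEN iffD1])
   qed
   moreover have "\<phi> i k x = a i k" if "i : {1..p}" "k : {1..n i}" for i k
    unfolding \<phi>_def x(2) d_def using that by simp
   ultimately show ?thesis using x(1) by blast
  qed
 qed
 then show ?thesis by blast
qed

end

section \<open>Invariants of a decomposition\<close>

definition torsion_element :: "('a, 'r) ring_scheme => ('a, 'b, 'm) module_scheme => 'b => bool" where
 "torsion_element R M x \<longleftrightarrow> (EX d:regular_elements R. d \<odot>\<^bsub>M\<^esub> x = \<zero>\<^bsub>M\<^esub>)"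

text \<open>This predicate and \<open>independent_after\<close> speak of \<open>M\<close> alone.
  Whatever a decomposition can be recovered from in terms of them is therefore an invariant.\<close>

definition torsion_generated :: "('a, 'r) ring_scheme => ('a, 'b, 'm) module_scheme => 'a => nat => bool" where
 "torsion_generated R M r k \<longleftrightarrow> (EX t. (ALL b. t b : carrier M & torsion_element R M (t b)) &
  (ALL x:carrier M. torsion_element R M x -->
   (EX c. (ALL b. c b : carrier R) & r \<odot>\<^bsub>M\<^esub> x = r \<odot>\<^bsub>M\<^esub> lc M k c t)))"

definition independent_after :: "('a, 'r) ring_scheme => ('a, 'b, 'm) module_scheme => 'a => nat => bool" where
 "independent_after R M s N \<longleftrightarrow> (EX v. (ALL k. v k : carrier M) &
  (ALL x. (ALL k. x k : carrier R) --> lc M N x v = \<zero>\<^bsub>M\<^esub> --> (ALL k<N. s \<otimes>\<^bsub>R\<^esub> x k = \<zero>\<^bsub>R\<^esub>)))"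

lemma (in cring) ex_prime_above:
 assumes Q: "ideal Q R" and 1: "\<one> ~: Q"
 shows "EX P. primeideal P R & Q <= P"
proof -
 define S where "S = {I. ideal I R & Q <= I & \<one> ~: I}"
 have "EX P:S. ALL I:S. P <= I --> I = P"
 proof (rule subset_Zorn_nonempty)
  show "S ~= {}" using Q 1 unfolding S_def by blast
  fix C assume C: "C ~= {}" "subset.chain S C"
  then have CS: "C <= S" by (simp add: subset.chain_def)
  have "subset.chain {I. ideal I R} C" using C(2) unfolding subset.chain_def S_def by blast
  from chain_Union_is_ideal[OF this] have "ideal (\<Union>C) R" using C(1) by simp
  then show "\<Union>C : S" using CS C(1) unfolding S_def by blast
 qed
 then obtain P where P: "P : S" and mx: "!!I. I : S ==> P <= I ==> I = P" by blast
 have idP: "ideal P R" "Q <= P" "\<one> ~: P" using P unfolding S_def by blast+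
 have "maximalideal P R"
 proof (rule maximalidealI[OF idP(1)])
  show "carrier R ~= P" using idP(3) by blast
  fix I assume I: "ideal I R" "P <= I" "I <= carrier R"
  show "I = P | I = carrier R"
  proof (cases "\<one> : I")
   case True
   then show ?thesis using ideal.one_imp_carrier[OF I(1)] by blast
  next
   case False
   then have "I : S" using I idP(2) unfolding S_def by blast
   then show ?thesis using mx I(2) by blast
  qed
 qed
 then show ?thesis using maximalideal_prime idP(2) by blast
qed

text \<open>The data from which uniqueness is derived. The invertibility of an ideal enters only
  through one element: a regular one in \<open>I j\<close>, and one in J i k with the annihilator of
  e i.\<close>

locale decomposed_module = decomposition_shape R M m p I e n J
 for R :: "('a, 'r) ring_scheme" (structure) and M :: "('a, 'b, 'm) module_scheme" (structure)
  and m p I e n J +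
 fixes \<gamma> :: "nat => 'b => 'a" and \<phi> :: "nat => nat => 'b => 'a"
 assumes reduced: "x : carrier R ==> x \<otimes> x = \<zero> ==> x = \<zero>"
  and coords: "decomp_coords R M m I p n J \<gamma> \<phi>"
  and I_regular: "j : {1..m} ==> EX d:I j. d : regular_elements R"
  and I_proper: "j : {1..m} ==> I j ~= carrier R"
  and I_Suc: "j : {1..<m} ==> I (Suc j) <= I j"
  and e_carrier: "i : {1..p} ==> e i : carrier R"
  and e_idem: "i : {1..p} ==> e i \<otimes> e i = e i"
  and e_nonzero: "i : {1..p} ==> e i ~= \<zero>"
  and e_orth: "i : {1..p} ==> i' : {1..p} ==> i ~= i' ==> e i \<otimes> e i' = \<zero>"
  and n_pos: "i : {1..p} ==> 0 < n i"
  and n_mono: "strict_mono_on {1..p} n"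
  and J_ideal: "i : {1..p} ==> k : {1..n i} ==> ideal (J i k) R"
  and J_unit: "i : {1..p} ==> k : {1..n i} ==> x : J i k ==> e i \<otimes> x = x"
  and J_regular: "i : {1..p} ==> k : {1..n i} ==> EX d:J i k. ALL r:carrier R. r \<otimes> d = \<zero> --> r \<otimes> e i = \<zero>"
begin

lemma
 shows gamma_closed: "j : {1..m} ==> x : carrier M ==> \<gamma> j x : carrier R"
  and gamma_add: "j : {1..m} ==> x : carrier M ==> y : carrier M ==> \<gamma> j (x \<oplus>\<^bsub>M\<^esub> y) \<ominus> (\<gamma> j x \<oplus> \<gamma> j y) : I j"
  and gamma_smult: "j : {1..m} ==> r : carrier R ==> x : carrier M ==> \<gamma> j (r \<odot>\<^bsub>M\<^esub> x) \<ominus> r \<otimes> \<gamma> j x : I j"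
  and phi_functional: "i : {1..p} ==> k : {1..n i} ==> functional R M (\<phi> i k)"
  and phi_in: "i : {1..p} ==> k : {1..n i} ==> x : carrier M ==> \<phi> i k x : J i k"
proof -
 note c = coords[unfolded decomp_coords_def]
 show "j : {1..m} ==> x : carrier M ==> \<gamma> j x : carrier R"
  using c[THEN conjunct1] by blast
 show "j : {1..m} ==> x : carrier M ==> y : carrier M ==> \<gamma> j (x \<oplus>\<^bsub>M\<^esub> y) \<ominus> (\<gamma> j x \<oplus> \<gamma> j y) : I j"
  using c[THEN conjunct2, THEN conjunct1] by blast
 show "j : {1..m} ==> r : carrier R ==> x : carrier M ==> \<gamma> j (r \<odot>\<^bsub>M\<^esub> x) \<ominus> r \<otimes> \<gamma> j x : I j"
  using c[THEN conjunct2, THEN conjunct2, THEN conjunct1] by blast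
 show "i : {1..p} ==> k : {1..n i} ==> functional R M (\<phi> i k)"
  using c[THEN conjunct2, THEN conjunct2, THEN conjunct2, THEN conjunct1] by blast
 show "i : {1..p} ==> k : {1..n i} ==> x : carrier M ==> \<phi> i k x : J i k"
  using c[THEN conjunct2, THEN conjunct2, THEN conjunct2, THEN conjunct2, THEN conjunct1] by blast
qed

lemma coords_inject:
 assumes "x : carrier M" "ALL j:{1..m}. \<gamma> j x : I j" "ALL i:{1..p}. ALL k:{1..n i}. \<phi> i k x = \<zero>"
 shows "x = \<zero>\<^bsub>M\<^esub>"
 using coords[unfolded decomp_coords_def, THEN conjunct2, THEN conjunct2, THEN conjunct2, THEN conjunct2, THEN conjunct2, THEN conjunct1] assms
 by blast

lemma coords_surject:
 assumes "ALL j:{1..m}. c j : carrier R" "ALL i:{1..p}. ALL k:{1..n i}. a i k : J i k"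
 shows "EX x:carrier M. (ALL j:{1..m}. \<gamma> j x \<ominus> c j : I j) & (ALL i:{1..p}. ALL k:{1..n i}. \<phi> i k x = a i k)"
 by (rule coords[unfolded decomp_coords_def, THEN conjunct2, THEN conjunct2, THEN conjunct2, THEN conjunct2, THEN conjunct2, THEN conjunct2,
   THEN spec, THEN spec, THEN mp, THEN mp]) (use assms in simp_all)

lemma phi_closed: "i : {1..p} ==> k : {1..n i} ==> x : carrier M ==> \<phi> i k x : carrier R"
 using functional_closed[OF phi_functional] .

lemma J_zero: "i : {1..p} ==> k : {1..n i} ==> \<zero> : J i k"
 using additive_subgroup.zero_closed[OF ideal.axioms(1)[OF J_ideal]] .

lemma ex_with_phi:
 assumes "ALL i:{1..p}. ALL k:{1..n i}. a i k : J i k"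
 shows "EX x:carrier M. ALL i:{1..p}. ALL k:{1..n i}. \<phi> i k x = a i k"
 using coords_surject[of "%_. \<zero>", OF _ assms] R.zero_closed by blast

lemma I_antimono: "1 <= j ==> j <= j' ==> j' <= m ==> I j' <= I j"
proof (induction j')
 case (Suc j')
 show ?case
 proof (cases "j = Suc j'")
  case False
  then have "j <= j'" using Suc.prems by simp
  then show ?thesis using Suc.IH Suc.prems I_Suc[of j'] by auto
 qed simp
qed simp

lemma gamma_smult_in:
 assumes j: "j : {1..m}" and r: "r : I j | \<gamma> j x : I j" "r : carrier R" and x: "x : carrier M"
 shows "\<gamma> j (r \<odot>\<^bsub>M\<^esub> x) : I j"
proof -
 have "r \<otimes> \<gamma> j x : I j" using r ideal_lin[OF ideal_I[OF j]] gamma_closed[OF j x] by blast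
 then show ?thesis
  using R.ideal_cong[OF ideal_I[OF j] _ _ gamma_smult[OF j r(2) x]] gamma_closed[OF j] r(2) x by simp
qed

text \<open>Coordinates \<phi> lie in \<open>R\<close>, where a regular factor cancels. Conversely,
  a regular element of the smallest ideal \<open>I m\<close> lies in every \<open>I j\<close> and
  kills all elements without \<phi>-coordinates at once.\<close>

lemma torsion_iff:
 assumes x: "x : carrier M"
 shows "torsion_element R M x \<longleftrightarrow> (ALL i:{1..p}. ALL k:{1..n i}. \<phi> i k x = \<zero>)"
proof
 assume "torsion_element R M x"
 then obtain d where d: "d : regular_elements R" "d \<odot>\<^bsub>M\<^esub> x = \<zero>\<^bsub>M\<^esub>" unfolding torsion_element_def by blast
 show "ALL i:{1..p}. ALL k:{1..n i}. \<phi> i k x = \<zero>"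
 proof (intro ballI)
  fix i k assume ik: "i : {1..p}" "k : {1..n i}"
  have "d \<otimes> \<phi> i k x = \<zero>"
   using functional_smult[OF phi_functional[OF ik] regularD(1)[OF d(1)] x] functional_zero[OF phi_functional[OF ik]] d(2) by simp
  then show "\<phi> i k x = \<zero>" using regularD(2)[OF d(1)] phi_closed[OF ik x] by blast
 qed
next
 assume z: "ALL i:{1..p}. ALL k:{1..n i}. \<phi> i k x = \<zero>"
 have "EX d:regular_elements R. ALL j:{1..m}. d : I j"
 proof (cases "m = 0")
  case True
  have "\<one> : regular_elements R" by (rule regularI) auto
  then show ?thesis using True by auto
 next
  case False
  then obtain d where d: "d : I m" "d : regular_elements R" using I_regular[of m] by auto
  moreover have "d : I j" if "j : {1..m}" for j using I_antimono[of j m] that d(1) by auto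
  ultimately show ?thesis by blast
 qed
 then obtain d where d: "d : regular_elements R" "!!j. j : {1..m} ==> d : I j" by blast
 note dR = regularD(1)[OF d(1)]
 have "d \<odot>\<^bsub>M\<^esub> x = \<zero>\<^bsub>M\<^esub>"
 proof (rule coords_inject)
  show "d \<odot>\<^bsub>M\<^esub> x : carrier M" using dR x by simp
  show "ALL j:{1..m}. \<gamma> j (d \<odot>\<^bsub>M\<^esub> x) : I j" using gamma_smult_in d(2) dR x by blast
  show "ALL i:{1..p}. ALL k:{1..n i}. \<phi> i k (d \<odot>\<^bsub>M\<^esub> x) = \<zero>"
   using functional_smult[OF phi_functional dR x] z dR by simp
 qed
 then show "torsion_element R M x" unfolding torsion_element_def using d(1) by blast
qed

lemma gamma_zero: "j : {1..m} ==> \<gamma> j \<zero>\<^bsub>M\<^esub> : I j"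
 using gamma_smult_in[of j \<zero> "\<zero>\<^bsub>M\<^esub>"] additive_subgroup.zero_closed[OF ideal.axioms(1)[OF ideal_I]] smult_l_null[of "\<zero>\<^bsub>M\<^esub>"]
 by auto

lemma gamma_lc:
 assumes j: "j : {1..m}" and [simp]: "!!b. c b : carrier R" "!!b. t b : carrier M"
 shows "\<gamma> j (lc M k c t) \<ominus> dot R k c (%b. \<gamma> j (t b)) : I j"
proof (induction k)
 note [simp] = gamma_closed[OF j]
 case 0
 have "\<gamma> j \<zero>\<^bsub>M\<^esub> \<ominus> \<zero> = \<gamma> j \<zero>\<^bsub>M\<^esub>" by (simp add: R.minus_eq)
 then show ?case using gamma_zero[OF j] by (simp add: lc_def dot_def)
next
 note [simp] = gamma_closed[OF j]
 case (Suc k)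
 have l: "lc M (Suc k) c t = lc M k c t \<oplus>\<^bsub>M\<^esub> c k \<odot>\<^bsub>M\<^esub> t k" unfolding lc_def by (rule M.finsum_lessThan_Suc) simp
 have d: "dot R (Suc k) c (%b. \<gamma> j (t b)) = dot R k c (%b. \<gamma> j (t b)) \<oplus> c k \<otimes> \<gamma> j (t k)"
  unfolding dot_def by (rule R.finsum_lessThan_Suc) simp
 have *: "g \<ominus> (a \<oplus> b) = (g \<ominus> (g1 \<oplus> g2)) \<oplus> ((g1 \<ominus> a) \<oplus> (g2 \<ominus> b))"
  if "g : carrier R" "g1 : carrier R" "g2 : carrier R" "a : carrier R" "b : carrier R" for g g1 g2 a b
  using that by algebra
 have "\<gamma> j (lc M (Suc k) c t) \<ominus> dot R (Suc k) c (%b. \<gamma> j (t b)) =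
   (\<gamma> j (lc M k c t \<oplus>\<^bsub>M\<^esub> c k \<odot>\<^bsub>M\<^esub> t k) \<ominus> (\<gamma> j (lc M k c t) \<oplus> \<gamma> j (c k \<odot>\<^bsub>M\<^esub> t k))) \<oplus>
   ((\<gamma> j (lc M k c t) \<ominus> dot R k c (%b. \<gamma> j (t b))) \<oplus> (\<gamma> j (c k \<odot>\<^bsub>M\<^esub> t k) \<ominus> c k \<otimes> \<gamma> j (t k)))"
  unfolding l d by (rule *) auto
 moreover have "\<gamma> j (lc M k c t \<oplus>\<^bsub>M\<^esub> c k \<odot>\<^bsub>M\<^esub> t k) \<ominus> (\<gamma> j (lc M k c t) \<oplus> \<gamma> j (c k \<odot>\<^bsub>M\<^esub> t k)) : I j"
  by (rule gamma_add[OF j]) auto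
 moreover have "\<gamma> j (c k \<odot>\<^bsub>M\<^esub> t k) \<ominus> c k \<otimes> \<gamma> j (t k) : I j" by (rule gamma_smult[OF j]) auto
 ultimately show ?case using Suc R.ideal_add(1)[OF ideal_I[OF j]] by metis
qed

lemma gamma_eq_in:
 assumes j: "j : {1..m}" and x: "x : carrier M" "y : carrier M" and d: "\<gamma> j x \<ominus> \<gamma> j y : I j"
 shows "\<gamma> j (x \<ominus>\<^bsub>M\<^esub> y) : I j"
proof -
 note Ij = ideal_I[OF j]
 have 2: "\<gamma> j (x \<ominus>\<^bsub>M\<^esub> y) \<ominus> (\<gamma> j x \<oplus> \<gamma> j (\<ominus>\<^bsub>M\<^esub> y)) : I j" unfolding M.minus_eq using x by (intro gamma_add j) auto
 have my: "\<ominus>\<^bsub>M\<^esub> y = (\<ominus> \<one>) \<odot>\<^bsub>M\<^esub> y" using x by (simp add: smult_l_minus)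
 have 3: "\<gamma> j (\<ominus>\<^bsub>M\<^esub> y) \<ominus> (\<ominus> \<one>) \<otimes> \<gamma> j y : I j" unfolding my using x by (intro gamma_smult j) auto
 have *: "a = (a \<ominus> (b \<oplus> c)) \<oplus> ((c \<ominus> (\<ominus> \<one>) \<otimes> d) \<oplus> (b \<ominus> d))"
  if "a : carrier R" "b : carrier R" "c : carrier R" "d : carrier R" for a b c d using that by algebra
 have "\<gamma> j (x \<ominus>\<^bsub>M\<^esub> y) = (\<gamma> j (x \<ominus>\<^bsub>M\<^esub> y) \<ominus> (\<gamma> j x \<oplus> \<gamma> j (\<ominus>\<^bsub>M\<^esub> y))) \<oplus> ((\<gamma> j (\<ominus>\<^bsub>M\<^esub> y) \<ominus> (\<ominus> \<one>) \<otimes> \<gamma> j y) \<oplus> (\<gamma> j x \<ominus> \<gamma> j y))"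
  by (rule *) (use gamma_closed[OF j] x in auto)
 then show ?thesis
  using R.ideal_add(1)[OF Ij 2 R.ideal_add(1)[OF Ij 3 d]] by metis
qed

lemma torsion_lc:
 assumes [simp]: "!!b. c b : carrier R" "!!b. t b : carrier M" and t: "!!b. torsion_element R M (t b)"
 shows "torsion_element R M (lc M k c t)"
proof -
 have "\<phi> i l (lc M k c t) = \<zero>" if il: "i : {1..p}" "l : {1..n i}" for i l
 proof -
  have z: "\<phi> i l (t b) = \<zero>" for b using t[of b] il torsion_iff[of "t b"] by simp
  show ?thesis by (subst functional_lc[OF phi_functional[OF il]]) (simp_all add: z dot_def)
 qed
 then show ?thesis by (subst torsion_iff) auto
qed

text \<open>The torsion elements t b with coordinate one at m - b and zero elsewhere carry the last
  k coordinates. Every other index satisfies j + k <= m, and there \<open>r\<close> annihilates R /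
  I j.\<close>

lemma torsion_generated_if:
 assumes r: "r : carrier R" and rI: "!!j. j : {1..m} ==> j + k <= m ==> r : I j"
 shows "torsion_generated R M r k"
proof -
 have "EX x:carrier M. (ALL j:{1..m}. \<gamma> j x \<ominus> (if j + b = m then \<one> else \<zero>) : I j) & (ALL i:{1..p}. ALL k:{1..n i}. \<phi> i k x = \<zero>)" for b
  using coords_surject[of "%j. if j + b = m then \<one> else \<zero>" "%_ _. \<zero>"] J_zero by auto
 then have "EX t. ALL b. t b : carrier M & (ALL j:{1..m}. \<gamma> j (t b) \<ominus> (if j + b = m then \<one> else \<zero>) : I j) & (ALL i:{1..p}. ALL k:{1..n i}. \<phi> i k (t b) = \<zero>)"
  by (intro choice allI) blast
 then obtain t where t': "ALL b. t b : carrier M & (ALL j:{1..m}. \<gamma> j (t b) \<ominus> (if j + b = m then \<one> else \<zero>) : I j) & (ALL i:{1..p}. ALL k:{1..n i}. \<phi> i k (t b) = \<zero>)"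
  by (elim exE)
 then have t [simp]: "t b : carrier M" and tg: "j : {1..m} ==> \<gamma> j (t b) \<ominus> (if j + b = m then \<one> else \<zero>) : I j"
  and tp: "i : {1..p} ==> l : {1..n i} ==> \<phi> i l (t b) = \<zero>" for b j i l by blast+
 have tor: "torsion_element R M (t b)" for b using torsion_iff[of "t b"] tp by simp
 have "EX c. (ALL b. c b : carrier R) & r \<odot>\<^bsub>M\<^esub> x = r \<odot>\<^bsub>M\<^esub> lc M k c t" if x: "x : carrier M" "torsion_element R M x" for x
 proof -
  define c where "c b = (if b < m then \<gamma> (m - b) x else \<zero>)" for b
  have c [simp]: "c b : carrier R" for b unfolding c_def using gamma_closed[of "m - b" x] x by auto
  define y where "y = lc M k c t"
  have y [simp]: "y : carrier M" unfolding y_def by (rule lc_closed) auto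
  have "r \<odot>\<^bsub>M\<^esub> (x \<ominus>\<^bsub>M\<^esub> y) = \<zero>\<^bsub>M\<^esub>"
  proof (rule coords_inject)
   show "r \<odot>\<^bsub>M\<^esub> (x \<ominus>\<^bsub>M\<^esub> y) : carrier M" using r x by simp
   have "\<phi> i l (x \<ominus>\<^bsub>M\<^esub> y) = \<zero>" if il: "i : {1..p}" "l : {1..n i}" for i l
   proof -
    have "torsion_element R M y" unfolding y_def by (rule torsion_lc) (auto simp: tor)
    then have "\<phi> i l x = \<zero>" "\<phi> i l y = \<zero>" using torsion_iff x il y by auto
    then show ?thesis using functional_minus(2)[OF phi_functional[OF il] x(1) y] by (simp add: R.minus_eq)
   qed
   then show "ALL i:{1..p}. ALL l:{1..n i}. \<phi> i l (r \<odot>\<^bsub>M\<^esub> (x \<ominus>\<^bsub>M\<^esub> y)) = \<zero>"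
    using functional_smult[OF phi_functional r, of _ _ "x \<ominus>\<^bsub>M\<^esub> y"] x r by simp
   show "ALL j:{1..m}. \<gamma> j (r \<odot>\<^bsub>M\<^esub> (x \<ominus>\<^bsub>M\<^esub> y)) : I j"
   proof
    fix j assume j: "j : {1..m}"
    show "\<gamma> j (r \<odot>\<^bsub>M\<^esub> (x \<ominus>\<^bsub>M\<^esub> y)) : I j"
    proof (rule gamma_smult_in[OF j])
     show "r : I j | \<gamma> j (x \<ominus>\<^bsub>M\<^esub> y) : I j"
     proof (cases "j + k <= m")
      case True
      then show ?thesis using rI j by blast
     next
      case False
      note [simp] = gamma_closed[OF j]
      define b where "b = m - j"
      have b: "b < k" "b < m" "j = m - b" "j + b = m" using False j by (auto simp: b_def)
      have "dot R k c (%a. \<gamma> j (t a)) \<ominus> c b : I j"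
      proof -
       have "c b = dot R k (%a. if a = b then \<one> else \<zero>) c" by (rule dot_delta[symmetric, OF b(1)]) simp
       also have "... = dot R k c (%a. if a = b then \<one> else \<zero>)" by (rule R.dot_comm) auto
       finally have cb: "c b = dot R k c (%a. if a = b then \<one> else \<zero>)" .
       have "dot R k c (%a. \<gamma> j (t a)) \<ominus> c b = (\<Oplus>a\<in>{..<k}. c a \<otimes> \<gamma> j (t a) \<ominus> c a \<otimes> (if a = b then \<one> else \<zero>))"
        unfolding cb dot_def by (rule finsum_minus[symmetric]) auto
       also have "... : I j"
       proof (rule ideal.finsum_in_ideal[OF ideal_I[OF j]])
        fix a
        have e: "(if a = b then \<one> else \<zero>) = (if j + a = m then \<one> else \<zero>)" using b by auto
        have "c a \<otimes> (\<gamma> j (t a) \<ominus> (if j + a = m then \<one> else \<zero>)) : I j"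
         by (rule ideal_lin(1)[OF ideal_I[OF j] tg[OF j]]) simp
        moreover have "u \<otimes> (v \<ominus> w) = u \<otimes> v \<ominus> u \<otimes> w" if "u : carrier R" "v : carrier R" "w : carrier R" for u v w
         using that by algebra
        ultimately show "c a \<otimes> \<gamma> j (t a) \<ominus> c a \<otimes> (if a = b then \<one> else \<zero>) : I j" unfolding e by simp
       qed
       finally show ?thesis .
      qed
      moreover have "c b = \<gamma> j x" using b by (simp add: c_def)
      ultimately have 1: "dot R k c (%a. \<gamma> j (t a)) \<ominus> \<gamma> j x : I j" by simp
      have 2: "\<gamma> j y \<ominus> dot R k c (%b. \<gamma> j (t b)) : I j" unfolding y_def by (rule gamma_lc[OF j]) auto
      have *: "u \<ominus> v = \<ominus> ((v \<ominus> w) \<oplus> (w \<ominus> u))" if "u : carrier R" "v : carrier R" "w : carrier R" for u v w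
       using that by algebra
      have "\<gamma> j x \<ominus> \<gamma> j y = \<ominus> ((\<gamma> j y \<ominus> dot R k c (%b. \<gamma> j (t b))) \<oplus> (dot R k c (%b. \<gamma> j (t b)) \<ominus> \<gamma> j x))"
       by (rule *) (use x in auto)
      then have "\<gamma> j x \<ominus> \<gamma> j y : I j"
       using R.ideal_add(2)[OF ideal_I[OF j] R.ideal_add(1)[OF ideal_I[OF j] 2 1] 1] by simp
      then show ?thesis using gamma_eq_in[OF j x(1) y] by blast
     qed
    qed (use r x in simp_all)
   qed
  qed
  then have "r \<odot>\<^bsub>M\<^esub> x = r \<odot>\<^bsub>M\<^esub> y"
   using M.minus_zeroD[of "r \<odot>\<^bsub>M\<^esub> x" "r \<odot>\<^bsub>M\<^esub> y"] r x
   by (simp add: M.minus_eq smult_r_distr smult_r_minus)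
  then show ?thesis unfolding y_def by (intro exI[of _ c]) simp
 qed
 then show ?thesis unfolding torsion_generated_def using t tor by (intro exI[of _ t]) blast
qed

text \<open>Suppose \<open>r\<close> is not in \<open>I j\<close>, and take a prime P above the
  ideal quotient (I j : r). The k + 1 ideals I j, ..., I (j + k) are all contained in P, and after
  cancelling \<open>r\<close> the corresponding coordinates of torsion elements, read modulo P, are
  all spanned by those of k elements. Hence k vectors would span the k + 1 unit vectors over a
  domain.\<close>

lemma torsion_generatedD:
 assumes r: "r : carrier R" and tg: "torsion_generated R M r k" and j: "j : {1..m}" "j + k <= m"
 shows "r : I j"
proof (rule ccontr)
 assume nr: "r ~: I j"
 note Ij = ideal_I[OF j(1)]
 \<comment> \<open>The ideal quotient (I j : r); a multiple of \<open>r\<close> in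
   \<open>I j\<close> may be divided by \<open>r\<close> at the price of passing to this
   ideal.\<close>
 define Q where "Q = {q : carrier R. q \<otimes> r : I j}"
 have idQ: "ideal Q R"
 proof (rule idealI)
  show "ring R" by (rule R.ring_axioms)
  show "subgroup Q (add_monoid R)"
  proof (rule R.add.subgroupI)
   show "Q <= carrier R" unfolding Q_def by blast
   show "Q ~= {}" unfolding Q_def using additive_subgroup.zero_closed[OF ideal.axioms(1)[OF Ij]] r by (auto intro!: exI[of _ \<zero>])
   show "\<ominus> a : Q" if "a : Q" for a
    using that R.ideal_add(2)[OF Ij, of "a \<otimes> r" "a \<otimes> r"] r unfolding Q_def by (simp add: R.l_minus)
   show "a \<oplus> b : Q" if "a : Q" "b : Q" for a b
    using that R.ideal_add(1)[OF Ij, of "a \<otimes> r" "b \<otimes> r"] r unfolding Q_def by (simp add: R.l_distr)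
  qed
  show x1: "x \<otimes> a : Q" if "a : Q" "x : carrier R" for a x
   using that ideal_lin(1)[OF Ij, of "a \<otimes> r" x] r unfolding Q_def by (simp add: R.m_assoc)
  show "a \<otimes> x : Q" if "a : Q" "x : carrier R" for a x
   using x1[OF that] that R.m_comm[of a x] unfolding Q_def by simp
 qed
 have "\<one> ~: Q" using nr r unfolding Q_def by simp
 then obtain P where P: "primeideal P R" and QP: "Q <= P" using R.ex_prime_above[OF idQ] by blast
 interpret P: primeideal P R by fact
 have idP: "ideal P R" by (rule P.is_ideal)
 have 1: "\<one> ~: P" using P.I_notcarr P.one_imp_carrier by blast
 have IQ: "I j <= P" using QP ideal_lin(2)[OF Ij _ r] ideal.Icarr[OF Ij] unfolding Q_def by blast
 obtain t where t': "ALL b. t b : carrier M & torsion_element R M (t b)"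
  and tx: "ALL x:carrier M. torsion_element R M x --> (EX c. (ALL b. c b : carrier R) & r \<odot>\<^bsub>M\<^esub> x = r \<odot>\<^bsub>M\<^esub> lc M k c t)"
  using tg unfolding torsion_generated_def by (elim exE conjE)
 have t [simp]: "t b : carrier M" for b using t' by blast
 have jl: "j + l : {1..m}" if "l < Suc k" for l using j that by auto
 have Ijl: "I (j + l) <= I j" if "l < Suc k" for l using I_antimono[of j "j + l"] jl[OF that] j by auto
 define v where "v l b = (if l < Suc k then \<gamma> (j + l) (t b) else \<zero>)" for l b
 have v [simp]: "v l b : carrier R" for l b unfolding v_def using gamma_closed[OF jl] by simp
 \<comment> \<open>A linear form on the k + 1 coordinates that vanishes modulo P on every t b, but
   has a coefficient outside P.\<close>
 have "EX x. (ALL k::nat. x k : carrier R) & (ALL i<k. (\<Oplus>l\<in>{..<Suc k}. x l \<otimes> v l i) : P) & (EX j<Suc k. \<one> \<otimes> x j ~: P)"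
  by (rule R.ex_dependence[OF idP _ R.one_closed 1 v]) (use P.I_prime in blast)
 then obtain w where ww: "(ALL k::nat. w k : carrier R) & (ALL i<k. (\<Oplus>l\<in>{..<Suc k}. w l \<otimes> v l i) : P) & (EX j<Suc k. \<one> \<otimes> w j ~: P)"
  by (rule exE)
 have w': "ALL l. w l : carrier R" and wv': "ALL i<k. (\<Oplus>l\<in>{..<Suc k}. w l \<otimes> v l i) : P"
  and wj: "EX l<Suc k. \<one> \<otimes> w l ~: P"
  using ww by - (elim conjE, assumption)+
 have w [simp]: "w l : carrier R" for l using w' by (rule spec)
 have wv: "(\<Oplus>l\<in>{..<Suc k}. w l \<otimes> v l i) : P" if "i < k" for i using wv' that by simp
 from wj obtain l0 where l0: "l0 < Suc k" "\<one> \<otimes> w l0 ~: P" by (elim exE conjE)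
 then have l0: "l0 < Suc k" "w l0 ~: P" by simp_all
 \<comment> \<open>The torsion element that is the unit vector at a coordinate where the form does
   not vanish modulo P.\<close>
 have "EX x:carrier M. (ALL i:{1..m}. \<gamma> i x \<ominus> (if i = j + l0 then \<one> else \<zero>) : I i) & (ALL i:{1..p}. ALL k:{1..n i}. \<phi> i k x = \<zero>)"
  by (rule coords_surject) (auto simp: J_zero)
 then obtain x where x: "x : carrier M" "ALL i:{1..m}. \<gamma> i x \<ominus> (if i = j + l0 then \<one> else \<zero>) : I i" "ALL i:{1..p}. ALL k:{1..n i}. \<phi> i k x = \<zero>"
  by (elim bexE conjE)
 have "torsion_element R M x" unfolding torsion_iff[OF x(1)] by (rule x(3))
 from mp[OF bspec[OF tx x(1)] this] obtain c where c': "ALL b. c b : carrier R" and rc: "r \<odot>\<^bsub>M\<^esub> x = r \<odot>\<^bsub>M\<^esub> lc M k c t" by (elim exE conjE)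
 have c [simp]: "c b : carrier R" for b using c' by (rule spec)
 have key: "(if l = l0 then \<one> else \<zero>) \<ominus> dot R k c (v l) : P" if l: "l < Suc k" for l
 proof -
  note J = jl[OF l]
  note [simp] = gamma_closed[OF J]
  note idJ = ideal_I[OF J]
  have vl: "v l = (%b. \<gamma> (j + l) (t b))" using l by (auto simp: v_def)
  let ?y = "lc M k c t"
  have [simp]: "?y : carrier M" by (rule lc_closed) auto
  have a: "\<gamma> (j + l) (r \<odot>\<^bsub>M\<^esub> x) \<ominus> r \<otimes> \<gamma> (j + l) x : I (j + l)" by (rule gamma_smult[OF J r x(1)])
  have b: "\<gamma> (j + l) (r \<odot>\<^bsub>M\<^esub> x) \<ominus> r \<otimes> \<gamma> (j + l) ?y : I (j + l)" unfolding rc by (rule gamma_smult[OF J r]) simp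
  have "\<gamma> (j + l) x \<ominus> \<gamma> (j + l) ?y : P"
  proof -
   have *: "(u \<ominus> v) \<otimes> r = (g \<ominus> r \<otimes> v) \<ominus> (g \<ominus> r \<otimes> u)" if "u : carrier R" "v : carrier R" "g : carrier R" for u v g
    using that r by algebra
   have "(\<gamma> (j + l) x \<ominus> \<gamma> (j + l) ?y) \<otimes> r = (\<gamma> (j + l) (r \<odot>\<^bsub>M\<^esub> x) \<ominus> r \<otimes> \<gamma> (j + l) ?y) \<ominus> (\<gamma> (j + l) (r \<odot>\<^bsub>M\<^esub> x) \<ominus> r \<otimes> \<gamma> (j + l) x)"
    by (rule *) (use x r in auto)
   then have "(\<gamma> (j + l) x \<ominus> \<gamma> (j + l) ?y) \<otimes> r : I j" using R.ideal_add(3)[OF idJ b a] Ijl[OF l] by auto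
   then show ?thesis using QP x unfolding Q_def by auto
  qed
  moreover have "\<gamma> (j + l) ?y \<ominus> dot R k c (v l) : P"
   unfolding vl using gamma_lc[OF J, of c t k] Ijl[OF l] IQ by auto
  moreover have "\<gamma> (j + l) x \<ominus> (if l = l0 then \<one> else \<zero>) : P"
   using bspec[OF x(2) J] Ijl[OF l] IQ by auto
  moreover have *: "u \<ominus> w = ((x \<ominus> y) \<oplus> (y \<ominus> w)) \<ominus> (x \<ominus> u)" if "u : carrier R" "w : carrier R" "x : carrier R" "y : carrier R" for u w x y
   using that by algebra
  have "(if l = l0 then \<one> else \<zero>) \<ominus> dot R k c (v l) =
   ((\<gamma> (j + l) x \<ominus> \<gamma> (j + l) ?y) \<oplus> (\<gamma> (j + l) ?y \<ominus> dot R k c (v l))) \<ominus> (\<gamma> (j + l) x \<ominus> (if l = l0 then \<one> else \<zero>))"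
   by (rule *) (use x in auto)
  ultimately show ?thesis using R.ideal_add(1,3)[OF idP] by metis
 qed
 have "(\<Oplus>l\<in>{..<Suc k}. w l \<otimes> ((if l = l0 then \<one> else \<zero>) \<ominus> dot R k c (v l))) : P"
  by (rule ideal.finsum_in_ideal[OF idP], rule ideal_lin(1)[OF idP key]) auto
 also have "(\<Oplus>l\<in>{..<Suc k}. w l \<otimes> ((if l = l0 then \<one> else \<zero>) \<ominus> dot R k c (v l))) =
   (\<Oplus>l\<in>{..<Suc k}. w l \<otimes> (if l = l0 then \<one> else \<zero>) \<ominus> w l \<otimes> dot R k c (v l))"
 proof (rule R.finsum_cong')
  fix l
  have "u \<otimes> (v \<ominus> w) = u \<otimes> v \<ominus> u \<otimes> w" if "u : carrier R" "v : carrier R" "w : carrier R" for u v w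
   using that by algebra
  then show "w l \<otimes> ((if l = l0 then \<one> else \<zero>) \<ominus> dot R k c (v l)) = w l \<otimes> (if l = l0 then \<one> else \<zero>) \<ominus> w l \<otimes> dot R k c (v l)" by simp
 qed auto
 also have "... = (\<Oplus>l\<in>{..<Suc k}. w l \<otimes> (if l = l0 then \<one> else \<zero>)) \<ominus> dot R (Suc k) w (%l. dot R k c (v l))"
  unfolding dot_def[of R "Suc k"] by (rule finsum_minus) auto
 also have "(\<Oplus>l\<in>{..<Suc k}. w l \<otimes> (if l = l0 then \<one> else \<zero>)) = w l0" by (rule sum_delta_left(2)) (use l0 in auto)
 also have "dot R (Suc k) w (%l. dot R k c (v l)) = dot R k c (%b. dot R (Suc k) w (%l. v l b))"
 proof -
  have "dot R (Suc k) w (%l. dot R k c (v l)) = dot R (Suc k) (%l. dot R k c (v l)) w" by (rule R.dot_comm) auto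
  also have "... = dot R k c (%b. dot R (Suc k) (%l. v l b) w)"
   using R.dot_sum[of c "%b l. v l b" w "Suc k" k] by simp
  also have "... = dot R k c (%b. dot R (Suc k) w (%l. v l b))" using R.dot_comm[of w "%l. v l _"] by simp
  finally show ?thesis .
 qed
 finally have f: "w l0 \<ominus> dot R k c (%b. dot R (Suc k) w (%l. v l b)) : P" .
 have "dot R k c (%b. dot R (Suc k) w (%l. v l b)) : P"
  unfolding dot_def[of R k] by (rule ideal.finsum_in_ideal[OF idP]) (unfold dot_def, rule ideal_lin(1)[OF idP wv], auto)
 then show False using l0(2) R.ideal_cong[OF idP _ _ f] by simp
qed

lemma torsion_generated_iff:
 "r : carrier R ==> torsion_generated R M r k \<longleftrightarrow> (ALL j:{1..m}. j + k <= m --> r : I j)"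
 using torsion_generated_if torsion_generatedD by blast

text \<open>The ideals are proper, so for r = 1 the criterion demands that no index satisfies j + k
  <= m. Thus m is the least number of generators of the torsion.\<close>

lemma le_iff_torsion_generated: "m <= k \<longleftrightarrow> torsion_generated R M \<one> k"
proof -
 have "\<one> ~: I j" if "j : {1..m}" for j using I_proper[OF that] ideal.one_imp_carrier[OF ideal_I[OF that]] by blast
 then have "torsion_generated R M \<one> k \<longleftrightarrow> (ALL j:{1..m}. ~j + k <= m)" using torsion_generated_iff[OF R.one_closed] by blast
 also have "... \<longleftrightarrow> m <= k"
 proof
  assume "ALL j:{1..m}. ~j + k <= m"
  from bspec[OF this, of 1] show "m <= k" by (cases "m = 0") auto
 qed auto
 finally show ?thesis by blast
qed

text \<open>The indices j' with j' + (m - j) <= m are those up to \<open>j\<close>, and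
  \<open>I j\<close> is the smallest of their ideals.\<close>

lemma I_eq_torsion_generated:
 assumes j: "j : {1..m}"
 shows "I j = {r : carrier R. torsion_generated R M r (m - j)}"
proof -
 have "(ALL j':{1..m}. j' + (m - j) <= m --> r : I j') \<longleftrightarrow> r : I j" for r
 proof
  assume "r : I j"
  moreover have "I j <= I j'" if "j' : {1..m}" "j' + (m - j) <= m" for j' using that j by (intro I_antimono) auto
  ultimately show "ALL j':{1..m}. j' + (m - j) <= m --> r : I j'" by blast
 qed (use j in auto)
 then show ?thesis using torsion_generated_iff ideal.Icarr[OF ideal_I[OF j]] by blast
qed

end

section \<open>The idempotents and ranks of the free part\<close>

context decomposed_module
begin

text \<open>It marks the part of the spectrum where the module modulo torsion has rank at least
  N.\<close>

definition rank_idempotent :: "nat => 'a" where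
 "rank_idempotent N = (\<Oplus>i\<in>{i : {1..p}. N <= n i}. e i)"

lemma rank_idempotent_closed [simp]: "rank_idempotent N : carrier R"
 unfolding rank_idempotent_def by (rule R.finsum_closed') (simp add: e_carrier)

lemma e_mult_rank_idempotent:
 assumes i: "i : {1..p}"
 shows "e i \<otimes> rank_idempotent N = (if N <= n i then e i else \<zero>)"
proof -
 let ?A = "{i : {1..p}. N <= n i}"
 have "e i \<otimes> rank_idempotent N = (\<Oplus>i'\<in>?A. e i \<otimes> e i')"
  unfolding rank_idempotent_def by (rule R.finsum_rdistr) (use e_carrier i in auto)
 also have "... = (\<Oplus>i'\<in>?A. if i' = i then e i' else \<zero>)"
  by (rule R.finsum_cong') (use e_carrier e_idem e_orth i in auto)
 also have "... = (if N <= n i then e i else \<zero>)"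
 proof (cases "N <= n i")
  case True
  then show ?thesis using R.finsum_delta[of ?A i e] i e_carrier by simp
 next
  case False
  then have "(\<Oplus>i'\<in>?A. if i' = i then e i' else \<zero>) = (\<Oplus>i'\<in>?A. \<zero>)"
   by (intro R.finsum_cong') auto
  then show ?thesis using False by simp
 qed
 finally show ?thesis .
qed

lemma mult_rank_idempotent:
 assumes r: "r : carrier R" and z: "!!i. i : {1..p} ==> N <= n i ==> r \<otimes> e i = \<zero>"
 shows "r \<otimes> rank_idempotent N = \<zero>"
proof -
 have "r \<otimes> rank_idempotent N = (\<Oplus>i\<in>{i : {1..p}. N <= n i}. r \<otimes> e i)"
  unfolding rank_idempotent_def by (rule R.finsum_rdistr) (use e_carrier r in auto)
 also have "... = (\<Oplus>i\<in>{i : {1..p}. N <= n i}. \<zero>)" by (rule R.finsum_cong') (use z in auto)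
 finally show ?thesis by simp
qed

lemma rank_idempotent_idem: "rank_idempotent N \<otimes> rank_idempotent N = rank_idempotent N"
proof -
 let ?E = "rank_idempotent N"
 have "(\<one> \<ominus> ?E) \<otimes> ?E = \<zero>"
 proof (rule mult_rank_idempotent)
  fix i assume i: "i : {1..p}" "N <= n i"
  have "(\<one> \<ominus> ?E) \<otimes> e i = e i \<ominus> e i \<otimes> ?E" using e_carrier[OF i(1)] rank_idempotent_closed[of N] by algebra
  then show "(\<one> \<ominus> ?E) \<otimes> e i = \<zero>" using e_mult_rank_idempotent[OF i(1)] i e_carrier by (simp add: R.minus_eq R.r_neg)
 qed simp
 then have "?E \<ominus> ?E \<otimes> ?E = \<zero>" using R.complement_mult[of ?E ?E] by simp
 then show ?thesis using R.minus_zeroD[of ?E "?E \<otimes> ?E"] by simp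
qed

text \<open>Let v k have, in every block, the coordinate at Suc k equal to a regular element of the
  corresponding ideal and all others zero. In a block with n i >= N the coordinates of a relation x
  give x k times a regular element equal to zero, hence x k e i = 0; multiplying by \<open>s\<close>
  discards the other blocks.\<close>

lemma independent_after_if:
 assumes s: "s : carrier R" and sE: "s \<otimes> rank_idempotent N = s"
 shows "independent_after R M s N"
proof -
 have "EX d. ALL i:{1..p}. ALL k:{1..n i}. d i k : J i k & (ALL r:carrier R. r \<otimes> d i k = \<zero> --> r \<otimes> e i = \<zero>)"
  by (rule exI[of _ "%i k. SOME d. d : J i k & (ALL r:carrier R. r \<otimes> d = \<zero> --> r \<otimes> e i = \<zero>)"], intro ballI, rule someI_ex)
   (use J_regular in blast)
 then obtain d where d': "ALL i:{1..p}. ALL k:{1..n i}. d i k : J i k & (ALL r:carrier R. r \<otimes> d i k = \<zero> --> r \<otimes> e i = \<zero>)"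
  by (rule exE)
 have "ALL k. EX x. x : carrier M & (ALL i:{1..p}. ALL l:{1..n i}. \<phi> i l x = (if l = Suc k then d i l else \<zero>))"
 proof
  fix k
  have "EX x:carrier M. ALL i:{1..p}. ALL l:{1..n i}. \<phi> i l x = (if l = Suc k then d i l else \<zero>)"
   by (rule ex_with_phi) (use d' J_zero in auto)
  then show "EX x. x : carrier M & (ALL i:{1..p}. ALL l:{1..n i}. \<phi> i l x = (if l = Suc k then d i l else \<zero>))" by blast
 qed
 from choice[OF this] obtain v where v': "ALL k. v k : carrier M & (ALL i:{1..p}. ALL l:{1..n i}. \<phi> i l (v k) = (if l = Suc k then d i l else \<zero>))"
  by (rule exE)
 have v [simp]: "v k : carrier M" for k using v' by blast
 have vf: "\<phi> i l (v k) = (if l = Suc k then d i l else \<zero>)" if "i : {1..p}" "l : {1..n i}" for i l k using v' that by blast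
 have "s \<otimes> x k = \<zero>" if x': "ALL k. x k : carrier R" and l: "lc M N x v = \<zero>\<^bsub>M\<^esub>" and k: "k < N" for x k
 proof -
  have x [simp]: "x k : carrier R" for k using x' by blast
  have "x k \<otimes> rank_idempotent N = \<zero>"
  proof (rule mult_rank_idempotent)
   fix i assume i: "i : {1..p}" "N <= n i"
   have ik: "Suc k : {1..n i}" using i k by simp
   have dik: "d i (Suc k) : carrier R" using d' i ik J_carrier by blast
   have "\<phi> i (Suc k) (lc M N x v) = dot R N x (%b. \<phi> i (Suc k) (v b))"
    by (rule functional_lc[OF phi_functional[OF i(1) ik]]) simp_all
   also have "(%b. \<phi> i (Suc k) (v b)) = (%b. if b = k then d i (Suc k) else \<zero>)"
    using vf[OF i(1) ik] by auto
   also have "dot R N x (%b. if b = k then d i (Suc k) else \<zero>) = (\<Oplus>b\<in>{..<N}. if b = k then x b \<otimes> d i (Suc k) else \<zero>)"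
    unfolding dot_def by (rule R.finsum_cong') (use dik in auto)
   also have "... = x k \<otimes> d i (Suc k)" by (rule R.finsum_delta) (use k dik in auto)
   finally have "x k \<otimes> d i (Suc k) = \<zero>" using l functional_zero[OF phi_functional[OF i(1) ik]] by simp
   then show "x k \<otimes> e i = \<zero>" using d' i(1) ik x by blast
  qed simp
  moreover have "s \<otimes> x k = s \<otimes> (x k \<otimes> rank_idempotent N)"
  proof -
   have "s \<otimes> x k = s \<otimes> rank_idempotent N \<otimes> x k" unfolding sE ..
   also have "... = s \<otimes> (x k \<otimes> rank_idempotent N)" using s x[of k] rank_idempotent_closed[of N] by algebra
   finally show ?thesis .
  qed
  ultimately show ?thesis using s by simp
 qed
 then show ?thesis unfolding independent_after_def by (intro exI[of _ v]) simp
qed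

text \<open>\<open>s\<close> has to vanish outside the rank idempotent, and this is checked in two
  places. In a block with n i < N, any n i + 1 vectors are linearly dependent over the reduced ring.
  Outside all blocks the module is torsion, so even the single vector v 0, which exists because 1 <=
  N, satisfies a relation.\<close>

lemma independent_afterD:
 assumes s: "s : carrier R" and ind: "independent_after R M s N" and N: "1 <= N"
 shows "s \<otimes> rank_idempotent N = s"
proof -
 obtain v where v': "ALL k. v k : carrier M"
  and vi: "ALL x. (ALL k. x k : carrier R) --> lc M N x v = \<zero>\<^bsub>M\<^esub> --> (ALL k<N. s \<otimes> x k = \<zero>)"
  using ind unfolding independent_after_def by (elim exE conjE)
 have v [simp]: "v k : carrier M" for k using v' by (rule spec)
 \<comment> \<open>A combination that is merely torsion counts as a relation: multiply it by a
   regular element and cancel that element afterwards.\<close>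
 have tor: "s \<otimes> x k = \<zero>" if x [simp]: "!!k. x k : carrier R" and t: "torsion_element R M (lc M N x v)" and k: "k < N" for x k
 proof -
  obtain d where d: "d : regular_elements R" "d \<odot>\<^bsub>M\<^esub> lc M N x v = \<zero>\<^bsub>M\<^esub>" using t unfolding torsion_element_def by blast
  note dR [simp] = regularD(1)[OF d(1)]
  have "lc M N (%k. d \<otimes> x k) v = \<zero>\<^bsub>M\<^esub>" by (subst lc_smult) (use d in auto)
  then have "s \<otimes> (d \<otimes> x k) = \<zero>" using spec[OF vi, of "%k. d \<otimes> x k"] k by simp
  moreover have "s \<otimes> (d \<otimes> x k) = d \<otimes> (s \<otimes> x k)" using s x[of k] dR by algebra
  ultimately show ?thesis using regularD(2)[OF d(1), of "s \<otimes> x k"] s by simp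
 qed
 have small: "s \<otimes> e i = \<zero>" if i: "i : {1..p}" and iN: "n i < N" for i
 proof (rule ccontr)
  note ei [simp] = e_carrier[OF i]
  assume ne: "s \<otimes> e i ~= \<zero>"
  define V where "V k l = (if l < n i then \<phi> i (Suc l) (v k) else \<zero>)" for k l
  have V [simp]: "V k l : carrier R" for k l unfolding V_def using phi_closed[OF i] by simp
  have idz: "ideal {\<zero>} R" by (rule R.zeroideal)
  have "EX x. (ALL k::nat. x k : carrier R) & (ALL l<n i. (\<Oplus>k\<in>{..<Suc (n i)}. x k \<otimes> V k l) : {\<zero>}) &
   (EX j<Suc (n i). s \<otimes> e i \<otimes> x j ~: {\<zero>})"
  proof (rule R.ex_dependence[OF idz])
   show "x : {\<zero>}" if "x : carrier R" "x \<otimes> x : {\<zero>}" for x using reduced[OF that(1)] that(2) by blast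
   show "s \<otimes> e i : carrier R" using s by simp
   show "s \<otimes> e i ~: {\<zero>}" using ne by blast
  qed (rule V)
  then obtain x where xx: "(ALL k::nat. x k : carrier R) & (ALL l<n i. (\<Oplus>k\<in>{..<Suc (n i)}. x k \<otimes> V k l) : {\<zero>}) &
   (EX j<Suc (n i). s \<otimes> e i \<otimes> x j ~: {\<zero>})" by (rule exE)
  have x [simp]: "x k : carrier R" for k using xx by blast
  have x0: "(\<Oplus>k\<in>{..<Suc (n i)}. x k \<otimes> V k l) = \<zero>" if "l < n i" for l using xx that by blast
  obtain j where j: "j < Suc (n i)" "s \<otimes> e i \<otimes> x j ~= \<zero>" using xx by blast
  \<comment> \<open>The factor e i removes the coordinates in the other blocks. Padding with zeros
    is possible because Suc (n i) <= N.\<close>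
  define y where "y k = (if k < Suc (n i) then e i \<otimes> x k else \<zero>)" for k
  have y [simp]: "y k : carrier R" for k by (simp add: y_def)
  have "torsion_element R M (lc M N y v)"
  proof (subst torsion_iff)
   show "lc M N y v : carrier M" by (rule lc_closed) auto
   show "ALL i:{1..p}. ALL k:{1..n i}. \<phi> i k (lc M N y v) = \<zero>"
   proof (intro ballI)
    fix i' l assume il: "i' : {1..p}" "l : {1..n i'}"
    note [simp] = phi_closed[OF il]
    have "\<phi> i' l (lc M N y v) = (\<Oplus>k\<in>{..<N}. y k \<otimes> \<phi> i' l (v k))"
     by (subst functional_lc[OF phi_functional[OF il]]) (simp_all add: dot_def)
    also have "... = \<zero>"
    proof (cases "i' = i")
     case False
     have "y k \<otimes> \<phi> i' l (v k) = \<zero>" for k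
     proof -
      have "e i \<otimes> \<phi> i' l (v k) = e i \<otimes> (e i' \<otimes> \<phi> i' l (v k))" using J_unit[OF il phi_in[OF il]] by simp
      also have "... = \<zero>" using e_orth[OF i il(1)] False e_carrier[OF il(1)] by (simp add: R.m_assoc[symmetric])
      finally have e0: "e i \<otimes> \<phi> i' l (v k) = \<zero>" .
      have "e i \<otimes> x k \<otimes> \<phi> i' l (v k) = x k \<otimes> (e i \<otimes> \<phi> i' l (v k))" using x[of k] ei phi_closed[OF il v] by algebra
      then show ?thesis using e0 by (simp add: y_def)
     qed
     then show ?thesis by simp
    next
     case True
     then have li: "l - 1 < n i" "Suc (l - 1) = l" using il by auto
     have pcl: "\<phi> i l (v k) : carrier R" for k using phi_closed[OF i _ v] il True by simp
     have "(\<Oplus>k\<in>{..<N}. y k \<otimes> \<phi> i' l (v k)) = (\<Oplus>k\<in>{..<Suc (n i)}. y k \<otimes> \<phi> i' l (v k))"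
      by (rule R.add.finprod_mono_neutral_cong_right) (use iN in \<open>auto simp: y_def\<close>)
     also have "... = (\<Oplus>k\<in>{..<Suc (n i)}. e i \<otimes> (x k \<otimes> V k (l - 1)))"
      by (rule R.finsum_cong') (use li True pcl in \<open>auto simp: y_def V_def R.m_assoc\<close>)
     also have "... = e i \<otimes> (\<Oplus>k\<in>{..<Suc (n i)}. x k \<otimes> V k (l - 1))" by (rule R.finsum_rdistr[symmetric]) auto
     finally show ?thesis using x0[OF li(1)] by simp
    qed
    finally show "\<phi> i' l (lc M N y v) = \<zero>" .
   qed
  qed
  from tor[OF y this, of j] have "s \<otimes> y j = \<zero>" using j(1) iN by simp
  then show False using j s by (simp add: y_def R.m_assoc)
 qed
 let ?E = "rank_idempotent N" and ?F = "rank_idempotent 0"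
 \<comment> \<open>\<open>?F\<close> is the sum of all e i, so 1 - ?F annihilates every coordinate
   \<phi>.\<close>
 have sF: "s \<otimes> (\<one> \<ominus> ?F) = \<zero>"
 proof -
  define y where "y k = (if k = (0::nat) then \<one> \<ominus> ?F else \<zero>)" for k
  have y [simp]: "y k : carrier R" for k by (simp add: y_def)
  have "torsion_element R M (lc M N y v)"
  proof (subst torsion_iff)
   show "lc M N y v : carrier M" by (rule lc_closed) auto
   show "ALL i:{1..p}. ALL k:{1..n i}. \<phi> i k (lc M N y v) = \<zero>"
   proof (intro ballI)
    fix i l assume il: "i : {1..p}" "l : {1..n i}"
    have "y k \<otimes> \<phi> i l (v k) = \<zero>" for k
    proof -
     note pc = phi_closed[OF il v[of k]]
     have "(\<one> \<ominus> ?F) \<otimes> \<phi> i l (v k) = (\<one> \<ominus> ?F) \<otimes> (e i \<otimes> \<phi> i l (v k))" using J_unit[OF il phi_in[OF il]] by simp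
     also have "... = (e i \<ominus> e i \<otimes> ?F) \<otimes> \<phi> i l (v k)" using pc e_carrier[OF il(1)] rank_idempotent_closed[of 0] by algebra
     also have "e i \<ominus> e i \<otimes> ?F = \<zero>" unfolding e_mult_rank_idempotent[OF il(1)] using e_carrier[OF il(1)] by (simp add: R.minus_eq R.r_neg)
     finally show ?thesis using pc by (cases "k = 0") (simp_all add: y_def)
    qed
    then show "\<phi> i l (lc M N y v) = \<zero>"
     by (subst functional_lc[OF phi_functional[OF il]]) (simp_all add: dot_def)
   qed
  qed
  from tor[OF y this, of 0] show ?thesis using N by (simp add: y_def)
 qed
 have "(s \<otimes> (\<one> \<ominus> ?E)) \<otimes> ?F = \<zero>"
 proof (rule mult_rank_idempotent)
  fix i assume i: "i : {1..p}"
  note ei = e_carrier[OF i]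
  have *: "(s \<otimes> (\<one> \<ominus> ?E)) \<otimes> e i = s \<otimes> (e i \<ominus> e i \<otimes> ?E)" using s ei rank_idempotent_closed[of N] by algebra
  show "(s \<otimes> (\<one> \<ominus> ?E)) \<otimes> e i = \<zero>"
  proof (cases "N <= n i")
   case True
   then show ?thesis unfolding * e_mult_rank_idempotent[OF i] using s ei by (simp add: R.minus_eq R.r_neg)
  next
   case False
   then show ?thesis unfolding * e_mult_rank_idempotent[OF i] using s ei small[OF i] by (simp add: R.minus_eq)
  qed
 qed (use s in simp)
 moreover have "s \<otimes> (\<one> \<ominus> ?E) = (s \<otimes> (\<one> \<ominus> ?E)) \<otimes> ?F \<oplus> (s \<otimes> (\<one> \<ominus> ?F)) \<otimes> (\<one> \<ominus> ?E)"
  using s rank_idempotent_closed[of 0] rank_idempotent_closed[of N] by algebra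
 ultimately have z: "s \<otimes> (\<one> \<ominus> ?E) = \<zero>" using sF s by simp
 have "s \<otimes> ?E = s \<ominus> s \<otimes> (\<one> \<ominus> ?E)" using s rank_idempotent_closed[of N] by algebra
 then show ?thesis unfolding z using s by (simp add: R.minus_eq)
qed

lemma independent_after_iff:
 "1 <= N ==> s : carrier R ==> independent_after R M s N \<longleftrightarrow> s \<otimes> rank_idempotent N = s"
 using independent_afterD independent_after_if by blast

text \<open>As \<open>n\<close> is injective, \<open>i\<close> is the only index lost when the bound
  passes from n i to its successor.\<close>

lemma e_eq_rank_idempotents:
 assumes i: "i : {1..p}"
 shows "e i = rank_idempotent (n i) \<ominus> rank_idempotent (Suc (n i))"
proof -
 have "{i' : {1..p}. n i <= n i'} = insert i {i' : {1..p}. Suc (n i) <= n i'}"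
  using i strict_mono_on_eqD[OF n_mono] by (auto simp: Suc_le_eq dest: le_neq_implies_less)
 then have "rank_idempotent (n i) = e i \<oplus> rank_idempotent (Suc (n i))"
  unfolding rank_idempotent_def using i e_carrier by (simp add: R.finsum_insert)
 then show ?thesis using e_carrier[OF i] rank_idempotent_closed[of "Suc (n i)"] R.minus_eq R.a_assoc R.r_neg by simp
qed

lemma n_image: "n ` {1..p} = {N. 1 <= N & rank_idempotent N ~= rank_idempotent (Suc N)}"
proof (intro equalityI subsetI)
 fix N assume "N : n ` {1..p}"
 then obtain i where i: "i : {1..p}" "N = n i" by blast
 have "rank_idempotent N ~= rank_idempotent (Suc N)"
  using e_eq_rank_idempotents[OF i(1)] e_nonzero[OF i(1)] i(2) R.r_neg R.minus_eq by auto
 then show "N : {N. 1 <= N & rank_idempotent N ~= rank_idempotent (Suc N)}" using n_pos[OF i(1)] i(2) by auto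
next
 fix N assume N: "N : {N. 1 <= N & rank_idempotent N ~= rank_idempotent (Suc N)}"
 show "N : n ` {1..p}"
 proof (rule ccontr)
  assume "N ~: n ` {1..p}"
  then have "{i : {1..p}. N <= n i} = {i : {1..p}. Suc N <= n i}"
   by (auto simp: Suc_le_eq image_iff dest: le_neq_implies_less)
  then show False using N unfolding rank_idempotent_def by simp
 qed
qed

text \<open>The rank of n i within the image determines the index, so a strictly increasing
  \<open>n\<close> is recovered from its image.\<close>

lemma n_index: "i : {1..p} ==> card {N : n ` {1..p}. N <= n i} = i"
proof -
 assume i: "i : {1..p}"
 have le: "n i' <= n i \<longleftrightarrow> i' <= i" if "i' : {1..p}" for i'
  using strict_mono_on_less_eq[OF n_mono that i] .
 have "{N : n ` {1..p}. N <= n i} = n ` {1..i}" using le i by auto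
 moreover have "inj_on n {1..i}" using strict_mono_on_imp_inj_on[OF n_mono] i by (auto elim: inj_on_subset)
 ultimately show ?thesis by (simp add: card_image)
qed

end

lemma decomposed_module_unique:
 assumes 1: "decomposed_module R M m p I e n J \<gamma> \<phi>" and 2: "decomposed_module R M m' p' I' e' n' J' \<gamma>' \<phi>'"
 shows "m = m'" "ALL j:{1..m}. I j = I' j" "p = p'" "ALL i:{1..p}. e i = e' i" "ALL i:{1..p}. n i = n' i"
proof -
 interpret A: decomposed_module R M m p I e n J \<gamma> \<phi> by fact
 interpret B: decomposed_module R M m' p' I' e' n' J' \<gamma>' \<phi>' by fact
 show m: "m = m'"
  using A.le_iff_torsion_generated[of m'] B.le_iff_torsion_generated[of m']
   A.le_iff_torsion_generated[of m] B.le_iff_torsion_generated[of m] by auto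
 show "ALL j:{1..m}. I j = I' j"
  using A.I_eq_torsion_generated B.I_eq_torsion_generated unfolding m by blast
 \<comment> \<open>Both idempotents fix the same elements \<open>s\<close>, hence each fixes the
   other.\<close>
 have E: "A.rank_idempotent N = B.rank_idempotent N" if N: "1 <= N" for N
 proof -
  let ?a = "A.rank_idempotent N" and ?b = "B.rank_idempotent N"
  have "?a \<otimes>\<^bsub>R\<^esub> ?b = ?a"
   using A.independent_after_iff[OF N, of ?a] B.independent_after_iff[OF N, of ?a] A.rank_idempotent_idem by simp
  moreover have "?b \<otimes>\<^bsub>R\<^esub> ?a = ?b"
   using A.independent_after_iff[OF N, of ?b] B.independent_after_iff[OF N, of ?b] B.rank_idempotent_idem by simp
  ultimately show ?thesis using A.R.m_comm[of ?a ?b] by simp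
 qed
 have im: "n ` {1..p} = n' ` {1..p'}" unfolding A.n_image B.n_image using E by auto
 have "card (n ` {1..p}) = p" "card (n' ` {1..p'}) = p'"
  using strict_mono_on_imp_inj_on[OF A.n_mono] strict_mono_on_imp_inj_on[OF B.n_mono] by (simp_all add: card_image)
 then show p: "p = p'" using im by simp
 show n: "ALL i:{1..p}. n i = n' i"
 proof
  fix i assume i: "i : {1..p}"
  then obtain i' where i': "i' : {1..p'}" "n i = n' i'" using im by blast
  have "i = i'" using A.n_index[OF i] B.n_index[OF i'(1)] im i'(2) by simp
  then show "n i = n' i" using i' by simp
 qed
 show "ALL i:{1..p}. e i = e' i"
  using A.e_eq_rank_idempotents B.e_eq_rank_idempotents A.n_pos E n unfolding p by (simp add: Suc_le_eq)
qed

section \<open>Products of ideals of a corner ring\<close>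

context cring
begin

lemma corner_ring_simps [simp]:
 "monoid.mult (corner_ring R e) = (\<otimes>)" "ring.add (corner_ring R e) = (\<oplus>)"
 "ring.zero (corner_ring R e) = \<zero>" "monoid.one (corner_ring R e) = e"
 by (simp_all add: corner_ring_def)

lemma corner_ring_carrier:
 assumes e: "e : carrier R" "e \<otimes> e = e"
 shows "x : carrier (corner_ring R e) \<longleftrightarrow> x : carrier R & e \<otimes> x = x"
proof
 assume "x : carrier (corner_ring R e)"
 then obtain r where r: "r : carrier R" "x = r \<otimes> e" by (auto simp: corner_ring_def r_coset_def)
 then have "e \<otimes> x = r \<otimes> (e \<otimes> e)" using e(1) by (simp add: m_ac)
 then show "x : carrier R & e \<otimes> x = x" using r e by simp
next
 assume "x : carrier R & e \<otimes> x = x"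
 then have "x = x \<otimes> e" "x : carrier R" using e(1) m_comm by auto
 then show "x : carrier (corner_ring R e)" by (auto simp: corner_ring_def r_coset_def)
qed

lemma corner_ring_cring:
 assumes e: "e : carrier R" "e \<otimes> e = e"
 shows "cring (corner_ring R e)"
proof (rule cringI)
 note c = corner_ring_carrier[OF e]
 show "abelian_group (corner_ring R e)"
 proof (rule abelian_groupI)
  fix x assume x: "x : carrier (corner_ring R e)"
  have "\<ominus> x : carrier (corner_ring R e)" "\<ominus> x \<oplus> x = \<zero>" using x e by (auto simp: c r_minus l_neg)
  then show "EX y:carrier (corner_ring R e). y \<oplus>\<^bsub>corner_ring R e\<^esub> x = \<zero>\<^bsub>corner_ring R e\<^esub>" by auto
 qed (use e in \<open>auto simp: c r_distr a_ac\<close>)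
 show "comm_monoid (corner_ring R e)"
 proof (rule comm_monoidI)
  show "x \<otimes>\<^bsub>corner_ring R e\<^esub> y : carrier (corner_ring R e)"
   if "x : carrier (corner_ring R e)" "y : carrier (corner_ring R e)" for x y
   using that e by (simp add: c m_assoc[symmetric])
  show "\<one>\<^bsub>corner_ring R e\<^esub> : carrier (corner_ring R e)" using e by (simp add: c)
  show "x \<otimes>\<^bsub>corner_ring R e\<^esub> y \<otimes>\<^bsub>corner_ring R e\<^esub> z = x \<otimes>\<^bsub>corner_ring R e\<^esub> (y \<otimes>\<^bsub>corner_ring R e\<^esub> z)"
   if "x : carrier (corner_ring R e)" "y : carrier (corner_ring R e)" "z : carrier (corner_ring R e)" for x y z
   using that by (simp add: c m_assoc)
 qed (auto simp: c m_comm)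
qed (use e in \<open>auto simp: corner_ring_carrier l_distr\<close>)

lemma corner_idealD:
 assumes e: "e : carrier R" "e \<otimes> e = e" and K: "ideal K (corner_ring R e)"
 shows "ideal K R" "x : K ==> e \<otimes> x = x"
proof -
 note c = corner_ring_carrier[OF e]
 interpret K: ideal K "corner_ring R e" by fact
 have KR: "x : carrier R" "e \<otimes> x = x" if "x : K" for x using K.Icarr[OF that] c by auto
 show "x : K ==> e \<otimes> x = x" by (rule KR)
 have sm: "r \<otimes> x : K" if x: "x : K" and r: "r : carrier R" for r x
 proof -
  have "e \<otimes> r : carrier (corner_ring R e)" using c e r by (simp add: m_assoc[symmetric])
  from K.I_l_closed[OF x this] have "e \<otimes> r \<otimes> x : K" by simp
  also have "e \<otimes> r \<otimes> x = r \<otimes> (e \<otimes> x)" using e KR(1)[OF x] r by (simp add: m_ac)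
  finally show ?thesis using KR(2)[OF x] by simp
 qed
 show "ideal K R"
 proof (rule idealI)
  show "ring R" by (rule ring_axioms)
  show "subgroup K (add_monoid R)"
  proof (rule add.subgroupI)
   show "K <= carrier R" using KR by blast
   show "K ~= {}" using additive_subgroup.zero_closed[OF ideal.axioms(1)[OF K]] by blast
   show "\<ominus> a : K" if "a : K" for a using sm[OF that, of "\<ominus> \<one>"] KR(1)[OF that] by (simp add: l_minus)
   show "a \<oplus> b : K" if "a : K" "b : K" for a b using additive_subgroup.a_closed[OF ideal.axioms(1)[OF K] that] by simp
  qed
  show "x \<otimes> a : K" if "a : K" "x : carrier R" for a x using sm that .
  show "a \<otimes> x : K" if "a : K" "x : carrier R" for a x using sm[OF that] m_comm[of a x] KR(1)[OF that(1)] that(2) by simp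
 qed
qed

lemma corner_idealI:
 assumes e: "e : carrier R" "e \<otimes> e = e" and K: "ideal K R" and Ke: "!!x. x : K ==> e \<otimes> x = x"
 shows "ideal K (corner_ring R e)"
proof (rule idealI)
 note c = corner_ring_carrier[OF e]
 interpret K: ideal K R by fact
 interpret C: cring "corner_ring R e" by (rule corner_ring_cring[OF e])
 show "ring (corner_ring R e)" by (rule C.ring_axioms)
 show "subgroup K (add_monoid (corner_ring R e))"
 proof (rule C.add.subgroupI)
  show "K <= carrier (corner_ring R e)" using Ke K.Icarr by (auto simp: c)
  show "K ~= {}" using K.zero_closed by blast
  fix a assume a: "a : K"
  show "\<ominus>\<^bsub>corner_ring R e\<^esub> a : K"
  proof -
   have "\<ominus>\<^bsub>corner_ring R e\<^esub> a = \<ominus> a"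
    by (rule C.minus_equality) (use a K.Icarr Ke e in \<open>auto simp: c l_neg r_minus\<close>)
   then show ?thesis using K.a_inv_closed[OF a] by simp
  qed
 qed (use K.a_closed in auto)
 show "x \<otimes>\<^bsub>corner_ring R e\<^esub> a : K" "a \<otimes>\<^bsub>corner_ring R e\<^esub> x : K" if "a : K" "x : carrier (corner_ring R e)" for a x
  using that K.I_l_closed K.I_r_closed by (auto simp: c)
qed

definition corner_product :: "'a => (nat => 'a set) => nat => 'a set" where
 "corner_product e J n = finprod (ideals_set (corner_ring R e)) J {1..n}"

text \<open>A membership rule and an induction rule for the product ideal. The factor
  \<open>e\<close> accounts for the empty product: it is one for elements, while the empty product
  of ideals is the corner ring itself, generated by \<open>e\<close>.\<close>

lemma corner_product:
 assumes e: "e : carrier R" "e \<otimes> e = e"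
 shows "(ALL k:{1..n}. ideal (J k) (corner_ring R e)) ==>
  ideal (corner_product e J n) (corner_ring R e) &
  (ALL a. (ALL k. a k : carrier R) --> (ALL k<n. a k : J (Suc k)) --> e \<otimes> (\<Otimes>k\<in>{..<n}. a k) : corner_product e J n) &
  (ALL S. (ALL x:S. ALL y:S. x \<oplus> y : S) --> (ALL r:carrier R. ALL x:S. r \<otimes> x : S) -->
   (ALL a. (ALL k. a k : carrier R) --> (ALL k<n. a k : J (Suc k)) --> e \<otimes> (\<Otimes>k\<in>{..<n}. a k) : S) -->
   corner_product e J n <= S)"
proof (induction n)
 case 0
 interpret C: cring "corner_ring R e" by (rule corner_ring_cring[OF e])
 interpret L: comm_monoid "ideals_set (corner_ring R e)" by (rule C.ideals_set_is_comm_monoid)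
 have P0: "corner_product e J 0 = carrier (corner_ring R e)"
 proof -
  have "corner_product e J 0 = \<one>\<^bsub>ideals_set (corner_ring R e)\<^esub>"
   unfolding corner_product_def using L.finprod_empty by simp
  then show ?thesis by (simp add: ideals_set_def)
 qed
 have *: "x : S" if S: "ALL r:carrier R. ALL x:S. r \<otimes> x : S" "e : S" and x: "x : carrier (corner_ring R e)" for S x
 proof -
  have "x : carrier R" "x = x \<otimes> e" using x e m_comm[of e x] by (auto simp: corner_ring_carrier)
  then show ?thesis using S by metis
 qed
 show ?case
  unfolding P0
 proof (intro conjI allI impI)
  show "ideal (carrier (corner_ring R e)) (corner_ring R e)" by (rule C.oneideal)
  show "e \<otimes> (\<Otimes>k\<in>{..<0}. a k) : carrier (corner_ring R e)" for a :: "nat => 'a" using e by (simp add: corner_ring_carrier)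
  fix S assume sm: "ALL r:carrier R. ALL x:S. r \<otimes> x : S"
   and S: "ALL a. (ALL k. a k : carrier R) --> (ALL k<0. a k : J (Suc k)) --> e \<otimes> (\<Otimes>k\<in>{..<0}. a k) : S"
  have "e : S" using S[THEN spec, of "%_. \<zero>"] e by simp
  then show "carrier (corner_ring R e) <= S" using * sm by blast
 qed
next
 case (Suc n)
 interpret C: cring "corner_ring R e" by (rule corner_ring_cring[OF e])
 interpret L: comm_monoid "ideals_set (corner_ring R e)" by (rule C.ideals_set_is_comm_monoid)
 have idJ: "ideal (J k) (corner_ring R e)" if "k : {1..Suc n}" for k using Suc.prems that by blast
 note J = corner_idealD[OF e idJ]
 have prems': "ALL k:{1..n}. ideal (J k) (corner_ring R e)" using Suc.prems by auto
 have IH: "ideal (corner_product e J n) (corner_ring R e)"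
  and IHm: "ALL a. (ALL k. a k : carrier R) --> (ALL k<n. a k : J (Suc k)) --> e \<otimes> (\<Otimes>k\<in>{..<n}. a k) : corner_product e J n"
  and IHs: "ALL S. (ALL x:S. ALL y:S. x \<oplus> y : S) --> (ALL r:carrier R. ALL x:S. r \<otimes> x : S) -->
   (ALL a. (ALL k. a k : carrier R) --> (ALL k<n. a k : J (Suc k)) --> e \<otimes> (\<Otimes>k\<in>{..<n}. a k) : S) -->
   corner_product e J n <= S"
  using Suc.IH[OF prems'] by - (elim conjE, assumption)+
 have "{1..Suc n} = insert (Suc n) {1..n}" by auto
 then have PS: "corner_product e J (Suc n) = ideal_prod (corner_ring R e) (J (Suc n)) (corner_product e J n)"
 proof -
  have "J k : carrier (ideals_set (corner_ring R e))" if "k : {1..Suc n}" for k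
   using idJ[OF that] by (simp add: ideals_set_def)
  then have "corner_product e J (Suc n) = J (Suc n) \<otimes>\<^bsub>ideals_set (corner_ring R e)\<^esub> corner_product e J n"
   unfolding corner_product_def \<open>{1..Suc n} = insert (Suc n) {1..n}\<close> by (intro L.finprod_insert) auto
  then show ?thesis by (simp add: ideals_set_def)
 qed
 have JR: "x : carrier R" if "x : J (Suc n)" for x using ideal.Icarr[OF J(1), of "Suc n" x] that by simp
 have PR: "x : carrier R" if "x : corner_product e J n" for x using ideal.Icarr[OF corner_idealD(1)[OF e IH] that] .
 show ?case
 proof (intro conjI allI impI)
  show "ideal (corner_product e J (Suc n)) (corner_ring R e)"
   unfolding PS by (rule C.ideal_prod_is_ideal[OF idJ IH]) simp
 next
  fix a assume a: "ALL k. a k : carrier R" "ALL k<Suc n. a k : J (Suc k)"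
  have pc: "(\<Otimes>k\<in>{..<n}. a k) : carrier R" using a by (intro finprod_closed') simp
  have "e \<otimes> (\<Otimes>k\<in>{..<Suc n}. a k) = e \<otimes> ((\<Otimes>k\<in>{..<n}. a k) \<otimes> a n)"
   using a(1) by (simp only: finprod_lessThan_Suc[of a])
  also have "... = a n \<otimes> (e \<otimes> (\<Otimes>k\<in>{..<n}. a k))" using pc a(1) e(1) by (simp add: m_ac)
  also have "... : ideal_prod (corner_ring R e) (J (Suc n)) (corner_product e J n)"
   using ideal_prod.prod[of "a n" "J (Suc n)" "e \<otimes> (\<Otimes>k\<in>{..<n}. a k)" "corner_product e J n" "corner_ring R e"] a IHm by simp
  finally show "e \<otimes> (\<Otimes>k\<in>{..<Suc n}. a k) : corner_product e J (Suc n)" unfolding PS .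
 next
  fix S assume add: "ALL x:S. ALL y:S. x \<oplus> y : S" and sm: "ALL r:carrier R. ALL x:S. r \<otimes> x : S"
   and S: "ALL a. (ALL k. a k : carrier R) --> (ALL k<Suc n. a k : J (Suc k)) --> e \<otimes> (\<Otimes>k\<in>{..<Suc n}. a k) : S"
  show "corner_product e J (Suc n) <= S"
  proof
   fix x assume "x : corner_product e J (Suc n)"
   then have "x : ideal_prod (corner_ring R e) (J (Suc n)) (corner_product e J n)" unfolding PS .
   then show "x : S"
   proof induction
    case (prod i j)
    note iR = JR[OF prod(1)]
    \<comment> \<open>The induction hypothesis is applied to the cofactors of \<open>i\<close>, that
      is, to the y with i y in \<open>S\<close>.\<close>
    have "corner_product e J n <= {y : carrier R. i \<otimes> y : S}"
    proof (rule IHs[THEN spec, THEN mp, THEN mp, THEN mp])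
     show "ALL x:{y : carrier R. i \<otimes> y : S}. ALL y:{y : carrier R. i \<otimes> y : S}. x \<oplus> y : {y : carrier R. i \<otimes> y : S}"
      using add iR by (simp add: r_distr)
     show "ALL r:carrier R. ALL x:{y : carrier R. i \<otimes> y : S}. r \<otimes> x : {y : carrier R. i \<otimes> y : S}"
      using sm iR by (simp add: m_lcomm)
     show "ALL a. (ALL k. a k : carrier R) --> (ALL k<n. a k : J (Suc k)) --> e \<otimes> (\<Otimes>k\<in>{..<n}. a k) : {y : carrier R. i \<otimes> y : S}"
     proof (intro allI impI)
      fix a assume a: "ALL k. a k : carrier R" "ALL k<n. a k : J (Suc k)"
      have pc: "(\<Otimes>k\<in>{..<n}. a k) : carrier R" using a by (intro finprod_closed') simp
      have "e \<otimes> (\<Otimes>k\<in>{..<Suc n}. (a(n := i)) k) : S" using S prod(1) a iR by (auto simp: less_Suc_eq)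
      also have "(\<Otimes>k\<in>{..<Suc n}. (a(n := i)) k) = (\<Otimes>k\<in>{..<n}. (a(n := i)) k) \<otimes> i"
       using a(1) iR by (subst finprod_lessThan_Suc) auto
      also have "(\<Otimes>k\<in>{..<n}. (a(n := i)) k) = (\<Otimes>k\<in>{..<n}. a k)"
       by (rule finprod_cong') (use a(1) in auto)
      also have "e \<otimes> ((\<Otimes>k\<in>{..<n}. a k) \<otimes> i) = i \<otimes> (e \<otimes> (\<Otimes>k\<in>{..<n}. a k))" using pc iR e(1) by (simp add: m_ac)
      finally show "e \<otimes> (\<Otimes>k\<in>{..<n}. a k) : {y : carrier R. i \<otimes> y : S}" using pc e(1) by simp
     qed
    qed
    then show ?case using prod(2) by auto
   next
    case (sum s1 s2)
    then show ?case using add by simp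
   qed
  qed
 qed
qed

text \<open>Think of A / d as the matrix of a map from the direct sum of the J k to that of the J'
  l. Scaling column k of A by an element a k of J (Suc k) gives d times a matrix whose row l has
  entries in J' (Suc l). Taking determinants, the product of the a k times det A is d ^ n times a
  determinant each of whose terms, multiplied by e, lies in the product of the J'.\<close>

lemma corner_product_transfer:
 assumes e: "e : carrier R" "e \<otimes> e = e"
  and J: "ALL k:{1..n}. ideal (J k) (corner_ring R e)" and J': "ALL k:{1..n}. ideal (J' k) (corner_ring R e)"
  and d [simp]: "d : carrier R" and A [simp]: "!!l k. A l k : carrier R"
  and hA: "ALL k<n. ALL a:J (Suc k). EX \<alpha>. ALL l<n. \<alpha> l : J' (Suc l) & d \<otimes> \<alpha> l = a \<otimes> A l k"
  and x: "x : corner_product e J n"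
 shows "EX z:corner_product e J' n. d [^] n \<otimes> z = rdet R n A \<otimes> x"
proof -
 let ?P' = "corner_product e J' n" and ?D = "rdet R n A"
 note [simp] = e(1)
 have P': "ideal ?P' R" by (rule corner_idealD(1)[OF e corner_product[OF e J', THEN conjunct1]])
 interpret P': ideal ?P' R by fact
 have D [simp]: "?D : carrier R" by (rule rdet_closed) simp
 have dn [simp]: "d [^] n : carrier R" by simp
 define S where "S = {x : carrier R. EX z:?P'. d [^] n \<otimes> z = ?D \<otimes> x}"
 have "corner_product e J n <= S"
 proof (rule corner_product[OF e J, THEN conjunct2, THEN conjunct2, THEN spec, THEN mp, THEN mp, THEN mp])
  show "ALL x:S. ALL y:S. x \<oplus> y : S"
  proof (intro ballI)
   fix x y assume "x : S" "y : S"
   then obtain z w where zw: "x : carrier R" "y : carrier R" "z : ?P'" "w : ?P'" "d [^] n \<otimes> z = ?D \<otimes> x" "d [^] n \<otimes> w = ?D \<otimes> y"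
    unfolding S_def by blast
   then have "d [^] n \<otimes> (z \<oplus> w) = ?D \<otimes> (x \<oplus> y)" by (simp add: r_distr P'.Icarr)
   then show "x \<oplus> y : S" using zw P'.a_closed unfolding S_def by blast
  qed
  show "ALL r:carrier R. ALL x:S. r \<otimes> x : S"
  proof (intro ballI)
   fix r x assume r: "r : carrier R" and "x : S"
   then obtain z where z: "x : carrier R" "z : ?P'" "d [^] n \<otimes> z = ?D \<otimes> x"
    unfolding S_def by blast
   have "d [^] n \<otimes> (r \<otimes> z) = r \<otimes> (d [^] n \<otimes> z)" using r P'.Icarr[OF z(2)] dn by algebra
   also have "... = ?D \<otimes> (r \<otimes> x)" unfolding z(3) using r z(1) D by algebra
   finally show "r \<otimes> x : S" using r z P'.I_l_closed unfolding S_def by blast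
  qed
  show "ALL a. (ALL k. a k : carrier R) --> (ALL k<n. a k : J (Suc k)) --> e \<otimes> (\<Otimes>k\<in>{..<n}. a k) : S"
  proof (intro allI impI)
   fix a assume aR: "ALL k. a k : carrier R" and aJ: "ALL k<n. a k : J (Suc k)"
   have a [simp]: "a k : carrier R" for k using aR by blast
   have "ALL k. EX \<alpha>. k < n --> (ALL l<n. \<alpha> l : J' (Suc l) & d \<otimes> \<alpha> l = a k \<otimes> A l k)" using hA aJ by blast
   from choice[OF this] obtain \<alpha> where \<alpha>: "ALL k. k < n --> (ALL l<n. \<alpha> k l : J' (Suc l) & d \<otimes> \<alpha> k l = a k \<otimes> A l k)"
    by (rule exE)
   define W where "W l k = (if k < n & l < n then \<alpha> k l else \<zero>)" for l k
   have WJ: "W l k : J' (Suc l)" if "k < n" "l < n" for k l using \<alpha> that by (simp add: W_def)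
   have W [simp]: "W l k : carrier R" for l k
   proof (cases "k < n & l < n")
    case True
    then have "ideal (J' (Suc l)) (corner_ring R e)" using J' by simp
    from ideal.Icarr[OF corner_idealD(1)[OF e this] WJ] show ?thesis using True by simp
   qed (auto simp: W_def)
   have pc [simp]: "(\<Otimes>k\<in>{..<n}. a k) : carrier R" by (intro finprod_closed') simp
   have det [simp]: "rdet R n W : carrier R" by (rule rdet_closed) simp
   have "(\<Otimes>k\<in>{..<n}. a k) \<otimes> ?D = rdet R n (%l k. a k \<otimes> A l k)" by (rule rdet_scale_columns[symmetric]) auto
   also have "... = rdet R n (%l k. d \<otimes> W l k)" by (rule rdet_cong) (use \<alpha> in \<open>auto simp: W_def\<close>)
   also have "... = (\<Otimes>k\<in>{..<n}. d) \<otimes> rdet R n W" by (rule rdet_scale_columns) auto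
   also have "(\<Otimes>k\<in>{..<n}. d) = d [^] n" using finprod_const[of d "{..<n}"] by simp
   finally have eq: "(\<Otimes>k\<in>{..<n}. a k) \<otimes> ?D = d [^] n \<otimes> rdet R n W" .
   have "d [^] n \<otimes> (e \<otimes> rdet R n W) = e \<otimes> ((\<Otimes>k\<in>{..<n}. a k) \<otimes> ?D)"
    unfolding eq using dn det e(1) by algebra
   also have "... = ?D \<otimes> (e \<otimes> (\<Otimes>k\<in>{..<n}. a k))" using pc D e(1) by algebra
   finally have eq: "d [^] n \<otimes> (e \<otimes> rdet R n W) = ?D \<otimes> (e \<otimes> (\<Otimes>k\<in>{..<n}. a k))" .
   have "e \<otimes> rdet R n W = (\<Oplus>p\<in>{p. p permutes {..<n}}. e \<otimes> (rsign R p \<otimes> (\<Otimes>i\<in>{..<n}. W i (p i))))"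
    unfolding rdet_def by (rule finsum_rdistr) (auto simp: finite_perms intro!: finprod_closed')
   also have "... : ?P'"
   proof (rule P'.finsum_in_ideal)
    fix p assume p: "p : {p. p permutes {..<n}}"
    have wc: "(\<Otimes>i\<in>{..<n}. W i (p i)) : carrier R" by (intro finprod_closed') simp
    have "W k (p k) : J' (Suc k)" if "k < n" for k
     using p permutes_in_image[of p "{..<n}" k] that by (intro WJ) auto
    then have "e \<otimes> (\<Otimes>i\<in>{..<n}. W i (p i)) : ?P'"
     using corner_product[OF e J', THEN conjunct2, THEN conjunct1, THEN spec, of "%i. W i (p i)"] by simp
    then have "rsign R p \<otimes> (e \<otimes> (\<Otimes>i\<in>{..<n}. W i (p i))) : ?P'" by (rule P'.I_l_closed) simp
    then show "e \<otimes> (rsign R p \<otimes> (\<Otimes>i\<in>{..<n}. W i (p i))) : ?P'" using wc by (simp add: m_lcomm)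
   qed
   finally have "e \<otimes> rdet R n W : ?P'" .
   then show "e \<otimes> (\<Otimes>k\<in>{..<n}. a k) : S" unfolding S_def using eq by auto
  qed
 qed
 then show ?thesis using x unfolding S_def by blast
qed

text \<open>The isomorphism is multiplication by det A / d ^ n. Because B A = d d, the determinants
  satisfy det B det A = d ^ (2 n), so multiplication by det B / d ^ n inverts it. Division by d ^ n
  is unambiguous, since d is regular in the corner ring.\<close>

lemma corner_product_iso:
 assumes e: "e : carrier R" "e \<otimes> e = e"
  and J: "ALL k:{1..n}. ideal (J k) (corner_ring R e)" and J': "ALL k:{1..n}. ideal (J' k) (corner_ring R e)"
  and d [simp]: "d : carrier R" and ed: "e \<otimes> d = d" and dreg: "ALL r:carrier R. r \<otimes> d = \<zero> --> r \<otimes> e = \<zero>"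
  and A [simp]: "!!l k. A l k : carrier R" and B [simp]: "!!l k. B l k : carrier R"
  and hA: "ALL k<n. ALL a:J (Suc k). EX \<alpha>. ALL l<n. \<alpha> l : J' (Suc l) & d \<otimes> \<alpha> l = a \<otimes> A l k"
  and hB: "ALL k<n. ALL a:J' (Suc k). EX \<alpha>. ALL l<n. \<alpha> l : J (Suc l) & d \<otimes> \<alpha> l = a \<otimes> B l k"
  and BA: "ALL k<n. ALL k'<n. (\<Oplus>l\<in>{..<n}. B k l \<otimes> A l k') = (if k = k' then d \<otimes> d else \<zero>)"
 shows "mod_isomorphic R (ideal_module R (corner_product e J n)) (ideal_module R (corner_product e J' n))"
proof -
 let ?P = "corner_product e J n" and ?P' = "corner_product e J' n" and ?a = "rdet R n A" and ?b = "rdet R n B"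
 note idPc = corner_product[OF e J, THEN conjunct1] and idPc' = corner_product[OF e J', THEN conjunct1]
 note idP = corner_idealD(1)[OF e idPc] and Pe = corner_idealD(2)[OF e idPc]
 note idP' = corner_idealD(1)[OF e idPc'] and Pe' = corner_idealD(2)[OF e idPc']
 interpret P: ideal ?P R by fact
 interpret P': ideal ?P' R by fact
 define q where "q = d [^] n"
 have [simp]: "?a : carrier R" "?b : carrier R" by (auto intro: rdet_closed)
 have q [simp]: "q : carrier R" by (simp add: q_def)
 have "r \<otimes> e = \<zero>" if "r : carrier R" "d [^] N \<otimes> r = \<zero>" for r and N :: nat using that
 proof (induction N arbitrary: r)
  case (Suc N)
  have "d [^] N \<otimes> (d \<otimes> r) = d [^] Suc N \<otimes> r" using Suc.prems by (simp add: m_assoc)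
  then have "d \<otimes> r \<otimes> e = \<zero>" using Suc by simp
  moreover have "d \<otimes> r \<otimes> e = r \<otimes> (e \<otimes> d)" using Suc.prems(1) d e(1) by algebra
  ultimately show ?case using dreg Suc.prems ed by simp
 qed (use e in simp)
 then have qc: "r = \<zero>" if "r : carrier R" "e \<otimes> r = r" "q \<otimes> r = \<zero>" for r
  using that e(1) m_comm[of r e] unfolding q_def by metis
 \<comment> \<open>This is cancellation of q = d ^ n in the corner ring.\<close>
 have qeq: "u = v" if "u : carrier R" "v : carrier R" "e \<otimes> u = u" "e \<otimes> v = v" "q \<otimes> u = q \<otimes> v" for u v
 proof -
  have eq: "e \<otimes> (u \<ominus> v) = e \<otimes> u \<ominus> e \<otimes> v" "q \<otimes> (u \<ominus> v) = q \<otimes> u \<ominus> q \<otimes> v" using that(1,2) e(1) q by algebra+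
  have "u \<ominus> v = \<zero>"
  proof (rule qc)
   show "u \<ominus> v : carrier R" using that by simp
   show "e \<otimes> (u \<ominus> v) = u \<ominus> v" unfolding eq(1) that(3,4) ..
   show "q \<otimes> (u \<ominus> v) = \<zero>" unfolding eq(2) that(5) using that(2) by (simp add: minus_eq r_neg)
  qed
  then show ?thesis using minus_zeroD that by blast
 qed
 have qq: "?b \<otimes> ?a = q \<otimes> q"
 proof -
  have "?b \<otimes> ?a = rdet R n (%k k'. \<Oplus>l\<in>{..<n}. B k l \<otimes> A l k')" by (rule rdet_mult[symmetric]) auto
  also have "... = rdet R n (%k k'. if k = k' then d \<otimes> d else \<zero>)" by (rule rdet_cong) (use BA in auto)
  also have "... = (\<Otimes>k\<in>{..<n}. if k = k then d \<otimes> d else \<zero>)" by (rule rdet_diagonal) auto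
  also have "... = (d \<otimes> d) [^] n" using finprod_const[of "d \<otimes> d" "{..<n}"] by simp
  also have "... = q \<otimes> q" unfolding q_def by (rule pow_mult_distrib) (auto simp: m_comm)
  finally show ?thesis .
 qed
 have "ALL x. EX z. x : ?P --> z : ?P' & q \<otimes> z = ?a \<otimes> x"
  using corner_product_transfer[OF e J J' d A hA] unfolding q_def by blast
 from choice[OF this] obtain \<psi> where \<psi>': "ALL x. x : ?P --> \<psi> x : ?P' & q \<otimes> \<psi> x = ?a \<otimes> x" by (rule exE)
 have \<psi>: "\<psi> x : ?P'" "q \<otimes> \<psi> x = ?a \<otimes> x" if "x : ?P" for x using \<psi>' that by blast+
 have uniq: "z = w" if "z : ?P'" "w : ?P'" "q \<otimes> z = q \<otimes> w" for z w
  by (rule qeq) (use that P'.Icarr Pe' in auto)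
 have add: "\<psi> (x \<oplus> y) = \<psi> x \<oplus> \<psi> y" if xy: "x : ?P" "y : ?P" for x y
  by (rule uniq) (use xy \<psi> P.a_closed P'.a_closed P.Icarr P'.Icarr in \<open>auto simp: r_distr\<close>)
 have sm: "\<psi> (r \<otimes> x) = r \<otimes> \<psi> x" if x: "x : ?P" and r: "r : carrier R" for r x
 proof (rule uniq)
  have "q \<otimes> (r \<otimes> \<psi> x) = r \<otimes> (q \<otimes> \<psi> x)" using r P'.Icarr[OF \<psi>(1)[OF x]] q by algebra
  also have "... = ?a \<otimes> (r \<otimes> x)" unfolding \<psi>(2)[OF x] using r P.Icarr[OF x] \<open>?a : carrier R\<close> by algebra
  finally show "q \<otimes> \<psi> (r \<otimes> x) = q \<otimes> (r \<otimes> \<psi> x)" using \<psi>(2)[OF P.I_l_closed[OF x r]] by simp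
 qed (use x r \<psi> P.I_l_closed P'.I_l_closed in auto)
 have "inj_on \<psi> ?P"
 proof (rule inj_onI)
  fix x y assume xy: "x : ?P" "y : ?P" and eq: "\<psi> x = \<psi> y"
  note [simp] = P.Icarr[OF xy(1)] P.Icarr[OF xy(2)]
  have "?a \<otimes> x = ?a \<otimes> y" using \<psi>(2)[OF xy(1)] \<psi>(2)[OF xy(2)] eq by simp
  then have "(?b \<otimes> ?a) \<otimes> x = (?b \<otimes> ?a) \<otimes> y" by (simp add: m_assoc)
  then have "q \<otimes> (q \<otimes> x) = q \<otimes> (q \<otimes> y)" unfolding qq by (simp add: m_assoc)
  moreover have "e \<otimes> (q \<otimes> z) = q \<otimes> z" if "z : ?P" for z
   using Pe[OF that] m_lcomm[OF e(1) q P.Icarr[OF that]] by simp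
  ultimately have "q \<otimes> x = q \<otimes> y" using xy by - (rule qeq, auto)
  then show "x = y" using xy Pe by - (rule qeq, auto)
 qed
 moreover have "\<psi> ` ?P = ?P'"
 proof (intro equalityI subsetI)
  fix z assume z: "z : ?P'"
  note [simp] = P'.Icarr[OF z]
  obtain x where x: "x : ?P" "q \<otimes> x = ?b \<otimes> z"
   using corner_product_transfer[OF e J' J d B hB z] unfolding q_def by (elim bexE)
  note [simp] = P.Icarr[OF x(1)]
  note pc = P'.Icarr[OF \<psi>(1)[OF x(1)]]
  have "q \<otimes> (q \<otimes> \<psi> x) = ?a \<otimes> (q \<otimes> x)" unfolding \<psi>(2)[OF x(1)] by (rule m_lcomm) auto
  also have "... = (?b \<otimes> ?a) \<otimes> z" unfolding x(2) by (simp add: m_ac)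
  also have "... = q \<otimes> (q \<otimes> z)" unfolding qq by (simp add: m_assoc)
  finally have "q \<otimes> (q \<otimes> \<psi> x) = q \<otimes> (q \<otimes> z)" .
  moreover have "e \<otimes> (q \<otimes> w) = q \<otimes> w" if "w : ?P'" for w
   using Pe'[OF that] m_lcomm[OF e(1) q P'.Icarr[OF that]] by simp
  ultimately have "q \<otimes> \<psi> x = q \<otimes> z" using z \<psi>(1)[OF x(1)] pc Pe' by - (rule qeq, auto)
  then have "\<psi> x = z" using uniq z \<psi>(1)[OF x(1)] by blast
  then show "z : \<psi> ` ?P" using x(1) by blast
 qed (use \<psi> in auto)
 ultimately have "bij_betw \<psi> ?P ?P'" unfolding bij_betw_def by blast
 moreover have "\<psi> : mod_hom R (ideal_module R ?P) (ideal_module R ?P')"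
  unfolding mod_hom_def ideal_module_def self_module_def using \<psi>(1) add sm by auto
 ultimately show ?thesis unfolding mod_isomorphic_def by (intro bexI[of _ \<psi>]) (simp_all add: ideal_module_def)
qed

end

lemma mod_isomorphic_direct_sum:
 assumes A: "finite A" and iso: "ALL i:A. mod_isomorphic R (N i) (N' i)"
 shows "mod_isomorphic R (direct_sum A N) (direct_sum A N')"
proof -
 have "ALL i. EX h. i : A --> h : mod_hom R (N i) (N' i) & bij_betw h (carrier (N i)) (carrier (N' i))"
  using iso unfolding mod_isomorphic_def by blast
 from choice[OF this] obtain h where h: "ALL i. i : A --> h i : mod_hom R (N i) (N' i) & bij_betw (h i) (carrier (N i)) (carrier (N' i))"
  by (rule exE)
 have hb: "bij_betw (h i) (carrier (N i)) (carrier (N' i))" if "i : A" for i using h that by blast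
 have c: "carrier (direct_sum A N) = (\<Pi>\<^sub>E i\<in>A. carrier (N i))" "carrier (direct_sum A N') = (\<Pi>\<^sub>E i\<in>A. carrier (N' i))"
  using A by (simp_all add: direct_sum_def)
 define H where "H x = (\<lambda>i\<in>A. h i (x i))" for x
 have Hc: "H x : (\<Pi>\<^sub>E i\<in>A. carrier (N' i))" if x: "x : (\<Pi>\<^sub>E i\<in>A. carrier (N i))" for x
  unfolding H_def restrict_PiE_iff using bij_betw_apply[OF hb] PiE_mem[OF x] by blast
 have "inj_on H (\<Pi>\<^sub>E i\<in>A. carrier (N i))"
 proof (rule inj_onI)
  fix x y assume x: "x : (\<Pi>\<^sub>E i\<in>A. carrier (N i))" and y: "y : (\<Pi>\<^sub>E i\<in>A. carrier (N i))" and e: "H x = H y"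
  show "x = y"
  proof (rule PiE_ext[OF x y])
   fix i assume i: "i : A"
   have "h i (x i) = h i (y i)" using fun_cong[OF e, of i] i by (simp add: H_def)
   then show "x i = y i" using inj_onD[OF bij_betw_imp_inj_on[OF hb[OF i]]] PiE_mem[OF x i] PiE_mem[OF y i] by blast
  qed
 qed
 moreover have "H ` (\<Pi>\<^sub>E i\<in>A. carrier (N i)) = (\<Pi>\<^sub>E i\<in>A. carrier (N' i))"
 proof (intro equalityI subsetI)
  fix z assume z: "z : (\<Pi>\<^sub>E i\<in>A. carrier (N' i))"
  define x where "x = (\<lambda>i\<in>A. inv_into (carrier (N i)) (h i) (z i))"
  have zi: "z i : h i ` carrier (N i)" if "i : A" for i
   using PiE_mem[OF z that] bij_betw_imp_surj_on[OF hb[OF that]] by simp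
  have "x : (\<Pi>\<^sub>E i\<in>A. carrier (N i))" unfolding x_def restrict_PiE_iff using inv_into_into[OF zi] by blast
  moreover have "H x = z"
  proof (rule PiE_ext[OF Hc[OF calculation] z])
   fix i assume i: "i : A"
   show "H x i = z i" using i f_inv_into_f[OF zi[OF i]] by (simp add: H_def x_def)
  qed
  ultimately show "z : H ` (\<Pi>\<^sub>E i\<in>A. carrier (N i))" by blast
 qed (use Hc in auto)
 ultimately have "bij_betw H (carrier (direct_sum A N)) (carrier (direct_sum A N'))"
  unfolding bij_betw_def c by blast
 moreover have "H : mod_hom R (direct_sum A N) (direct_sum A N')"
  unfolding mod_hom_def
 proof (intro CollectI conjI ballI funcsetI)
  show "H x : carrier (direct_sum A N')" if "x : carrier (direct_sum A N)" for x using that unfolding c by (rule Hc)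
  fix x assume x: "x : carrier (direct_sum A N)"
  show "H (x \<oplus>\<^bsub>direct_sum A N\<^esub> y) = H x \<oplus>\<^bsub>direct_sum A N'\<^esub> H y" if y: "y : carrier (direct_sum A N)" for y
  proof
   fix i
   have "h i (x i \<oplus>\<^bsub>N i\<^esub> y i) = h i (x i) \<oplus>\<^bsub>N' i\<^esub> h i (y i)" if i: "i : A"
    using h i PiE_mem[OF x[unfolded c] i] PiE_mem[OF y[unfolded c] i] unfolding mod_hom_def by blast
   then show "H (x \<oplus>\<^bsub>direct_sum A N\<^esub> y) i = (H x \<oplus>\<^bsub>direct_sum A N'\<^esub> H y) i"
    by (simp add: H_def direct_sum_def)
  qed
  show "H (r \<odot>\<^bsub>direct_sum A N\<^esub> x) = r \<odot>\<^bsub>direct_sum A N'\<^esub> H x" if r: "r : carrier R" for r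
  proof
   fix i
   have "h i (r \<odot>\<^bsub>N i\<^esub> x i) = r \<odot>\<^bsub>N' i\<^esub> h i (x i)" if i: "i : A"
    using h i r PiE_mem[OF x[unfolded c] i] unfolding mod_hom_def by blast
   then show "H (r \<odot>\<^bsub>direct_sum A N\<^esub> x) i = (r \<odot>\<^bsub>direct_sum A N'\<^esub> H x) i"
    by (simp add: H_def direct_sum_def)
  qed
 qed
 ultimately show ?thesis unfolding mod_isomorphic_def by blast
qed

section \<open>Comparison of two coordinate systems on one module\<close>

context decomposed_module
begin

text \<open>The product of one regular element from each ideal lies in all of them; the empty
  product is e i.\<close>

lemma ex_common_regular:
 assumes i: "i : {1..p}"
 shows "EX d:carrier R. e i \<otimes> d = d & (ALL r:carrier R. r \<otimes> d = \<zero> --> r \<otimes> e i = \<zero>) & (ALL k:{1..n i}. d : J i k)"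
proof -
 note ei [simp] = e_carrier[OF i]
 have "N <= n i ==> EX d:carrier R. e i \<otimes> d = d & (ALL r:carrier R. r \<otimes> d = \<zero> --> r \<otimes> e i = \<zero>) & (ALL k:{1..N}. d : J i k)" for N
 proof (induction N)
  case 0
  then show ?case using e_idem[OF i] by (intro bexI[of _ "e i"]) auto
 next
  case (Suc N)
  then obtain d where d: "d : carrier R" "e i \<otimes> d = d" "ALL r:carrier R. r \<otimes> d = \<zero> --> r \<otimes> e i = \<zero>" "ALL k:{1..N}. d : J i k"
   by auto
  have iN: "Suc N : {1..n i}" using Suc.prems by simp
  obtain c where c: "c : J i (Suc N)" "ALL r:carrier R. r \<otimes> c = \<zero> --> r \<otimes> e i = \<zero>" using J_regular[OF i iN] by blast
  have cR: "c : carrier R" using c(1) J_carrier[OF i iN] by blast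
  show ?case
  proof (intro bexI[of _ "c \<otimes> d"] conjI ballI impI)
   show "c \<otimes> d : carrier R" using cR d(1) by simp
   have "e i \<otimes> (c \<otimes> d) = c \<otimes> (e i \<otimes> d)" by (rule R.m_lcomm) (use cR d in auto)
   then show "e i \<otimes> (c \<otimes> d) = c \<otimes> d" using d(2) by simp
   show "r \<otimes> e i = \<zero>" if r: "r : carrier R" "r \<otimes> (c \<otimes> d) = \<zero>" for r
   proof -
    have "(r \<otimes> c) \<otimes> d = \<zero>" using r cR d(1) by (simp add: R.m_assoc)
    then have "(r \<otimes> c) \<otimes> e i = \<zero>" using d(3) r(1) cR by simp
    moreover have "(r \<otimes> c) \<otimes> e i = r \<otimes> (e i \<otimes> c)" using r(1) cR ei by algebra
    ultimately have "r \<otimes> c = \<zero>" using J_unit[OF i iN c(1)] by simp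
    then show ?thesis using c(2) r(1) by blast
   qed
   show "c \<otimes> d : J i k" if k: "k : {1..Suc N}" for k
   proof (cases "k = Suc N")
    case True
    then show ?thesis using ideal_lin(2)[OF J_ideal[OF i iN] c(1) d(1)] by simp
   next
    case False
    then have k: "k : {1..N}" using k by auto
    then have "k : {1..n i}" using Suc.prems by simp
    from ideal_lin(1)[OF J_ideal[OF i this], of d c] show ?thesis using d(4) k cR by blast
   qed
  qed
 qed
 then show ?thesis by blast
qed

text \<open>Substitutes for basis vectors: the coordinate one need not be in J i k, so an element d
  common to all ideals of the block takes its place.\<close>

lemma ex_coordinate_vectors:
 assumes i: "i : {1..p}" and d: "ALL k:{1..n i}. d : J i k"
 shows "EX v. ALL k. v k : carrier M & (ALL i':{1..p}. ALL l:{1..n i'}. \<phi> i' l (v k) = (if i' = i & l = Suc k then d else \<zero>))"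
proof (rule choice, rule allI)
 fix k
 have "EX x:carrier M. ALL i':{1..p}. ALL l:{1..n i'}. \<phi> i' l x = (if i' = i & l = Suc k then d else \<zero>)"
  by (rule ex_with_phi) (use d J_zero in auto)
 then show "EX x. x : carrier M & (ALL i':{1..p}. ALL l:{1..n i'}. \<phi> i' l x = (if i' = i & l = Suc k then d else \<zero>))"
  by blast
qed

end

text \<open>Elements of the module whose free coordinates agree differ by torsion, so they also have the
  same free coordinates in any other decomposition.\<close>

lemma phi_eq_transfer:
 assumes A: "decomposed_module R M m p I e n J \<gamma> \<phi>" and B: "decomposed_module R M m' p' I' e' n' J' \<gamma>' \<phi>'"
  and xy: "x : carrier M" "y : carrier M" and eq: "ALL i:{1..p}. ALL k:{1..n i}. \<phi> i k x = \<phi> i k y"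
  and i: "i : {1..p'}" and k: "k : {1..n' i}"
 shows "\<phi>' i k x = \<phi>' i k y"
proof -
 interpret A: decomposed_module R M m p I e n J \<gamma> \<phi> by fact
 interpret B: decomposed_module R M m' p' I' e' n' J' \<gamma>' \<phi>' by fact
 have "\<phi> i k (x \<ominus>\<^bsub>M\<^esub> y) = \<zero>\<^bsub>R\<^esub>" if ik: "i : {1..p}" "k : {1..n i}" for i k
  using A.functional_minus(2)[OF A.phi_functional[OF ik] xy] eq ik A.phi_closed[OF ik xy(2)]
  by (simp add: A.R.minus_eq A.R.r_neg)
 then have "torsion_element R M (x \<ominus>\<^bsub>M\<^esub> y)" using A.torsion_iff[of "x \<ominus>\<^bsub>M\<^esub> y"] xy by simp
 then have "\<phi>' i k (x \<ominus>\<^bsub>M\<^esub> y) = \<zero>\<^bsub>R\<^esub>" using B.torsion_iff[of "x \<ominus>\<^bsub>M\<^esub> y"] xy i k by simp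
 then show ?thesis
  using A.functional_minus(2)[OF B.phi_functional[OF i k] xy] B.phi_closed[OF i k xy(1)] B.phi_closed[OF i k xy(2)] A.R.minus_zeroD
  by metis
qed

text \<open>Let x have the single coordinate \<open>a\<close> at Suc k in block i. Then d x and a v
  k have the same coordinates \<phi>, so their coordinates \<phi>' agree too, and \<alpha> l can be
  taken as the coordinate \<phi>' i (Suc l) of x.\<close>

lemma decomposed_module_scaling:
 assumes A: "decomposed_module R M m p I e n J \<gamma> \<phi>" and B: "decomposed_module R M m' p' I' e' n' J' \<gamma>' \<phi>'"
  and i: "i : {1..p}" "i : {1..p'}" and ni: "n' i = n i" and k: "k < n i"
  and d: "d : carrier R"
  and v: "ALL k. v k : carrier M & (ALL i':{1..p}. ALL l:{1..n i'}. \<phi> i' l (v k) = (if i' = i & l = Suc k then d else \<zero>\<^bsub>R\<^esub>))"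
  and a: "a : J i (Suc k)"
 shows "EX \<alpha>. ALL l<n i. \<alpha> l : J' i (Suc l) & d \<otimes>\<^bsub>R\<^esub> \<alpha> l = a \<otimes>\<^bsub>R\<^esub> \<phi>' i (Suc l) (v k)"
proof -
 interpret A: decomposed_module R M m p I e n J \<gamma> \<phi> by fact
 interpret B: decomposed_module R M m' p' I' e' n' J' \<gamma>' \<phi>' by fact
 have ik: "Suc k : {1..n i}" using k by simp
 have aR: "a : carrier R" using A.J_carrier[OF i(1) ik] a by blast
 have vk: "v k : carrier M" and vf: "!!i' l. i' : {1..p} ==> l : {1..n i'} ==> \<phi> i' l (v k) = (if i' = i & l = Suc k then d else \<zero>\<^bsub>R\<^esub>)"
  using v by blast+
 have "EX x:carrier M. ALL i':{1..p}. ALL l:{1..n i'}. \<phi> i' l x = (if i' = i & l = Suc k then a else \<zero>\<^bsub>R\<^esub>)"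
  by (rule A.ex_with_phi) (use a A.J_zero in auto)
 then obtain x where x: "x : carrier M" "ALL i':{1..p}. ALL l:{1..n i'}. \<phi> i' l x = (if i' = i & l = Suc k then a else \<zero>\<^bsub>R\<^esub>)"
  by (elim bexE)
 have eq: "ALL i':{1..p}. ALL l:{1..n i'}. \<phi> i' l (d \<odot>\<^bsub>M\<^esub> x) = \<phi> i' l (a \<odot>\<^bsub>M\<^esub> v k)"
 proof (intro ballI)
  fix i' l assume il: "i' : {1..p}" "l : {1..n i'}"
  show "\<phi> i' l (d \<odot>\<^bsub>M\<^esub> x) = \<phi> i' l (a \<odot>\<^bsub>M\<^esub> v k)"
   unfolding A.functional_smult[OF A.phi_functional[OF il] d x(1)] A.functional_smult[OF A.phi_functional[OF il] aR vk]
   using vf[OF il] bspec[OF bspec[OF x(2) il(1)] il(2)] aR d by (simp add: A.R.m_comm)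
 qed
 have "\<phi>' i (Suc l) x : J' i (Suc l) & d \<otimes>\<^bsub>R\<^esub> \<phi>' i (Suc l) x = a \<otimes>\<^bsub>R\<^esub> \<phi>' i (Suc l) (v k)" if l: "l < n i" for l
 proof -
  have il: "Suc l : {1..n' i}" using l ni by simp
  have "\<phi>' i (Suc l) (d \<odot>\<^bsub>M\<^esub> x) = \<phi>' i (Suc l) (a \<odot>\<^bsub>M\<^esub> v k)"
   by (rule phi_eq_transfer[OF A B _ _ eq i(2) il]) (use d aR vk x in auto)
  then show ?thesis
   unfolding A.functional_smult[OF B.phi_functional[OF i(2) il] d x(1)] A.functional_smult[OF B.phi_functional[OF i(2) il] aR vk]
   using B.phi_in[OF i(2) il x(1)] by blast
 qed
 then show ?thesis by (intro exI[of _ "%l. \<phi>' i (Suc l) x"]) simp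
qed

text \<open>Both matrices are \<open>d\<close> times a change of coordinates, in opposite
  directions. In detail, d v k' and the combination of the v' l with coefficients \<phi>' i (Suc l)
  (v k') have the same coordinates \<phi>', hence the same coordinates \<phi>.\<close>

lemma decomposed_module_inverse:
 assumes A: "decomposed_module R M m p I e n J \<gamma> \<phi>" and B: "decomposed_module R M m' p' I' e' n' J' \<gamma>' \<phi>'"
  and i: "i : {1..p}" "i : {1..p'}" and ni: "n' i = n i" and ei: "e' i = e i" and k: "k < n i" "k' < n i"
  and d: "d : carrier R" "e i \<otimes>\<^bsub>R\<^esub> d = d"
  and v: "ALL k. v k : carrier M & (ALL i':{1..p}. ALL l:{1..n i'}. \<phi> i' l (v k) = (if i' = i & l = Suc k then d else \<zero>\<^bsub>R\<^esub>))"
  and v': "ALL k. v' k : carrier M & (ALL i':{1..p'}. ALL l:{1..n' i'}. \<phi>' i' l (v' k) = (if i' = i & l = Suc k then d else \<zero>\<^bsub>R\<^esub>))"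
 shows "(\<Oplus>\<^bsub>R\<^esub>l\<in>{..<n i}. \<phi> i (Suc k) (v' l) \<otimes>\<^bsub>R\<^esub> \<phi>' i (Suc l) (v k')) = (if k = k' then d \<otimes>\<^bsub>R\<^esub> d else \<zero>\<^bsub>R\<^esub>)"
proof -
 interpret A: decomposed_module R M m p I e n J \<gamma> \<phi> by fact
 interpret B: decomposed_module R M m' p' I' e' n' J' \<gamma>' \<phi>' by fact
 note dR [simp] = d(1)
 have vM [simp]: "v k : carrier M" "v' k : carrier M" for k using v v' by blast+
 have vf: "\<phi> i' l (v k) = (if i' = i & l = Suc k then d else \<zero>\<^bsub>R\<^esub>)" if "i' : {1..p}" "l : {1..n i'}" for i' l k
  using v that by blast
 have vf': "\<phi>' i' l (v' k) = (if i' = i & l = Suc k then d else \<zero>\<^bsub>R\<^esub>)" if "i' : {1..p'}" "l : {1..n' i'}" for i' l k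
  using v' that by blast
 have ik: "Suc k : {1..n i}" using k by simp
 define c where "c l = (if l < n i then \<phi>' i (Suc l) (v k') else \<zero>\<^bsub>R\<^esub>)" for l
 have c [simp]: "c l : carrier R" for l unfolding c_def using B.phi_closed[OF i(2), of "Suc l" "v k'"] ni by simp
 let ?y = "lc M (n i) c v'"
 have y [simp]: "?y : carrier M" by (rule A.lc_closed) auto
 have eq: "ALL i':{1..p'}. ALL l:{1..n' i'}. \<phi>' i' l (d \<odot>\<^bsub>M\<^esub> v k') = \<phi>' i' l ?y"
 proof (intro ballI)
  fix i' l assume il: "i' : {1..p'}" "l : {1..n' i'}"
  note pc = B.phi_closed[OF il vM(1)[of k']]
  have L: "\<phi>' i' l (d \<odot>\<^bsub>M\<^esub> v k') = d \<otimes>\<^bsub>R\<^esub> \<phi>' i' l (v k')" by (rule A.functional_smult[OF B.phi_functional[OF il]]) auto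
  have Y: "\<phi>' i' l ?y = dot R (n i) c (%b. \<phi>' i' l (v' b))" by (rule A.functional_lc[OF B.phi_functional[OF il]]) auto
  show "\<phi>' i' l (d \<odot>\<^bsub>M\<^esub> v k') = \<phi>' i' l ?y"
  proof (cases "i' = i")
   case False
   \<comment> \<open>Since \<open>d\<close> is a multiple of e i, it kills the coordinates in every
     other block.\<close>
   have "d \<otimes>\<^bsub>R\<^esub> \<phi>' i' l (v k') = (e i \<otimes>\<^bsub>R\<^esub> d) \<otimes>\<^bsub>R\<^esub> (e' i' \<otimes>\<^bsub>R\<^esub> \<phi>' i' l (v k'))"
    using B.J_unit[OF il B.phi_in[OF il vM(1)]] d by simp
   also have "... = (e' i \<otimes>\<^bsub>R\<^esub> e' i') \<otimes>\<^bsub>R\<^esub> (d \<otimes>\<^bsub>R\<^esub> \<phi>' i' l (v k'))"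
    unfolding ei using A.e_carrier[OF i(1)] B.e_carrier[OF il(1)] dR pc by (simp add: A.R.m_ac)
   also have "... = \<zero>\<^bsub>R\<^esub>" using B.e_orth[OF i(2) il(1)] False pc by simp
   finally have "\<phi>' i' l (d \<odot>\<^bsub>M\<^esub> v k') = \<zero>\<^bsub>R\<^esub>" unfolding L .
   moreover have "\<phi>' i' l ?y = \<zero>\<^bsub>R\<^esub>" unfolding Y using vf'[OF il] False by (simp add: dot_def)
   ultimately show ?thesis by simp
  next
   case True
   define l0 where "l0 = l - 1"
   have l0: "l = Suc l0" "l0 < n i" using il True ni by (auto simp: l0_def)
   have "\<phi>' i' l ?y = dot R (n i) c (%b. if b = l0 then d else \<zero>\<^bsub>R\<^esub>)"
    unfolding Y using vf'[OF il] True l0 by (simp add: eq_commute)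
   also have "... = (\<Oplus>\<^bsub>R\<^esub>b\<in>{..<n i}. if b = l0 then c b \<otimes>\<^bsub>R\<^esub> d else \<zero>\<^bsub>R\<^esub>)"
    unfolding dot_def by (rule A.R.finsum_cong') auto
   also have "... = c l0 \<otimes>\<^bsub>R\<^esub> d" by (rule A.R.finsum_delta) (use l0 in auto)
   also have "... = d \<otimes>\<^bsub>R\<^esub> \<phi>' i' l (v k')" using l0 True pc by (simp add: c_def A.R.m_comm)
   finally show ?thesis unfolding L by simp
  qed
 qed
 have "\<phi> i (Suc k) (d \<odot>\<^bsub>M\<^esub> v k') = \<phi> i (Suc k) ?y"
  by (rule phi_eq_transfer[OF B A _ _ eq i(1) ik]) auto
 moreover have "\<phi> i (Suc k) (d \<odot>\<^bsub>M\<^esub> v k') = (if k = k' then d \<otimes>\<^bsub>R\<^esub> d else \<zero>\<^bsub>R\<^esub>)"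
  by (subst A.functional_smult[OF A.phi_functional[OF i(1) ik]]) (use vf[OF i(1) ik] in auto)
 moreover have "\<phi> i (Suc k) ?y = (\<Oplus>\<^bsub>R\<^esub>l\<in>{..<n i}. \<phi> i (Suc k) (v' l) \<otimes>\<^bsub>R\<^esub> \<phi>' i (Suc l) (v k'))"
 proof -
  note pc = A.phi_closed[OF i(1) ik vM(2)]
  have "\<phi> i (Suc k) ?y = dot R (n i) c (%b. \<phi> i (Suc k) (v' b))" by (rule A.functional_lc[OF A.phi_functional[OF i(1) ik]]) auto
  also have "... = (\<Oplus>\<^bsub>R\<^esub>l\<in>{..<n i}. \<phi> i (Suc k) (v' l) \<otimes>\<^bsub>R\<^esub> \<phi>' i (Suc l) (v k'))"
   unfolding dot_def
  proof (rule A.R.finsum_cong')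
   fix l assume "l : {..<n i}"
   then show "c l \<otimes>\<^bsub>R\<^esub> \<phi> i (Suc k) (v' l) = \<phi> i (Suc k) (v' l) \<otimes>\<^bsub>R\<^esub> \<phi>' i (Suc l) (v k')"
    using A.R.m_comm[OF c[of l] pc[of l]] by (simp add: c_def)
  qed (use pc B.phi_closed[OF i(2)] ni in auto)
  finally show ?thesis .
 qed
 ultimately show ?thesis by simp
qed

lemma decomposed_module_product_iso:
 assumes A: "decomposed_module R M m p I e n J \<gamma> \<phi>" and B: "decomposed_module R M m' p' I' e' n' J' \<gamma>' \<phi>'"
 shows "mod_isomorphic R (product_module R p e n J) (product_module R p' e' n' J')"
proof -
 note u = decomposed_module_unique[OF A B]
 interpret A: decomposed_module R M m p I e n J \<gamma> \<phi> by fact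
 interpret B: decomposed_module R M m' p' I' e' n' J' \<gamma>' \<phi>' by fact
 have "mod_isomorphic R (ideal_module R (A.R.corner_product (e i) (J i) (n i))) (ideal_module R (A.R.corner_product (e' i) (J' i) (n' i)))"
  if i: "i : {1..p}" for i
 proof -
  have i': "i : {1..p'}" using i u(3) by simp
  have ni: "n' i = n i" and ei: "e' i = e i" using u i by auto
  note eR [simp] = A.e_carrier[OF i] and ee = A.e_idem[OF i]
  obtain d1 where d1: "d1 : carrier R" "e i \<otimes>\<^bsub>R\<^esub> d1 = d1" "ALL r:carrier R. r \<otimes>\<^bsub>R\<^esub> d1 = \<zero>\<^bsub>R\<^esub> --> r \<otimes>\<^bsub>R\<^esub> e i = \<zero>\<^bsub>R\<^esub>" "ALL k:{1..n i}. d1 : J i k"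
   using A.ex_common_regular[OF i] by blast
  obtain d2 where d2: "d2 : carrier R" "e i \<otimes>\<^bsub>R\<^esub> d2 = d2" "ALL r:carrier R. r \<otimes>\<^bsub>R\<^esub> d2 = \<zero>\<^bsub>R\<^esub> --> r \<otimes>\<^bsub>R\<^esub> e i = \<zero>\<^bsub>R\<^esub>" "ALL k:{1..n i}. d2 : J' i k"
   using B.ex_common_regular[OF i'] unfolding ni ei by blast
  \<comment> \<open>The product lies in the ideals of both decompositions, so coordinate vectors for
    the same \<open>d\<close> exist on both sides.\<close>
  define d where "d = d1 \<otimes>\<^bsub>R\<^esub> d2"
  have d [simp]: "d : carrier R" using d1 d2 by (simp add: d_def)
  have ed: "e i \<otimes>\<^bsub>R\<^esub> d = d" using A.R.m_assoc[OF eR d1(1) d2(1)] d1(2) by (simp add: d_def)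
  have dreg: "ALL r:carrier R. r \<otimes>\<^bsub>R\<^esub> d = \<zero>\<^bsub>R\<^esub> --> r \<otimes>\<^bsub>R\<^esub> e i = \<zero>\<^bsub>R\<^esub>"
  proof (intro ballI impI)
   fix r assume r: "r : carrier R" "r \<otimes>\<^bsub>R\<^esub> d = \<zero>\<^bsub>R\<^esub>"
   have "(r \<otimes>\<^bsub>R\<^esub> d1) \<otimes>\<^bsub>R\<^esub> d2 = \<zero>\<^bsub>R\<^esub>" using r d1(1) d2(1) by (simp add: d_def A.R.m_assoc)
   then have "(r \<otimes>\<^bsub>R\<^esub> d1) \<otimes>\<^bsub>R\<^esub> e i = \<zero>\<^bsub>R\<^esub>" using d2(3) r(1) d1(1) by simp
   moreover have "(r \<otimes>\<^bsub>R\<^esub> d1) \<otimes>\<^bsub>R\<^esub> e i = r \<otimes>\<^bsub>R\<^esub> (e i \<otimes>\<^bsub>R\<^esub> d1)" using r(1) d1(1) eR A.R.m_assoc A.R.m_comm by simp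
   ultimately have "r \<otimes>\<^bsub>R\<^esub> d1 = \<zero>\<^bsub>R\<^esub>" using d1(2) by simp
   then show "r \<otimes>\<^bsub>R\<^esub> e i = \<zero>\<^bsub>R\<^esub>" using d1(3) r(1) by blast
  qed
  have dJ: "ALL k:{1..n i}. d : J i k"
   using A.R.ideal_lin(2)[OF A.J_ideal[OF i]] d1(4) d2(1) by (simp add: d_def)
  have dJ': "ALL k:{1..n' i}. d : J' i k"
   using A.R.ideal_lin(1)[OF B.J_ideal[OF i']] d2(4) d1(1) ni by (simp add: d_def)
  obtain v where v: "ALL k. v k : carrier M & (ALL i':{1..p}. ALL l:{1..n i'}. \<phi> i' l (v k) = (if i' = i & l = Suc k then d else \<zero>\<^bsub>R\<^esub>))"
   using A.ex_coordinate_vectors[OF i dJ] by (rule exE)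
  obtain v' where v': "ALL k. v' k : carrier M & (ALL i':{1..p'}. ALL l:{1..n' i'}. \<phi>' i' l (v' k) = (if i' = i & l = Suc k then d else \<zero>\<^bsub>R\<^esub>))"
   using B.ex_coordinate_vectors[OF i' dJ'] by (rule exE)
  have vM: "v k : carrier M" "v' k : carrier M" for k using v v' by blast+
  define a where "a l k = (if l < n i then \<phi>' i (Suc l) (v k) else \<zero>\<^bsub>R\<^esub>)" for l k
  define b where "b l k = (if l < n i then \<phi> i (Suc l) (v' k) else \<zero>\<^bsub>R\<^esub>)" for l k
  have "mod_isomorphic R (ideal_module R (A.R.corner_product (e i) (J i) (n i))) (ideal_module R (A.R.corner_product (e i) (J' i) (n i)))"
  proof (rule A.R.corner_product_iso[OF eR ee _ _ d ed dreg])
   show "a l k : carrier R" for l k using B.phi_closed[OF i' _ vM(1), of "Suc l" k] ni by (simp add: a_def)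
   show "b l k : carrier R" for l k using A.phi_closed[OF i _ vM(2), of "Suc l" k] by (simp add: b_def)
   show "ALL k:{1..n i}. ideal (J i k) (corner_ring R (e i))"
    using A.R.corner_idealI[OF eR ee A.J_ideal[OF i]] A.J_unit[OF i] by blast
   show "ALL k:{1..n i}. ideal (J' i k) (corner_ring R (e i))"
    using A.R.corner_idealI[OF eR ee B.J_ideal[OF i']] B.J_unit[OF i'] unfolding ni ei by blast
   show "ALL k<n i. ALL x:J i (Suc k). EX \<alpha>. ALL l<n i. \<alpha> l : J' i (Suc l) & d \<otimes>\<^bsub>R\<^esub> \<alpha> l = x \<otimes>\<^bsub>R\<^esub> a l k"
    using decomposed_module_scaling[OF A B i i' ni _ d v] by (auto simp: a_def)
   show "ALL k<n i. ALL x:J' i (Suc k). EX \<alpha>. ALL l<n i. \<alpha> l : J i (Suc l) & d \<otimes>\<^bsub>R\<^esub> \<alpha> l = x \<otimes>\<^bsub>R\<^esub> b l k"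
    using decomposed_module_scaling[OF B A i' i ni[symmetric] _ d v'] ni by (auto simp: b_def)
   show "ALL k<n i. ALL k'<n i. (\<Oplus>\<^bsub>R\<^esub>l\<in>{..<n i}. b k l \<otimes>\<^bsub>R\<^esub> a l k') = (if k = k' then d \<otimes>\<^bsub>R\<^esub> d else \<zero>\<^bsub>R\<^esub>)"
   proof (intro allI impI)
    fix k k' assume k: "k < n i" "k' < n i"
    have "(\<Oplus>\<^bsub>R\<^esub>l\<in>{..<n i}. b k l \<otimes>\<^bsub>R\<^esub> a l k') = (\<Oplus>\<^bsub>R\<^esub>l\<in>{..<n i}. \<phi> i (Suc k) (v' l) \<otimes>\<^bsub>R\<^esub> \<phi>' i (Suc l) (v k'))"
     by (rule A.R.finsum_cong')
      (use k A.phi_closed[OF i _ vM(2)] B.phi_closed[OF i' _ vM(1)] ni in \<open>auto simp: a_def b_def\<close>)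
    then show "(\<Oplus>\<^bsub>R\<^esub>l\<in>{..<n i}. b k l \<otimes>\<^bsub>R\<^esub> a l k') = (if k = k' then d \<otimes>\<^bsub>R\<^esub> d else \<zero>\<^bsub>R\<^esub>)"
     using decomposed_module_inverse[OF A B i i' ni ei k d ed v v'] by simp
   qed
  qed
  then show ?thesis unfolding ni ei .
 qed
 then show ?thesis
  unfolding product_module_def u(3)[symmetric] A.R.corner_product_def[symmetric]
  by (intro mod_isomorphic_direct_sum) auto
qed

lemma mod_isomorphic_trans:
 assumes "mod_isomorphic R M N" "mod_isomorphic R N L"
 shows "mod_isomorphic R M L"
proof -
 obtain f g where f: "f : mod_hom R M N" "bij_betw f (carrier M) (carrier N)"
  and g: "g : mod_hom R N L" "bij_betw g (carrier N) (carrier L)"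
  using assms unfolding mod_isomorphic_def by blast
 have "g \<circ> f : mod_hom R M L" using f(1) g(1) unfolding mod_hom_def by (auto simp: Pi_iff)
 then show ?thesis using bij_betw_trans[OF f(2) g(2)] unfolding mod_isomorphic_def by blast
qed

lemma is_decomposition_imp_decomposed_module:
 assumes sh: "semihereditary_ring R" and M: "module R M" and dec: "is_decomposition R M m I p e n J"
 shows "EX \<gamma> \<phi>. decomposed_module R M m p I e n J \<gamma> \<phi>"
proof -
 interpret semihereditary_ring R by fact
 interpret M: module R M by fact
 have d1: "ALL j:{1..m}. invertible_ideal (I j) R & I j ~= carrier R"
  and d2: "ALL j:{1..<m}. I (Suc j) <= I j"
  and d3: "ALL i:{1..p}. e i : carrier R & e i \<otimes>\<^bsub>R\<^esub> e i = e i & e i ~= \<zero>\<^bsub>R\<^esub>"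
  and d4: "ALL i:{1..p}. ALL i':{1..p}. i ~= i' --> e i \<otimes>\<^bsub>R\<^esub> e i' = \<zero>\<^bsub>R\<^esub>"
  and d5: "ALL i:{1..p}. 0 < n i" and d6: "strict_mono_on {1..p} n"
  and d7: "ALL i:{1..p}. ALL k:{1..n i}. invertible_ideal (J i k) (corner_ring R (e i))"
  and d8: "mod_isomorphic R M (decomposition_sum R m I p e n J)"
  using dec[unfolded is_decomposition_def] by - (elim conjE, assumption)+
 have e: "e i : carrier R" "e i \<otimes>\<^bsub>R\<^esub> e i = e i" if "i : {1..p}" for i using d3 that by blast+
 have Jc: "ideal (J i k) (corner_ring R (e i))" if "i : {1..p}" "k : {1..n i}" for i k
  using d7 that unfolding invertible_ideal_def by blast
 have J: "ideal (J i k) R" and Ju: "!!x. x : J i k ==> e i \<otimes>\<^bsub>R\<^esub> x = x" if ik: "i : {1..p}" "k : {1..n i}" for i k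
  using corner_idealD[OF e[OF ik(1)] Jc[OF ik]] by blast+
 have Jr: "EX d:J i k. ALL r:carrier R. r \<otimes>\<^bsub>R\<^esub> d = \<zero>\<^bsub>R\<^esub> --> r \<otimes>\<^bsub>R\<^esub> e i = \<zero>\<^bsub>R\<^esub>" if ik: "i : {1..p}" "k : {1..n i}" for i k
 proof -
  note ei = e[OF ik(1)]
  interpret C: cring "corner_ring R (e i)" by (rule corner_ring_cring[OF ei])
  obtain d where d: "d : J i k" "d : regular_elements (corner_ring R (e i))"
   using C.invertible_ideal_regular d7 ik by blast
  have dR: "d : carrier R" using ideal.Icarr[OF J[OF ik] d(1)] .
  have "r \<otimes>\<^bsub>R\<^esub> e i = \<zero>\<^bsub>R\<^esub>" if r: "r : carrier R" "r \<otimes>\<^bsub>R\<^esub> d = \<zero>\<^bsub>R\<^esub>" for r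
  proof -
   have "e i \<otimes>\<^bsub>R\<^esub> (r \<otimes>\<^bsub>R\<^esub> e i) = r \<otimes>\<^bsub>R\<^esub> (e i \<otimes>\<^bsub>R\<^esub> e i)" by (rule m_lcomm) (use r ei in auto)
   then have c: "r \<otimes>\<^bsub>R\<^esub> e i : carrier (corner_ring R (e i))" using corner_ring_carrier[OF ei] ei r by simp
   have "d \<otimes>\<^bsub>R\<^esub> (r \<otimes>\<^bsub>R\<^esub> e i) = (r \<otimes>\<^bsub>R\<^esub> d) \<otimes>\<^bsub>R\<^esub> e i" using r(1) dR ei(1) by algebra
   then show ?thesis using C.regularD(2)[OF d(2) c] r(2) ei(1) by simp
  qed
  then show ?thesis using d(1) by blast
 qed
 have I: "ideal (I j) R" if "j : {1..m}" for j using d1 that unfolding invertible_ideal_def by blast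
 have shape: "decomposition_shape R M m p I e n J"
 proof (rule decomposition_shape.intro[OF M], rule decomposition_shape_axioms.intro)
  show "J i k #>\<^bsub>R\<^esub> e i = J i k" if ik: "i : {1..p}" "k : {1..n i}" for i k
  proof -
   have "x \<otimes>\<^bsub>R\<^esub> e i = x" if x: "x : J i k" for x
    using Ju[OF ik x] m_comm[OF e(1)[OF ik(1)] ideal.Icarr[OF J[OF ik] x]] by simp
   then show ?thesis unfolding r_coset_def by auto
  qed
  show "J i k <= carrier R" if "i : {1..p}" "k : {1..n i}" for i k using ideal.Icarr[OF J[OF that]] by blast
 qed (rule I)
 obtain \<gamma> \<phi> where c: "decomp_coords R M m I p n J \<gamma> \<phi>"
  using decomposition_shape.iso_imp_coords[OF shape d8] by blast
 have "decomposed_module R M m p I e n J \<gamma> \<phi>"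
 proof (rule decomposed_module.intro[OF shape], rule decomposed_module_axioms.intro)
  show "x = \<zero>\<^bsub>R\<^esub>" if "x : carrier R" "x \<otimes>\<^bsub>R\<^esub> x = \<zero>\<^bsub>R\<^esub>" for x using reduced that .
  show "EX d:I j. d : regular_elements R" if "j : {1..m}" for j using invertible_ideal_regular d1 that by blast
  show "decomp_coords R M m I p n J \<gamma> \<phi>" by (rule c)
  show "strict_mono_on {1..p} n" by (rule d6)
  show "ideal (J i k) R" if "i : {1..p}" "k : {1..n i}" for i k using J that .
  show "e i \<otimes>\<^bsub>R\<^esub> x = x" if "i : {1..p}" "k : {1..n i}" "x : J i k" for i k x using Ju that .
  show "EX d:J i k. ALL r:carrier R. r \<otimes>\<^bsub>R\<^esub> d = \<zero>\<^bsub>R\<^esub> --> r \<otimes>\<^bsub>R\<^esub> e i = \<zero>\<^bsub>R\<^esub>" if "i : {1..p}" "k : {1..n i}" for i k using Jr that .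
 qed (use d1 d2 d3 d4 d5 in blast)+
 then show ?thesis by (intro exI)
qed

section \<open>Existence of a decomposition\<close>

lemma (in cring) free_module_simps:
 fixes t :: nat
 defines "F \<equiv> direct_sum {..<t} (%_. self_module R)"
 shows "carrier F = ({..<t} \<rightarrow>\<^sub>E carrier R)" "x \<oplus>\<^bsub>F\<^esub> y = (\<lambda>i\<in>{..<t}. x i \<oplus> y i)"
  "r \<odot>\<^bsub>F\<^esub> x = (\<lambda>i\<in>{..<t}. r \<otimes> x i)" "\<zero>\<^bsub>F\<^esub> = (\<lambda>i\<in>{..<t}. \<zero>)"
 unfolding F_def by (auto simp: direct_sum_def self_module_def)

lemma (in module) free_hom_lc:
 fixes t :: nat
 assumes f: "f : mod_hom R (direct_sum {..<t} (%_. self_module R)) M"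
 shows "EX y. (ALL a. y a : carrier M) & (ALL w. (ALL a. w a : carrier R) --> f (restrict w {..<t}) = lc M t w y)"
proof -
 let ?F = "direct_sum {..<t} (%_. self_module R)"
 note F = R.free_module_simps[of t]
 have fM: "f x : carrier M" if "x : carrier ?F" for x using f that unfolding mod_hom_def by blast
 have fadd: "f (x \<oplus>\<^bsub>?F\<^esub> z) = f x \<oplus>\<^bsub>M\<^esub> f z" if "x : carrier ?F" "z : carrier ?F" for x z
  using f that unfolding mod_hom_def by blast
 have fsm: "f (r \<odot>\<^bsub>?F\<^esub> x) = r \<odot>\<^bsub>M\<^esub> f x" if "r : carrier R" "x : carrier ?F" for r x
  using f that unfolding mod_hom_def by blast
 define \<epsilon> where "\<epsilon> a = (\<lambda>i\<in>{..<t}. if i = a then \<one> else \<zero>)" for a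
 have \<epsilon>F: "\<epsilon> a : carrier ?F" for a unfolding \<epsilon>_def F by auto
 have yM: "f (\<epsilon> a) : carrier M" for a by (rule fM[OF \<epsilon>F])
 have "f (restrict w {..<t}) = lc M t w (%a. f (\<epsilon> a))" if w: "ALL a. w a : carrier R" for w
 proof -
  have [simp]: "w a : carrier R" for a using w by blast
  \<comment> \<open>The truncations of w, which take in one coordinate at a time.\<close>
  define W where "W s = (\<lambda>i\<in>{..<t}. if i < s then w i else \<zero>)" for s
  have WF: "W s : carrier ?F" for s unfolding W_def F by auto
  have *: "f (W s) = lc M s w (%a. f (\<epsilon> a))" if "s <= t" for s using that
  proof (induction s)
   case 0
   have "W 0 = \<zero> \<odot>\<^bsub>?F\<^esub> W 0" unfolding F W_def by auto
   then have "f (W 0) = \<zero>\<^bsub>M\<^esub>" using fsm[OF R.zero_closed WF[of 0]] fM[OF WF[of 0]] by simp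
   then show ?case by (simp add: lc_def)
  next
   case (Suc s)
   have "W (Suc s) = W s \<oplus>\<^bsub>?F\<^esub> w s \<odot>\<^bsub>?F\<^esub> \<epsilon> s"
    unfolding F W_def \<epsilon>_def using Suc.prems by (auto simp: less_Suc_eq intro!: restrict_ext)
   moreover have "w s \<odot>\<^bsub>?F\<^esub> \<epsilon> s : carrier ?F" unfolding F \<epsilon>_def by auto
   ultimately have "f (W (Suc s)) = f (W s) \<oplus>\<^bsub>M\<^esub> w s \<odot>\<^bsub>M\<^esub> f (\<epsilon> s)" using fadd[OF WF] fsm \<epsilon>F by simp
   also have "... = lc M (Suc s) w (%a. f (\<epsilon> a))"
    using Suc yM unfolding lc_def by (subst M.finsum_lessThan_Suc) auto
   finally show ?case .
  qed
  have "W t = restrict w {..<t}" unfolding W_def by auto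
  then show ?thesis using *[OF order_refl] by simp
 qed
 then show ?thesis using yM by (intro exI[of _ "%a. f (\<epsilon> a)"]) blast
qed

lemma (in module) finitely_presented_relations:
 assumes "finitely_presented R M"
 shows "EX t y. spans R M t y & fg_relations R M t y"
proof -
 obtain s t :: nat and g f where
  g: "g : mod_hom R (direct_sum {..<s} (%_. self_module R)) (direct_sum {..<t} (%_. self_module R))" and
  f: "f : mod_hom R (direct_sum {..<t} (%_. self_module R)) M" and
  fs: "f ` carrier (direct_sum {..<t} (%_. self_module R)) = carrier M" and
  gk: "g ` carrier (direct_sum {..<s} (%_. self_module R)) = {x : carrier (direct_sum {..<t} (%_. self_module R)). f x = \<zero>\<^bsub>M\<^esub>}"
  using assms unfolding finitely_presented_def Let_def by (elim exE bexE conjE)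
 let ?F = "direct_sum {..<t} (%_. self_module R)" and ?G = "direct_sum {..<s} (%_. self_module R)"
 interpret F: module R ?F by (rule R.free_module) simp
 note Fs = R.free_module_simps[of t] and Gs = R.free_module_simps[of s]
 obtain y where y': "(ALL a. y a : carrier M) & (ALL w. (ALL a. w a : carrier R) --> f (restrict w {..<t}) = lc M t w y)"
  using free_hom_lc[OF f] by (rule exE)
 have y [simp]: "y a : carrier M" for a using y' by blast
 have fy: "f (restrict w {..<t}) = lc M t w y" if "ALL a. w a : carrier R" for w using y' that by blast
 obtain z where z': "(ALL a. z a : carrier ?F) & (ALL w. (ALL a. w a : carrier R) --> g (restrict w {..<s}) = lc ?F s w z)"
  using F.free_hom_lc[OF g] by (rule exE)
 have z [simp]: "z a : carrier ?F" for a using z' by blast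
 have gz: "g (restrict w {..<s}) = lc ?F s w z" if "ALL a. w a : carrier R" for w using z' that by blast
 have zR: "z b a : carrier R" if "a < t" for a b using PiE_mem[OF z[of b, unfolded Fs], of a] that by simp
 \<comment> \<open>Elements of the free module are \<open>undefined\<close> beyond t; extending them
   by zero gives coefficients that lie in the carrier everywhere.\<close>
 define ext where "ext x a = (if a < t then x a else \<zero>)" for x :: "nat => 'a" and a
 have extR: "ALL a. ext x a : carrier R" and extr: "restrict (ext x) {..<t} = x" if "x : carrier ?F" for x
 proof -
  show "ALL a. ext x a : carrier R" using PiE_mem[OF that[unfolded Fs]] by (simp add: ext_def)
  show "restrict (ext x) {..<t} = x"
   by (rule PiE_ext[OF _ that[unfolded Fs]]) (use PiE_mem[OF that[unfolded Fs]] in \<open>auto simp: ext_def\<close>)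
 qed
 have sp: "spans R M t y"
  unfolding spans_def
 proof (intro conjI allI ballI)
  fix x assume "x : carrier M"
  then obtain u where u: "u : carrier ?F" "x = f u" using fs by blast
  then have "x = lc M t (ext u) y" using fy[OF extR[OF u(1)]] extr[OF u(1)] by simp
  then show "EX w. (ALL i. w i : carrier R) & x = lc M t w y" using extR[OF u(1)] by blast
 qed (rule y)
 have "fg_relations R M t y"
  unfolding fg_relations_def
 proof (intro exI[of _ s] exI[of _ "%b. ext (z b)"] conjI allI impI)
  show "ext (z b) a : carrier R" for b a using extR[OF z] by blast
  show "lc M t (ext (z b)) y = \<zero>\<^bsub>M\<^esub>" if b: "b < s" for b
  proof -
   have "z b = lc ?F s (%j. if j = b then \<one> else \<zero>) z" by (rule F.lc_delta[symmetric, OF b]) simp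
   also have "... = g (restrict (%j. if j = b then \<one> else \<zero>) {..<s})" by (rule gz[symmetric]) simp
   finally have "z b : g ` carrier ?G" unfolding Gs by auto
   then have "f (z b) = \<zero>\<^bsub>M\<^esub>" unfolding gk by blast
   then show ?thesis using fy[OF extR[OF z[of b]]] extr[OF z[of b]] by simp
  qed
  fix w assume w: "ALL a. w a : carrier R" and wz: "lc M t w y = \<zero>\<^bsub>M\<^esub>"
  have "restrict w {..<t} : carrier ?F" unfolding Fs using w by auto
  then have "restrict w {..<t} : g ` carrier ?G" unfolding gk using fy[OF w] wz by simp
  then obtain u where u: "u : carrier ?G" "restrict w {..<t} = g u" by blast
  define c where "c b = (if b < s then u b else \<zero>)" for b
  have c: "ALL b. c b : carrier R" using PiE_mem[OF u(1)[unfolded Gs]] by (simp add: c_def)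
  have "restrict c {..<s} = u"
   by (rule PiE_ext[OF _ u(1)[unfolded Gs]]) (use PiE_mem[OF u(1)[unfolded Gs]] in \<open>auto simp: c_def\<close>)
  then have eq: "restrict w {..<t} = lc ?F s c z" using gz[OF c] u(2) by simp
  have "w a = dot R s c (%b. ext (z b) a)" if a: "a < t" for a
  proof -
   have fa: "functional R ?F (%x. x a)"
    unfolding functional_def Fs using a by (auto simp: PiE_mem)
   have "w a = lc ?F s c z a" using fun_cong[OF eq, of a] a by simp
   also have "... = dot R s c (%b. z b a)" by (rule F.functional_lc[OF fa]) (use c in auto)
   finally show ?thesis using a by (simp add: ext_def)
  qed
  then show "EX c. (ALL b. c b : carrier R) & (ALL a<t. w a = dot R s c (%b. ext (z b) a))" using c by blast
 qed
 then show ?thesis using sp by blast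
qed

text \<open>The forms from \<open>ex_saturation\<close> vanish on all relations and so descend to
  functionals on \<open>M\<close>. An element that they all kill has coefficients in the saturation
  of the relations, hence is killed by \<open>D\<close>.\<close>

lemma (in module) ex_torsion_functionals:
 assumes sh: "semihereditary_ring R" and sp: "spans R M t y" and rel: "fg_relations R M t y"
 shows "EX \<theta> D. (ALL i. functional R M (\<theta> i)) & D : regular_elements R &
  (ALL x:carrier M. (ALL i<t. \<theta> i x = \<zero>) --> D \<odot>\<^bsub>M\<^esub> x = \<zero>\<^bsub>M\<^esub>)"
proof -
 interpret sh: semihereditary_ring R by fact
 note y [simp] = spans_closed[OF sp]
 obtain N g where g': "ALL b a. g b a : carrier R" and g0: "ALL b<N. lc M t (g b) y = \<zero>\<^bsub>M\<^esub>"
  and gr: "ALL w. (ALL a. w a : carrier R) --> lc M t w y = \<zero>\<^bsub>M\<^esub> -->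
   (EX c. (ALL b. c b : carrier R) & (ALL a<t. w a = dot R N c (%b. g b a)))"
  using rel unfolding fg_relations_def by (elim exE conjE)
 have g [simp]: "g b a : carrier R" for b a using g' by blast
 obtain \<theta> D where \<theta>': "ALL i a. \<theta> i a : carrier R" and D: "D : regular_elements R"
  and \<theta>g: "ALL b<N. ALL i<t. dot R t (\<theta> i) (g b) = \<zero>"
  and sat: "ALL w. (ALL a. w a : carrier R) --> (ALL i<t. dot R t (\<theta> i) w = \<zero>) -->
   (EX c. (ALL b. c b : carrier R) & (ALL a<t. D \<otimes> w a = dot R N c (%b. g b a)))"
  using sh.ex_saturation[of g N t, OF g] by (elim exE conjE)
 have \<theta> [simp]: "\<theta> i a : carrier R" for i a using \<theta>' by blast
 note DR [simp] = R.regularD(1)[OF D]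
 have rel0: "dot R t (\<theta> i) w = \<zero>" if i: "i < t" and w: "ALL a. w a : carrier R" "lc M t w y = \<zero>\<^bsub>M\<^esub>" for i w
 proof -
  obtain c where c: "ALL b. c b : carrier R" "ALL a<t. w a = dot R N c (%b. g b a)" using gr w by blast
  have [simp]: "c b : carrier R" for b using c by blast
  have "dot R t (\<theta> i) w = dot R t w (\<theta> i)" by (rule R.dot_comm) (use w in auto)
  also have "... = dot R t (%a. dot R N c (%b. g b a)) (\<theta> i)" by (rule R.dot_cong) (use c in auto)
  also have "... = dot R N c (%b. dot R t (g b) (\<theta> i))" by (rule R.dot_sum) auto
  also have "... = (\<Oplus>b\<in>{..<N}. c b \<otimes> \<zero>)"
   unfolding dot_def[of R N]
  proof (rule R.finsum_cong')
   fix b assume "b : {..<N}"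
   then have "dot R t (g b) (\<theta> i) = \<zero>" using \<theta>g i R.dot_comm[of "g b" "\<theta> i" t] by simp
   then show "c b \<otimes> dot R t (g b) (\<theta> i) = c b \<otimes> \<zero>" by simp
  qed auto
  also have "... = \<zero>" by simp
  finally show ?thesis .
 qed
 define W where "W x = (SOME w. (ALL a. w a : carrier R) & x = lc M t w y)" for x
 have W': "(ALL a. W x a : carrier R) & x = lc M t (W x) y" if x: "x : carrier M" for x
 proof -
  have "EX w. (ALL a. w a : carrier R) & x = lc M t w y" using sp x unfolding spans_def by blast
  then show ?thesis unfolding W_def by (rule someI_ex)
 qed
 have W: "W x a : carrier R" "lc M t (W x) y = x" if "x : carrier M" for x a using W'[OF that] by auto
 \<comment> \<open>The value depends on the coefficients only up to relations, where \<theta> i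
   vanishes. From t on the functionals are zero, since a functional is wanted at every
   index.\<close>
 define \<Theta> where "\<Theta> i x = (if i < t then dot R t (\<theta> i) (W x) else \<zero>)" for i x
 have \<Theta>lc: "\<Theta> i (lc M t w y) = dot R t (\<theta> i) w" if i: "i < t" and w: "ALL a. w a : carrier R" for i w
 proof -
  have [simp]: "w a : carrier R" for a using w by blast
  let ?x = "lc M t w y"
  have x: "?x : carrier M" by (rule lc_closed) auto
  note [simp] = W(1)[OF x]
  have "lc M t (%a. W ?x a \<ominus> w a) y = \<zero>\<^bsub>M\<^esub>"
   using lc_minus[of "W ?x" w y t] W(2)[OF x] x by (simp add: M.minus_eq M.r_neg)
  then have "dot R t (\<theta> i) (%a. W ?x a \<ominus> w a) = \<zero>" by (intro rel0[OF i]) auto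
  moreover have "dot R t (\<theta> i) (%a. W ?x a \<ominus> w a) = dot R t (\<theta> i) (W ?x) \<ominus> dot R t (\<theta> i) w"
   using R.dot_lin_right[of \<one> \<one> "W ?x" w "\<theta> i" t] by simp
  ultimately show ?thesis using R.minus_zeroD[of "dot R t (\<theta> i) (W ?x)" "dot R t (\<theta> i) w"] i by (simp add: \<Theta>_def)
 qed
 have fn: "functional R M (\<Theta> i)" for i
 proof (cases "i < t")
  case True
  show ?thesis
   unfolding functional_def
  proof (intro conjI ballI)
   fix x assume x: "x : carrier M"
   note [simp] = W(1)[OF x]
   show "\<Theta> i x : carrier R" by (simp add: \<Theta>_def)
   show "\<Theta> i (r \<odot>\<^bsub>M\<^esub> x) = r \<otimes> \<Theta> i x" if r: "r : carrier R" for r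
   proof -
    have "r \<odot>\<^bsub>M\<^esub> x = lc M t (%a. r \<otimes> W x a) y" using W(2)[OF x] r by (subst lc_smult) auto
    then have "\<Theta> i (r \<odot>\<^bsub>M\<^esub> x) = dot R t (\<theta> i) (%a. r \<otimes> W x a)" using \<Theta>lc[OF True] r by simp
    also have "... = dot R t (%a. r \<otimes> W x a) (\<theta> i)" by (rule R.dot_comm) (use r in auto)
    also have "... = r \<otimes> dot R t (W x) (\<theta> i)" by (rule R.dot_smult) (use r in auto)
    also have "dot R t (W x) (\<theta> i) = \<Theta> i x" using True R.dot_comm[of "W x" "\<theta> i" t] by (simp add: \<Theta>_def)
    finally show ?thesis .
   qed
   fix z assume z: "z : carrier M"
   note [simp] = W(1)[OF z]
   have "x \<oplus>\<^bsub>M\<^esub> z = lc M t (%a. W x a \<oplus> W z a) y" using W(2)[OF x] W(2)[OF z] by (subst lc_add) auto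
   then have "\<Theta> i (x \<oplus>\<^bsub>M\<^esub> z) = dot R t (\<theta> i) (%a. W x a \<oplus> W z a)" using \<Theta>lc[OF True] by simp
   also have "... = dot R t (%a. W x a \<oplus> W z a) (\<theta> i)" by (rule R.dot_comm) auto
   also have "... = dot R t (W x) (\<theta> i) \<oplus> dot R t (W z) (\<theta> i)" by (rule R.dot_add) auto
   also have "... = \<Theta> i x \<oplus> \<Theta> i z"
    using True R.dot_comm[of "W x" "\<theta> i" t] R.dot_comm[of "W z" "\<theta> i" t] by (simp add: \<Theta>_def)
   finally show "\<Theta> i (x \<oplus>\<^bsub>M\<^esub> z) = \<Theta> i x \<oplus> \<Theta> i z" .
  qed
 next
  case False
  then show ?thesis unfolding functional_def \<Theta>_def by simp
 qed
 have "D \<odot>\<^bsub>M\<^esub> x = \<zero>\<^bsub>M\<^esub>" if x: "x : carrier M" and z: "ALL i<t. \<Theta> i x = \<zero>" for x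
 proof -
  note [simp] = W(1)[OF x]
  have "ALL i<t. dot R t (\<theta> i) (W x) = \<zero>" using z by (simp add: \<Theta>_def)
  then obtain c where c: "ALL b. c b : carrier R" "ALL a<t. D \<otimes> W x a = dot R N c (%b. g b a)"
   using sat by (metis W(1)[OF x])
  have [simp]: "c b : carrier R" for b using c by blast
  have "D \<odot>\<^bsub>M\<^esub> x = lc M t (%a. D \<otimes> W x a) y" using W(2)[OF x] by (subst lc_smult) auto
  also have "... = lc M t (%a. dot R N c (%b. g b a)) y" by (rule lc_cong) (use c in auto)
  also have "... = lc M N c (%b. lc M t (g b) y)" by (rule lc_lc[symmetric]) auto
  also have "... = lc M N c (%_. \<zero>\<^bsub>M\<^esub>)" by (rule lc_cong2) (use g0 in auto)
  also have "... = \<zero>\<^bsub>M\<^esub>" by (simp add: lc_def)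
  finally show ?thesis .
 qed
 then show ?thesis using fn D by (intro exI[of _ \<Theta>] exI[of _ D]) blast
qed

section \<open>From a splitting to a decomposition\<close>

lemma (in cring) fg_ideal_ideal:
 assumes "fg_ideal R C"
 shows "ideal C R"
proof -
 obtain N g where g: "ALL i::nat. g i : carrier R" "C = Idl (g ` {..<N})"
  using assms unfolding fg_ideal_def by (elim exE conjE)
 have "g ` {..<N} <= carrier R" using g(1) by auto
 then show ?thesis unfolding g(2) by (rule genideal_ideal)
qed

lemma splitting_chain:
 assumes sp: "splitting R M n f B \<beta> H \<pi>" and R: "cring R" and kl: "k <= l" "l <= n"
 shows "f l \<otimes>\<^bsub>R\<^esub> f k = f l"
proof -
 interpret cring R by fact
 note s1 = sp[unfolded splitting_def, THEN conjunct1] and s2 = sp[unfolded splitting_def, THEN conjunct2, THEN conjunct1]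
 have fR: "f k : carrier R" and ff: "f k \<otimes>\<^bsub>R\<^esub> f k = f k" for k using s1 by simp_all
 show ?thesis using kl
 proof (induction l)
  case 0
  then show ?case using ff by simp
 next
  case (Suc l)
  show ?case
  proof (cases "k = Suc l")
   case True
   then show ?thesis using ff by simp
  next
   case False
   have s: "f (Suc l) \<otimes>\<^bsub>R\<^esub> f l = f (Suc l)" using s2 Suc.prems by simp
   have "f (Suc l) \<otimes>\<^bsub>R\<^esub> f k = (f (Suc l) \<otimes>\<^bsub>R\<^esub> f l) \<otimes>\<^bsub>R\<^esub> f k" unfolding s ..
   also have "... = f (Suc l) \<otimes>\<^bsub>R\<^esub> (f l \<otimes>\<^bsub>R\<^esub> f k)" by (rule m_assoc) (rule fR)+
   also have "f l \<otimes>\<^bsub>R\<^esub> f k = f l" using Suc.IH Suc.prems False by simp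
   finally show ?thesis using s by simp
  qed
 qed
qed

text \<open>A rank count. The part split off is embedded by t functionals. Choose in it t + 1
  vectors v k whose only coordinate \<beta> k is an element d k with the annihilator of f k. If f t
  were not zero, some combination x of them would be killed by all \<theta> i, hence be zero, while
  f t x j is not zero for some j. But the coordinate \<beta> j of the combination is x j d j, so x j
  f j = 0 and therefore f t x j = f t f j x j = 0.\<close>

lemma (in module) splitting_vanishes:
 assumes sh: "semihereditary_ring R" and sp: "splitting R M (Suc t) f B \<beta> H \<pi>"
  and \<theta>: "ALL i. functional R M (\<theta> i)"
  and inj: "ALL x:carrier M. \<pi> x = \<zero>\<^bsub>M\<^esub> --> (ALL i<t. \<theta> i x = \<zero>) --> x = \<zero>\<^bsub>M\<^esub>"
 shows "f t = \<zero>"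
proof (rule ccontr)
 assume ft: "f t ~= \<zero>"
 interpret sh: semihereditary_ring R by fact
 have s1: "ALL k. f k : carrier R & f k \<otimes> f k = f k"
  and s3: "ALL k<Suc t. fg_ideal R (B k) & (ALL b:B k. f k \<otimes> b = b) & (EX d:B k. ALL r:carrier R. r \<otimes> d = \<zero> --> r \<otimes> f k = \<zero>)"
  and lp: "linear_proj R M H \<pi>" and s5: "ALL k<Suc t. functional R M (\<beta> k)"
  and s9: "ALL b. (ALL k<Suc t. b k : B k) --> (EX x:carrier M. \<pi> x = \<zero>\<^bsub>M\<^esub> & (ALL k<Suc t. \<beta> k x = b k))"
  using sp[unfolded splitting_def] by - (elim conjE, assumption)+
 have fR [simp]: "f k : carrier R" for k using s1 by blast
 have "ALL k. EX d. k < Suc t --> d : B k & (ALL r:carrier R. r \<otimes> d = \<zero> --> r \<otimes> f k = \<zero>)" using s3 by blast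
 from choice[OF this] obtain d where d: "ALL k. k < Suc t --> d k : B k & (ALL r:carrier R. r \<otimes> d k = \<zero> --> r \<otimes> f k = \<zero>)" by (rule exE)
 have B0: "\<zero> : B k" and BR: "!!b. b : B k ==> b : carrier R" if "k < Suc t" for k
 proof -
  have "fg_ideal R (B k)" using s3 that by simp
  then have idB: "ideal (B k) R" by (rule fg_ideal_ideal)
  show "\<zero> : B k" by (rule additive_subgroup.zero_closed[OF ideal.axioms(1)[OF idB]])
  show "!!b. b : B k ==> b : carrier R" by (rule ideal.Icarr[OF idB])
 qed
 have "ALL k. EX x. x : carrier M & \<pi> x = \<zero>\<^bsub>M\<^esub> & (ALL l<Suc t. \<beta> l x = (if l = k then d l else \<zero>))"
 proof
  fix k
  have "EX x:carrier M. \<pi> x = \<zero>\<^bsub>M\<^esub> & (ALL l<Suc t. \<beta> l x = (if l = k then d l else \<zero>))"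
   by (rule s9[THEN spec, THEN mp]) (use d B0 in auto)
  then show "EX x. x : carrier M & \<pi> x = \<zero>\<^bsub>M\<^esub> & (ALL l<Suc t. \<beta> l x = (if l = k then d l else \<zero>))" by blast
 qed
 from choice[OF this] obtain v where v': "ALL k. v k : carrier M & \<pi> (v k) = \<zero>\<^bsub>M\<^esub> & (ALL l<Suc t. \<beta> l (v k) = (if l = k then d l else \<zero>))"
  by (rule exE)
 have v [simp]: "v k : carrier M" "\<pi> (v k) = \<zero>\<^bsub>M\<^esub>" for k using v' by blast+
 have vb: "\<beta> l (v k) = (if l = k then d l else \<zero>)" if "l < Suc t" for l k using v' that by blast
 define V where "V k i = \<theta> i (v k)" for k i
 have V [simp]: "V k i : carrier R" for k i unfolding V_def using functional_closed \<theta> v by blast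
 have "EX x. (ALL k::nat. x k : carrier R) & (ALL i<t. (\<Oplus>k\<in>{..<Suc t}. x k \<otimes> V k i) : {\<zero>}) & (EX j<Suc t. f t \<otimes> x j ~: {\<zero>})"
 proof (rule R.ex_dependence[OF R.zeroideal])
  show "x : {\<zero>}" if "x : carrier R" "x \<otimes> x : {\<zero>}" for x using sh.reduced[OF that(1)] that(2) by blast
  show "f t ~: {\<zero>}" using ft by blast
 qed (rule fR V)+
 then obtain x where xx: "(ALL k::nat. x k : carrier R) & (ALL i<t. (\<Oplus>k\<in>{..<Suc t}. x k \<otimes> V k i) : {\<zero>}) & (EX j<Suc t. f t \<otimes> x j ~: {\<zero>})"
  by (rule exE)
 have x [simp]: "x k : carrier R" for k using xx by blast
 have x0: "(\<Oplus>k\<in>{..<Suc t}. x k \<otimes> V k i) = \<zero>" if "i < t" for i using xx that by blast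
 obtain j where j: "j < Suc t" "f t \<otimes> x j ~= \<zero>" using xx by blast
 define u where "u = lc M (Suc t) x v"
 have u: "u : carrier M" unfolding u_def by (rule lc_closed) auto
 have "u = \<zero>\<^bsub>M\<^esub>"
 proof (rule inj[THEN bspec, THEN mp, THEN mp])
  show "u : carrier M" by (rule u)
  show "\<pi> u = \<zero>\<^bsub>M\<^esub>" unfolding u_def by (subst linear_proj_lc[OF lp]) (simp_all add: lc_def)
  show "ALL i<t. \<theta> i u = \<zero>"
   unfolding u_def using functional_lc[OF \<theta>[THEN spec], of x v] x0 by (simp add: dot_def V_def)
 qed
 then have "\<beta> j u = \<zero>" using functional_zero s5 j(1) by blast
 moreover have "\<beta> j u = x j \<otimes> d j"
 proof -
  have dj: "d j : carrier R" using BR d j(1) by blast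
  have "\<beta> j u = dot R (Suc t) x (%k. \<beta> j (v k))" unfolding u_def by (rule functional_lc) (use s5 j in auto)
  also have "... = (\<Oplus>k\<in>{..<Suc t}. if k = j then x k \<otimes> d j else \<zero>)"
   unfolding dot_def by (rule R.finsum_cong') (use vb[OF j(1)] dj in auto)
  also have "... = x j \<otimes> d j" by (rule R.finsum_delta) (use j dj in auto)
  finally show ?thesis .
 qed
 ultimately have "x j \<otimes> f j = \<zero>" using d j(1) x by auto
 moreover have "f t \<otimes> x j = f t \<otimes> (x j \<otimes> f j)"
 proof -
  have "f t \<otimes> x j = (f t \<otimes> f j) \<otimes> x j" using splitting_chain[OF sp R.is_cring, of j t] j(1) by simp
  also have "... = f t \<otimes> (x j \<otimes> f j)" using fR[of t] fR[of j] x[of j] by algebra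
  finally show ?thesis .
 qed
 ultimately show False using j(2) by simp
qed

text \<open>The set in question is e B. Multiplying a dual basis of B by e gives one for e B, and e
  d is regular in the corner ring because e f = e.\<close>

lemma (in semihereditary_ring) corner_part_invertible:
 assumes B: "fg_ideal R B" and f: "f : carrier R"
  and d: "d : B" "ALL r:carrier R. r \<otimes> d = \<zero> --> r \<otimes> f = \<zero>"
  and e: "e : carrier R" "e \<otimes> e = e" and ef: "e \<otimes> f = e"
 shows "invertible_ideal {x : B. e \<otimes> x = x} (corner_ring R e)"
proof -
 let ?C = "corner_ring R e" and ?J = "{x : B. e \<otimes> x = x}"
 note ec = corner_ring_carrier[OF e]
 note [simp] = e(1)
 interpret C: cring ?C by (rule corner_ring_cring[OF e])
 obtain N g where gN: "ALL i::nat. g i : carrier R" and Bg: "B = Idl (g ` {..<N})"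
  using B unfolding fg_ideal_def by (elim exE conjE)
 have g [simp]: "g i : carrier R" for i using gN by blast
 have gR: "g ` {..<N} <= carrier R" by auto
 have idB: "ideal B R" by (rule fg_ideal_ideal[OF B])
 interpret B: ideal B R by fact
 obtain h where hc: "!!i x. x : B ==> h i x : carrier R"
  and ha: "!!i x z. x : B ==> z : B ==> h i (x \<oplus> z) = h i x \<oplus> h i z"
  and hm: "!!i r x. r : carrier R ==> x : B ==> h i (r \<otimes> x) = r \<otimes> h i x"
  and hs: "!!x. x : B ==> x = (\<Oplus>i\<in>{..<N}. h i x \<otimes> g i)"
  by (rule dual_basis[of "{..<N}" g]) (auto simp: Bg)
 have ee: "e \<otimes> (e \<otimes> x) = e \<otimes> x" if "x : carrier R" for x using that e by (simp add: m_assoc[symmetric])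
 have ecl: "e \<otimes> x : carrier ?C" if "x : carrier R" for x using that ee by (simp add: ec)
 have eJ: "e \<otimes> x : ?J" if "x : B" for x using that ee B.Icarr B.I_l_closed by simp
 have dR [simp]: "d : carrier R" using d(1) B.Icarr by blast
 note [simp] = hc[OF d(1)]
 have idJ: "ideal ?J R"
 proof (rule idealI)
  show "ring R" by (rule ring_axioms)
  show "subgroup ?J (add_monoid R)"
  proof (rule add.subgroupI)
   show "?J <= carrier R" using B.Icarr by blast
   show "?J ~= {}" using eJ[OF d(1)] by blast
   show "\<ominus> a : ?J" if "a : ?J" for a using that B.Icarr ideal_add(2)[OF idB, of a a] by (simp add: r_minus)
   show "a \<oplus> b : ?J" if "a : ?J" "b : ?J" for a b
    using that B.Icarr ideal_add(1)[OF idB, of a b] by (simp add: r_distr)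
  qed
  show x1: "x \<otimes> a : ?J" if "a : ?J" "x : carrier R" for a x
  proof -
   have a: "a : B" "e \<otimes> a = a" "a : carrier R" using that B.Icarr by auto
   have "e \<otimes> (x \<otimes> a) = x \<otimes> (e \<otimes> a)" by (rule m_lcomm) (use that a in auto)
   then show ?thesis using a that(2) B.I_l_closed by simp
  qed
  show "a \<otimes> x : ?J" if "a : ?J" "x : carrier R" for a x
   using x1[OF that] that m_comm[of a x] B.Icarr by simp
 qed
 show ?thesis
 proof (rule C.invertible_idealI)
  show "ideal ?J ?C" by (rule corner_idealI[OF e idJ]) blast
  show "e \<otimes> d : ?J" by (rule eJ[OF d(1)])
  show "e \<otimes> d : regular_elements ?C"
  proof (rule C.regularI)
   show "e \<otimes> d : carrier ?C" by (rule ecl) simp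
   fix b assume b: "b : carrier ?C" "(e \<otimes> d) \<otimes>\<^bsub>?C\<^esub> b = \<zero>\<^bsub>?C\<^esub>"
   have bR: "b : carrier R" "e \<otimes> b = b" using b(1) ec by auto
   have "(b \<otimes> e) \<otimes> d = (e \<otimes> d) \<otimes> b" using bR(1) dR e(1) by algebra
   then have "(b \<otimes> e) \<otimes> d = \<zero>" using b(2) by simp
   then have "(b \<otimes> e) \<otimes> f = \<zero>" using d(2) bR(1) by simp
   then have "b \<otimes> (e \<otimes> f) = \<zero>" using m_assoc[OF bR(1) e(1) f] by simp
   then show "b = \<zero>\<^bsub>?C\<^esub>" using ef bR m_comm[of e b] by simp
  qed
  show "finite {..<N}" by simp
  show "e \<otimes> g i : ?J" if "i : {..<N}" for i
   by (rule eJ) (use genideal_self[OF gR] that in \<open>auto simp: Bg\<close>)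
  show "e \<otimes> h i d : carrier ?C" for i by (rule ecl) simp
  show "e \<otimes> d = (\<Oplus>\<^bsub>?C\<^esub>i\<in>{..<N}. (e \<otimes> g i) \<otimes>\<^bsub>?C\<^esub> (e \<otimes> h i d))"
  proof -
   have c: "(e \<otimes> g i) \<otimes> (e \<otimes> h i d) : carrier ?C" for i using ecl[of "g i"] ecl[of "h i d"] C.m_closed by simp
   have "(\<Oplus>\<^bsub>?C\<^esub>i\<in>{..<N}. (e \<otimes> g i) \<otimes> (e \<otimes> h i d)) = (\<Oplus>i\<in>{..<N}. (e \<otimes> g i) \<otimes> (e \<otimes> h i d))"
    by (rule finsum_hom[where h = "%x. x", OF C.abelian_monoid_axioms abelian_monoid_axioms]) (use c ec in auto)
   also have "... = (\<Oplus>i\<in>{..<N}. e \<otimes> (h i d \<otimes> g i))"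
   proof (rule finsum_cong')
    fix i
    have "(e \<otimes> g i) \<otimes> (e \<otimes> h i d) = (e \<otimes> e) \<otimes> (h i d \<otimes> g i)" using e(1) g[of i] hc[OF d(1), of i] by algebra
    then show "(e \<otimes> g i) \<otimes> (e \<otimes> h i d) = e \<otimes> (h i d \<otimes> g i)" using e(2) by simp
   qed auto
   also have "... = e \<otimes> (\<Oplus>i\<in>{..<N}. h i d \<otimes> g i)" by (rule finsum_rdistr[symmetric]) auto
   also have "(\<Oplus>i\<in>{..<N}. h i d \<otimes> g i) = d" by (rule hs[OF d(1), symmetric])
   finally show ?thesis by simp
  qed
  show "EX y:carrier ?C. x \<otimes>\<^bsub>?C\<^esub> (e \<otimes> h i d) = (e \<otimes> d) \<otimes>\<^bsub>?C\<^esub> y" if x: "x : ?J" for i x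
  proof (rule bexI[of _ "e \<otimes> h i x"])
   have xB: "x : B" using x by blast
   note xR = B.Icarr[OF xB] and hx = hc[OF xB, of i] and hd = hc[OF d(1), of i]
   have "x \<otimes> h i d = d \<otimes> h i x"
    using hm[OF xR d(1), of i] hm[OF dR xB, of i] m_comm[OF xR dR] by simp
   moreover have "x \<otimes> (e \<otimes> h i d) = e \<otimes> (x \<otimes> h i d)" "(e \<otimes> d) \<otimes> (e \<otimes> h i x) = (e \<otimes> e) \<otimes> (d \<otimes> h i x)"
    using xR hx hd dR e(1) by algebra+
   ultimately show "x \<otimes>\<^bsub>?C\<^esub> (e \<otimes> h i d) = (e \<otimes> d) \<otimes>\<^bsub>?C\<^esub> (e \<otimes> h i x)" using e(2) by simp
   show "e \<otimes> h i x : carrier ?C" by (rule ecl[OF hx])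
  qed
 qed
qed

text \<open>Since the chain ends in zero, f k is the sum of the differences at the drops beyond k.
  Each B k therefore breaks up into the parts e i B k with n i > k, and sorting these parts by i
  instead of by k gives the blocks of the decomposition.\<close>

lemma (in module) splitting_decomposition:
 assumes sh: "semihereditary_ring R" and sp: "splitting R M (Suc t) f B \<beta> H \<pi>" and ft: "f t = \<zero>"
  and tc: "torsion_coords R (M\<lparr>carrier := H\<rparr>) m Is \<gamma>"
 shows "EX I p e n J. is_decomposition R M m I p e n J"
proof -
 interpret sh: semihereditary_ring R by fact
 have s1: "ALL k. f k : carrier R & f k \<otimes> f k = f k"
  and s3: "ALL k<Suc t. fg_ideal R (B k) & (ALL b:B k. f k \<otimes> b = b) & (EX d:B k. ALL r:carrier R. r \<otimes> d = \<zero> --> r \<otimes> f k = \<zero>)"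
  and lp: "linear_proj R M H \<pi>" and s5: "ALL k<Suc t. functional R M (\<beta> k)"
  and s6: "ALL k<Suc t. ALL x:carrier M. \<beta> k x : B k" and s7: "ALL k<Suc t. ALL x:H. \<beta> k x = \<zero>"
  and s8: "ALL x:carrier M. \<pi> x = \<zero>\<^bsub>M\<^esub> --> (ALL k<Suc t. \<beta> k x = \<zero>) --> x = \<zero>\<^bsub>M\<^esub>"
  and s9: "ALL b. (ALL k<Suc t. b k : B k) --> (EX x:carrier M. \<pi> x = \<zero>\<^bsub>M\<^esub> & (ALL k<Suc t. \<beta> k x = b k))"
  using sp[unfolded splitting_def] by - (elim conjE, assumption)+
 have t1: "ALL j<m. invertible_ideal (Is j) R & Is j ~= carrier R"
  and t2: "ALL j. Suc j < m --> Is (Suc j) <= Is j"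
  and t3: "ALL j<m. ALL x:carrier (M\<lparr>carrier := H\<rparr>). \<gamma> j x : carrier R"
  and t4: "ALL j<m. ALL x:carrier (M\<lparr>carrier := H\<rparr>). ALL y:carrier (M\<lparr>carrier := H\<rparr>). \<gamma> j (x \<oplus>\<^bsub>M\<lparr>carrier := H\<rparr>\<^esub> y) \<ominus>\<^bsub>R\<^esub> (\<gamma> j x \<oplus>\<^bsub>R\<^esub> \<gamma> j y) : Is j"
  and t5: "ALL j<m. ALL r:carrier R. ALL x:carrier (M\<lparr>carrier := H\<rparr>). \<gamma> j (r \<odot>\<^bsub>M\<lparr>carrier := H\<rparr>\<^esub> x) \<ominus>\<^bsub>R\<^esub> r \<otimes>\<^bsub>R\<^esub> \<gamma> j x : Is j"
  and t6: "ALL x:carrier (M\<lparr>carrier := H\<rparr>). (ALL j<m. \<gamma> j x : Is j) --> x = \<zero>\<^bsub>M\<lparr>carrier := H\<rparr>\<^esub>"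
  and t7: "ALL c. (ALL j<m. c j : carrier R) --> (EX x:carrier (M\<lparr>carrier := H\<rparr>). ALL j<m. \<gamma> j x \<ominus>\<^bsub>R\<^esub> c j : Is j)"
  using tc[unfolded torsion_coords_def] by - (elim conjE, assumption)+
 note pH [simp] = linear_projD(2)[OF lp] and HM = submodule_closed[OF linear_projD(1)[OF lp]]
 have fR [simp]: "f k : carrier R" and ff: "f k \<otimes> f k = f k" for k using s1 by blast+
 have fle: "f l \<otimes> f k = f l" "f k \<otimes> f l = f l" if "k <= l" "l <= Suc t" for k l
  using splitting_chain[OF sp R.is_cring that] R.m_comm[of "f k" "f l"] by simp_all
 have fB: "f k \<otimes> b = b" if "k < Suc t" "b : B k" for k b using s3 that by blast
 have idB: "ideal (B k) R" if "k < Suc t" for k using s3 that fg_ideal_ideal by blast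
 have bf: "functional R M (\<beta> k)" if "k < Suc t" for k using s5 that by blast
 have bB: "\<beta> k x : B k" if "k < Suc t" "x : carrier M" for k x using s6 that by blast
 have BR: "b : carrier R" if "k < Suc t" "b : B k" for k b using ideal.Icarr[OF idB] that by blast

 \<comment> \<open>The places at which the chain drops; listed in increasing order they are the
   ranks n i.\<close>
 define L where "L = {l : {1..t}. f (l - 1) ~= f l}"
 have L: "finite L" unfolding L_def by simp
 define xs where "xs = sorted_list_of_set L"
 define p where "p = length xs"
 define n where "n i = xs ! (i - 1)" for i
 have xs: "set xs = L" "sorted_wrt (<) xs" unfolding xs_def using L by simp_all
 have nL: "n i : L" if "i : {1..p}" for i
  using nth_mem[of "i - 1" xs] that xs(1) unfolding n_def p_def by auto
 have nLex: "EX i:{1..p}. n i = l" if l: "l : L" for l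
 proof -
  obtain k where k: "k < length xs" "xs ! k = l" using l xs(1) by (metis in_set_conv_nth)
  then show ?thesis by (intro bexI[of _ "Suc k"]) (auto simp: n_def p_def)
 qed
 have nmono: "n i < n i'" if "i : {1..p}" "i' : {1..p}" "i < i'" for i i'
  unfolding n_def by (rule sorted_wrt_nth_less[OF xs(2)]) (use that in \<open>auto simp: p_def\<close>)
 have n1: "1 <= n i" "n i <= t" "f (n i - 1) ~= f (n i)" if "i : {1..p}" for i
  using nL[OF that] unfolding L_def by auto
 define e where "e i = f (n i - 1) \<ominus> f (n i)" for i
 have eR [simp]: "e i : carrier R" for i unfolding e_def by simp
 have ef1: "e i \<otimes> f k = e i" if i: "i : {1..p}" and k: "k <= n i - 1" for i k
 proof -
  have "e i \<otimes> f k = f (n i - 1) \<otimes> f k \<ominus> f (n i) \<otimes> f k"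
   unfolding e_def using fR[of "n i - 1"] fR[of "n i"] fR[of k] by algebra
  then show ?thesis using fle(1)[of k "n i - 1"] fle(1)[of k "n i"] n1[OF i] k by (simp add: e_def)
 qed
 have ef0: "e i \<otimes> f k = \<zero>" if i: "i : {1..p}" and k: "n i <= k" "k <= t" for i k
 proof -
  have "e i \<otimes> f k = f (n i - 1) \<otimes> f k \<ominus> f (n i) \<otimes> f k"
   unfolding e_def using fR[of "n i - 1"] fR[of "n i"] fR[of k] by algebra
  then show ?thesis using fle(2)[of "n i - 1" k] fle(2)[of "n i" k] n1[OF i] k by (simp add: R.minus_eq R.r_neg)
 qed
 have ex: "e i \<otimes> e i' = e i \<otimes> f (n i' - 1) \<ominus> e i \<otimes> f (n i')" for i i'
  unfolding e_def[of i'] using eR[of i] fR[of "n i' - 1"] fR[of "n i'"] by algebra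
 have ee: "e i \<otimes> e i = e i" if i: "i : {1..p}" for i
  unfolding ex using ef1[OF i order_refl] ef0[OF i order_refl] n1[OF i] by (simp add: R.minus_eq)
 have eo': "e i \<otimes> e i' = \<zero>" if i: "i : {1..p}" "i' : {1..p}" "i < i'" for i i'
 proof -
  have "e i \<otimes> f (n i' - 1) = \<zero>" "e i \<otimes> f (n i') = \<zero>"
   using nmono[OF i] n1[OF i(2)] by (auto intro!: ef0[OF i(1)])
  then show ?thesis unfolding ex by (simp add: R.minus_eq)
 qed
 have eo: "e i \<otimes> e i' = \<zero>" if i: "i : {1..p}" "i' : {1..p}" "i ~= i'" for i i'
  using eo'[OF i(1,2)] eo'[OF i(2,1)] i(3) R.m_comm[of "e i" "e i'"] by (cases "i < i'") auto
 have enz: "e i ~= \<zero>" if i: "i : {1..p}" for i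
  using R.minus_zeroD[of "f (n i - 1)" "f (n i)"] n1[OF i] unfolding e_def by auto

 \<comment> \<open>The ideals B are numbered from 0, those of a block from 1. In block i the indices
   up to n i occur, where f (k - 1) still fixes e i.\<close>
 define J where "J i k = {x : B (k - 1). e i \<otimes> x = x}" for i k
 have kt: "k - 1 < Suc t" "k - 1 <= n i - 1" if "i : {1..p}" "k : {1..n i}" for i k using n1[OF that(1)] that by auto
 have ecl: "e i \<otimes> b : J i k" if ik: "i : {1..p}" "k : {1..n i}" and b: "b : B (k - 1)" for i k b
 proof -
  have "e i \<otimes> (e i \<otimes> b) = e i \<otimes> b" using R.m_assoc[of "e i" "e i" b] ee[OF ik(1)] BR[OF kt(1)[OF ik] b] by simp
  then show ?thesis using R.ideal_lin(1)[OF idB[OF kt(1)[OF ik]] b, of "e i"] by (simp add: J_def)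
 qed
 have Jinv: "invertible_ideal (J i k) (corner_ring R (e i))" if ik: "i : {1..p}" "k : {1..n i}" for i k
 proof -
  obtain d where d: "d : B (k - 1)" "ALL r:carrier R. r \<otimes> d = \<zero> --> r \<otimes> f (k - 1) = \<zero>"
   using s3 kt(1)[OF ik] by blast
  have fg: "fg_ideal R (B (k - 1))" using s3 kt(1)[OF ik] by blast
  show ?thesis
   unfolding J_def by (rule sh.corner_part_invertible[OF fg fR d eR ee[OF ik(1)] ef1[OF ik(1) kt(2)[OF ik]]])
 qed
 define I where "I j = Is (j - 1)" for j
 define \<Gamma> where "\<Gamma> j x = \<gamma> (j - 1) (\<pi> x)" for j x
 define \<phi> where "\<phi> i k x = e i \<otimes> \<beta> (k - 1) x" for i k x
 have jm: "j - 1 < m" if "j : {1..m}" for j using that by auto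
 have coords: "decomp_coords R M m I p n J \<Gamma> \<phi>"
  unfolding decomp_coords_def
 proof (intro conjI ballI allI impI)
  show "\<Gamma> j x : carrier R" if "j : {1..m}" "x : carrier M" for j x
   using t3 jm[OF that(1)] that(2) by (simp add: \<Gamma>_def)
  show "\<Gamma> j (x \<oplus>\<^bsub>M\<^esub> y) \<ominus> (\<Gamma> j x \<oplus> \<Gamma> j y) : I j" if "j : {1..m}" "x : carrier M" "y : carrier M" for j x y
   using t4 jm[OF that(1)] that(2,3) linear_projD(5)[OF lp that(2,3)] by (simp add: \<Gamma>_def I_def)
  show "\<Gamma> j (r \<odot>\<^bsub>M\<^esub> x) \<ominus> r \<otimes> \<Gamma> j x : I j" if "j : {1..m}" "r : carrier R" "x : carrier M" for j r x
   using t5 jm[OF that(1)] that(2,3) linear_projD(6)[OF lp that(2,3)] by (simp add: \<Gamma>_def I_def)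
  show "functional R M (\<phi> i k)" if ik: "i : {1..p}" "k : {1..n i}" for i k
  proof -
   define l where "l = k - 1"
   have b: "functional R M (\<beta> l)" unfolding l_def by (rule bf[OF kt(1)[OF ik]])
   note [simp] = functional_closed[OF b] functional_add[OF b] functional_smult[OF b]
   show ?thesis unfolding functional_def \<phi>_def l_def[symmetric] by (simp add: R.r_distr R.m_lcomm)
  qed
  show "\<phi> i k x : J i k" if ik: "i : {1..p}" "k : {1..n i}" and x: "x : carrier M" for i k x
   unfolding \<phi>_def by (rule ecl[OF ik bB[OF kt(1)[OF ik] x]])
  show "x = \<zero>\<^bsub>M\<^esub>" if x: "x : carrier M" and g: "ALL j:{1..m}. \<Gamma> j x : I j"
   and z: "ALL i:{1..p}. ALL k:{1..n i}. \<phi> i k x = \<zero>" for x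
  proof -
   have "\<gamma> j (\<pi> x) : Is j" if "j < m" for j using bspec[OF g, of "Suc j"] that by (simp add: \<Gamma>_def I_def)
   then have px: "\<pi> x = \<zero>\<^bsub>M\<^esub>" using t6 pH[OF x] by simp
   have "\<beta> k x = \<zero>" if k: "k < Suc t" for k
   proof -
    let ?b = "\<beta> k x"
    have bR [simp]: "?b : carrier R" by (rule functional_closed[OF bf[OF k] x])
    \<comment> \<open>Going up the chain from its end f t = 0: between drops nothing changes, and at
      a drop the difference is some e i, which kills \<beta> k x by assumption. The goal is f k,
      which fixes every element of B k.\<close>
    have "j <= t - k ==> f (t - j) \<otimes> ?b = \<zero>" for j
    proof (induction j)
     case (Suc j)
     define l where "l = t - j"
     have l: "t - Suc j = l - 1" "Suc k <= l" "l <= t" "1 <= l" using Suc.prems by (auto simp: l_def)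
     have IH: "f l \<otimes> ?b = \<zero>" using Suc by (simp add: l_def)
     show ?case
     proof (cases "f (l - 1) = f l")
      case True
      then show ?thesis using IH l(1) by simp
     next
      case False
      then have "l : L" using l by (simp add: L_def)
      then obtain i where i: "i : {1..p}" "n i = l" using nLex by blast
      have "e i \<otimes> ?b = \<zero>" using bspec[OF bspec[OF z i(1)], of "Suc k"] i(2) l(2) by (simp add: \<phi>_def)
      moreover have "e i \<otimes> ?b = f (l - 1) \<otimes> ?b \<ominus> f l \<otimes> ?b"
       unfolding e_def i(2) using fR[of "l - 1"] fR[of l] bR by algebra
      ultimately show ?thesis using IH l(1) by (simp add: R.minus_eq)
     qed
    qed (simp add: ft)
    from this[of "t - k"] have "f k \<otimes> ?b = \<zero>" using k by simp
    then show ?thesis using fB[OF k bB[OF k x]] by simp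
   qed
   then show ?thesis using s8 x px by blast
  qed
  show "EX x:carrier M. (ALL j:{1..m}. \<Gamma> j x \<ominus> c j : I j) & (ALL i:{1..p}. ALL k:{1..n i}. \<phi> i k x = a i k)"
   if c: "ALL j:{1..m}. c j : carrier R" and a: "ALL i:{1..p}. ALL k:{1..n i}. a i k : J i k" for c a
  proof -
   have aJ: "a i k : B (k - 1)" "e i \<otimes> a i k = a i k" "a i k : carrier R" if ik: "i : {1..p}" "k : {1..n i}" for i k
    using a ik BR[OF kt(1)[OF ik]] unfolding J_def by blast+
   define P where "P k = {i : {1..p}. Suc k <= n i}" for k
   \<comment> \<open>The prescribed coordinates at level k, collected from all blocks that reach
     this level; multiplying by e i recovers each of them.\<close>
   define b where "b k = (\<Oplus>i\<in>P k. a i (Suc k))" for k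
   have "ALL k<Suc t. b k : B k"
   proof (intro allI impI)
    fix k assume k: "k < Suc t"
    show "b k : B k" unfolding b_def
     by (rule ideal.finsum_in_ideal[OF idB[OF k]]) (use aJ(1)[of _ "Suc k"] in \<open>auto simp: P_def\<close>)
   qed
   then obtain x1 where x1: "x1 : carrier M" "\<pi> x1 = \<zero>\<^bsub>M\<^esub>" "ALL k<Suc t. \<beta> k x1 = b k" using s9 by blast
   have "EX x:carrier (M\<lparr>carrier := H\<rparr>). ALL j<m. \<gamma> j x \<ominus> c (Suc j) : Is j"
    by (rule t7[THEN spec, THEN mp]) (use c in auto)
   then obtain x2 where x2: "x2 : H" "ALL j<m. \<gamma> j x2 \<ominus> c (Suc j) : Is j" by auto
   have x2M: "x2 : carrier M" using HM x2(1) by blast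
   have "\<pi> (x1 \<oplus>\<^bsub>M\<^esub> x2) = x2"
    using linear_projD(5)[OF lp x1(1) x2M] x1(2) linear_projD(4)[OF lp x2(1)] x2M by simp
   then have px: "\<pi> (x1 \<oplus>\<^bsub>M\<^esub> x2) = x2" .
   have 1: "ALL j:{1..m}. \<Gamma> j (x1 \<oplus>\<^bsub>M\<^esub> x2) \<ominus> c j : I j"
   proof
    fix j assume j: "j : {1..m}"
    have "Suc (j - 1) = j" using j by simp
    then show "\<Gamma> j (x1 \<oplus>\<^bsub>M\<^esub> x2) \<ominus> c j : I j"
     using mp[OF spec[OF x2(2), of "j - 1"] jm[OF j]] unfolding \<Gamma>_def I_def px by metis
   qed
   have 2: "ALL i:{1..p}. ALL k:{1..n i}. \<phi> i k (x1 \<oplus>\<^bsub>M\<^esub> x2) = a i k"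
   proof (intro ballI)
    fix i k assume ik: "i : {1..p}" "k : {1..n i}"
    note k = kt(1)[OF ik]
    define l where "l = k - 1"
    have kl: "k = Suc l" "l < Suc t" using ik k by (auto simp: l_def)
    have ac: "a i' (Suc l) : carrier R" "e i' \<otimes> a i' (Suc l) = a i' (Suc l)" if "i' : P l" for i'
     using aJ[of i' "Suc l"] that unfolding P_def by auto
    have iP: "i : P l" using ik kl by (simp add: P_def)
    have bl: "b l : carrier R" unfolding b_def by (rule R.finsum_closed') (rule ac)
    have "\<beta> l (x1 \<oplus>\<^bsub>M\<^esub> x2) = b l"
     using functional_add[OF bf[OF kl(2)] x1(1) x2M] x1(3) s7 x2(1) kl(2) bl by simp
    then have "\<phi> i k (x1 \<oplus>\<^bsub>M\<^esub> x2) = e i \<otimes> b l" by (simp add: \<phi>_def kl)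
    also have "... = (\<Oplus>i'\<in>P l. e i \<otimes> a i' (Suc l))"
     unfolding b_def by (rule R.finsum_rdistr) (use ac in \<open>auto simp: P_def\<close>)
    also have "... = (\<Oplus>i'\<in>P l. if i' = i then a i' (Suc l) else \<zero>)"
    proof (rule R.finsum_cong')
     fix i' assume i': "i' : P l"
     show "e i \<otimes> a i' (Suc l) = (if i' = i then a i' (Suc l) else \<zero>)"
     proof (cases "i' = i")
      case True
      then show ?thesis using ac[OF i'] by simp
     next
      case False
      have "e i \<otimes> a i' (Suc l) = (e i \<otimes> e i') \<otimes> a i' (Suc l)" using ac[OF i'] R.m_assoc[of "e i" "e i'" "a i' (Suc l)"] by simp
      then show ?thesis using eo[of i i'] ik(1) i' False ac[OF i'] by (auto simp: P_def)
     qed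
    qed (use ac in auto)
    also have "... = a i (Suc l)" by (rule R.finsum_delta) (use iP ac in \<open>auto simp: P_def\<close>)
    finally show "\<phi> i k (x1 \<oplus>\<^bsub>M\<^esub> x2) = a i k" by (simp add: kl)
   qed
   show ?thesis using 1 2 x1(1) x2M by blast
  qed
 qed
 have "decomposition_shape R M m p I e n J"
 proof (rule decomposition_shape.intro[OF module_axioms], rule decomposition_shape_axioms.intro)
  show "ideal (I j) R" if "j : {1..m}" for j
   using t1 jm[OF that] unfolding I_def invertible_ideal_def by blast
  show Jc: "J i k <= carrier R" if ik: "i : {1..p}" "k : {1..n i}" for i k
   using BR[OF kt(1)[OF ik]] unfolding J_def by blast
  show "J i k #> e i = J i k" if ik: "i : {1..p}" "k : {1..n i}" for i k
  proof -
   have "x \<otimes> e i = x" if x: "x : J i k" for x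
    using x Jc[OF ik] R.m_comm[OF eR[of i], of x] by (auto simp: J_def)
   then show ?thesis unfolding r_coset_def by auto
  qed
 qed
 from decomposition_shape.coords_imp_iso[OF this coords]
 have iso: "mod_isomorphic R M (decomposition_sum R m I p e n J)" .
 have "is_decomposition R M m I p e n J"
  unfolding is_decomposition_def
 proof (intro conjI ballI impI)
  show "invertible_ideal (I j) R" "I j ~= carrier R" if "j : {1..m}" for j
   using t1 jm[OF that] by (auto simp: I_def)
  show "I (Suc j) <= I j" if "j : {1..<m}" for j
  proof -
   have "Suc (j - 1) < m" "Suc (j - 1) = j" using that by auto
   then show ?thesis using t2[THEN spec, of "j - 1"] by (simp add: I_def)
  qed
  show "strict_mono_on {1..p} n" by (rule strict_mono_onI) (rule nmono)
  show "0 < n i" if "i : {1..p}" for i using n1[OF that] by simp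
 qed (use eR ee enz eo Jinv iso in auto)
 then show ?thesis by (intro exI)
qed

lemma ex_decomposition:
 assumes sh: "semihereditary_ring R" and alg: "almost_local_global R" and M: "module R M" and fp: "finitely_presented R M"
 shows "EX m I p e n J. is_decomposition R M m I p e n J"
proof -
 interpret module R M by fact
 interpret sh: semihereditary_ring R by fact
 obtain t y where sp: "spans R M t y" and rel: "fg_relations R M t y"
  using finitely_presented_relations[OF fp] by blast
 obtain \<theta> D where th: "ALL i. functional R M (\<theta> i)" and D: "D : regular_elements R"
  and Dk: "ALL x:carrier M. (ALL i<t. \<theta> i x = \<zero>\<^bsub>R\<^esub>) --> D \<odot>\<^bsub>M\<^esub> x = \<zero>\<^bsub>M\<^esub>"
  using ex_torsion_functionals[OF sh sp rel] by (elim exE conjE)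
 \<comment> \<open>One step more than there are functionals: the rank count needs the ideal
   \<open>B t\<close> in order to show that its support \<open>f t\<close> is zero.\<close>
 obtain f B \<beta> H \<pi> where split: "splitting R M (Suc t) f B \<beta> H \<pi>"
  and fH: "ALL x:H. ALL i<t. f (Suc t) \<otimes>\<^bsub>R\<^esub> \<theta> i x = \<theta> i x"
  and inj: "ALL x:carrier M. \<pi> x = \<zero>\<^bsub>M\<^esub> --> (ALL i<t. \<theta> i x = \<zero>\<^bsub>R\<^esub>) --> x = \<zero>\<^bsub>M\<^esub>"
  using ex_splitting[where \<theta> = \<theta> and q = t and n = "Suc t", OF sh M sp th[THEN spec]] by (elim exE conjE)
 have ft: "f t = \<zero>\<^bsub>R\<^esub>" by (rule splitting_vanishes[OF sh split th inj])
 have lp: "linear_proj R M H \<pi>" using split[unfolded splitting_def] by (elim conjE)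
 have fR: "f k : carrier R" for k using split[unfolded splitting_def] by simp
 \<comment> \<open>The idempotent that supports the \<theta> i on the remainder H vanishes along
   with f t; hence the \<theta> i vanish on H, and \<open>D\<close> kills H.\<close>
 have "f (Suc t) = \<zero>\<^bsub>R\<^esub>"
  using splitting_chain[OF split R.is_cring, of t "Suc t"] ft fR[of "Suc t"] by simp
 then have "\<theta> i x = \<zero>\<^bsub>R\<^esub>" if "x : H" "i < t" for i x
  using bspec[OF fH that(1)] that functional_closed[OF th[THEN spec], of x i] submodule_closed[OF linear_projD(1)[OF lp] that(1)] by force
 then have DH: "ALL z:carrier (M\<lparr>carrier := H\<rparr>). D \<odot>\<^bsub>M\<lparr>carrier := H\<rparr>\<^esub> z = \<zero>\<^bsub>M\<lparr>carrier := H\<rparr>\<^esub>"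
  using Dk submodule_closed[OF linear_projD(1)[OF lp]] by simp
 have HN: "module R (M\<lparr>carrier := H\<rparr>)"
  by (rule submodule.submodule_is_module[OF linear_projD(1)[OF lp] M])
 \<comment> \<open>The first bound on the entries of the relations is the whole ring.\<close>
 have triv: "ALL w. (ALL a. w a : carrier R) --> lc (M\<lparr>carrier := H\<rparr>) t w (%i. \<pi> (y i)) = \<zero>\<^bsub>M\<lparr>carrier := H\<rparr>\<^esub> --> (ALL a<t. w a : carrier R)"
  by blast
 obtain m Is \<gamma> where "torsion_coords R (M\<lparr>carrier := H\<rparr>) m Is \<gamma>"
  using ex_torsion_coords[OF sh alg D HN spans_proj[OF lp sp] fg_relations_proj[OF lp sp rel] DH R.oneideal triv]
  by (elim exE conjE)
 from splitting_decomposition[OF sh split ft this] show ?thesis by (intro exI[of _ m])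
qed

theorem theorem2:
  fixes R :: "('a, 'r) ring_scheme"
    and M :: "('a, 'b, 'm) module_scheme"
    and M' :: "('a, 'c, 'n) module_scheme"
  assumes "cring R" and "semihereditary R" and "almost_local_global R"
    and "module R M" and "finitely_presented R M"
  shows "(\<exists>m I p e n J. is_decomposition R M m I p e n J) \<and>
    (module R M' \<longrightarrow> mod_isomorphic R M M' \<longrightarrow>
      (\<forall>m I p e n J m' I' p' e' n' J'.
         is_decomposition R M m I p e n J \<longrightarrow> is_decomposition R M' m' I' p' e' n' J' \<longrightarrow>
           m = m' \<and> (\<forall>j\<in>{1..m}. I j = I' j) \<and>
           p = p' \<and> (\<forall>i\<in>{1..p}. e i = e' i) \<and>
           (\<forall>i\<in>{1..p}. n i = n' i) \<and>
           mod_isomorphic R (product_module R p e n J) (product_module R p' e' n' J')))"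
proof -
 have sh: "semihereditary_ring R" using assms(1,2) by (intro semihereditary_ring.intro semihereditary_ring_axioms.intro)
 show ?thesis
 proof (intro conjI[OF ex_decomposition[OF sh assms(3-5)]] impI allI)
  fix m I p e n J m' I' p' e' n' J'
  assume iso: "mod_isomorphic R M M'"
   and dec: "is_decomposition R M m I p e n J" and dec': "is_decomposition R M' m' I' p' e' n' J'"
  \<comment> \<open>Composition with the isomorphism makes a decomposition of M' one of
    \<open>M\<close>, so it remains to compare two decompositions of a single module.\<close>
  have "mod_isomorphic R M (decomposition_sum R m' I' p' e' n' J')"
   by (rule mod_isomorphic_trans[OF iso]) (use dec' in \<open>simp add: is_decomposition_def\<close>)
  then have dec2: "is_decomposition R M m' I' p' e' n' J'" using dec' by (simp add: is_decomposition_def)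
  obtain \<gamma> \<phi> where A: "decomposed_module R M m p I e n J \<gamma> \<phi>"
   using is_decomposition_imp_decomposed_module[OF sh assms(4) dec] by (elim exE)
  obtain \<gamma>' \<phi>' where B: "decomposed_module R M m' p' I' e' n' J' \<gamma>' \<phi>'"
   using is_decomposition_imp_decomposed_module[OF sh assms(4) dec2] by (elim exE)
  show "m = m' & (ALL j:{1..m}. I j = I' j) & p = p' & (ALL i:{1..p}. e i = e' i) & (ALL i:{1..p}. n i = n' i) &
    mod_isomorphic R (product_module R p e n J) (product_module R p' e' n' J')"
   using decomposed_module_unique[OF A B] decomposed_module_product_iso[OF A B] by (intro conjI)
 qed
qed

end
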